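(* Let $d\ge1$, $\Omega=[0,1]^d$, $s\ge\frac12$, $k\in\mathbb{Z}_{\ge0}$ and $m\ge0$ with $m\le s-\frac12$ and $m<k+\frac12$. There is a constant $C>0$ depending only on $s,k,m,d$ such that for every $f\in\mathcal{B}^s(\Omega)$ and every integer $n\ge2$, $$\inf_{f_n\in \Sigma^k_{n}}\|f - f_n\|_{H^m(\Omega)} \le C\, \|f\|_{\mathcal{B}^s(\Omega)}\,n^{-t}\log(n)^q,$$ where $$t=\frac12+\min\left(\frac{2(s-m)-1}{2(d+1)},\,k-m+\frac12\right)=\begin{cases}\frac12+\frac{2(s-m)-1}{2(d+1)} & \text{if } s<(d+1)\left(k-m+\frac12\right)+m+\frac12,\\ k-m+1 & \text{if } s\ge(d+1)\left(k-m+\frac12\right)+m+\frac12,\end{cases}$$ and $$q=\begin{cases}0 & \text{if } s<(d+1)\left(k-m+\frac12\right)+m+\frac12,\\ 1 & \text{if } s>(d+1)\left(k-m+\frac12\right)+m+\frac12,\\ 1+\left(k-m+\frac12\right) & \text{if } s=(d+1)\left(k-m+\frac12\right)+m+\frac12.\end{cases}$$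
   Context: The Fourier transform is $\hat g(\xi)=\int_{\mathbb{R}^d} g(x)e^{-2\pi \mathrm{i}\,\xi\cdot x}\,dx$, and $|\cdot|$ is the Euclidean norm. For $s\ge 0$, the spectral Barron space is $$\mathcal{B}^s(\Omega)=\Big\{f:\Omega\to\mathbb{C}:\ \|f\|_{\mathcal{B}^s(\Omega)}:=\inf_{f_e|_\Omega=f}\int_{\mathbb{R}^d}(1+|\xi|)^s|\hat f_e(\xi)|\,d\xi<\infty\Big\},$$ where the infimum is over extensions $f_e\in L^1(\mathbb{R}^d)$ of $f$. The activation function is $\sigma_k(x)=[\max(0,x)]^k$, with the convention $0^0=0$, so that $\sigma_0$ is the Heaviside function ($0$ for $x\le0$, $1$ for $x>0$). Set $$\Sigma^k_n=\Big\{\sum_{i=1}^n a_i\sigma_k(\omega_i\cdot x+b_i):\ \omega_i\in S^{d-1},\ b_i\in\mathbb{R},\ a_i\in\mathbb{C}\Big\},$$ where $S^{d-1}$ is the unit sphere in $\mathbb{R}^d$. $H^m(\Omega)$ is the usual $L^2$-based Sobolev space of order $m$ (the fractional, Sobolev–Slobodeckij, space if $m$ is not an integer), with $H^0=L^2$; the norm is $+\infty$ for functions not in $H^m(\Omega)$. Functions are identified when equal almost everywhere. *)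

theory Defs
  imports "HOL-Analysis.Analysis"
begin

definition fourier :: "(real ^ 'n \<Rightarrow> complex) \<Rightarrow> real ^ 'n \<Rightarrow> complex" where
  "fourier g \<xi> = (LINT x|lebesgue. g x * exp (- 2 * of_real pi * \<i> * of_real (\<xi> \<bullet> x)))"

text \<open>
  Functions on \<open>\<Omega>\<close> are represented by total functions whose values outside \<open>\<Omega>\<close> are ignored;
  functions are identified when they agree almost everywhere. The infimum over an empty set of
  extensions is \<open>\<infinity>\<close>.
\<close>

definition L1_extensions ::
    "(real ^ 'n) set \<Rightarrow> (real ^ 'n \<Rightarrow> complex) \<Rightarrow> (real ^ 'n \<Rightarrow> complex) set" where
  "L1_extensions \<Omega> f =
     {fe. integrable lebesgue fe \<and> (AE x in lebesgue. x \<in> \<Omega> \<longrightarrow> fe x = f x)}"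

definition barron_norm :: "real \<Rightarrow> (real ^ 'n) set \<Rightarrow> (real ^ 'n \<Rightarrow> complex) \<Rightarrow> ennreal" where
  "barron_norm s \<Omega> f =
     (INF fe \<in> L1_extensions \<Omega> f.
        \<integral>\<^sup>+\<xi>. ennreal ((1 + norm \<xi>) powr s * cmod (fourier fe \<xi>)) \<partial>lebesgue)"

definition barron_space :: "real \<Rightarrow> (real ^ 'n) set \<Rightarrow> (real ^ 'n \<Rightarrow> complex) set" where
  "barron_space s \<Omega> = {f. barron_norm s \<Omega> f < \<infinity>}"

text \<open>
  This is \<open>max 0 x ^ k\<close> under the convention \<open>0 ^ 0 = 0\<close>; in HOL, \<open>0 ^ 0 = 1\<close>, hence the
  case distinction.
\<close>

definition relu_pow :: "nat \<Rightarrow> real \<Rightarrow> real" where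
  "relu_pow k x = (if 0 < x then x ^ k else 0)"

definition shallow_networks :: "nat \<Rightarrow> nat \<Rightarrow> (real ^ 'n \<Rightarrow> complex) set" where
  "shallow_networks k n =
     {\<lambda>x. \<Sum>i=1..n. a i * of_real (relu_pow k (\<omega> i \<bullet> x + b i)) | (a :: nat \<Rightarrow> complex) \<omega> b.
        \<forall>i\<in>{1..n}. \<omega> i \<in> sphere 0 1}"

definition partial_deriv :: "'n \<Rightarrow> (real ^ 'n \<Rightarrow> real) \<Rightarrow> real ^ 'n \<Rightarrow> real" where
  "partial_deriv i \<phi> x = deriv (\<lambda>t. \<phi> (x + t *\<^sub>R axis i 1)) 0"

abbreviation partial_derivs :: "'n list \<Rightarrow> (real ^ 'n \<Rightarrow> real) \<Rightarrow> real ^ 'n \<Rightarrow> real" where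
  "partial_derivs is \<phi> \<equiv> foldr partial_deriv is \<phi>"

text \<open>
  Total differentiability of every iterated partial derivative makes all of them continuous, so the
  following is the class of smooth functions with compact support in \<open>U\<close>.
\<close>

definition test_functions :: "(real ^ 'n) set \<Rightarrow> (real ^ 'n \<Rightarrow> real) set" where
  "test_functions U =
     {\<phi>. (\<forall>is x. partial_derivs is \<phi> differentiable (at x)) \<and>
          compact (closure {x. \<phi> x \<noteq> 0}) \<and> closure {x. \<phi> x \<noteq> 0} \<subseteq> U}"

definition locally_integrable :: "(real ^ 'n) set \<Rightarrow> (real ^ 'n \<Rightarrow> complex) \<Rightarrow> bool" where
  "locally_integrable U f \<longleftrightarrow> (\<forall>K. compact K \<and> K \<subseteq> U \<longrightarrow> set_integrable lebesgue K f)"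

definition multi_index_order :: "('n::finite \<Rightarrow> nat) \<Rightarrow> nat" where
  "multi_index_order \<alpha> = (\<Sum>i\<in>UNIV. \<alpha> i)"

text \<open>
  The lists \<open>is\<close> with \<open>count_list is = \<alpha>\<close> are the orders in which the partial derivatives making up
  \<open>D\<^sup>\<alpha>\<close> can be taken; on test functions they all give the same result.
\<close>

definition has_weak_deriv ::
    "('n \<Rightarrow> nat) \<Rightarrow> (real ^ 'n) set \<Rightarrow> (real ^ 'n \<Rightarrow> complex) \<Rightarrow> (real ^ 'n \<Rightarrow> complex) \<Rightarrow> bool" where
  "has_weak_deriv \<alpha> U f g \<longleftrightarrow>
     locally_integrable U f \<and> locally_integrable U g \<and>
     (\<forall>\<phi>\<in>test_functions U. \<forall>is. count_list is = \<alpha> \<longrightarrow>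
        (LINT x:U|lebesgue. f x * of_real (partial_derivs is \<phi> x)) =
        (-1) ^ multi_index_order \<alpha> * (LINT x:U|lebesgue. g x * of_real (\<phi> x)))"

definition weak_deriv ::
    "('n \<Rightarrow> nat) \<Rightarrow> (real ^ 'n) set \<Rightarrow> (real ^ 'n \<Rightarrow> complex) \<Rightarrow> real ^ 'n \<Rightarrow> complex" where
  "weak_deriv \<alpha> U f = (SOME g. has_weak_deriv \<alpha> U f g)"

definition L2_sq :: "(real ^ 'n) set \<Rightarrow> (real ^ 'n \<Rightarrow> complex) \<Rightarrow> ennreal" where
  "L2_sq U g = (\<integral>\<^sup>+x\<in>U. ennreal ((cmod (g x))\<^sup>2) \<partial>lebesgue)"

text \<open>The Gagliardo integral; the integrand is \<open>0 / 0 = 0\<close> on the diagonal, a null set.\<close>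

definition slobodeckij_sq ::
    "real \<Rightarrow> (real ^ 'n) set \<Rightarrow> (real ^ 'n \<Rightarrow> complex) \<Rightarrow> ennreal" where
  "slobodeckij_sq \<theta> U g =
     (\<integral>\<^sup>+x\<in>U. (\<integral>\<^sup>+y\<in>U.
        ennreal ((cmod (g x - g y))\<^sup>2 / norm (x - y) powr (real CARD('n) + 2 * \<theta>))
        \<partial>lebesgue) \<partial>lebesgue)"

definition sobolev_sq :: "real \<Rightarrow> (real ^ 'n) set \<Rightarrow> (real ^ 'n \<Rightarrow> complex) \<Rightarrow> ennreal" where
  "sobolev_sq m U f =
     (\<Sum>\<alpha> | multi_index_order \<alpha> \<le> nat \<lfloor>m\<rfloor>. L2_sq U (weak_deriv \<alpha> U f)) +
     (if m \<in> \<int> then 0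
      else \<Sum>\<alpha> | multi_index_order \<alpha> = nat \<lfloor>m\<rfloor>. slobodeckij_sq (frac m) U (weak_deriv \<alpha> U f))"

definition sobolev_norm :: "real \<Rightarrow> (real ^ 'n) set \<Rightarrow> (real ^ 'n \<Rightarrow> complex) \<Rightarrow> ennreal" where
  "sobolev_norm m U f =
     (if (\<forall>\<alpha>. multi_index_order \<alpha> \<le> nat \<lfloor>m\<rfloor> \<longrightarrow> (\<exists>g. has_weak_deriv \<alpha> U f g)) \<and>
         sobolev_sq m U f < \<infinity>
      then ennreal (sqrt (enn2real (sobolev_sq m U f))) else \<infinity>)"

definition unit_cube :: "(real ^ 'n) set" where
  "unit_cube = {x. \<forall>i. 0 \<le> x $ i \<and> x $ i \<le> 1}"

definition critical_smoothness :: "nat \<Rightarrow> nat \<Rightarrow> real \<Rightarrow> real" where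
  "critical_smoothness d k m = (real d + 1) * (real k - m + 1/2) + m + 1/2"

definition rate_exponent :: "nat \<Rightarrow> real \<Rightarrow> nat \<Rightarrow> real \<Rightarrow> real" where
  "rate_exponent d s k m =
     1/2 + min ((2 * (s - m) - 1) / (2 * (real d + 1))) (real k - m + 1/2)"

lemma rate_exponent_cases:
  "rate_exponent d s k m =
     (if s < critical_smoothness d k m
      then 1/2 + (2 * (s - m) - 1) / (2 * (real d + 1))
      else real k - m + 1)"
proof -
  have "(2 * (s - m) - 1) / (2 * (real d + 1)) < real k - m + 1/2
      \<longleftrightarrow> 2 * (s - m) - 1 < (real k - m + 1/2) * (2 * (real d + 1))"
    by (simp add: pos_divide_less_eq)
  also have "\<dots> \<longleftrightarrow> s < critical_smoothness d k m"
    by (auto simp: critical_smoothness_def algebra_simps add_divide_distrib)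
  finally show ?thesis
    by (auto simp: rate_exponent_def min_def)
qed

definition log_exponent :: "nat \<Rightarrow> real \<Rightarrow> nat \<Rightarrow> real \<Rightarrow> real" where
  "log_exponent d s k m =
     (if s < critical_smoothness d k m then 0
      else if s > critical_smoothness d k m then 1
      else 1 + (real k - m + 1/2))"

end

theory Submission
 imports Defs "HOL-Probability.Probability"
begin

text \<open>
On the cube, \<open>f\<close> is an absolutely convergent series of exponentials \<open>exp(i \<nu> \<bullet> x)\<close> with integer
frequencies \<open>\<nu>\<close> and \<open>\<Sum> |a\<^sub>\<nu>| (1 + |\<nu>|)^s\<close> at most a constant times the Barron norm: by Fourier inversion it
suffices to expand one exponential on \<open>[0,1]\<close> in integer frequencies that concentrate near the given
one, which an averaged sinc series does. Each exponential \<open>exp(i \<nu> \<bullet> x)\<close> is an integral over \<open>b\<close> of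
combinations of \<open>k + 2\<close> ridge functions that live on a slab of width \<open>1 / (1 + |\<nu>|)\<close> (B-splines); for the
low frequencies \<open>|\<nu>| \<le> n^(1/(d+1))\<close>, subtracting a piecewise polynomial interpolation, which is an explicit
network with about \<open>N\<^sub>\<nu>\<close> neurons, decreases the width to \<open>1 / N\<^sub>\<nu>\<close>. A ridge function on a slab of width \<open>w\<close>
has \<open>H^m\<close> norm \<open>O(w^(k - m + 1/2))\<close>, so sampling the frequencies and the \<open>b\<close> (Maurey's argument in
\<open>H^m\<close>) gains the factor \<open>n^(-1/2)\<close>. Choosing the \<open>N\<^sub>\<nu>\<close> optimally subject to \<open>\<Sum> N\<^sub>\<nu> = O(n)\<close> yields the three regimes.
\<close>

section \<open>Uniqueness of weak derivatives\<close>

text \<open>Integer frequencies have period 2 pi, longer than the side of the cube. On a full period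
  the Fourier series of one exponential decays only like 1/|j|, since its periodic extension jumps;
  correctness on [0,1] alone leaves room to average p times over windows of length 1/p, which gains
  p powers of decay. Put \<kappa> = k - m + 1/2 and \<sigma> = s - m - 1/2. A frequency of size M
  with N neurons has normalised error M^(k+1-s) N^(-\<kappa>): the spline weight has size M^(k+1),
  the coefficient pays for M^s, and width 1/N gains N^(-\<kappa>). Without explicit neurons M
  replaces N, which leaves M^(-\<sigma>). Equal errors mean N proportional to
  M^(1-\<sigma>/\<kappa>), and over dyadic shells the neurons form a geometric sum with ratio
  2^(d+1-\<sigma>/\<kappa>); ratio above, equal to or below 1 separates the regimes. The cutoff
  n^(1/(d+1)) is the radius R at which R^d frequencies with R neurons each use up n. The bound m < k
  + 1/2 is the threshold at which a jump, the top derivative of a ridge function, has finite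
  Gagliardo energy.\<close>

lemma has_real_derivative_zero_of_square_bound:
 fixes f :: "real => real"
 assumes "!!s. \<bar>f s - f t\<bar> <= C * (s - t)\<^sup>2"
 shows "(f has_real_derivative 0) (at t)"
proof -
 have "((%s. (f s - f t) / (s - t)) \<longlongrightarrow> 0) (at t)"
 proof (rule Lim_null_comparison)
  show "((%s. C * \<bar>s - t\<bar>) \<longlongrightarrow> 0) (at t)"
   by (auto intro!: tendsto_eq_intros)
  show "\<forall>\<^sub>F s in at t. norm ((f s - f t) / (s - t)) <= C * \<bar>s - t\<bar>"
   unfolding eventually_at_filter
  proof (intro always_eventually allI impI)
   fix s assume "s ~= t"
   then have "\<bar>f s - f t\<bar> / \<bar>s - t\<bar> <= C * \<bar>s - t\<bar>"
    using assms[of s] by (simp add: pos_divide_le_eq power2_eq_square mult.assoc)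
   then show "norm ((f s - f t) / (s - t)) <= C * \<bar>s - t\<bar>" by simp
  qed
 qed
 then show ?thesis by (simp add: has_field_derivative_iff)
qed

text \<open>The cutoff is \<open>exp (- c / ((t - a) * (b - t)))\<close>, the case
  \<open>p = 1\<close>, \<open>N = 0\<close>; as c decreases to 0 it increases to the indicator of
  the open interval. The polynomial and the power \<open>N\<close> make the family closed under
  differentiation.\<close>

definition bump :: "real => real => real => real poly => nat => real => real" where
 "bump a b c p N t =
   (if a < t \<and> t < b
   then poly p t * inverse ((t - a) * (b - t)) ^ N * exp (- c * inverse ((t - a) * (b - t))) else 0)"

text \<open>A single term of the exponential series, \<open>(c * w) ^ N / fact N\<close>, is at most
  \<open>exp (c * w)\<close>.\<close>

lemma power_mult_exp_minus_le:
 fixes c w :: real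
 assumes "c > 0" "w >= 0"
 shows "w ^ N * exp (- c * w) <= fact N / c ^ N"
proof -
 have "(c * w) ^ N / fact N <= exp (c * w)"
  using assms sum_le_suminf[of "%n. (c * w) ^ n /\<^sub>R fact n" "{N}"] summable_exp_generic[of "c * w"]
  by (auto simp: exp_def field_simps)
 then have "(c * w) ^ N <= fact N * exp (c * w)" by (simp add: field_simps)
 then have "(c * w) ^ N * exp (- (c * w)) <= fact N" by (simp add: exp_minus field_simps)
 then show ?thesis using assms by (simp add: field_simps power_mult_distrib)
qed

text \<open>Inside the interval put \<open>w = 1 / D\<close>, with derivative
  \<open>- D' * w^2\<close>: the product rule yields powers of \<open>w\<close> up to
  \<open>N + 2\<close>, and factors \<open>w * D = 1\<close> bring all terms to that power, which is
  how \<open>q\<close> arises. Outside, the exponential dominates all powers of \<open>w\<close>, so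
  the bump at \<open>s\<close> is at most a constant times \<open>D(s)^2\<close>, and
  \<open>D(s)\<close> is at most \<open>(b - a) * \<bar>s - t\<bar>\<close> for any \<open>t\<close>
  outside the interval.\<close>

lemma has_real_derivative_bump:
 assumes c: "c > 0"
 shows "\<exists>q. \<forall>t. (bump a b c p N has_real_derivative bump a b c q (N + 2) t) (at t)"
proof -
 define D where "D = [:- a * b, a + b, -1:]"
 have D: "poly D t = (t - a) * (b - t)" for t
  by (simp add: D_def algebra_simps)
 define q where "q = pderiv p * D ^ 2 - smult (real N) (p * D * pderiv D) + smult c (p * pderiv D)"
 have "(bump a b c p N has_real_derivative bump a b c q (N + 2) t) (at t)" for t
 proof (cases "a < t \<and> t < b")
  case True
  define w where "w = inverse (poly D t)"
  have Dpos: "poly D t > 0" using True by (simp add: D)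
  have wD: "w * poly D t = 1" using Dpos by (simp add: w_def)
  let ?g = "%t. poly p t * inverse (poly D t) ^ N * exp (- c * inverse (poly D t))"
  \<comment> \<open>At \<open>N = 0\<close> the exponent is truncated, but then the factor
    \<open>real N\<close> is zero.\<close>
  have N: "real N * (w ^ (N - Suc 0) * (w * w)) = real N * w ^ Suc N"
   by (cases N) simp_all
  let ?z1 = "%t. poly (pderiv D) t * (w * w)"
  have dw: "((%t. inverse (poly D t)) has_real_derivative (- (?z1 t))) (at t)"
   using Dpos by (auto intro!: derivative_eq_intros poly_DERIV simp: w_def)
  have "(?g has_real_derivative
    poly (pderiv p) t * w ^ N * exp (- c * w)
    + poly p t * (real N * w ^ (N - Suc 0) * (- (?z1 t))) * exp (- c * w)
    + poly p t * w ^ N * (exp (- c * w) * (c * (?z1 t)))) (at t)"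
   using Dpos dw
   by (auto intro!: derivative_eq_intros poly_DERIV simp flip: w_def) (simp add: algebra_simps)
  also have "poly (pderiv p) t * w ^ N * exp (- c * w)
    + poly p t * (real N * w ^ (N - Suc 0) * (- (?z1 t))) * exp (- c * w)
    + poly p t * w ^ N * (exp (- c * w) * (c * (?z1 t)))
    = (poly (pderiv p) t * w ^ N - poly p t * poly (pderiv D) t * (real N * w ^ Suc N) + poly p t * w ^ N * c * poly (pderiv D) t * (w * w)) * exp (- c * w)"
   unfolding N[symmetric] by (simp add: algebra_simps)
  also have "... = (poly (pderiv p) t * w ^ N * (w * poly D t)\<^sup>2 - poly p t * poly (pderiv D) t * (real N * w ^ Suc N) * (w * poly D t) + poly p t * w ^ N * c * poly (pderiv D) t * (w * w)) * exp (- c * w)"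
   by (simp only: wD) simp
  also have "... = poly q t * w ^ (N + 2) * exp (- c * w)"
   by (simp add: q_def algebra_simps power2_eq_square)
  finally have g: "(?g has_real_derivative poly q t * w ^ (N + 2) * exp (- c * w)) (at t)" .
  have "(bump a b c p N has_real_derivative poly q t * w ^ (N + 2) * exp (- c * w)) (at t)"
   using g
  proof (rule has_field_derivative_transform_within_open[where S = "{a<..<b}"])
  qed (use True in \<open>auto simp: bump_def D\<close>)
  then show ?thesis using True by (simp add: bump_def w_def D)
 next
  case False
  have "bounded (poly p ` {a..b})"
   by (intro compact_imp_bounded compact_continuous_image continuous_intros) auto
  then obtain B where B0: "B > 0" and B: "!!s. s \<in> {a..b} ==> \<bar>poly p s\<bar> <= B"
   unfolding bounded_pos by auto
  have bump_t: "bump a b c p N t = 0" using False unfolding bump_def by meson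
  let ?z0 = "fact (N + 2) / c ^ (N + 2)"
  have "\<bar>bump a b c p N s - bump a b c p N t\<bar> <= (B * ?z0 * (b - a)\<^sup>2) * (s - t)\<^sup>2" for s
  proof (cases "a < s \<and> s < b")
   case s: True
   define d where "d = (s - a) * (b - s)"
   have d: "d > 0" using s by (simp add: d_def)
   have Bs: "\<bar>poly p s\<bar> <= B" using B[of s] s by simp
   have "d <= \<bar>s - t\<bar> * (b - a)"
   proof (cases "t <= a")
    case True
    then show ?thesis unfolding d_def using s by (intro mult_mono) auto
   next
    case t: False
    then have "(b - s) * (s - a) <= \<bar>s - t\<bar> * (b - a)"
     using s False by (intro mult_mono) auto
    then show ?thesis by (simp add: d_def mult.commute)
   qed
   then have d2: "d\<^sup>2 <= (b - a)\<^sup>2 * (s - t)\<^sup>2"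
    using d power_mono[of d "\<bar>s - t\<bar> * (b - a)" 2] by (simp add: power_mult_distrib mult.commute)
   have "inverse d ^ N * exp (- c * inverse d) = d\<^sup>2 * (inverse d ^ (N + 2) * exp (- c * inverse d))"
    using d by (simp add: power_add field_simps power2_eq_square)
   also have "... <= d\<^sup>2 * ?z0"
    using d c power_mult_exp_minus_le[of c "inverse d" "N + 2"] by (intro mult_left_mono) auto
   finally have e: "inverse d ^ N * exp (- c * inverse d) <= d\<^sup>2 * ?z0" .
   have "\<bar>bump a b c p N s - bump a b c p N t\<bar> = \<bar>poly p s\<bar> * (inverse d ^ N * exp (- c * inverse d))"
    unfolding bump_t using s d by (simp add: bump_def d_def[symmetric] abs_mult del: inverse_mult_distrib)
   also have "... <= B * (d\<^sup>2 * ?z0)"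
    by (rule mult_mono[OF Bs e]) (use B0 d in auto)
   also have "... <= B * (((b - a)\<^sup>2 * (s - t)\<^sup>2) * ?z0)"
    using d2 c by (intro mult_left_mono mult_right_mono) (use B0 in auto)
   finally show ?thesis by (simp add: mult_ac)
  next
   case s: False
   have "bump a b c p N s = 0" using s unfolding bump_def by meson
   then show ?thesis
    using B0 c by (simp add: bump_t)
  qed
  then have "(bump a b c p N has_real_derivative 0) (at t)"
   by (rule has_real_derivative_zero_of_square_bound)
  moreover have "bump a b c q (N + 2) t = 0" using False unfolding bump_def by meson
  ultimately show ?thesis by simp
 qed
 then show ?thesis by blast
qed

definition bump_functions :: "(real => real) set" where
 "bump_functions = {bump a b c p N | a b c p N. c > 0}"

lemma bump_functions_deriv:
 assumes "u \<in> bump_functions"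
 shows "deriv u \<in> bump_functions" "(u has_real_derivative deriv u t) (at t)"
proof -
 from assms obtain a b c p N where u: "u = bump a b c p N" "c > 0"
  by (auto simp: bump_functions_def)
 obtain q where q: "!!t. (u has_real_derivative bump a b c q (N + 2) t) (at t)"
  using has_real_derivative_bump[OF u(2)] unfolding u(1) by blast
 have d: "deriv u = bump a b c q (N + 2)"
  using DERIV_imp_deriv[OF q] by auto
 show "deriv u \<in> bump_functions" unfolding d bump_functions_def using u(2) by blast
 show "(u has_real_derivative deriv u t) (at t)" using q by (simp add: d)
qed

section \<open>Products of one-variable bumps as test functions\<close>

lemma partial_deriv_prod:
 fixes v :: "'n::finite => real => real"
 assumes "!!i. v i \<in> bump_functions"
 shows "partial_deriv l (%x. \<Prod>i\<in>UNIV. v i (x $ i)) =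
     (%x. \<Prod>i\<in>UNIV. (v(l := deriv (v l))) i (x $ i))"
proof
 fix x :: "real ^ 'n"
 have "(\<Prod>i\<in>UNIV. v i ((x + t *\<^sub>R axis l 1) $ i)) = v l (x $ l + t) * (\<Prod>i\<in>UNIV - {l}. v i (x $ i))" for t
  by (subst prod.remove[of UNIV l]) (auto simp: axis_def intro!: arg_cong2[where f = "(*)"] prod.cong)
 moreover have "(\<Prod>i\<in>UNIV. (v(l := deriv (v l))) i (x $ i)) = deriv (v l) (x $ l) * (\<Prod>i\<in>UNIV - {l}. v i (x $ i))"
  by (subst prod.remove[of UNIV l]) (auto intro!: arg_cong2[where f = "(*)"] prod.cong)
 moreover have "((%t. v l (x $ l + t)) has_real_derivative deriv (v l) (x $ l)) (at 0)"
  using DERIV_shift[of "v l" "deriv (v l) (x $ l)" 0 "x $ l"] bump_functions_deriv(2)[OF assms[of l], of "x $ l"]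
  by (simp add: add.commute)
 then have "((%t. v l (x $ l + t) * (\<Prod>i\<in>UNIV - {l}. v i (x $ i))) has_real_derivative deriv (v l) (x $ l) * (\<Prod>i\<in>UNIV - {l}. v i (x $ i))) (at 0)"
  by (rule DERIV_cmult_right)
 ultimately show "partial_deriv l (%x. \<Prod>i\<in>UNIV. v i (x $ i)) x = (\<Prod>i\<in>UNIV. (v(l := deriv (v l))) i (x $ i))"
  by (simp add: partial_deriv_def DERIV_imp_deriv)
qed

lemma partial_derivs_prod:
 fixes v :: "'n::finite => real => real"
 assumes "!!i. v i \<in> bump_functions"
 shows "\<exists>w. (\<forall>i. w i \<in> bump_functions) \<and>
   partial_derivs is (%x. \<Prod>i\<in>UNIV. v i (x $ i)) = (%x. \<Prod>i\<in>UNIV. w i (x $ i))"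
proof (induction "is")
 case Nil
 then show ?case using assms by auto
next
 case (Cons l "is")
 then obtain w where w: "!!i. w i \<in> bump_functions"
   "partial_derivs is (%x. \<Prod>i\<in>UNIV. v i (x $ i)) = (%x. \<Prod>i\<in>UNIV. w i (x $ i))"
  by blast
 have "partial_derivs (l # is) (%x. \<Prod>i\<in>UNIV. v i (x $ i)) = (%x. \<Prod>i\<in>UNIV. (w(l := deriv (w l))) i (x $ i))"
  by (simp only: foldr.simps comp_def w(2) partial_deriv_prod[OF w(1)])
 moreover have "(w(l := deriv (w l))) i \<in> bump_functions" for i
  using w(1) bump_functions_deriv(1)[OF w(1)] by simp
 ultimately show ?case by blast
qed

text \<open>Every iterated partial derivative is again a product of one-variable bumps, hence
  totally differentiable.\<close>

lemma prod_bump_in_test_functions: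
 fixes a b :: "real ^ 'n"
 assumes "cbox a b \<subseteq> U" "c > 0"
 shows "(%x. \<Prod>i\<in>UNIV. bump (a $ i) (b $ i) c 1 0 (x $ i)) \<in> test_functions U"
proof -
 let ?\<phi> = "%x. \<Prod>i\<in>UNIV. bump (a $ i) (b $ i) c 1 0 (x $ i)"
 have "closure {x. ?\<phi> x ~= 0} \<subseteq> cbox a b"
  by (intro closure_minimal) (auto simp: bump_def mem_box_cart less_imp_le split: if_splits)
 moreover from this have "compact (closure {x. ?\<phi> x ~= 0})"
  using bounded_subset[OF bounded_cbox] by (auto simp: compact_eq_bounded_closed)
 moreover have "partial_derivs is ?\<phi> differentiable (at x)" for "is" x
 proof -
  obtain w where w: "!!i. w i \<in> bump_functions" "partial_derivs is ?\<phi> = (%x. \<Prod>i\<in>UNIV. w i (x $ i))"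
   using partial_derivs_prod[of "%i. bump (a $ i) (b $ i) c 1 0" "is"] assms(2)
   by (force simp: bump_functions_def)
  have hd: "((%x. w i (x $ i)) has_derivative (%h. deriv (w i) (x $ i) * h $ i)) (at x)" for i
   using has_derivative_compose[of "%x. x $ i" "%h. h $ i" x UNIV "w i" "%h. deriv (w i) (x $ i) * h"]
     bump_functions_deriv(2)[OF w(1), unfolded has_field_derivative_def, of i "x $ i"]
   by (simp add: bounded_linear_imp_has_derivative bounded_linear_vec_nth)
  show ?thesis unfolding w(2) differentiable_def
   by (rule exI, rule has_derivative_prod, rule hd)
 qed
 ultimately show ?thesis using assms(1) unfolding test_functions_def by blast
qed

text \<open>Boxes generate the Borel sets and are closed under intersection, so Dynkin's argument
  extends vanishing from boxes to all Borel sets. The complement step uses that the total integral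
  is zero, a limit over growing boxes.\<close>

lemma integral_zero_on_boxes_imp_AE_zero:
 fixes f :: "'a::euclidean_space => complex"
 assumes f: "integrable lborel f" and z: "!!a b. (LINT x:box a b|lborel. f x) = 0"
 shows "AE x in lborel. f x = 0"
proof (rule sigma_finite_measure.density_zero[OF lborel.sigma_finite_measure_axioms f])
 have si: "set_integrable lborel A f" if "A \<in> sets borel" for A
  using f that by (simp add: integrable_mult_indicator set_integrable_def)
 have "(%n::nat. LINT x:box (- (real n *\<^sub>R One)) (real n *\<^sub>R One)|lborel. f x)
   \<longlonglongrightarrow> (LINT x:(\<Union>n::nat. box (- (real n *\<^sub>R One)) (real n *\<^sub>R One))|lborel. f x)"
  by (rule set_integral_cont_up) (auto simp: incseq_def subset_box intro!: si)
 then have tot: "(LINT x|lborel. f x) = 0"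
  unfolding z UN_box_eq_UNIV by (simp add: set_lebesgue_integral_def LIMSEQ_const_iff)
 fix A assume "A \<in> sets (lborel :: 'a measure)"
 then have A: "A \<in> sigma_sets UNIV (range (%(a, b). box a b))"
  by (simp add: borel_eq_box)
 have "Int_stable (range (%(a, b). box a b :: 'a set))"
  by (auto simp: Int_stable_def box_Int_box)
 moreover have "range (%(a, b). box a b :: 'a set) \<subseteq> Pow UNIV" by simp
 ultimately show "(LINT x:A|lborel. f x) = 0" using A
 proof (induct rule: sigma_sets_induct_disjoint)
  case (basic A)
  then show ?case using z by auto
 next
  case empty
  then show ?case by (simp add: set_lebesgue_integral_def)
 next
  case (compl A)
  then have A: "A \<in> sets borel" by (simp add: borel_eq_box)
  have "(LINT x:UNIV - A|lborel. f x) = (LINT x|lborel. f x) - (LINT x:A|lborel. f x)"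
  proof -
   have "(LINT x|lborel. f x) = (LINT x:A \<union> (UNIV - A)|lborel. f x)"
    by (simp add: set_lebesgue_integral_def)
   also have "... = (LINT x:A|lborel. f x) + (LINT x:UNIV - A|lborel. f x)"
    using A by (intro set_integral_Un si) auto
   finally show ?thesis by simp
  qed
  then show ?case using compl tot by simp
 next
  case (union A)
  then have "range A \<subseteq> sets borel" by (simp add: borel_eq_box)
  then have "(LINT x:(\<Union>i. A i)|lborel. f x) = (\<Sum>i. (LINT x:A i|lborel. f x))"
   using union(1) by (intro lebesgue_integral_countable_add si) (auto simp: disjoint_family_on_def)
  then show ?case using union by simp
 qed
qed

text \<open>The definitions integrate over \<open>lebesgue\<close>, whereas Fubini is applied over
  \<open>lborel\<close>; a Borel representative links the two.\<close>

lemma lebesgue_integrable_imp_borel: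
 fixes f :: "'a::euclidean_space => complex"
 assumes "integrable lebesgue f"
 shows "\<exists>g. integrable lborel g \<and> (AE x in lebesgue. f x = g x)"
proof -
 have "(%x. Re (f x)) \<in> borel_measurable lebesgue" "(%x. Im (f x)) \<in> borel_measurable lebesgue"
  using assms by auto
 from this[THEN completion_ex_borel_measurable_real] obtain u v where
  u: "u \<in> borel_measurable lborel" "AE x in lborel. Re (f x) = u x" and
  v: "v \<in> borel_measurable lborel" "AE x in lborel. Im (f x) = v x" by blast
 let ?g = "%x. Complex (u x) (v x)"
 have g: "?g \<in> borel_measurable lborel" using u(1) v(1) 
  by (subst borel_measurable_complex_iff) auto
 have ae: "AE x in lborel. f x = ?g x" using u(2) v(2) by eventually_elim (auto simp: complex_eq_iff)
 then have "AE x in lebesgue. f x = ?g x" by (rule AE_completion)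
 moreover have "?g \<in> borel_measurable lebesgue" using g by (rule measurable_completion)
 ultimately have "integrable lebesgue ?g"
  using integrable_cong_AE[of f lebesgue ?g] assms by auto
 then have "integrable lborel ?g" using integrable_completion[OF g] by simp
 with \<open>AE x in lebesgue. f x = ?g x\<close> show ?thesis by blast
qed

text \<open>Cut \<open>g\<close> off outside the box; the intersection of two boxes is a box, so the
  previous criterion applies to the cut-off function.\<close>

lemma AE_zero_on_box:
 fixes g :: "'a::euclidean_space => complex"
 assumes g: "set_integrable lebesgue (box a b) g"
  and z: "!!c d. box c d \<subseteq> box a b ==> (LINT x:box c d|lebesgue. g x) = 0"
 shows "AE x in lebesgue. x \<in> box a b --> g x = 0"
proof -
 let ?f = "%x. indicator (box a b) x *\<^sub>R g x"
 obtain h where h: "integrable lborel h" "AE x in lebesgue. ?f x = h x"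
  using lebesgue_integrable_imp_borel[of ?f] g unfolding set_integrable_def by blast
 have "AE x in lborel. h x = 0"
 proof (rule integral_zero_on_boxes_imp_AE_zero[OF h(1)])
  fix c d :: 'a
  obtain c' d' where c': "box c d \<inter> box a b = box c' d'"
   unfolding box_Int_box by blast
  have hm: "h \<in> borel_measurable lborel" using h(1) by auto
  have "(LINT x:box c d|lborel. h x) = (LINT x:box c d|lebesgue. h x)"
   unfolding set_lebesgue_integral_def using hm by (intro integral_completion[symmetric]) auto
  also have "... = (LINT x:box c d|lebesgue. ?f x)"
   unfolding set_lebesgue_integral_def
  proof (rule integral_cong_AE)
   show "AE x in lebesgue. indicator (box c d) x *\<^sub>R h x = indicator (box c d) x *\<^sub>R ?f x"
    using h(2) by eventually_elim simp
   show "(%x. indicator (box c d) x *\<^sub>R h x) \<in> borel_measurable lebesgue"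
    using hm by (intro measurable_completion) simp
   have "?f \<in> borel_measurable lebesgue" using g by (auto simp: set_integrable_def)
   then show "(%x. indicator (box c d) x *\<^sub>R ?f x) \<in> borel_measurable lebesgue"
    by (rule borel_measurable_scaleR[rotated]) (auto intro!: borel_measurable_indicator)
  qed
  also have "... = (LINT x:box c' d'|lebesgue. g x)"
   unfolding set_lebesgue_integral_def c'[symmetric]
   by (intro Bochner_Integration.integral_cong) (auto simp: indicator_def)
  also have "... = 0" using c' by (intro z) auto
  finally show "(LINT x:box c d|lborel. h x) = 0" .
 qed
 then have "AE x in lebesgue. h x = 0" by (rule AE_completion)
 with h(2) show ?thesis by eventually_elim (auto simp: indicator_def)
qed

text \<open>The fundamental lemma of the calculus of variations. As \<open>c\<close> tends to 0 the
  product bumps converge boundedly to the indicator of an open box, so \<open>g\<close> integrates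
  to zero over every open box whose closed box lies in \<open>U\<close>; countably many closed boxes
  cover \<open>U\<close>, and their frontiers are null.\<close>

lemma AE_zero_of_test_functions:
 fixes g :: "real ^ 'n => complex"
 assumes U: "open U" and li: "locally_integrable U g"
  and z: "!!\<phi>. \<phi> \<in> test_functions U ==> (LINT x:U|lebesgue. g x * of_real (\<phi> x)) = 0"
 shows "AE x in lebesgue. x \<in> U --> g x = 0"
proof -
 have si: "set_integrable lebesgue (cbox a b) g" if "cbox a b \<subseteq> U" for a b
  using li that by (auto simp: locally_integrable_def)
 have zb: "(LINT x:box a b|lebesgue. g x) = 0" if ab: "cbox a b \<subseteq> U" for a b
 proof -
  define \<phi> where "\<phi> j x = (\<Prod>i\<in>UNIV. bump (a $ i) (b $ i) (inverse (Suc j)) 1 0 (x $ i))" for j :: nat and x :: "real ^ 'n"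
  have \<phi>0: "\<phi> j x = 0" if "x \<notin> box a b" for j x
   using that unfolding \<phi>_def mem_box_cart by (auto simp: bump_def)
  have \<phi>1: "\<bar>\<phi> j x\<bar> <= 1" for j x
   unfolding \<phi>_def abs_prod by (intro prod_le_1) (auto simp: bump_def intro!: divide_nonneg_nonneg)
  have lim: "(%j. \<phi> j x) \<longlonglongrightarrow> 1" if "x \<in> box a b" for x
  proof -
   have "(%j. bump (a $ i) (b $ i) (inverse (Suc j)) 1 0 (x $ i)) \<longlonglongrightarrow> 1" for i
   proof -
    have *: "a $ i < x $ i" "x $ i < b $ i" using that by (auto simp: mem_box_cart)
    have "(%j. exp (- inverse (real (Suc j)) * inverse ((x $ i - a $ i) * (b $ i - x $ i)))) \<longlonglongrightarrow> exp (- 0 * inverse ((x $ i - a $ i) * (b $ i - x $ i)))"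
     by (intro tendsto_intros LIMSEQ_inverse_real_of_nat)
    then show ?thesis using * by (simp add: bump_def)
   qed
   then have "(%j. \<phi> j x) \<longlonglongrightarrow> (\<Prod>i\<in>(UNIV::'n set). 1)" unfolding \<phi>_def by (intro tendsto_prod)
   then show ?thesis by simp
  qed
  have "\<phi> j \<in> test_functions U" for j
   unfolding \<phi>_def using ab by (rule prod_bump_in_test_functions) simp
  then have z': "(LINT x:U|lebesgue. g x * of_real (\<phi> j x)) = 0" for j by (rule z)
  have eq: "indicator U x *\<^sub>R (g x * complex_of_real (\<phi> j x)) = indicator (cbox a b) x *\<^sub>R g x * of_real (\<phi> j x)" for j x
   using \<phi>0[of x j] ab box_subset_cbox[of a b] by (cases "x \<in> box a b") (auto simp: indicator_def)
  have gm[measurable]: "(%x. indicator (cbox a b) x *\<^sub>R g x) \<in> borel_measurable lebesgue"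
   using si[OF ab] by (auto simp: set_integrable_def)
  have \<phi>m: "(%x. complex_of_real (\<phi> j x)) \<in> borel_measurable lebesgue" for j
  proof -
   have "partial_derivs [] (\<phi> j) differentiable (at x)" for x
    using \<open>\<phi> j \<in> test_functions U\<close> unfolding test_functions_def by blast
   then have "continuous_on UNIV (\<phi> j)"
    by (auto simp: continuous_on_eq_continuous_at intro!: differentiable_imp_continuous_within)
   then have "\<phi> j \<in> borel_measurable borel" by (rule borel_measurable_continuous_onI)
   then show ?thesis by (intro measurable_completion) simp
  qed
  let ?z0 = "%x. indicator (cbox a b) x *\<^sub>R g x"
  have "(%j. LINT x|lebesgue. indicator (cbox a b) x *\<^sub>R g x * of_real (\<phi> j x)) \<longlonglongrightarrow> (LINT x|lebesgue. indicator (box a b) x *\<^sub>R g x)"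
  proof (rule integral_dominated_convergence[where w = "%x. norm (?z0 x)"])
   show "(%x. indicator (box a b) x *\<^sub>R g x) \<in> borel_measurable lebesgue"
   proof -
    have "(%x. indicator (box a b) x *\<^sub>R (?z0 x)) \<in> borel_measurable lebesgue"
     by (rule borel_measurable_scaleR[rotated, OF gm]) (auto intro!: borel_measurable_indicator)
    also have "(%x. indicator (box a b) x *\<^sub>R (?z0 x)) = (%x. indicator (box a b) x *\<^sub>R g x)"
     using box_subset_cbox[of a b] by (intro ext) (auto simp: indicator_def)
    finally show ?thesis .
   qed
   show "(%x. indicator (cbox a b) x *\<^sub>R g x * of_real (\<phi> j x)) \<in> borel_measurable lebesgue" for j
    using gm \<phi>m by (rule borel_measurable_times)
   show "integrable lebesgue (%x. norm (?z0 x))"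
    using si[OF ab] unfolding set_integrable_def by (rule integrable_norm)
   let ?z1 = "%j x. %j. indicator (cbox a b) x *\<^sub>R g x * of_real (\<phi> j x)"
   show "AE x in lebesgue. (?z1 j x) \<longlonglongrightarrow> indicator (box a b) x *\<^sub>R g x"
   proof (rule AE_I2)
    fix x
    show "(?z1 j x) \<longlonglongrightarrow> indicator (box a b) x *\<^sub>R g x"
    proof (cases "x \<in> box a b")
     case True
     then have "(?z1 j x) \<longlonglongrightarrow> indicator (cbox a b) x *\<^sub>R g x * of_real 1"
      by (intro tendsto_intros lim)
     then show ?thesis using True box_subset_cbox[of a b] by (auto simp: indicator_def)
    qed (simp add: \<phi>0)
   qed
   show "AE x in lebesgue. norm (indicator (cbox a b) x *\<^sub>R g x * of_real (\<phi> j x)) <= norm (?z0 x)" for j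
   proof (rule AE_I2)
    fix x
    have "norm (?z0 x) * \<bar>\<phi> j x\<bar> <= norm (?z0 x)"
     by (intro mult_left_le \<phi>1 norm_ge_zero)
    then show "norm (indicator (cbox a b) x *\<^sub>R g x * of_real (\<phi> j x)) <= norm (?z0 x)"
     by (simp only: norm_mult norm_of_real)
   qed
  qed
  moreover have "(LINT x|lebesgue. indicator (cbox a b) x *\<^sub>R g x * of_real (\<phi> j x)) = 0" for j
   using z'[of j] unfolding set_lebesgue_integral_def eq .
  ultimately show ?thesis by (simp add: LIMSEQ_const_iff set_lebesgue_integral_def)
 qed
 obtain D where D: "countable D" "D \<subseteq> Pow U" "!!X. X \<in> D ==> \<exists>a b. X = cbox a b" "\<Union>D = U"
  using open_countable_Union_open_cbox[OF U] by blast
 have "AE x in lebesgue. x \<in> X --> g x = 0" if XD: "X \<in> D" for X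
 proof -
  obtain a b where X: "X = cbox a b" using D(3)[OF XD] by blast
  have sub: "cbox a b \<subseteq> U" using D(2) XD X by auto
  have "AE x in lebesgue. x \<in> box a b --> g x = 0"
  proof (rule AE_zero_on_box)
   show "set_integrable lebesgue (box a b) g"
    using si[OF sub] by (rule set_integrable_subset) (simp_all add: box_subset_cbox)
   fix c d assume cd: "box c d \<subseteq> box a b"
   \<comment> \<open>\<open>zb\<close> asks for the closed box inside \<open>U\<close>. An empty
     open box may come from a degenerate \<open>cbox\<close> that is not contained in
     \<open>U\<close>, hence the case distinction.\<close>
   show "(LINT x:box c d|lebesgue. g x) = 0"
   proof (cases "box c d = {}")
    case False
    then have "cbox c d = closure (box c d)" by (rule closure_box[symmetric])
    also have "... \<subseteq> closure (box a b)" by (rule closure_mono[OF cd])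
    also have "... \<subseteq> cbox a b" by (rule closure_minimal[OF box_subset_cbox closed_cbox])
    also note sub
    finally show ?thesis by (rule zb)
   qed (simp add: set_lebesgue_integral_def)
  qed
  moreover have "AE x in lebesgue. x \<notin> cbox a b - box a b"
   by (intro AE_not_in iffD1[OF negligible_iff_null_sets] negligible_frontier_interval)
  ultimately show ?thesis unfolding X by eventually_elim auto
 qed
 then have "AE x in lebesgue. \<forall>X\<in>D. x \<in> X --> g x = 0"
  by (subst AE_ball_countable[OF D(1)]) blast
 then show ?thesis by eventually_elim (use D(4) in blast)
qed

section \<open>Calculus with test functions\<close>

lemma test_function_partial_derivs:
 assumes "\<phi> \<in> test_functions U"
 shows "partial_derivs is \<phi> differentiable (at x)"
  and "partial_derivs is \<phi> \<in> test_functions U" 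
proof -
 have d: "\<forall>is x. partial_derivs is \<phi> differentiable (at x)"
  using assms by (simp add: test_functions_def)
 then show "partial_derivs is \<phi> differentiable (at x)" by blast
 have z: "partial_derivs is \<phi> x = 0" if "x \<notin> closure {x. \<phi> x ~= 0}" for x
  using that
 proof (induction "is" arbitrary: x)
  case Nil
  then show ?case using closure_subset[of "{x. \<phi> x ~= 0}"] by auto
 next
  case (Cons i "is")
  have "open (- closure {x. \<phi> x ~= 0})" by auto
  moreover have "isCont (%t. x + t *\<^sub>R axis i (1::real)) 0" by (intro continuous_intros)
  ultimately have "\<forall>\<^sub>F t in nhds 0. x + t *\<^sub>R axis i 1 \<in> - closure {x. \<phi> x ~= 0}"
   using Cons.prems by (intro topological_tendstoD[where f = "%t. x + t *\<^sub>R axis i 1" and l = x]) 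
    (auto simp: isCont_def tendsto_nhds_iff)
  then have "\<forall>\<^sub>F t in nhds 0. partial_derivs is \<phi> (x + t *\<^sub>R axis i 1) = 0"
   by eventually_elim (use Cons.IH in auto)
  then have "deriv (%t. partial_derivs is \<phi> (x + t *\<^sub>R axis i 1)) 0 = deriv (%t. 0) 0"
   by (intro deriv_cong_ev) auto
  moreover have "partial_derivs (i # is) \<phi> x = deriv (%t. partial_derivs is \<phi> (x + t *\<^sub>R axis i 1)) 0"
   by (simp only: foldr.simps comp_def partial_deriv_def[of i])
  ultimately show ?case by simp
 qed
 have sub: "closure {x. partial_derivs is \<phi> x ~= 0} \<subseteq> closure {x. \<phi> x ~= 0}"
  using z by (intro closure_minimal) auto
 have "\<forall>js x. partial_derivs js (partial_derivs is \<phi>) differentiable (at x)"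
  using d by (simp flip: foldr_append comp_apply[of "foldr partial_deriv _"])
 moreover have "compact (closure {x. partial_derivs is \<phi> x ~= 0})"
  using sub assms compact_Int_closed[of "closure {x. \<phi> x ~= 0}" "closure {x. partial_derivs is \<phi> x ~= 0}"]
  by (simp add: test_functions_def Int_absorb1)
 moreover have "closure {x. partial_derivs is \<phi> x ~= 0} \<subseteq> U"
  using sub assms by (auto simp: test_functions_def)
 ultimately show "partial_derivs is \<phi> \<in> test_functions U" by (simp add: test_functions_def)
qed

lemma test_function_continuous: "\<phi> \<in> test_functions U ==> continuous_on S \<phi>"
 using test_function_partial_derivs(1)[of \<phi> U "[]"]
 by (auto intro!: continuous_at_imp_continuous_on differentiable_imp_continuous_within)

lemma test_function_measurable:
 assumes "\<phi> \<in> test_functions U"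
 shows "\<phi> \<in> borel_measurable borel"
 by (intro borel_measurable_continuous_onI test_function_continuous[OF assms])

lemma test_function_bounded:
 assumes "\<phi> \<in> test_functions U"
 shows "\<exists>B\<ge>0. \<forall>x. \<bar>\<phi> x\<bar> <= B"
proof -
 let ?K = "closure {x. \<phi> x ~= 0}"
 have "compact ?K" using assms by (simp add: test_functions_def)
 then have "bounded (\<phi> ` ?K)"
  by (intro compact_imp_bounded compact_continuous_image test_function_continuous[OF assms])
 then obtain B where B: "B > 0" "\<forall>x\<in>?K. \<bar>\<phi> x\<bar> <= B" by (auto simp: bounded_pos)
 have "\<bar>\<phi> x\<bar> <= B" for x
  using B closure_subset[of "{x. \<phi> x ~= 0}"] by (cases "\<phi> x = 0") auto
 then show ?thesis using B(1) by (intro exI[of _ B]) auto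
qed

lemma set_integrable_times_test_function:
 fixes u :: "real ^ 'n => complex"
 assumes \<phi>: "\<phi> \<in> test_functions U" and u: "locally_integrable U u"
 shows "set_integrable lebesgue U (%x. u x * of_real (\<phi> x))"
proof -
 let ?K = "closure {x. \<phi> x ~= 0}"
 have K: "compact ?K" "?K \<subseteq> U" using \<phi> by (auto simp: test_functions_def)
 obtain B where B: "B >= 0" "!!x. \<bar>\<phi> x\<bar> <= B" using test_function_bounded[OF \<phi>] by blast
 have *: "integrable lebesgue (%x. indicator ?K x *\<^sub>R u x)"
  using u K unfolding locally_integrable_def set_integrable_def by blast
 have "integrable lebesgue (%x. indicator ?K x *\<^sub>R u x * of_real (\<phi> x))"
 proof (rule Bochner_Integration.integrable_bound)
  let ?z0 = "%x. indicator ?K x *\<^sub>R u x"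
  show "integrable lebesgue (%x. B *\<^sub>R (?z0 x))" by (intro integrable_scaleR_right *)
  have "(%x. complex_of_real (\<phi> x)) \<in> borel_measurable lebesgue"
   using test_function_measurable[OF \<phi>] by (intro measurable_completion) simp
  with borel_measurable_integrable[OF *]
  show "(%x. indicator ?K x *\<^sub>R u x * of_real (\<phi> x)) \<in> borel_measurable lebesgue"
   by (rule borel_measurable_times)
  show "AE x in lebesgue. norm (indicator ?K x *\<^sub>R u x * of_real (\<phi> x)) <= norm (B *\<^sub>R (?z0 x))"
  proof (rule AE_I2)
   fix x
   have "norm (?z0 x) * \<bar>\<phi> x\<bar> <= norm (?z0 x) * B"
    by (intro mult_left_mono B) auto
   then show "norm (indicator ?K x *\<^sub>R u x * of_real (\<phi> x)) <= norm (B *\<^sub>R (?z0 x))"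
    using B(1) by (simp add: norm_mult mult_ac)
  qed
 qed
 moreover have "indicator ?K x *\<^sub>R u x * of_real (\<phi> x) = indicator U x *\<^sub>R (u x * of_real (\<phi> x))" for x
 proof (cases "\<phi> x = 0")
  case False
  then have "x \<in> ?K" using closure_subset[of "{x. \<phi> x ~= 0}"] by blast
  then show ?thesis using K(2) by (simp add: subset_iff)
 qed simp
 ultimately show ?thesis unfolding set_integrable_def by (simp only:)
qed

text \<open>Guards against vacuity: \<open>has_weak_deriv\<close> quantifies over the lists with
  \<open>count_list is = \<alpha>\<close>, and uniqueness needs at least one of them.\<close>

lemma count_list_surj: "\<exists>is. count_list is = (\<alpha> :: 'n::finite => nat)"
proof -
 obtain js :: "'n list" where js: "set js = UNIV" "distinct js"
  using finite_distinct_list[OF finite_class.finite_UNIV] by blast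
 have rep: "count_list (replicate n x) y = (if x = y then n else 0)" for n and x y :: 'n
  by (induction n) auto
 have "count_list (concat (map (%i. replicate (\<alpha> i) i) ks)) i = (if i \<in> set ks then \<alpha> i else 0)"
  if "distinct ks" for ks i
  using that by (induction ks) (auto simp: rep)
 then have "count_list (concat (map (%i. replicate (\<alpha> i) i) js)) = \<alpha>" using js by auto
 then show ?thesis by blast
qed

text \<open>\<open>weak_deriv\<close> chooses by \<open>SOME\<close>; with uniqueness the Sobolev
  norm can be computed from any explicit weak derivative.\<close>

lemma weak_deriv_AE_unique:
 fixes f :: "real ^ 'n => complex"
 assumes U: "open U" and g: "has_weak_deriv \<alpha> U f g" and h: "has_weak_deriv \<alpha> U f h"
 shows "AE x in lebesgue. x \<in> U --> g x = h x"
proof -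
 obtain "is" where c: "count_list is = \<alpha>" using count_list_surj by blast
 have ig: "locally_integrable U g" and ih: "locally_integrable U h"
  using g h by (auto simp: has_weak_deriv_def)
 have "AE x in lebesgue. x \<in> U --> g x - h x = 0"
 proof (rule AE_zero_of_test_functions[OF U])
  show "locally_integrable U (%x. g x - h x)"
   using ig ih unfolding locally_integrable_def by (blast intro: set_integral_diff)
  fix \<phi> assume \<phi>: "\<phi> \<in> test_functions U"
  note D = conjunct2[OF conjunct2[OF iffD1[OF has_weak_deriv_def]], rule_format, OF _ \<phi> c]
  have "(LINT x:U|lebesgue. g x * of_real (\<phi> x)) = (LINT x:U|lebesgue. h x * of_real (\<phi> x))"
   using D[OF g] D[OF h] by simp
  then show "(LINT x:U|lebesgue. (g x - h x) * of_real (\<phi> x)) = 0"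
   using set_integral_diff(2)[OF set_integrable_times_test_function[OF \<phi> ig] set_integrable_times_test_function[OF \<phi> ih]]
   by (simp add: left_diff_distrib)
 qed
 then show ?thesis by eventually_elim auto
qed

section \<open>Weak derivatives of ridge functions\<close>

lemma relu_pow_measurable [measurable]: "relu_pow k \<in> borel_measurable borel"
 unfolding relu_pow_def by measurable

lemma power_diff_bound:
 fixes x y T :: real
 assumes "0 <= x" "x <= T" "0 <= y" "y <= T"
 shows "\<bar>x ^ Suc n - y ^ Suc n\<bar> <= real (Suc n) * T ^ n * \<bar>x - y\<bar>"
proof (induction n)
 case (Suc n)
 have "x ^ Suc (Suc n) - y ^ Suc (Suc n) = x * (x ^ Suc n - y ^ Suc n) + (x - y) * y ^ Suc n"
  by (simp add: algebra_simps)
 then have "\<bar>x ^ Suc (Suc n) - y ^ Suc (Suc n)\<bar> <= \<bar>x\<bar> * \<bar>x ^ Suc n - y ^ Suc n\<bar> + \<bar>x - y\<bar> * \<bar>y ^ Suc n\<bar>"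
  by (metis abs_mult abs_triangle_ineq)
 also have "... <= T * (real (Suc n) * T ^ n * \<bar>x - y\<bar>) + \<bar>x - y\<bar> * T ^ Suc n"
  using Suc assms by (intro add_mono mult_mono) (auto simp: power_mono simp del: power_Suc)
 also have "... = real (Suc (Suc n)) * T ^ Suc n * \<bar>x - y\<bar>" by (simp add: algebra_simps)
 finally show ?case .
qed auto

lemma relu_pow_Suc: "relu_pow (Suc j) t = max 0 t ^ Suc j"
 by (auto simp: relu_pow_def)

lemma relu_pow_lipschitz:
 assumes "\<bar>s\<bar> <= T" "\<bar>t\<bar> <= T"
 shows "\<bar>relu_pow (Suc j) s - relu_pow (Suc j) t\<bar> <= real (Suc j) * T ^ j * \<bar>s - t\<bar>"
proof -
 have "\<bar>max 0 s ^ Suc j - max 0 t ^ Suc j\<bar> <= real (Suc j) * T ^ j * \<bar>max 0 s - max 0 t\<bar>"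
  using assms by (intro power_diff_bound) auto
 also have "... <= real (Suc j) * T ^ j * \<bar>s - t\<bar>"
  using assms by (intro mult_left_mono) auto
 finally show ?thesis unfolding relu_pow_Suc .
qed

lemma relu_pow_abs_le: "\<bar>t\<bar> <= T ==> \<bar>relu_pow k t\<bar> <= T ^ k"
 by (auto simp: relu_pow_def power_mono)

lemma relu_pow_DERIV:
 assumes "t ~= 0"
 shows "(relu_pow (Suc j) has_real_derivative real (Suc j) * relu_pow j t) (at t)"
proof (cases "t > 0")
 case True
 have "((%t. t ^ Suc j) has_real_derivative real (Suc j) * t ^ j) (at t)"
  using DERIV_pow[of "Suc j" t UNIV] by simp
 then have "(relu_pow (Suc j) has_real_derivative real (Suc j) * t ^ j) (at t)"
  by (rule has_field_derivative_transform_within_open[where S = "{0<..}"])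
   (use True in \<open>auto simp: relu_pow_def\<close>)
 then show ?thesis using True by (simp add: relu_pow_def)
next
 case False
 have "((%t. 0) has_real_derivative 0) (at t)" by simp
 then have "(relu_pow (Suc j) has_real_derivative 0) (at t)"
  by (rule has_field_derivative_transform_within_open[where S = "{..<0}"])
   (use False assms in \<open>auto simp: relu_pow_def\<close>)
 then show ?thesis using False by (simp add: relu_pow_def)
qed

lemma integral_lborel_translate:
 fixes f :: "'a::euclidean_space => 'b::{banach, second_countable_topology}"
 assumes [measurable]: "f \<in> borel_measurable borel"
 shows "(LINT x|lborel. f (x + c)) = (LINT x|lborel. f x)"
proof -
 have "(LINT x|lborel. f x) = (LINT x|distr lborel borel ((+) c). f x)"
  by (simp add: lborel_distr_plus)
 also have "... = (LINT x|lborel. f (c + x))" by (subst integral_distr) auto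
 finally show ?thesis by (simp add: add.commute)
qed

lemma partial_deriv_DERIV:
 fixes \<phi> :: "real ^ 'n => real"
 assumes "!!x. \<phi> differentiable (at x)"
 shows "((%t. \<phi> (x + t *\<^sub>R axis i 1)) has_real_derivative partial_deriv i \<phi> (x + t *\<^sub>R axis i 1)) (at t)"
proof -
 have *: "(%s. \<phi> (y + s *\<^sub>R axis i 1)) differentiable (at 0)" for y
 proof -
  have "(\<phi> \<circ> (%s. y + s *\<^sub>R axis i 1)) differentiable (at 0)"
   by (rule differentiable_chain_at) (auto intro!: derivative_intros assms)
  then show ?thesis by (simp add: comp_def)
 qed
 have "((%s. \<phi> ((x + t *\<^sub>R axis i 1) + s *\<^sub>R axis i 1)) has_real_derivative partial_deriv i \<phi> (x + t *\<^sub>R axis i 1)) (at 0)"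
  unfolding partial_deriv_def using * by (simp add: DERIV_deriv_iff_real_differentiable)
 then have "((%s. \<phi> (x + (s + t) *\<^sub>R axis i 1)) has_real_derivative partial_deriv i \<phi> (x + t *\<^sub>R axis i 1)) (at 0)"
  by (simp add: algebra_simps)
 then show ?thesis using DERIV_shift[of "%t. \<phi> (x + t *\<^sub>R axis i 1)" _ 0 t] by simp
qed

text \<open>For \<open>j = 0\<close> the power is only Lipschitz, with a kink along the hyperplane
  \<open>\<omega> \<bullet> x + b = 0\<close>, so the proof uses difference quotients. Those of
  \<open>v * \<phi>\<close> integrate to zero by translation invariance; they are dominated by the
  Lipschitz bounds and converge to the product rule off the hyperplane, a null set because
  \<open>\<omega>\<close> is nonzero.\<close>

lemma integration_by_parts_ridge:
 fixes \<phi> :: "real ^ 'n => real"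
 assumes \<phi>: "\<phi> \<in> test_functions U" and \<omega>: "\<omega> ~= 0"
 shows "(LINT x|lborel. relu_pow (Suc j) (\<omega> \<bullet> x + b) * partial_deriv i \<phi> x) =
  - (real (Suc j) * \<omega> $ i * (LINT x|lborel. relu_pow j (\<omega> \<bullet> x + b) * \<phi> x))"
proof -
 let ?e = "axis i 1 :: real ^ 'n"
 define v where "v x = relu_pow (Suc j) (\<omega> \<bullet> x + b)" for x
 define v' where "v' x = real (Suc j) * \<omega> $ i * relu_pow j (\<omega> \<bullet> x + b)" for x
 have d\<phi>: "partial_deriv i \<phi> \<in> test_functions U"
  using test_function_partial_derivs(2)[OF \<phi>, of "[i]"] by simp
 have [measurable]: "\<phi> \<in> borel_measurable borel" "partial_deriv i \<phi> \<in> borel_measurable borel"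
  using test_function_measurable \<phi> d\<phi> by blast+
 have [measurable]: "v \<in> borel_measurable borel" "v' \<in> borel_measurable borel"
  unfolding v_def v'_def by measurable
 have diff: "\<phi> differentiable (at x)" for x
  using test_function_partial_derivs(1)[OF \<phi>, of "[]"] by simp
 note D = partial_deriv_DERIV[of \<phi>, OF diff]
 obtain B where B: "B >= 0" "!!x. \<bar>\<phi> x\<bar> <= B" using test_function_bounded[OF \<phi>] by blast
 obtain B' where B': "B' >= 0" "!!x. \<bar>partial_deriv i \<phi> x\<bar> <= B'" using test_function_bounded[OF d\<phi>] by blast
 have "bounded (closure {x. \<phi> x ~= 0})" using \<phi> by (simp add: test_functions_def compact_imp_bounded)
 then obtain R where R: "R > 0" "!!x. \<phi> x ~= 0 ==> norm x <= R"
  using closure_subset[of "{x. \<phi> x ~= 0}"] by (auto simp: bounded_pos)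
 define h where "h n = inverse (real (Suc n))" for n
 have h: "h n > 0" "h n <= 1" for n by (auto simp: h_def field_simps)
 have hlim: "h \<longlonglongrightarrow> 0" unfolding h_def by (rule LIMSEQ_inverse_real_of_nat)
 \<comment> \<open>Bounds the argument of the power on the ball of radius \<open>R + 2\<close>: the
   quotients vanish outside radius \<open>R + 1\<close>, and the steps \<open>h n\<close> are at
   most 1.\<close>
 define T where "T = norm \<omega> * (R + 2) + \<bar>b\<bar>"
 have T: "\<bar>\<omega> \<bullet> x + b\<bar> <= T" if "norm x <= R + 2" for x
  using Cauchy_Schwarz_ineq2[of \<omega> x] mult_left_mono[OF that, of "norm \<omega>"] by (simp add: T_def)
 define q where "q n x = (v (x + h n *\<^sub>R ?e) * \<phi> (x + h n *\<^sub>R ?e) - v x * \<phi> x) / h n" for n x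
 define l where "l x = v' x * \<phi> x + v x * partial_deriv i \<phi> x" for x
 define W where "W = T ^ Suc j * B' + real (Suc j) * T ^ j * norm \<omega> * B"
 have W0: "W >= 0" unfolding W_def T_def using R(1) B B' by (intro add_nonneg_nonneg mult_nonneg_nonneg) auto
 have qb: "\<bar>q n x\<bar> <= indicator (cball 0 (R + 1)) x * W" for n x
 proof (cases "norm x <= R + 1")
  case True
  have hx: "norm (x + h n *\<^sub>R ?e) <= R + 2"
   using norm_triangle_ineq[of x "h n *\<^sub>R ?e"] True h[of n] by simp
  have phi: "\<bar>\<phi> (x + h n *\<^sub>R ?e) - \<phi> x\<bar> <= B' * h n"
  proof -
   have "\<exists>z>0. z < h n \<and> \<phi> (x + h n *\<^sub>R ?e) - \<phi> (x + 0 *\<^sub>R ?e) = (h n - 0) * partial_deriv i \<phi> (x + z *\<^sub>R ?e)"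
    by (rule MVT2) (use h D in auto)
   then show ?thesis using B' h[of n] by (auto simp: abs_mult mult.commute intro!: mult_right_mono)
  qed
  have vv: "\<bar>v (x + h n *\<^sub>R ?e) - v x\<bar> <= real (Suc j) * T ^ j * norm \<omega> * h n"
  proof -
   have "\<bar>v (x + h n *\<^sub>R ?e) - v x\<bar> <= real (Suc j) * T ^ j * \<bar>(\<omega> \<bullet> (x + h n *\<^sub>R ?e) + b) - (\<omega> \<bullet> x + b)\<bar>"
    unfolding v_def using T hx True by (intro relu_pow_lipschitz) auto
   also have "(\<omega> \<bullet> (x + h n *\<^sub>R ?e) + b) - (\<omega> \<bullet> x + b) = h n * (\<omega> $ i)"
    by (simp add: inner_axis inner_add_right)
   also have "real (Suc j) * T ^ j * \<bar>h n * (\<omega> $ i)\<bar> <= real (Suc j) * T ^ j * (norm \<omega> * h n)"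
    using h[of n] component_le_norm_cart[of \<omega> i] R(1) by (intro mult_left_mono) (auto simp: abs_mult T_def)
   finally show ?thesis by (simp add: mult.assoc)
  qed
  have vb: "\<bar>v (x + h n *\<^sub>R ?e)\<bar> <= T ^ Suc j"
   unfolding v_def by (rule relu_pow_abs_le, rule T, rule hx)
  have "v (x + h n *\<^sub>R ?e) * \<phi> (x + h n *\<^sub>R ?e) - v x * \<phi> x
    = v (x + h n *\<^sub>R ?e) * (\<phi> (x + h n *\<^sub>R ?e) - \<phi> x) + (v (x + h n *\<^sub>R ?e) - v x) * \<phi> x"
   by (simp add: algebra_simps)
  also have "\<bar>...\<bar> <= T ^ Suc j * (B' * h n) + (real (Suc j) * T ^ j * norm \<omega> * h n) * B"
   by (intro order_trans[OF abs_triangle_ineq] add_mono; unfold abs_mult; intro mult_mono)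
    (use vb phi vv B in \<open>auto simp del: power_Suc intro: order_trans[OF abs_ge_zero]\<close>)
  also have "... = W * h n" by (simp add: W_def algebra_simps)
  finally have "\<bar>q n x\<bar> <= W" using h[of n] unfolding q_def by (simp add: pos_divide_le_eq)
  then show ?thesis using True by simp
 next
  case False
  have "norm (h n *\<^sub>R ?e) <= 1" using h[of n] by simp
  then have "norm (x + h n *\<^sub>R ?e) > R" using False norm_triangle_ineq2[of x "- (h n *\<^sub>R ?e)"] by auto
  then have "\<phi> (x + h n *\<^sub>R ?e) = 0" "\<phi> x = 0" using R False by fastforce+
  then show ?thesis using False by (simp add: q_def)
 qed
 have ql: "(%n. q n x) \<longlonglongrightarrow> l x" if "\<omega> \<bullet> x + b ~= 0" for x
 proof -
  have "((%t. relu_pow (Suc j) (\<omega> \<bullet> (x + t *\<^sub>R ?e) + b)) has_real_derivative real (Suc j) * relu_pow j (\<omega> \<bullet> x + b) * (\<omega> $ i)) (at 0)"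
  proof (rule DERIV_chain2[where f = "relu_pow (Suc j)"])
   show "(relu_pow (Suc j) has_real_derivative real (Suc j) * relu_pow j (\<omega> \<bullet> x + b)) (at (\<omega> \<bullet> (x + 0 *\<^sub>R ?e) + b))"
    using relu_pow_DERIV[OF that] by simp
   have "((%t. \<omega> \<bullet> x + t * (\<omega> $ i) + b) has_real_derivative \<omega> $ i) (at 0)"
    by (auto intro!: derivative_eq_intros)
   then show "((%t. \<omega> \<bullet> (x + t *\<^sub>R ?e) + b) has_real_derivative \<omega> $ i) (at 0)"
    by (simp add: inner_add_right inner_axis)
  qed
  from DERIV_mult[OF this D[of x i 0]]
  have "((%t. v (x + t *\<^sub>R ?e) * \<phi> (x + t *\<^sub>R ?e)) has_real_derivative l x) (at 0)"
   by (simp add: v_def v'_def l_def algebra_simps)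
  then have "((%t. (v (x + t *\<^sub>R ?e) * \<phi> (x + t *\<^sub>R ?e) - v x * \<phi> x) / t) \<longlongrightarrow> l x) (at 0)"
   by (simp add: DERIV_def)
  then show ?thesis unfolding q_def
   by (rule filterlim_compose) (use h hlim in \<open>auto simp: filterlim_at intro!: always_eventually less_imp_neq[THEN not_sym]\<close>)
 qed
 have "(%n. LINT x|lborel. q n x) \<longlonglongrightarrow> (LINT x|lborel. l x)"
 proof (rule integral_dominated_convergence[where w = "%x. indicator (cball 0 (R + 1)) x * W"])
  show "l \<in> borel_measurable lborel" unfolding l_def by measurable
  show "q n \<in> borel_measurable lborel" for n unfolding q_def by measurable
  show "integrable lborel (%x::real ^ 'n. indicator (cball 0 (R + 1)) x * W)"
   using emeasure_bounded_finite[OF bounded_cball[of "0::real ^ 'n" "R + 1"]]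
   by (intro integrable_mult_left integrable_real_indicator) auto
  have "AE x in lebesgue. x \<notin> {x. \<omega> \<bullet> x = - b}"
   by (intro AE_not_in iffD1[OF negligible_iff_null_sets] negligible_hyperplane) (use \<omega> in simp)
  then have "AE x in lborel. x \<notin> {x. \<omega> \<bullet> x = - b}" by (simp add: AE_completion_iff)
  then show "AE x in lborel. (%n. q n x) \<longlonglongrightarrow> l x"
   by eventually_elim (use ql in force)
  show "AE x in lborel. norm (q n x) <= indicator (cball 0 (R + 1)) x * W" for n
   using qb by simp
 qed
 have int: "integrable lborel (%x. f x * \<psi> x)"
  if f: "f \<in> borel_measurable borel" and \<psi>: "\<psi> \<in> test_functions U" and bd: "!!x. norm x <= R + 2 ==> \<bar>f x\<bar> <= K" and s: "!!x. \<psi> x ~= 0 ==> norm x <= R + 2"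
  for f \<psi> K
 proof -
  obtain C where C: "C >= 0" "!!x. \<bar>\<psi> x\<bar> <= C" using test_function_bounded[OF \<psi>] by blast
  show ?thesis
  proof (rule Bochner_Integration.integrable_bound)
  show "integrable lborel (%x::real ^ 'n. indicator (cball 0 (R + 2)) x * (K * C))"
   using emeasure_bounded_finite[OF bounded_cball[of "0::real ^ 'n" "R + 2"]]
   by (intro integrable_mult_left integrable_real_indicator) auto
  show "(%x. f x * \<psi> x) \<in> borel_measurable lborel"
   using f test_function_measurable[OF \<psi>] by simp
  show "AE x in lborel. norm (f x * \<psi> x) <= norm (indicator (cball 0 (R + 2)) x * (K * C))"
  proof (rule AE_I2)
   fix x show "norm (f x * \<psi> x) <= norm (indicator (cball 0 (R + 2)) x * (K * C))"
   proof (cases "norm x <= R + 2")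
    case True
    have "\<bar>f x\<bar> * \<bar>\<psi> x\<bar> <= K * C" using bd[OF True] C by (intro mult_mono) auto
    also have "... <= \<bar>K * C\<bar>" by simp
    finally show ?thesis using True by (simp add: abs_mult)
   qed (use s in force)
  qed
  qed
 qed
 have sp: "partial_deriv i \<phi> x = 0" if "norm x > R" for x
 proof -
  have o: "open {x. norm x > R}" by (intro open_Collect_less continuous_intros)
  have "\<forall>\<^sub>F t in nhds 0. x + t *\<^sub>R ?e \<in> {x. norm x > R}"
  proof (rule topological_tendstoD)
   have "isCont (%t. x + t *\<^sub>R ?e) 0" by (intro continuous_intros)
   then show "((%t. x + t *\<^sub>R ?e) \<longlongrightarrow> x) (nhds 0)"
    by (simp add: isCont_def tendsto_nhds_iff)
  qed (use o that in auto)
  then have "\<forall>\<^sub>F t in nhds 0. \<phi> (x + t *\<^sub>R ?e) = 0"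
   by eventually_elim (use R in force)
  then have "deriv (%t. \<phi> (x + t *\<^sub>R ?e)) 0 = deriv (%t. 0) 0" by (intro deriv_cong_ev) auto
  then show ?thesis by (simp add: partial_deriv_def)
 qed
 have i1: "integrable lborel (%x. v x * \<phi> x)"
  by (rule int[where K = "T ^ Suc j"]) (use \<phi> R T relu_pow_abs_le[of _ T "Suc j"] in \<open>force simp: v_def simp del: power_Suc\<close>)+
 have i2: "integrable lborel (%x. v x * partial_deriv i \<phi> x)"
  by (rule int[where K = "T ^ Suc j"]) (use d\<phi> sp T relu_pow_abs_le[of _ T "Suc j"] in \<open>force simp: v_def simp del: power_Suc\<close>)+
 have i3: "integrable lborel (%x. relu_pow j (\<omega> \<bullet> x + b) * \<phi> x)"
  by (rule int[where K = "T ^ j"]) (use \<phi> R T relu_pow_abs_le[of _ T j] in force)+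
 have "(LINT x|lborel. q n x) = 0" for n
 proof -
  have "integrable lborel (%x. v (x + h n *\<^sub>R ?e) * \<phi> (x + h n *\<^sub>R ?e))"
  proof -
   have "integrable (distr lborel borel ((+) (h n *\<^sub>R ?e))) (%x. v x * \<phi> x)"
    using i1 by (simp add: lborel_distr_plus)
   then have "integrable lborel (%x. v (h n *\<^sub>R ?e + x) * \<phi> (h n *\<^sub>R ?e + x))"
    by (subst (asm) integrable_distr_eq) auto
   then show ?thesis by (simp add: add.commute)
  qed
  then show ?thesis unfolding q_def using i1 integral_lborel_translate[of "%x. v x * \<phi> x" "h n *\<^sub>R ?e"]
   by simp
 qed
 then have "(LINT x|lborel. l x) = 0"
  using \<open>(%n. LINT x|lborel. q n x) \<longlonglongrightarrow> (LINT x|lborel. l x)\<close> by (simp add: LIMSEQ_const_iff)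
 moreover have "(LINT x|lborel. l x) = real (Suc j) * \<omega> $ i * (LINT x|lborel. relu_pow j (\<omega> \<bullet> x + b) * \<phi> x) + (LINT x|lborel. v x * partial_deriv i \<phi> x)"
  unfolding l_def v'_def using i2 integrable_mult_right[OF i3, of "real (Suc j) * \<omega> $ i"]
  by (subst Bochner_Integration.integral_add) (auto simp: mult.assoc)
 ultimately show ?thesis by (simp add: v_def)
qed

text \<open>The weak derivative of order \<alpha> of the ridge function, for orders up to
  \<open>k\<close> (beyond that the subtraction truncates). At order \<open>k\<close> it is a
  multiple of a Heaviside function across a hyperplane.\<close>

definition ridge_deriv :: "('n::finite => nat) => nat => real ^ 'n => real => real ^ 'n => real" where
 "ridge_deriv \<alpha> k \<omega> b x =
   (\<Prod>i\<in>UNIV. (\<omega> $ i) ^ \<alpha> i) * (fact k / fact (k - multi_index_order \<alpha>)) *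
   relu_pow (k - multi_index_order \<alpha>) (\<omega> \<bullet> x + b)"

lemma integral_partial_derivs_ridge:
 fixes \<phi> :: "real ^ 'n => real"
 assumes \<phi>: "\<phi> \<in> test_functions U" and \<omega>: "\<omega> ~= 0" and "length is <= k"
 shows "(LINT x|lborel. relu_pow k (\<omega> \<bullet> x + b) * partial_derivs is \<phi> x) =
  (-1) ^ length is * ((\<Prod>i\<leftarrow>is. \<omega> $ i) * (fact k / fact (k - length is)) *
   (LINT x|lborel. relu_pow (k - length is) (\<omega> \<bullet> x + b) * \<phi> x))"
 using assms(3)
proof (induction "is" arbitrary: k)
 case (Cons i "is")
 then obtain j where k: "k = Suc j" by (cases k) auto
 have *: "fact k / (fact (k - length (i # is)) :: real) = real (Suc j) * (fact j / fact (j - length is))"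
  by (simp add: k)
 have "(LINT x|lborel. relu_pow k (\<omega> \<bullet> x + b) * partial_derivs (i # is) \<phi> x) =
  - (real (Suc j) * \<omega> $ i * (LINT x|lborel. relu_pow j (\<omega> \<bullet> x + b) * partial_derivs is \<phi> x))"
  using integration_by_parts_ridge[OF test_function_partial_derivs(2)[OF \<phi>, of "is"] \<omega>, of j b i] by (simp add: k comp_def)
 also have "... = (-1) ^ length (i # is) * ((\<Prod>i\<leftarrow>i # is. \<omega> $ i) * (real (Suc j) * (fact j / fact (j - length is))) *
   (LINT x|lborel. relu_pow (j - length is) (\<omega> \<bullet> x + b) * \<phi> x))"
  using Cons by (simp add: k mult_ac)
 finally show ?case unfolding * by (simp add: k)
qed simp

lemma count_list_prod_length:
 fixes f :: "'n::finite => real"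
 shows "(\<Prod>i\<leftarrow>is. f i) = (\<Prod>i\<in>UNIV. f i ^ count_list is i)"
  and "length is = multi_index_order (count_list is)"
proof -
 have "(\<Prod>i\<in>UNIV. f i ^ count_list (j # js) i) = f j * (\<Prod>i\<in>UNIV. f i ^ count_list js i)" for j js
 proof -
  have "(\<Prod>i\<in>UNIV. f i ^ count_list (j # js) i) = (\<Prod>i\<in>UNIV. (if i = j then f j else 1) * f i ^ count_list js i)"
   by (intro prod.cong) auto
  then show ?thesis by (simp add: prod.distrib)
 qed
 then show "(\<Prod>i\<leftarrow>is. f i) = (\<Prod>i\<in>UNIV. f i ^ count_list is i)" by (induction "is") auto
 have "(\<Sum>i\<in>UNIV. count_list (j # js) i) = Suc (\<Sum>i\<in>UNIV. count_list js i)" for j :: 'n and js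
 proof -
  have "(\<Sum>i\<in>UNIV. count_list (j # js) i) = (\<Sum>i\<in>UNIV. (if i = j then 1 else 0) + count_list js i)"
   by (intro sum.cong) auto
  then show ?thesis by (simp add: sum.distrib)
 qed
 then show "length is = multi_index_order (count_list is)"
  unfolding multi_index_order_def by (induction "is") auto
qed

lemma locally_integrable_bounded:
 fixes f :: "real ^ 'n => complex"
 assumes "f \<in> borel_measurable borel" and bd: "!!R. \<exists>B. \<forall>x. norm x <= R --> norm (f x) <= B"
 shows "locally_integrable U f"
 unfolding locally_integrable_def
proof (intro allI impI)
 fix K assume "compact K \<and> K \<subseteq> U"
 then have K: "compact K" "bounded K" by (auto simp: compact_imp_bounded)
 then obtain R where R: "!!x. x \<in> K ==> norm x <= R" by (auto simp: bounded_iff)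
 obtain B where B: "!!x. norm x <= R ==> norm (f x) <= B" using bd by blast
 have Kb: "K \<in> sets borel" using K(1) by (simp add: borel_closed compact_imp_closed)
 have "integrable lborel (%x. indicator K x *\<^sub>R f x)"
 proof (rule Bochner_Integration.integrable_bound)
  show "integrable lborel (%x. indicator K x * B)"
   using Kb emeasure_bounded_finite[OF K(2)] by (intro integrable_mult_left integrable_real_indicator) auto
  show "(%x. indicator K x *\<^sub>R f x) \<in> borel_measurable lborel" using assms(1) Kb by simp
  have "norm (indicator K x *\<^sub>R f x) <= norm (indicator K x * B)" for x
   using B[of x] R[of x] order_trans[OF norm_ge_zero B[of x]] by (cases "x \<in> K") auto
  then show "AE x in lborel. norm (indicator K x *\<^sub>R f x) <= norm (indicator K x * B)" by simp
 qed
 then show "set_integrable lebesgue K f"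
  unfolding set_integrable_def by (subst integrable_completion) auto
qed

lemma set_integral_test_function:
 fixes u :: "real ^ 'n => real"
 assumes \<phi>: "\<phi> \<in> test_functions U" and u: "u \<in> borel_measurable borel"
 shows "(LINT x:U|lebesgue. complex_of_real (u x) * of_real (\<phi> x)) = of_real (LINT x|lborel. u x * \<phi> x)"
proof -
 have "indicator U x *\<^sub>R (complex_of_real (u x) * of_real (\<phi> x)) = complex_of_real (u x * \<phi> x)" for x
  using \<phi> closure_subset[of "{x. \<phi> x ~= 0}"] by (cases "\<phi> x = 0") (auto simp: indicator_def test_functions_def)
 then have "(LINT x:U|lebesgue. complex_of_real (u x) * of_real (\<phi> x)) = (LINT x|lebesgue. complex_of_real (u x * \<phi> x))"
  unfolding set_lebesgue_integral_def by presburger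
 also have "... = (LINT x|lborel. complex_of_real (u x * \<phi> x))"
  using u test_function_measurable[OF \<phi>] by (intro integral_completion) auto
 finally show ?thesis by (simp only: integral_complex_of_real)
qed

lemma ridge_deriv_measurable [measurable]: "ridge_deriv \<alpha> k \<omega> b \<in> borel_measurable borel"
 unfolding ridge_deriv_def by measurable

lemma relu_ridge_bounded: "\<exists>B. \<forall>x. norm x <= R --> \<bar>relu_pow k (\<omega> \<bullet> x + b)\<bar> <= B"
proof (intro exI allI impI)
 fix x :: "'a :: real_inner" assume R: "norm x <= R"
 have "\<bar>\<omega> \<bullet> x + b\<bar> <= norm \<omega> * R + \<bar>b\<bar>"
  using Cauchy_Schwarz_ineq2[of \<omega> x] mult_left_mono[OF R, of "norm \<omega>"] by simp
 then show "\<bar>relu_pow k (\<omega> \<bullet> x + b)\<bar> <= (norm \<omega> * R + \<bar>b\<bar>) ^ k" by (rule relu_pow_abs_le)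
qed

lemma has_weak_deriv_ridge:
 fixes \<omega> :: "real ^ 'n"
 assumes "multi_index_order \<alpha> <= k" "\<omega> ~= 0"
 shows "has_weak_deriv \<alpha> U (%x. of_real (relu_pow k (\<omega> \<bullet> x + b))) (%x. of_real (ridge_deriv \<alpha> k \<omega> b x))"
 unfolding has_weak_deriv_def
proof (intro conjI ballI allI impI)
 show "locally_integrable U (%x. complex_of_real (relu_pow k (\<omega> \<bullet> x + b)))"
  by (rule locally_integrable_bounded) (use relu_ridge_bounded in auto)
 let ?z0 = "k - multi_index_order \<alpha>"
 show "locally_integrable U (%x. complex_of_real (ridge_deriv \<alpha> k \<omega> b x))"
 proof (rule locally_integrable_bounded)
  fix R
  obtain B where B: "\<forall>x. norm x <= R --> \<bar>relu_pow ?z0 (\<omega> \<bullet> x + b)\<bar> <= B"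
   using relu_ridge_bounded by blast
  show "\<exists>B. \<forall>x. norm x <= R --> norm (complex_of_real (ridge_deriv \<alpha> k \<omega> b x)) <= B"
   unfolding ridge_deriv_def norm_of_real abs_mult
   by (intro exI[of _ "\<bar>\<Prod>i\<in>UNIV. (\<omega> $ i) ^ \<alpha> i\<bar> * \<bar>fact k / fact ?z0\<bar> * B"] allI impI mult_left_mono) (use B in auto)
 qed simp
 fix \<phi> "is" assume \<phi>: "\<phi> \<in> test_functions U" and c: "count_list is = \<alpha>"
 have l: "length is = multi_index_order \<alpha>" using count_list_prod_length(2)[of "is"] c by simp
 have p: "(\<Prod>i\<leftarrow>is. \<omega> $ i) = (\<Prod>i\<in>UNIV. (\<omega> $ i) ^ \<alpha> i)" using count_list_prod_length(1)[of _ "is"] c by simp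
 have "(LINT x|lborel. ridge_deriv \<alpha> k \<omega> b x * \<phi> x) = 
   (\<Prod>i\<in>UNIV. (\<omega> $ i) ^ \<alpha> i) * (fact k / fact ?z0) *
   (LINT x|lborel. relu_pow ?z0 (\<omega> \<bullet> x + b) * \<phi> x)"
  unfolding ridge_deriv_def mult.assoc by (simp only: integral_mult_right_zero)
 then have "(LINT x|lborel. relu_pow k (\<omega> \<bullet> x + b) * partial_derivs is \<phi> x) =
  (-1) ^ multi_index_order \<alpha> * (LINT x|lborel. ridge_deriv \<alpha> k \<omega> b x * \<phi> x)"
  using integral_partial_derivs_ridge[OF \<phi> assms(2), of "is" k b] assms(1) l p by simp
 then show "(LINT x:U|lebesgue. complex_of_real (relu_pow k (\<omega> \<bullet> x + b)) * of_real (partial_derivs is \<phi> x)) =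
   (-1) ^ multi_index_order \<alpha> * (LINT x:U|lebesgue. complex_of_real (ridge_deriv \<alpha> k \<omega> b x) * of_real (\<phi> x))"
  by (simp add: set_integral_test_function[OF \<phi>] set_integral_test_function[OF test_function_partial_derivs(2)[OF \<phi>]])
qed

section \<open>Linearity of weak derivatives\<close>

lemma locally_integrable_add:
 "locally_integrable U f ==> locally_integrable U g ==> locally_integrable U (%x. f x + g x)"
 unfolding locally_integrable_def by (blast intro: set_integral_add)

lemma locally_integrable_cmult:
 "locally_integrable U f ==> locally_integrable U (%x. c * f x)"
 unfolding locally_integrable_def by (blast intro: set_integrable_mult_right)

lemma has_weak_deriv_add:
 fixes f g :: "real ^ 'n => complex"
 assumes "has_weak_deriv \<alpha> U f f'" "has_weak_deriv \<alpha> U g g'"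
 shows "has_weak_deriv \<alpha> U (%x. f x + g x) (%x. f' x + g' x)"
proof -
 have li: "locally_integrable U f" "locally_integrable U f'" "locally_integrable U g" "locally_integrable U g'"
  using assms by (auto simp: has_weak_deriv_def)
 have "(LINT x:U|lebesgue. (f x + g x) * of_real (partial_derivs is \<phi> x)) =
    (-1) ^ multi_index_order \<alpha> * (LINT x:U|lebesgue. (f' x + g' x) * of_real (\<phi> x))"
  if \<phi>: "\<phi> \<in> test_functions U" and c: "count_list is = \<alpha>" for \<phi> "is"
 proof -
  note D = conjunct2[OF conjunct2[OF iffD1[OF has_weak_deriv_def]], rule_format, OF _ \<phi> c]
  note S = set_integrable_times_test_function[OF \<phi>] set_integrable_times_test_function[OF test_function_partial_derivs(2)[OF \<phi>]]
  show ?thesis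
   unfolding distrib_right set_integral_add(2)[OF S(2)[OF li(1)] S(2)[OF li(3)]]
    set_integral_add(2)[OF S(1)[OF li(2)] S(1)[OF li(4)]]
   using D[OF assms(1)] D[OF assms(2)] by (simp add: distrib_left)
 qed
 then show ?thesis using li by (auto simp: has_weak_deriv_def locally_integrable_add)
qed

lemma has_weak_deriv_cmult:
 fixes f :: "real ^ 'n => complex"
 assumes "has_weak_deriv \<alpha> U f f'"
 shows "has_weak_deriv \<alpha> U (%x. c * f x) (%x. c * f' x)"
proof -
 have li: "locally_integrable U f" "locally_integrable U f'"
  using assms by (auto simp: has_weak_deriv_def)
 have "(LINT x:U|lebesgue. (c * f x) * of_real (partial_derivs is \<phi> x)) =
    (-1) ^ multi_index_order \<alpha> * (LINT x:U|lebesgue. (c * f' x) * of_real (\<phi> x))"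
  if \<phi>: "\<phi> \<in> test_functions U" and c: "count_list is = \<alpha>" for \<phi> "is"
  using conjunct2[OF conjunct2[OF iffD1[OF has_weak_deriv_def assms]], rule_format, OF \<phi> c]
  by (simp add: mult.assoc)
 then show ?thesis using li by (auto simp: has_weak_deriv_def locally_integrable_cmult)
qed

lemma has_weak_deriv_zero: "has_weak_deriv \<alpha> U (%x. 0) (%x. 0)"
 by (simp add: has_weak_deriv_def locally_integrable_def set_integrable_def set_lebesgue_integral_def)

lemma has_weak_deriv_sum:
 fixes f :: "'i => real ^ 'n => complex"
 assumes "!!i. i \<in> I ==> has_weak_deriv \<alpha> U (f i) (f' i)"
 shows "has_weak_deriv \<alpha> U (%x. \<Sum>i\<in>I. f i x) (%x. \<Sum>i\<in>I. f' i x)"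
 using assms by (induction I rule: infinite_finite_induct) (auto intro: has_weak_deriv_add has_weak_deriv_zero)

section \<open>Maurey sampling in Sobolev spaces\<close>

abbreviation esq :: "complex => ennreal" where
 "esq z \<equiv> ennreal ((cmod z)\<^sup>2)"

text \<open>Everything follows from \<open>E |a - X|^2 = |a - E X|^2 - |E X|^2 + E |X|^2\<close>:
  take \<open>a = h + E X\<close> and drop the negative term, or take
  \<open>a = E X\<close>.\<close>

lemma (in prob_space) variance_bound:
 fixes X :: "'a => complex"
 assumes X: "X \<in> borel_measurable M" and fin: "(\<integral>\<^sup>+y. esq (X y) \<partial>M) < \<infinity>"
 shows "integrable M X"
  and "(\<integral>\<^sup>+y. esq (h + expectation X - X y) \<partial>M)
    <= esq h + (\<integral>\<^sup>+y. esq (X y) \<partial>M)"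
  and "esq (expectation X) <= (\<integral>\<^sup>+y. esq (X y) \<partial>M)"
proof -
 note X[measurable]
 have i2: "integrable M (%y. (cmod (X y))\<^sup>2)"
  using fin by (intro integrableI_nonneg) auto
 show i1: "integrable M X"
 proof (rule Bochner_Integration.integrable_bound)
  show "integrable M (%y. 1 + (cmod (X y))\<^sup>2)" using i2 by auto
  have "cmod z <= 1 + (cmod z)\<^sup>2" for z
   using sum_squares_ge_zero[of "cmod z - 1" 0] by (simp add: power2_eq_square algebra_simps) (smt (verit) zero_le_square)
  then show "AE y in M. norm (X y) <= norm (1 + (cmod (X y))\<^sup>2)" by auto
 qed simp
 define E where "E = expectation X"
 have ex: "(cmod (a - X y))\<^sup>2 = (cmod a)\<^sup>2 - 2 * Re (cnj a * X y) + (cmod (X y))\<^sup>2" for a y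
  unfolding cmod_power2 by (simp add: power2_eq_square algebra_simps)
 have ia: "integrable M (%y. (cmod (a - X y))\<^sup>2)" for a
  unfolding ex using i1 i2 by (intro Bochner_Integration.integrable_add Bochner_Integration.integrable_diff integrable_mult_right integrable_Re) auto
 \<comment> \<open>The argument of \<open>?z0\<close> is a dummy, as the integral rebinds
   \<open>y\<close>; the term is the second moment of \<open>X\<close>.\<close>
 let ?z0 = "%y. LINT y|M. (cmod (X y))\<^sup>2"
 have int: "(LINT y|M. (cmod (a - X y))\<^sup>2) = (cmod (a - E))\<^sup>2 - (cmod E)\<^sup>2 + (?z0 y)" for a
 proof -
  have "(LINT y|M. (cmod (a - X y))\<^sup>2) = (cmod a)\<^sup>2 - 2 * Re (cnj a * E) + (?z0 y)"
  proof -
   have "integrable M (%y. 2 * Re (cnj a * X y))" "(LINT y|M. 2 * Re (cnj a * X y)) = 2 * Re (cnj a * E)"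
    using i1 integral_Re[of M "%y. cnj a * X y"] by (auto simp: E_def simp del: times_complex.sel)
   then show ?thesis unfolding ex using i2 by (simp add: prob_space del: times_complex.sel)
  qed
  moreover have "(cmod (a - E))\<^sup>2 = (cmod a)\<^sup>2 - 2 * Re (cnj a * E) + (cmod E)\<^sup>2"
   unfolding cmod_power2 by (simp add: power2_eq_square algebra_simps)
  ultimately show ?thesis by simp
 qed
 have nn: "(\<integral>\<^sup>+y. esq (X y) \<partial>M) = ennreal (?z0 y)"
  by (intro nn_integral_eq_integral i2) auto
 have "0 <= (LINT y|M. (cmod (E - X y))\<^sup>2)" by simp
 then have E2: "(cmod E)\<^sup>2 <= (?z0 y)" unfolding int by simp
 then show "esq (expectation X) <= (\<integral>\<^sup>+y. esq (X y) \<partial>M)"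
  unfolding nn E_def by (rule ennreal_leI)
 have "(\<integral>\<^sup>+y. esq (h + E - X y) \<partial>M) = ennreal (LINT y|M. (cmod (h + E - X y))\<^sup>2)"
  by (intro nn_integral_eq_integral ia) auto
 also have "... <= ennreal ((cmod h)\<^sup>2 + (?z0 y))"
  unfolding int by (intro ennreal_leI) simp
 also have "... = esq h + ennreal (?z0 y)"
  by (intro ennreal_plus) auto
 finally show "(\<integral>\<^sup>+y. esq (h + expectation X - X y) \<partial>M)
    <= esq h + (\<integral>\<^sup>+y. esq (X y) \<partial>M)"
  unfolding nn E_def .
qed

lemma (in prob_space) exists_le_nn_integral:
 assumes f: "f \<in> borel_measurable M" and c: "(\<integral>\<^sup>+y. f y \<partial>M) <= c"
 shows "\<exists>y\<in>space M. f y <= c"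
proof (rule ccontr)
 assume "\<not> ?thesis"
 then have gt: "!!y. y \<in> space M ==> c < f y" by auto
 then have "c < \<infinity>" using not_empty by (force simp: less_top[symmetric] top_unique)
 have "(\<integral>\<^sup>+y. (f y - c) \<partial>M) = (\<integral>\<^sup>+y. f y \<partial>M) - (\<integral>\<^sup>+y. c \<partial>M)"
  using f gt \<open>c < \<infinity>\<close> by (intro nn_integral_diff) (auto simp: emeasure_space_1 intro: less_imp_le)
 also have "... = 0" using c \<open>c < \<infinity>\<close> by (auto simp: emeasure_space_1 diff_eq_0_iff_ennreal intro: le_less_trans)
 finally have "AE y in M. f y - c = 0" using f by (subst (asm) nn_integral_0_iff_AE) auto
 moreover have "AE y in M. \<not> (f y - c = 0)"
  using gt by (intro AE_I2) (auto simp: diff_eq_0_iff_ennreal not_le less_top)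
 ultimately have "AE y in M. False" by eventually_elim simp
 then show False by simp
qed

text \<open>Maurey's argument without a product of probability spaces: the sample points are chosen
  one after the other. If \<open>h\<close> is the accumulated error, a further centred summand
  raises the expected square by at most \<open>V\<close>, because the cross term averages out, and
  some point does at least as well as the average. After \<open>n\<close> steps the square is at
  most \<open>n * V\<close>, and dividing the sum by \<open>n\<close> leaves \<open>V / n\<close>.
  The index \<open>l\<close> runs over finitely many components, whose squared norms are
  added.\<close>

lemma maurey:
 fixes P :: "'y measure" and M :: "'z measure" and \<Phi> :: "'l => 'y => 'z => complex"
 assumes P: "prob_space P" and M: "sigma_finite_measure M" and A: "finite A" and V: "V >= 0"
  and meas: "!!l. l \<in> A ==> case_prod (\<Phi> l) \<in> borel_measurable (P \<Otimes>\<^sub>M M)"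
  and bound: "!!y. y \<in> space P ==> (\<Sum>l\<in>A. \<integral>\<^sup>+z. esq (\<Phi> l y z) \<partial>M) <= ennreal V"
 shows "\<exists>y. (\<forall>i<n. y i \<in> space P) \<and>
  (\<Sum>l\<in>A. \<integral>\<^sup>+z. esq ((LINT y|P. \<Phi> l y z) - (\<Sum>i<n. \<Phi> l (y i) z) / of_nat n) \<partial>M)
   <= ennreal (V / max 1 (real n))"
proof -
 interpret P: prob_space P by fact
 interpret M: sigma_finite_measure M by fact
 interpret PM: pair_sigma_finite P M ..
 define F where "F l z = (LINT y|P. \<Phi> l y z)" for l z
 have [measurable]: "case_prod (\<Phi> l) \<in> borel_measurable (P \<Otimes>\<^sub>M M)" "(%(z, y). \<Phi> l y z) \<in> borel_measurable (M \<Otimes>\<^sub>M P)" if "l \<in> A" for l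
 proof -
  show m: "case_prod (\<Phi> l) \<in> borel_measurable (P \<Otimes>\<^sub>M M)" by (rule meas[OF that])
  show "(%(z, y). \<Phi> l y z) \<in> borel_measurable (M \<Otimes>\<^sub>M P)"
   using measurable_compose[OF measurable_pair_swap' m] by (simp add: case_prod_beta' comp_def)
 qed
 have sec1: "\<Phi> l y \<in> borel_measurable M" if "l \<in> A" "y \<in> space P" for l y
  using measurable_Pair2[OF meas[OF that(1)] that(2)] by simp
 have sec2: "(%y. \<Phi> l y z) \<in> borel_measurable P" if "l \<in> A" "z \<in> space M" for l z
  using measurable_Pair1[OF meas[OF that(1)] that(2)] by simp
 have F[measurable]: "F l \<in> borel_measurable M" if "l \<in> A" for l
  unfolding F_def using that by measurable
 define S where "S l z = (\<integral>\<^sup>+y. esq (\<Phi> l y z) \<partial>P)" for l z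
 have Sm[measurable]: "S l \<in> borel_measurable M" if "l \<in> A" for l
  unfolding S_def using that by measurable
 have tot: "(\<Sum>l\<in>A. \<integral>\<^sup>+z. S l z \<partial>M) <= ennreal V"
 proof -
  have "(\<Sum>l\<in>A. \<integral>\<^sup>+z. S l z \<partial>M) = (\<Sum>l\<in>A. \<integral>\<^sup>+y. (\<integral>\<^sup>+z. esq (\<Phi> l y z) \<partial>M) \<partial>P)"
   unfolding S_def by (intro sum.cong refl PM.Fubini') measurable
  also have "... = (\<integral>\<^sup>+y. (\<Sum>l\<in>A. \<integral>\<^sup>+z. esq (\<Phi> l y z) \<partial>M) \<partial>P)"
   by (intro nn_integral_sum[symmetric]) measurable
  also have "... <= (\<integral>\<^sup>+y. ennreal V \<partial>P)" by (intro nn_integral_mono bound)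
  finally show ?thesis by (simp add: P.emeasure_space_1)
 qed
 \<comment> \<open>The pointwise mean \<open>F l z\<close> is controlled as a Bochner integral only
   where the second moment is finite.\<close>
 have Sfin: "AE z in M. S l z < \<infinity>" if l: "l \<in> A" for l
 proof -
  have "(\<integral>\<^sup>+z. S l z \<partial>M) <= ennreal V"
   using tot member_le_sum[of l A "%l. \<integral>\<^sup>+z. S l z \<partial>M"] l A by (auto intro: order_trans)
  then have "(\<integral>\<^sup>+z. S l z \<partial>M) ~= \<infinity>" by (auto simp: top_unique)
  then show ?thesis using nn_integral_noteq_infinite[OF Sm[OF l]] by (simp add: less_top)
 qed
 have step: "\<exists>y\<in>space P. (\<Sum>l\<in>A. \<integral>\<^sup>+z. esq (h l z + (F l z - \<Phi> l y z)) \<partial>M)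
   <= (\<Sum>l\<in>A. \<integral>\<^sup>+z. esq (h l z) \<partial>M) + ennreal V"
  if hm[measurable]: "!!l. l \<in> A ==> h l \<in> borel_measurable M" for h
 proof (rule P.exists_le_nn_integral)
  show "(%y. \<Sum>l\<in>A. \<integral>\<^sup>+z. esq (h l z + (F l z - \<Phi> l y z)) \<partial>M) \<in> borel_measurable P"
   by measurable
  have "(\<integral>\<^sup>+y. (\<Sum>l\<in>A. \<integral>\<^sup>+z. esq (h l z + (F l z - \<Phi> l y z)) \<partial>M) \<partial>P)
   = (\<Sum>l\<in>A. \<integral>\<^sup>+y. \<integral>\<^sup>+z. esq (h l z + (F l z - \<Phi> l y z)) \<partial>M \<partial>P)"
   by (intro nn_integral_sum) measurable
  also have "... = (\<Sum>l\<in>A. \<integral>\<^sup>+z. \<integral>\<^sup>+y. esq (h l z + (F l z - \<Phi> l y z)) \<partial>P \<partial>M)"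
   by (intro sum.cong refl PM.Fubini'[symmetric]) measurable
  also have "... <= (\<Sum>l\<in>A. \<integral>\<^sup>+z. esq (h l z) + S l z \<partial>M)"
  proof (intro sum_mono nn_integral_mono_AE)
   fix l assume l: "l \<in> A"
   show "AE z in M. (\<integral>\<^sup>+y. esq (h l z + (F l z - \<Phi> l y z)) \<partial>P) <= esq (h l z) + S l z"
    using Sfin[OF l] AE_space
   proof eventually_elim
    case (elim z)
    show ?case
     using P.variance_bound(2)[OF sec2[OF l elim(2)], of "h l z"] elim(1) by (simp add: S_def F_def add_diff_eq)
   qed
  qed
  also have "... = (\<Sum>l\<in>A. (\<integral>\<^sup>+z. esq (h l z) \<partial>M) + (\<integral>\<^sup>+z. S l z \<partial>M))"
   by (intro sum.cong refl nn_integral_add) measurable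
  also have "... = (\<Sum>l\<in>A. \<integral>\<^sup>+z. esq (h l z) \<partial>M) + (\<Sum>l\<in>A. \<integral>\<^sup>+z. S l z \<partial>M)"
   by (rule sum.distrib)
  also have "... <= (\<Sum>l\<in>A. \<integral>\<^sup>+z. esq (h l z) \<partial>M) + ennreal V"
   using tot by (rule add_left_mono)
  finally show "(\<integral>\<^sup>+y. (\<Sum>l\<in>A. \<integral>\<^sup>+z. esq (h l z + (F l z - \<Phi> l y z)) \<partial>M) \<partial>P)
   <= (\<Sum>l\<in>A. \<integral>\<^sup>+z. esq (h l z) \<partial>M) + ennreal V" .
 qed
 have ex: "\<exists>y. (\<forall>i<n. y i \<in> space P) \<and>
  (\<Sum>l\<in>A. \<integral>\<^sup>+z. esq (\<Sum>i<n. F l z - \<Phi> l (y i) z) \<partial>M) <= ennreal (real n * V)" for n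
 proof (induction n)
  case (Suc n)
  then obtain y where y: "\<forall>i<n. y i \<in> space P"
   "(\<Sum>l\<in>A. \<integral>\<^sup>+z. esq (\<Sum>i<n. F l z - \<Phi> l (y i) z) \<partial>M) <= ennreal (real n * V)" by blast
  have "(%z. \<Sum>i<n. F l z - \<Phi> l (y i) z) \<in> borel_measurable M" if "l \<in> A" for l
   using that y(1) sec1 F by (intro borel_measurable_sum borel_measurable_diff) auto
  from step[of "%l z. \<Sum>i<n. F l z - \<Phi> l (y i) z", OF this]
  obtain y' where y': "y' \<in> space P" "(\<Sum>l\<in>A. \<integral>\<^sup>+z. esq ((\<Sum>i<n. F l z - \<Phi> l (y i) z) + (F l z - \<Phi> l y' z)) \<partial>M)
   <= (\<Sum>l\<in>A. \<integral>\<^sup>+z. esq (\<Sum>i<n. F l z - \<Phi> l (y i) z) \<partial>M) + ennreal V" by blast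
  let ?y = "y(n := y')"
  have "(\<Sum>i<Suc n. F l z - \<Phi> l (?y i) z) = (\<Sum>i<n. F l z - \<Phi> l (y i) z) + (F l z - \<Phi> l y' z)" for l z
   by simp
  then have "(\<Sum>l\<in>A. \<integral>\<^sup>+z. esq (\<Sum>i<Suc n. F l z - \<Phi> l (?y i) z) \<partial>M) <= ennreal (real n * V) + ennreal V"
   using order_trans[OF y'(2) add_right_mono[OF y(2)]] by presburger
  also have "... = ennreal (real (Suc n) * V)" using V by (simp add: algebra_simps flip: ennreal_plus)
  finally show ?case using y(1) y'(1) by (intro exI[of _ ?y]) (auto simp: less_Suc_eq)
 qed simp
 show ?thesis
 \<comment> \<open>With no samples the error is the mean itself, at most \<open>V\<close> by Jensen;
   \<open>max 1\<close> in the bound provides for this case, which later yields the zero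
   network.\<close>
 proof (cases "n = 0")
  case True
  have "(\<Sum>l\<in>A. \<integral>\<^sup>+z. esq (F l z) \<partial>M) <= (\<Sum>l\<in>A. \<integral>\<^sup>+z. S l z \<partial>M)"
  proof (intro sum_mono nn_integral_mono_AE)
   fix l assume l: "l \<in> A"
   show "AE z in M. esq (F l z) <= S l z"
    using Sfin[OF l] AE_space
    by eventually_elim (use P.variance_bound(3)[OF sec2[OF l]] in \<open>auto simp: S_def F_def\<close>)
  qed
  also note tot
  finally show ?thesis using True by (simp add: F_def)
 next
  case False
  obtain y where y: "\<forall>i<n. y i \<in> space P"
   "(\<Sum>l\<in>A. \<integral>\<^sup>+z. esq (\<Sum>i<n. F l z - \<Phi> l (y i) z) \<partial>M) <= ennreal (real n * V)" using ex by blast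
  have eq: "esq (F l z - (\<Sum>i<n. \<Phi> l (y i) z) / of_nat n) = ennreal (1 / (real n)\<^sup>2) * esq (\<Sum>i<n. F l z - \<Phi> l (y i) z)" for l z
  proof -
   have "F l z - (\<Sum>i<n. \<Phi> l (y i) z) / of_nat n = (\<Sum>i<n. F l z - \<Phi> l (y i) z) / of_nat n"
    using False by (simp add: sum_subtractf field_simps)
   then show ?thesis by (simp add: norm_divide power_divide flip: ennreal_mult)
  qed
  have sm: "(%z. \<Sum>i<n. F l z - \<Phi> l (y i) z) \<in> borel_measurable M" if "l \<in> A" for l
   using that y(1) sec1 F by (intro borel_measurable_sum borel_measurable_diff) auto
  have "(\<Sum>l\<in>A. \<integral>\<^sup>+z. esq (F l z - (\<Sum>i<n. \<Phi> l (y i) z) / of_nat n) \<partial>M)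
   = (\<Sum>l\<in>A. ennreal (1 / (real n)\<^sup>2) * (\<integral>\<^sup>+z. esq (\<Sum>i<n. F l z - \<Phi> l (y i) z) \<partial>M))"
   unfolding eq using sm by (intro sum.cong refl nn_integral_cmult) auto
  also have "... <= ennreal (1 / (real n)\<^sup>2) * ennreal (real n * V)"
   unfolding sum_distrib_left[symmetric] using y(2) by (rule mult_left_mono) simp
  also have "... = ennreal (V / max 1 (real n))"
   using False V by (simp add: power2_eq_square max_def flip: ennreal_mult)
  finally show ?thesis using y(1) unfolding F_def by blast
 qed
qed

section \<open>Weak derivatives under null sets and parameter integrals\<close>

lemma locally_integrable_cong_AE:
 fixes f g :: "real ^ 'n => complex"
 assumes ae: "AE x in lebesgue. x \<in> U --> f x = g x" and g: "locally_integrable U g"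
 shows "locally_integrable U f"
 unfolding locally_integrable_def
proof (intro allI impI)
 fix K assume K: "compact K \<and> K \<subseteq> U"
 then have "g absolutely_integrable_on K" using g by (auto simp: locally_integrable_def)
 moreover have "negligible {x. \<not> (x \<in> U --> f x = g x)}"
  using ae by (simp add: negligible_iff_null_sets completion.AE_iff_null_sets)
 ultimately show "set_integrable lebesgue K f"
  by (rule absolutely_integrable_spike) (use K in auto)
qed

lemma has_weak_deriv_cong_AE:
 fixes f g :: "real ^ 'n => complex"
 assumes ae: "AE x in lebesgue. x \<in> U --> f x = g x" and g: "has_weak_deriv \<alpha> U g h"
 shows "has_weak_deriv \<alpha> U f h"
proof -
 have li: "locally_integrable U f" "locally_integrable U g" "locally_integrable U h"
  using locally_integrable_cong_AE[OF ae] g by (auto simp: has_weak_deriv_def)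
 have "(LINT x:U|lebesgue. f x * of_real (partial_derivs is \<phi> x)) =
    (LINT x:U|lebesgue. g x * of_real (partial_derivs is \<phi> x))" if \<phi>: "\<phi> \<in> test_functions U" for \<phi> "is"
  unfolding set_lebesgue_integral_def
 proof (rule integral_cong_AE)
  note S = set_integrable_times_test_function[OF test_function_partial_derivs(2)[OF \<phi>], unfolded set_integrable_def, THEN borel_measurable_integrable]
  show "(%x. indicator U x *\<^sub>R (f x * of_real (partial_derivs is \<phi> x))) \<in> borel_measurable lebesgue"
   "(%x. indicator U x *\<^sub>R (g x * of_real (partial_derivs is \<phi> x))) \<in> borel_measurable lebesgue"
   using S li by blast+
  show "AE x in lebesgue. indicator U x *\<^sub>R (f x * of_real (partial_derivs is \<phi> x)) = indicator U x *\<^sub>R (g x * of_real (partial_derivs is \<phi> x))"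
   using ae by eventually_elim (auto simp: indicator_def)
 qed
 then show ?thesis using g li by (simp add: has_weak_deriv_def)
qed

text \<open>Fubini against each test function: weak differentiation commutes with the mean over a
  parameter. It supplies the derivatives of a function that is given as the mean of the sampled
  functions.\<close>

lemma has_weak_deriv_integral:
 fixes G G' :: "'y => real ^ 'n => complex"
 assumes P: "sigma_finite_measure P" and U: "open U"
  and int: "integrable (P \<Otimes>\<^sub>M lborel) (%(y, x). indicator U x *\<^sub>R G y x)"
   "integrable (P \<Otimes>\<^sub>M lborel) (%(y, x). indicator U x *\<^sub>R G' y x)"
  and wd: "!!y. y \<in> space P ==> has_weak_deriv \<alpha> U (G y) (G' y)"
 shows "has_weak_deriv \<alpha> U (%x. LINT y|P. G y x) (%x. LINT y|P. G' y x)"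
proof -
 interpret PL: pair_sigma_finite P "lborel :: (real ^ 'n) measure"
  using P by (simp add: pair_sigma_finite_def lborel.sigma_finite_measure_axioms)
 have li: "locally_integrable U (%x. LINT y|P. H y x)"
  if H: "integrable (P \<Otimes>\<^sub>M lborel) (%(y, x). indicator U x *\<^sub>R H y x)" for H :: "'y => real ^ 'n => complex"
  unfolding locally_integrable_def
 proof (intro allI impI)
  fix K assume K: "compact K \<and> K \<subseteq> U"
  have "integrable lborel (%x. LINT y|P. indicator U x *\<^sub>R H y x)"
   by (rule PL.integrable_snd[OF H])
  then have i: "integrable lborel (%x. indicator U x *\<^sub>R (LINT y|P. H y x))" by simp
  then have "integrable lebesgue (%x. indicator U x *\<^sub>R (LINT y|P. H y x))"
   by (subst integrable_completion[OF borel_measurable_integrable[OF i]])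
  then have "set_integrable lebesgue U (%x. LINT y|P. H y x)" by (simp add: set_integrable_def)
  then show "set_integrable lebesgue K (%x. LINT y|P. H y x)"
   by (rule set_integrable_subset) (use K in \<open>auto intro: lmeasurable_compact fmeasurableD\<close>)
 qed
 have ex: "(LINT x:U|lebesgue. (LINT y|P. H y x) * of_real (\<psi> x)) = (LINT y|P. (LINT x:U|lebesgue. H y x * of_real (\<psi> x)))"
  if H: "integrable (P \<Otimes>\<^sub>M lborel) (%(y, x). indicator U x *\<^sub>R H y x)" and \<psi>: "\<psi> \<in> test_functions U"
  for H :: "'y => real ^ 'n => complex" and \<psi>
 proof -
  obtain B where B: "B >= 0" "!!x. \<bar>\<psi> x\<bar> <= B" using test_function_bounded[OF \<psi>] by blast
  note [measurable] = test_function_measurable[OF \<psi>]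
  have Hm[measurable]: "(%(y, x). indicator U x *\<^sub>R H y x) \<in> borel_measurable (P \<Otimes>\<^sub>M lborel)"
   by (rule borel_measurable_integrable[OF H])
  have H\<psi>m: "(%(y, x). (indicator U x *\<^sub>R H y x) * complex_of_real (\<psi> x)) \<in> borel_measurable (P \<Otimes>\<^sub>M lborel)"
  proof -
   have "(%p. (case p of (y, x) => indicator U x *\<^sub>R H y x) * complex_of_real (\<psi> (snd p))) \<in> borel_measurable (P \<Otimes>\<^sub>M lborel)"
    by measurable
   then show ?thesis by (simp add: case_prod_beta')
  qed
  have iH: "integrable (P \<Otimes>\<^sub>M lborel) (%(y, x). (indicator U x *\<^sub>R H y x) * complex_of_real (\<psi> x))"
  proof (rule Bochner_Integration.integrable_bound)
   show "integrable (P \<Otimes>\<^sub>M lborel) (%p. B *\<^sub>R (case p of (y, x) => indicator U x *\<^sub>R H y x))"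
    by (intro integrable_scaleR_right H)
   show "AE p in P \<Otimes>\<^sub>M lborel. norm (case p of (y, x) => (indicator U x *\<^sub>R H y x) * complex_of_real (\<psi> x))
     <= norm (B *\<^sub>R (case p of (y, x) => indicator U x *\<^sub>R H y x))"
   proof (rule AE_I2)
    fix p :: "'y \<times> (real ^ 'n)"
    obtain y x where p: "p = (y, x)" by force
    have "norm (indicator U x *\<^sub>R H y x) * \<bar>\<psi> x\<bar> <= norm (indicator U x *\<^sub>R H y x) * B"
     using B by (intro mult_left_mono) auto
    then show "norm (case p of (y, x) => (indicator U x *\<^sub>R H y x) * complex_of_real (\<psi> x)) <= norm (B *\<^sub>R (case p of (y, x) => indicator U x *\<^sub>R H y x))"
     using B(1) by (simp add: p norm_mult mult_ac)
   qed
  qed (rule H\<psi>m)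
  have mx: "(%x. indicator U x *\<^sub>R ((LINT y|P. H y x) * complex_of_real (\<psi> x))) \<in> borel_measurable lborel"
  proof -
   have "(%x. (LINT y|P. indicator U x *\<^sub>R H y x) * complex_of_real (\<psi> x)) \<in> borel_measurable lborel"
    by (rule borel_measurable_times[OF borel_measurable_integrable[OF PL.integrable_snd[OF H]]]) simp
   then show ?thesis by simp
  qed
  have "(LINT x:U|lebesgue. (LINT y|P. H y x) * of_real (\<psi> x)) = (LINT x|lborel. indicator U x *\<^sub>R ((LINT y|P. H y x) * of_real (\<psi> x)))"
   unfolding set_lebesgue_integral_def by (rule integral_completion[OF mx])
  also have "... = (LINT x|lborel. (LINT y|P. (indicator U x *\<^sub>R H y x) * of_real (\<psi> x)))" by simp
  also have "... = (LINT y|P. (LINT x|lborel. (indicator U x *\<^sub>R H y x) * of_real (\<psi> x)))"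
   by (rule PL.Fubini_integral[OF iH])
  also have "... = (LINT y|P. (LINT x:U|lebesgue. H y x * of_real (\<psi> x)))"
  proof (rule Bochner_Integration.integral_cong[OF refl])
   fix y assume y: "y \<in> space P"
   have "(%x. (indicator U x *\<^sub>R H y x) * complex_of_real (\<psi> x)) \<in> borel_measurable lborel"
    using measurable_Pair2[OF H\<psi>m y] by simp
   from integral_completion[OF this]
   show "(LINT x|lborel. (indicator U x *\<^sub>R H y x) * of_real (\<psi> x)) = (LINT x:U|lebesgue. H y x * of_real (\<psi> x))"
    by (simp add: set_lebesgue_integral_def)
  qed
  finally show ?thesis .
 qed
 have "(LINT x:U|lebesgue. (LINT y|P. G y x) * of_real (partial_derivs is \<phi> x)) =
    (-1) ^ multi_index_order \<alpha> * (LINT x:U|lebesgue. (LINT y|P. G' y x) * of_real (\<phi> x))"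
  if \<phi>: "\<phi> \<in> test_functions U" and c: "count_list is = \<alpha>" for \<phi> "is"
 proof -
  have "(LINT y|P. (LINT x:U|lebesgue. G y x * of_real (partial_derivs is \<phi> x))) =
    (LINT y|P. (-1) ^ multi_index_order \<alpha> * (LINT x:U|lebesgue. G' y x * of_real (\<phi> x)))"
  proof (rule Bochner_Integration.integral_cong[OF refl])
   fix y assume "y \<in> space P"
   from conjunct2[OF conjunct2[OF iffD1[OF has_weak_deriv_def wd[OF this]]], rule_format, OF \<phi> c]
   show "(LINT x:U|lebesgue. G y x * of_real (partial_derivs is \<phi> x)) = (-1) ^ multi_index_order \<alpha> * (LINT x:U|lebesgue. G' y x * of_real (\<phi> x))" .
  qed
  then show ?thesis
   unfolding ex[OF int(1) test_function_partial_derivs(2)[OF \<phi>]] ex[OF int(2) \<phi>] by simp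
 qed
 then show ?thesis using li[OF int(1)] li[OF int(2)] by (simp add: has_weak_deriv_def)
qed

text \<open>\<open>sobolev_sq\<close> with an explicit family \<open>H\<close> in place of the
  derivatives that \<open>SOME\<close> selects.\<close>

definition sobolev_energy :: "real => (real ^ 'n) set => (('n => nat) => real ^ 'n => complex) => ennreal" where
 "sobolev_energy m U H =
   (\<Sum>\<alpha> | multi_index_order \<alpha> <= nat \<lfloor>m\<rfloor>. L2_sq U (H \<alpha>)) +
   (if m \<in> \<int> then 0
   else \<Sum>\<alpha> | multi_index_order \<alpha> = nat \<lfloor>m\<rfloor>. slobodeckij_sq (frac m) U (H \<alpha>))"

lemma finite_multi_index: "finite {\<alpha> :: 'n::finite => nat. multi_index_order \<alpha> <= J}"
proof (rule finite_subset)
 have "\<alpha> i <= multi_index_order \<alpha>" for \<alpha> :: "'n => nat" and i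
  unfolding multi_index_order_def by (rule member_le_sum) auto
 then have "\<alpha> i <= J" if "multi_index_order \<alpha> <= J" for \<alpha> :: "'n => nat" and i
  using that by (rule order_trans)
 then show "{\<alpha> :: 'n => nat. multi_index_order \<alpha> <= J} \<subseteq> (\<Pi>\<^sub>E i\<in>UNIV. {..J})"
  by (auto simp: PiE_UNIV_domain)
 show "finite (\<Pi>\<^sub>E i\<in>(UNIV :: 'n set). {..J})" by (intro finite_PiE) auto
qed

lemma L2_sq_cong_AE:
 assumes "AE x in lebesgue. x \<in> U --> f x = g x"
 shows "L2_sq U f = L2_sq U g"
 unfolding L2_sq_def
 by (intro nn_integral_cong_AE) (use assms in eventually_elim, auto simp: indicator_def)

lemma slobodeckij_sq_cong_AE:
 assumes "AE x in lebesgue. x \<in> U --> f x = g x"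
 shows "slobodeckij_sq \<theta> U f = slobodeckij_sq \<theta> U g"
 unfolding slobodeckij_sq_def
proof (rule nn_integral_cong_AE)
 let ?z0 = "real CARD('a) + 2 * \<theta>"
 have "(\<integral>\<^sup>+y\<in>U. ennreal ((cmod (f x - f y))\<^sup>2 / norm (x - y) powr ?z0) \<partial>lebesgue) =
    (\<integral>\<^sup>+y\<in>U. ennreal ((cmod (g x - g y))\<^sup>2 / norm (x - y) powr ?z0) \<partial>lebesgue)"
  if "f x = g x" for x
  by (intro nn_integral_cong_AE) (use assms in eventually_elim, use that in \<open>auto simp: indicator_def\<close>)
 then show "AE x in lebesgue. (\<integral>\<^sup>+y\<in>U. ennreal ((cmod (f x - f y))\<^sup>2 / norm (x - y) powr ?z0) \<partial>lebesgue) * indicator U x =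
    (\<integral>\<^sup>+y\<in>U. ennreal ((cmod (g x - g y))\<^sup>2 / norm (x - y) powr ?z0) \<partial>lebesgue) * indicator U x"
  using assms by (auto simp: indicator_def elim!: eventually_mono)
qed

lemma sobolev_norm_le:
 assumes U: "open U" and V: "V >= 0"
  and wd: "!!\<alpha>. multi_index_order \<alpha> <= nat \<lfloor>m\<rfloor> ==> has_weak_deriv \<alpha> U f (H \<alpha>)"
  and le: "sobolev_energy m U H <= ennreal V"
 shows "sobolev_norm m U f <= ennreal (sqrt V)"
proof -
 have eq: "AE x in lebesgue. x \<in> U --> weak_deriv \<alpha> U f x = H \<alpha> x" if "multi_index_order \<alpha> <= nat \<lfloor>m\<rfloor>" for \<alpha>
 proof (rule weak_deriv_AE_unique[OF U _ wd[OF that]])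
  show "has_weak_deriv \<alpha> U f (weak_deriv \<alpha> U f)"
   unfolding weak_deriv_def using someI[of "%g. has_weak_deriv \<alpha> U f g", OF wd[OF that]] by simp
 qed
 have "sobolev_sq m U f = sobolev_energy m U H"
  unfolding sobolev_sq_def sobolev_energy_def
  by (intro arg_cong2[where f = "(+)"] if_cong refl sum.cong L2_sq_cong_AE slobodeckij_sq_cong_AE eq) auto
 then have le': "sobolev_sq m U f <= ennreal V" using le by simp
 then have "sobolev_sq m U f < \<infinity>" by (auto intro: le_less_trans)
 moreover have "enn2real (sobolev_sq m U f) <= V" using enn2real_mono[OF le'] V by simp
 ultimately show ?thesis using wd unfolding sobolev_norm_def by (auto intro!: ennreal_leI)
qed

lemma nn_set_integral_lebesgue:
 fixes f :: "'a::euclidean_space => ennreal"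
 shows "(\<integral>\<^sup>+x\<in>U. f x \<partial>lebesgue) = (\<integral>\<^sup>+x\<in>U. f x \<partial>lborel)"
 by (rule nn_integral_completion)

text \<open>All parts of the squared norm are squared L^2 norms of linear expressions in the
  derivatives, so \<open>maurey\<close> bounds them simultaneously for one choice of sample points.
  \<open>G \<alpha> y\<close> is the derivative of order \<alpha> of \<open>G (%_. 0) y\<close>, the
  sampled function itself. The representation \<open>rep\<close> is asked for only where the mean
  exists, which by Fubini is almost everywhere in \<open>U\<close>.\<close>

lemma sobolev_maurey:
 fixes G :: "('n => nat) => 'y => real ^ 'n => complex" and F :: "real ^ 'n => complex"
 assumes P: "prob_space P" and U: "open U" and U1: "emeasure lborel U = 1" and V: "V >= 0"
  and meas: "!!\<alpha>. multi_index_order \<alpha> <= nat \<lfloor>m\<rfloor> ==> case_prod (G \<alpha>) \<in> borel_measurable (P \<Otimes>\<^sub>M lborel)"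
  and wd: "!!\<alpha> y. multi_index_order \<alpha> <= nat \<lfloor>m\<rfloor> ==> y \<in> space P ==> has_weak_deriv \<alpha> U (G (%_. 0) y) (G \<alpha> y)"
  and bound: "!!y. y \<in> space P ==> sobolev_energy m U (%\<alpha>. G \<alpha> y) <= ennreal V"
  and rep: "AE x in lborel. x \<in> U --> integrable P (%y. G (%_. 0) y x) --> F x = (LINT y|P. G (%_. 0) y x)"
 shows "\<exists>y. (\<forall>i<n. y i \<in> space P) \<and>
  sobolev_norm m U (%x. F x - (\<Sum>i<n. G (%_. 0) (y i) x) / of_nat n) <= ennreal (sqrt (V / max 1 (real n)))"
proof -
 interpret P: prob_space P by fact
 interpret PL: pair_sigma_finite P "lborel :: (real ^ 'n) measure"
  by (simp add: pair_sigma_finite_def lborel.sigma_finite_measure_axioms P.sigma_finite_measure_axioms)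
 let ?J = "nat \<lfloor>m\<rfloor>"
 let ?L = "lborel :: (real ^ 'n) measure"
 define D where "D = real CARD('n) + 2 * frac m"
 define A where "A = (Pair False ` {\<alpha> :: 'n => nat. multi_index_order \<alpha> <= ?J}) \<union> (if m \<in> \<int> then {} else Pair True ` {\<alpha>. multi_index_order \<alpha> = ?J})"
 have "finite {\<alpha> :: 'n => nat. multi_index_order \<alpha> = ?J}"
  by (rule finite_subset[OF _ finite_multi_index[of ?J]]) auto
 then have finA: "finite A" using finite_multi_index[of ?J] by (auto simp: A_def)
 have A_le: "multi_index_order (snd l) <= ?J" if "l \<in> A" for l using that by (auto simp: A_def split: if_splits)
 \<comment> \<open>As \<open>U\<close> has measure 1, both the \<open>L\<^sup>2\<close> and the Gagliardo parts are integrals over \<open>U \<times> U\<close>.\<close>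
 define feat :: "bool \<times> ('n => nat) => (('n => nat) => real ^ 'n => complex) => (real ^ 'n) \<times> (real ^ 'n) => complex" where
  "feat l H z = of_real (indicator U (fst z) * indicator U (snd z)) *
    (if fst l then (H (snd l) (fst z) - H (snd l) (snd z)) / of_real (norm (fst z - snd z) powr (D / 2)) else H (snd l) (fst z))" for l H z
 have Ub[measurable]: "U \<in> sets borel" using U by simp
 \<comment> \<open>Both arguments are dummies; \<open>?z0\<close> is Lebesgue measure on the
   product.\<close>
 let ?z0 = "%sub M. ?L \<Otimes>\<^sub>M ?L"
 have energy: "(\<Sum>l\<in>A. \<integral>\<^sup>+z. esq (feat l H z) \<partial>(?z0 sub M)) = sobolev_energy m U H"
  if Hm: "!!\<alpha>. multi_index_order \<alpha> <= ?J ==> H \<alpha> \<in> borel_measurable borel" for H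
 proof -
  have fm: "feat l H \<in> borel_measurable (?z0 sub M)" if "l \<in> A" for l
  proof -
   have [measurable]: "H (snd l) \<in> borel_measurable borel" using Hm A_le that by blast
   show ?thesis unfolding feat_def by measurable
  qed
  have it: "(\<integral>\<^sup>+z. esq (feat l H z) \<partial>(?z0 sub M)) = (\<integral>\<^sup>+x. \<integral>\<^sup>+x'. esq (feat l H (x, x')) \<partial>?L \<partial>?L)" if "l \<in> A" for l
   by (intro lborel.nn_integral_fst[symmetric] measurable_compose[OF fm[OF that], of "%w. esq w"]) measurable
  have F: "(\<integral>\<^sup>+z. esq (feat (False, \<alpha>) H z) \<partial>(?z0 sub M)) = L2_sq U (H \<alpha>)" if "(False, \<alpha>) \<in> A" for \<alpha>
  proof -
   have "esq (feat (False, \<alpha>) H (x, x')) = esq (H \<alpha> x) * indicator U x * indicator U x'" for x x'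
    by (auto simp: feat_def indicator_def)
   then show ?thesis
    unfolding it[OF that] L2_sq_def nn_set_integral_lebesgue by (simp add: nn_integral_cmult U1)
  qed
  have T: "(\<integral>\<^sup>+z. esq (feat (True, \<alpha>) H z) \<partial>(?z0 sub M)) = slobodeckij_sq (frac m) U (H \<alpha>)" if "(True, \<alpha>) \<in> A" for \<alpha>
  proof -
   have [measurable]: "H \<alpha> \<in> borel_measurable borel" using Hm A_le[OF that] by simp
   have sq: "(t powr (D / 2))\<^sup>2 = t powr D" for t :: real
    by (simp add: power2_eq_square flip: powr_add)
   have "esq (feat (True, \<alpha>) H (x, x')) = ennreal ((cmod (H \<alpha> x - H \<alpha> x'))\<^sup>2 / norm (x - x') powr D) * indicator U x' * indicator U x" for x x'
    by (auto simp: feat_def indicator_def norm_divide power_divide sq)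
   then show ?thesis
    unfolding it[OF that] slobodeckij_sq_def nn_set_integral_lebesgue D_def[symmetric] by (simp add: nn_integral_multc)
  qed
  have "(\<Sum>l\<in>A. \<integral>\<^sup>+z. esq (feat l H z) \<partial>(?z0 sub M))
   = (\<Sum>l\<in>Pair False ` {\<alpha>. multi_index_order \<alpha> <= ?J}. \<integral>\<^sup>+z. esq (feat l H z) \<partial>(?z0 sub M))
    + (\<Sum>l\<in>(if m \<in> \<int> then {} else Pair True ` {\<alpha>. multi_index_order \<alpha> = ?J}). \<integral>\<^sup>+z. esq (feat l H z) \<partial>(?z0 sub M))"
   using finA unfolding A_def by (intro sum.union_disjoint) (auto simp: finite_multi_index)
  also have "... = sobolev_energy m U H"
  proof -
   have 1: "(\<Sum>l\<in>Pair False ` {\<alpha>. multi_index_order \<alpha> <= ?J}. \<integral>\<^sup>+z. esq (feat l H z) \<partial>(?z0 sub M))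
     = (\<Sum>\<alpha> | multi_index_order \<alpha> <= ?J. L2_sq U (H \<alpha>))"
    by (subst sum.reindex) (simp_all add: inj_on_def A_def F)
   have 2: "(\<Sum>l\<in>Pair True ` {\<alpha>. multi_index_order \<alpha> = ?J}. \<integral>\<^sup>+z. esq (feat l H z) \<partial>(?z0 sub M))
     = (\<Sum>\<alpha> | multi_index_order \<alpha> = ?J. slobodeckij_sq (frac m) U (H \<alpha>))" if "m \<notin> \<int>"
    using that by (subst sum.reindex) (simp_all add: inj_on_def A_def T)
   show ?thesis unfolding sobolev_energy_def using 1 2 by simp
  qed
  finally show ?thesis .
 qed
 have Gsec: "G \<alpha> y \<in> borel_measurable borel" if "multi_index_order \<alpha> <= ?J" "y \<in> space P" for \<alpha> y
  using measurable_Pair2[OF meas[OF that(1)] that(2)] by simp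
 have Gsec': "(%y. G \<alpha> y x) \<in> borel_measurable P" if "multi_index_order \<alpha> <= ?J" for \<alpha> x
  using measurable_Pair1[OF meas[OF that(1)], of x] by simp
 define F' where "F' \<alpha> x = (LINT y|P. G \<alpha> y x)" for \<alpha> x
 have F'm: "F' \<alpha> \<in> borel_measurable borel" if "multi_index_order \<alpha> <= ?J" for \<alpha>
 proof -
  have "(%(x, y). G \<alpha> y x) \<in> borel_measurable (lborel \<Otimes>\<^sub>M P)"
   using measurable_compose[OF measurable_pair_swap' meas[OF that]] by (simp add: case_prod_beta' comp_def)
  then have "F' \<alpha> \<in> borel_measurable lborel" unfolding F'_def by (rule P.borel_measurable_lebesgue_integral)
  then show ?thesis by simp
 qed
 let ?z1 = "%\<alpha> G y. %\<alpha>. G \<alpha> y"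
 have L2V: "L2_sq U (G \<alpha> y) <= ennreal V" if "multi_index_order \<alpha> <= ?J" "y \<in> space P" for \<alpha> y
 proof -
  have "L2_sq U (G \<alpha> y) <= (\<Sum>\<alpha> | multi_index_order \<alpha> <= ?J. L2_sq U (G \<alpha> y))"
   by (rule member_le_sum) (use that finite_multi_index in auto)
  also have "... <= sobolev_energy m U (?z1 \<alpha> G y)" unfolding sobolev_energy_def by (simp add: add_increasing2)
  finally show ?thesis using bound[OF that(2)] by (rule order_trans)
 qed
 have GU: "(%(y, x). indicator U x *\<^sub>R G \<alpha> y x) \<in> borel_measurable (P \<Otimes>\<^sub>M lborel)" if "multi_index_order \<alpha> <= ?J" for \<alpha>
 proof -
  note [measurable] = meas[OF that]
  have "(%p. indicator U (snd p) *\<^sub>R (case p of (y, x) => G \<alpha> y x)) \<in> borel_measurable (P \<Otimes>\<^sub>M lborel)" by measurable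
  then show ?thesis by (simp add: case_prod_beta')
 qed
 have fin2: "(\<integral>\<^sup>+p. esq (case p of (y, x) => indicator U x *\<^sub>R G \<alpha> y x) \<partial>(P \<Otimes>\<^sub>M lborel)) <= ennreal V" if a: "multi_index_order \<alpha> <= ?J" for \<alpha>
 proof -
  have "(\<integral>\<^sup>+p. esq (case p of (y, x) => indicator U x *\<^sub>R G \<alpha> y x) \<partial>(P \<Otimes>\<^sub>M lborel)) =
    (\<integral>\<^sup>+y. (\<integral>\<^sup>+x. esq (indicator U x *\<^sub>R G \<alpha> y x) \<partial>lborel) \<partial>P)"
   using GU[OF a] by (subst lborel.nn_integral_fst[symmetric]) auto
  also have "... <= (\<integral>\<^sup>+y. ennreal V \<partial>P)"
  proof (rule nn_integral_mono)
   fix y assume y: "y \<in> space P"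
   have "(\<integral>\<^sup>+x. esq (indicator U x *\<^sub>R G \<alpha> y x) \<partial>lborel) = L2_sq U (G \<alpha> y)"
    unfolding L2_sq_def nn_set_integral_lebesgue by (intro nn_integral_cong) (auto simp: indicator_def)
   then show "(\<integral>\<^sup>+x. esq (indicator U x *\<^sub>R G \<alpha> y x) \<partial>lborel) <= ennreal V" using L2V[OF a y] by simp
  qed
  finally show ?thesis by (simp add: P.emeasure_space_1)
 qed
 \<comment> \<open>Both \<open>P\<close> and \<open>U\<close> have mass 1, so square integrability
   gives integrability by \<open>t <= 1 + t^2\<close>.\<close>
 have intG: "integrable (P \<Otimes>\<^sub>M lborel) (%(y, x). indicator U x *\<^sub>R G \<alpha> y x)" if a: "multi_index_order \<alpha> <= ?J" for \<alpha>
 proof (rule integrableI_bounded[OF GU[OF a]])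
  have 1: "(\<integral>\<^sup>+p. (indicator U (snd p) :: ennreal) \<partial>(P \<Otimes>\<^sub>M ?L)) = 1"
   by (subst lborel.nn_integral_fst[symmetric]) (auto simp: U1 P.emeasure_space_1)
  have e: "ennreal t <= 1 + ennreal (t\<^sup>2)" if "t >= 0" for t :: real
  proof -
   have "t <= 1 + t\<^sup>2" using sum_squares_ge_zero[of "t - 1" 0] that by (simp add: power2_eq_square algebra_simps)
   then have "ennreal t <= ennreal (1 + t\<^sup>2)" by (rule ennreal_leI)
   then show ?thesis by (simp add: ennreal_plus)
  qed
  have "(\<integral>\<^sup>+p. ennreal (cmod (case p of (y, x) => indicator U x *\<^sub>R G \<alpha> y x)) \<partial>(P \<Otimes>\<^sub>M lborel)) <=
   (\<integral>\<^sup>+p. indicator U (snd p) + esq (case p of (y, x) => indicator U x *\<^sub>R G \<alpha> y x) \<partial>(P \<Otimes>\<^sub>M lborel))"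
   by (intro nn_integral_mono) (auto simp: indicator_def e split: prod.splits)
  also have "... = 1 + (\<integral>\<^sup>+p. esq (case p of (y, x) => indicator U x *\<^sub>R G \<alpha> y x) \<partial>(P \<Otimes>\<^sub>M lborel))"
   using GU[OF a] by (subst nn_integral_add) (auto simp: 1)
  also have "... <= 1 + ennreal V" using fin2[OF a] by (rule add_left_mono)
  also have "... < \<infinity>" by simp
  finally show "(\<integral>\<^sup>+p. ennreal (cmod (case p of (y, x) => indicator U x *\<^sub>R G \<alpha> y x)) \<partial>(P \<Otimes>\<^sub>M lborel)) < \<infinity>" .
 qed
 have AEint: "AE x in lborel. x \<in> U --> integrable P (%y. G \<alpha> y x)" if a: "multi_index_order \<alpha> <= ?J" for \<alpha>
  using PL.AE_integrable_snd[OF intG[OF a]] by eventually_elim auto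
 have "\<exists>y. (\<forall>i<n. y i \<in> space P) \<and>
  (\<Sum>l\<in>A. \<integral>\<^sup>+z. esq ((LINT y|P. feat l (?z1 \<alpha> G y) z) - (\<Sum>i<n. feat l (%\<alpha>. G \<alpha> (y i)) z) / of_nat n) \<partial>(?z0 sub M))
   <= ennreal (V / max 1 (real n))"
 proof (rule maurey[where \<Phi> = "%l y z. feat l (?z1 \<alpha> G y) z", OF P _ finA V])
  show "sigma_finite_measure (?z0 sub M)" by (rule lborel_pair.sigma_finite_measure_axioms)
  show "(%(y, z). feat l (?z1 \<alpha> G y) z) \<in> borel_measurable (P \<Otimes>\<^sub>M (?z0 sub M))" if "l \<in> A" for l
  proof -
   note [measurable] = meas[OF A_le[OF that]]
   have 1: "(%p. G (snd l) (fst p) (fst (snd p))) \<in> borel_measurable (P \<Otimes>\<^sub>M (?z0 sub M))"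
    "(%p. G (snd l) (fst p) (snd (snd p))) \<in> borel_measurable (P \<Otimes>\<^sub>M (?z0 sub M))"
    by measurable
   note [measurable] = 1
   show ?thesis unfolding feat_def case_prod_beta' by measurable
  qed
  show "(\<Sum>l\<in>A. \<integral>\<^sup>+z. esq (feat l (?z1 \<alpha> G y) z) \<partial>(?z0 sub M)) <= ennreal V" if "y \<in> space P" for y
   using energy[of "%\<alpha>. G \<alpha> y"] Gsec that bound[OF that] by simp
 qed
 then obtain y where y: "\<forall>i<n. y i \<in> space P" and
  le: "(\<Sum>l\<in>A. \<integral>\<^sup>+z. esq ((LINT y|P. feat l (?z1 \<alpha> G y) z) - (\<Sum>i<n. feat l (%\<alpha>. G \<alpha> (y i)) z) / of_nat n) \<partial>(?z0 sub M))
   <= ennreal (V / max 1 (real n))" by (elim exE conjE) (rule that)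
 define H where "H \<alpha> x = F' \<alpha> x - (\<Sum>i<n. G \<alpha> (y i) x) / of_nat n" for \<alpha> x
 have Hm: "H \<alpha> \<in> borel_measurable borel" if "multi_index_order \<alpha> <= ?J" for \<alpha>
  unfolding H_def using F'm Gsec that y by (intro borel_measurable_diff borel_measurable_divide borel_measurable_sum) auto
 \<comment> \<open>The features involve two points, so the exceptional null set is removed from both
   coordinates.\<close>
 have AEp: "AE z in ?L \<Otimes>\<^sub>M ?L. (fst z \<in> U --> integrable P (%y. G \<alpha> y (fst z))) \<and> (snd z \<in> U --> integrable P (%y. G \<alpha> y (snd z)))"
  if a: "multi_index_order \<alpha> <= ?J" for \<alpha>
 proof -
  obtain N where N: "N \<in> null_sets ?L" "{x \<in> space ?L. \<not> (x \<in> U --> integrable P (%y. G \<alpha> y x))} \<subseteq> N"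
   using AEint[OF a] unfolding eventually_ae_filter by (elim bexE) (rule that)
  have "N \<times> UNIV \<in> null_sets (?z0 sub M)" "UNIV \<times> N \<in> null_sets (?z0 sub M)"
   using N(1) by (auto simp: null_sets_def lborel.emeasure_pair_measure_Times)
  then have "(N \<times> UNIV) \<union> (UNIV \<times> N) \<in> null_sets (?z0 sub M)" by (rule null_sets.Un)
  then show ?thesis by (rule AE_I') (use N(2) in \<open>force simp: space_pair_measure\<close>)
 qed
 have "sobolev_energy m U H = (\<Sum>l\<in>A. \<integral>\<^sup>+z. esq (feat l H z) \<partial>(?z0 sub M))"
  using energy[of H] Hm by simp
 also have "... = (\<Sum>l\<in>A. \<integral>\<^sup>+z. esq ((LINT y|P. feat l (?z1 \<alpha> G y) z) - (\<Sum>i<n. feat l (%\<alpha>. G \<alpha> (y i)) z) / of_nat n) \<partial>(?z0 sub M))"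
 proof (intro sum.cong refl nn_integral_cong_AE)
  fix l assume l: "l \<in> A"
  show "AE z in ?L \<Otimes>\<^sub>M ?L. esq (feat l H z) = esq ((LINT y|P. feat l (?z1 \<alpha> G y) z) - (\<Sum>i<n. feat l (%\<alpha>. G \<alpha> (y i)) z) / of_nat n)"
   using AEp[OF A_le[OF l]]
  proof eventually_elim
   case (elim z)
   \<comment> \<open>Features are linear in the family of derivatives, so the feature of the mean is
     the mean of the features once integrability holds at both points.\<close>
   have "feat l H z = (LINT y|P. feat l (?z1 \<alpha> G y) z) - (\<Sum>i<n. feat l (%\<alpha>. G \<alpha> (y i)) z) / of_nat n"
   proof (cases "fst z \<in> U \<and> snd z \<in> U")
    case True
    obtain x x' where z: "z = (x, x')" by force
    have i: "integrable P (%y. G (snd l) y x)" "integrable P (%y. G (snd l) y x')"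
     using elim True by (auto simp: z)
    show ?thesis
    proof (cases "fst l")
     case True
     define c where "c = complex_of_real (norm (x - x') powr (D / 2))"
     have "feat l K z = (K (snd l) x - K (snd l) x') / c" for K
      using \<open>fst z \<in> U \<and> snd z \<in> U\<close> True by (simp add: feat_def z c_def)
     moreover have "(LINT y|P. (G (snd l) y x - G (snd l) y x') / c) = (F' (snd l) x - F' (snd l) x') / c"
      using i by (simp add: F'_def)
     moreover have "(\<Sum>i<n. (G (snd l) (y i) x - G (snd l) (y i) x') / c) = ((\<Sum>i<n. G (snd l) (y i) x) - (\<Sum>i<n. G (snd l) (y i) x')) / c"
      unfolding sum_subtractf[symmetric] by (rule sum_divide_distrib[symmetric])
     moreover have "(a / c - (s / c) / of_nat n) = (a - s / of_nat n) / c" for a s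
      by (simp add: diff_divide_distrib)
     ultimately show ?thesis by (simp add: H_def diff_divide_distrib mult.commute)
    next
     case False
     then have "feat l K z = K (snd l) x" for K
      using \<open>fst z \<in> U \<and> snd z \<in> U\<close> by (simp add: feat_def z)
     then show ?thesis by (simp add: H_def F'_def)
    qed
   qed (auto simp: feat_def)
   then show ?case by simp
  qed
 qed
 also note le
 finally have en: "sobolev_energy m U H <= ennreal (V / max 1 (real n))" .
 have J0: "multi_index_order (%_ :: 'n. 0) <= ?J" by (simp add: multi_index_order_def)
 let ?z2 = "%i x. \<Sum>i<n. G (%_. 0) (y i) x"
 have "has_weak_deriv \<alpha> U (%x. F x - (?z2 i x) / of_nat n) (H \<alpha>)" if a: "multi_index_order \<alpha> <= ?J" for \<alpha>
 proof -
  have "has_weak_deriv \<alpha> U (F' (%_. 0)) (F' \<alpha>)"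
   unfolding F'_def by (rule has_weak_deriv_integral[OF P.sigma_finite_measure_axioms U intG[OF J0] intG[OF a] wd[OF a]])
  then have "has_weak_deriv \<alpha> U F (F' \<alpha>)"
  proof (rule has_weak_deriv_cong_AE[rotated])
   have "AE x in lborel. x \<in> U --> F x = F' (%_. 0) x"
    using rep AEint[OF J0] by eventually_elim (auto simp: F'_def)
   then show "AE x in lebesgue. x \<in> U --> F x = F' (%_. 0) x" by (rule AE_completion)
  qed
  moreover have "has_weak_deriv \<alpha> U (%x. (- 1 / of_nat n) * (?z2 i x)) (%x. (- 1 / of_nat n) * (\<Sum>i<n. G \<alpha> (y i) x))"
   using wd[OF a] y by (intro has_weak_deriv_cmult has_weak_deriv_sum) auto
  ultimately have "has_weak_deriv \<alpha> U (%x. F x + (- 1 / of_nat n) * (?z2 i x)) (%x. F' \<alpha> x + (- 1 / of_nat n) * (\<Sum>i<n. G \<alpha> (y i) x))"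
   by (rule has_weak_deriv_add)
  then show ?thesis by (simp add: H_def[abs_def])
 qed
 then have "sobolev_norm m U (%x. F x - (?z2 i x) / of_nat n) <= ennreal (sqrt (V / max 1 (real n)))"
  using V by (intro sobolev_norm_le[OF U _ _ en]) simp_all
 with y show ?thesis by (intro exI[of _ y] conjI)
qed

section \<open>Sobolev energy of localized ridge functions\<close>

lemma nn_integral_lborel_translate:
 fixes f :: "'a::euclidean_space => ennreal"
 assumes [measurable]: "f \<in> borel_measurable borel"
 shows "(\<integral>\<^sup>+x. f (x + c) \<partial>lborel) = (\<integral>\<^sup>+x. f x \<partial>lborel)"
proof -
 have "(\<integral>\<^sup>+x. f x \<partial>lborel) = (\<integral>\<^sup>+x. f x \<partial>distr lborel borel ((+) c))"
  by (simp add: lborel_distr_plus)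
 also have "... = (\<integral>\<^sup>+x. f (c + x) \<partial>lborel)" by (subst nn_integral_distr) auto
 finally show ?thesis by (simp add: add.commute)
qed

lemma suminf_ennreal_geometric:
 fixes q c :: real
 assumes "0 <= q" "q < 1" "c >= 0"
 shows "(\<Sum>i. ennreal (c * q ^ i)) = ennreal (c / (1 - q))"
proof -
 have "(%i. c * q ^ i) sums (c * (1 / (1 - q)))"
  using assms by (intro sums_mult geometric_sums) auto
 then have "(\<Sum>i. ennreal (c * q ^ i)) = ennreal (c * (1 / (1 - q)))"
  using assms by (intro suminf_ennreal_eq) auto
 then show ?thesis by simp
qed

lemma dyadic_above:
 fixes r :: real
 assumes "r >= 1"
 shows "\<exists>i::nat. 2 ^ i <= r \<and> r < 2 ^ Suc i"
proof -
 obtain n where n: "r < 2 ^ n" using real_arch_pow[of 2 r] by auto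
 define i where "i = (LEAST n. r < 2 ^ n)"
 have "r < 2 ^ i" unfolding i_def using n by (rule LeastI)
 moreover have "i ~= 0" using \<open>r < 2 ^ i\<close> assms by (cases i) auto
 then obtain j where j: "i = Suc j" by (cases i) auto
 have "\<not> r < 2 ^ j" using not_less_Least[of j "%n. r < 2 ^ n"] j by (simp add: i_def)
 ultimately show ?thesis using j by (intro exI[of _ j]) auto
qed

lemma power_two_powr: "((2::real) ^ i) powr u = (2 powr u) ^ i"
 by (induction i) (simp_all add: powr_mult)

lemma divide_powr_minus:
 fixes t c :: real
 assumes "t > 0" "c > 0"
 shows "(t / c) powr (- u) = t powr (- u) * c powr u"
proof -
 have "(t / c) powr (- u) = t powr (- u) / c powr (- u)" using assms by (simp only: powr_divide less_imp_le)
 then show ?thesis by (simp add: powr_minus[of c] divide_inverse)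
qed

text \<open>Dyadic balls replace polar coordinates. Where \<open>norm z\<close> is about
  \<open>2^i * h\<close> the contributions have ratio \<open>q1 = 2^(-2\<theta>)\<close>, and where
  it is about \<open>h / 2^i\<close> they have ratio \<open>q2 = 2^(2\<theta> - p)\<close>; the two
  hypotheses on \<theta> are the convergence of these geometric series. The power of
  \<open>h\<close> is dictated by scaling.\<close>

lemma radial_integral_bound:
 assumes th: "0 < \<theta>" "2 * \<theta> < real p"
 shows "\<exists>C\<ge>0. \<forall>h>0. (\<integral>\<^sup>+z. ennreal (norm z powr (- (real CARD('n) + 2 * \<theta>)) * min 1 (norm z / h) ^ p) \<partial>(lborel :: (real ^ 'n) measure))
   <= ennreal (C * h powr (- 2 * \<theta>))"
proof -
 let ?d = "CARD('n)"
 define D where "D = real ?d + 2 * \<theta>"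
 define V where "V = unit_ball_vol (real ?d)"
 have V: "V >= 0" by (simp add: V_def)
 define q1 where "q1 = (2::real) powr (- 2 * \<theta>)"
 define q2 where "q2 = (2::real) powr (2 * \<theta> - real p)"
 have q: "0 <= q1" "q1 < 1" "0 <= q2" "q2 < 1" using th by (auto simp: q1_def q2_def powr_less_one)
 define C where "C = V * 2 ^ ?d / (1 - q1) + V * 2 powr D / (1 - q2)"
 have C: "C >= 0" unfolding C_def using V q by (intro add_nonneg_nonneg divide_nonneg_nonneg) auto
 let ?z0 = "%z h. norm z powr (- D) * min 1 (norm z / h) ^ p"
 have "(\<integral>\<^sup>+z. ennreal (?z0 z h) \<partial>(lborel :: (real ^ 'n) measure)) <= ennreal (C * h powr (- 2 * \<theta>))" if h: "h > 0" for h
 proof -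
  define A where "A i = (2 ^ i * h) powr (- D)" for i :: nat
  define B where "B i = (h / 2 ^ Suc i) powr (- D) * (1 / 2 ^ i) ^ p" for i :: nat
  define f where "f i z = ennreal (A i) * indicator (cball 0 (2 ^ Suc i * h)) z + ennreal (B i) * indicator (cball 0 (h / 2 ^ i)) z" for i and z :: "real ^ 'n"
  have fm: "f i \<in> borel_measurable lborel" for i
   unfolding f_def by (intro borel_measurable_add borel_measurable_times_ennreal borel_measurable_indicator borel_measurable_const) auto
  have pt: "ennreal (?z0 z h) <= (\<Sum>i. f i z)" for z :: "real ^ 'n"
  proof (cases "z = 0")
   case False
   have Dn: "- D <= 0" using th by (simp add: D_def)
   have "\<exists>i. ennreal (?z0 z h) <= f i z"
   proof (cases "norm z >= h")
    case True
    then obtain i where i: "2 ^ i <= norm z / h" "norm z / h < 2 ^ Suc i"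
     using dyadic_above[of "norm z / h"] h by auto
    have "norm z powr (- D) * min 1 (norm z / h) ^ p <= (2 ^ i * h) powr (- D) * 1"
     using i h True Dn False by (intro mult_mono powr_mono2' power_le_one) (auto simp: field_simps)
    moreover have "z \<in> cball 0 (2 ^ Suc i * h)" using i h by (simp add: field_simps)
    ultimately have "ennreal (?z0 z h) <= f i z"
     by (simp add: f_def A_def add_increasing2 ennreal_leI)
    then show ?thesis ..
   next
    case lt: False
    then have "h / norm z >= 1" using False by simp
    then obtain i where i: "2 ^ i <= h / norm z" "h / norm z < 2 ^ Suc i" using dyadic_above by blast
    have z: "h / 2 ^ Suc i <= norm z" "norm z <= h / 2 ^ i" using i False by (auto simp: field_simps)
    have "norm z powr (- D) * min 1 (norm z / h) ^ p <= (h / 2 ^ Suc i) powr (- D) * (1 / 2 ^ i) ^ p"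
    proof (intro mult_mono powr_mono2' power_mono)
     show "min 1 (norm z / h) <= 1 / 2 ^ i"
      using z h by (intro min.coboundedI2) (simp add: field_simps)
    qed (use z h Dn in auto)
    moreover have "z \<in> cball 0 (h / 2 ^ i)" using z by simp
    ultimately have "ennreal (?z0 z h) <= f i z"
     by (simp add: f_def B_def add_increasing ennreal_leI)
    then show ?thesis ..
   qed
   then obtain i where "ennreal (?z0 z h) <= f i z" ..
   also have "f i z = (\<Sum>j\<in>{i}. f j z)" by simp
   also have "... <= (\<Sum>j. f j z)" by (rule sum_le_suminf) auto
   finally show ?thesis .
  qed simp
  let ?z1 = "%i. V * 2 powr D * h powr (- 2 * \<theta>) * q2 ^ i"
  have "(\<integral>\<^sup>+z. ennreal (?z0 z h) \<partial>(lborel :: (real ^ 'n) measure)) <= (\<integral>\<^sup>+z. (\<Sum>i. f i z) \<partial>lborel)"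
   by (intro nn_integral_mono pt)
  also have "... = (\<Sum>i. \<integral>\<^sup>+z. f i z \<partial>lborel)"
   by (intro nn_integral_suminf fm)
  also have "... = (\<Sum>i. ennreal (V * 2 ^ ?d * h powr (- 2 * \<theta>) * q1 ^ i) + ennreal (?z1 i))"
  proof (intro arg_cong[where f = suminf] ext)
   fix i
   have "(\<integral>\<^sup>+z. f i z \<partial>lborel) = ennreal (A i) * emeasure lborel (cball (0::real ^ 'n) (2 ^ Suc i * h)) + ennreal (B i) * emeasure lborel (cball (0::real ^ 'n) (h / 2 ^ i))"
    unfolding f_def
    by (subst nn_integral_add) (auto simp: nn_integral_cmult_indicator intro!: borel_measurable_times_ennreal borel_measurable_indicator)
   also have "... = ennreal (A i * (V * (2 ^ Suc i * h) ^ ?d)) + ennreal (B i * (V * (h / 2 ^ i) ^ ?d))"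
    using h V by (simp add: emeasure_cball V_def A_def B_def ennreal_mult' del: power_Suc)
   also have "A i * (V * (2 ^ Suc i * h) ^ ?d) = V * 2 ^ ?d * h powr (- 2 * \<theta>) * q1 ^ i"
   proof -
    define t where "t = 2 ^ i * h"
    have t: "t > 0" using h by (simp add: t_def)
    have "A i * (V * (2 ^ Suc i * h) ^ ?d) = V * 2 ^ ?d * (t powr (- D) * t powr (real ?d))"
    proof -
     have "2 ^ Suc i * h = 2 * t" by (simp add: t_def)
     then show ?thesis unfolding A_def t_def[symmetric] powr_realpow[OF t] by (simp only: power_mult_distrib mult_ac)
    qed
    also have "t powr (- D) * t powr (real ?d) = t powr (- 2 * \<theta>)" using t by (simp add: D_def flip: powr_add)
    also have "t powr (- 2 * \<theta>) = h powr (- 2 * \<theta>) * q1 ^ i"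
     unfolding t_def q1_def power_two_powr[symmetric] using h by (simp add: powr_mult)
    finally show ?thesis by (simp add: mult.assoc)
   qed
   also have "B i * (V * (h / 2 ^ i) ^ ?d) = V * 2 powr D * h powr (- 2 * \<theta>) * q2 ^ i"
   proof -
    define t where "t = h / 2 ^ i"
    have t: "t > 0" using h by (simp add: t_def)
    have th': "h / 2 ^ Suc i = t / 2" by (simp add: t_def)
    have "B i * (V * (h / 2 ^ i) ^ ?d) = V * 2 powr D * (t powr (- D) * t powr (real ?d)) * (1 / 2 ^ i) ^ p"
     unfolding B_def th' t_def[symmetric] divide_powr_minus[OF t zero_less_numeral] powr_realpow[OF t]
     by (simp only: mult_ac)
    also have "t powr (- D) * t powr (real ?d) = t powr (- 2 * \<theta>)" using t by (simp add: D_def flip: powr_add)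
    also have "t powr (- 2 * \<theta>) = h powr (- 2 * \<theta>) * (2 ^ i) powr (2 * \<theta>)"
     unfolding t_def using divide_powr_minus[of h "2 ^ i" "2 * \<theta>"] h by simp
    also have "V * 2 powr D * (h powr (- 2 * \<theta>) * (2 ^ i) powr (2 * \<theta>)) * (1 / 2 ^ i) ^ p = V * 2 powr D * h powr (- 2 * \<theta>) * ((2 ^ i) powr (2 * \<theta>) * (1 / 2 ^ i) ^ p)"
     by simp
    also have "(2 ^ i) powr (2 * \<theta>) * (1 / 2 ^ i) ^ p = q2 ^ i"
    proof -
     have "q2 ^ i = (2 ^ i) powr (2 * \<theta>) / (2 ^ i) powr real p"
      unfolding q2_def power_two_powr[symmetric] by (rule powr_diff)
     also have "((2::real) ^ i) powr real p = (2 ^ i) ^ p" by (rule powr_realpow) simp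
     finally show ?thesis by (simp add: power_one_over)
    qed
    finally show ?thesis .
   qed
   finally show "(\<integral>\<^sup>+z. f i z \<partial>lborel) = ennreal (V * 2 ^ ?d * h powr (- 2 * \<theta>) * q1 ^ i) + ennreal (?z1 i)" .
  qed
  also have "... = (\<Sum>i. ennreal (V * 2 ^ ?d * h powr (- 2 * \<theta>) * q1 ^ i)) + (\<Sum>i. ennreal (?z1 i))"
   by (rule suminf_add[symmetric]) auto
  also have "... = ennreal (V * 2 ^ ?d * h powr (- 2 * \<theta>) / (1 - q1)) + ennreal (V * 2 powr D * h powr (- 2 * \<theta>) / (1 - q2))"
   using V q by (intro arg_cong2[where f = "(+)"] suminf_ennreal_geometric) auto
  also have "... = ennreal (C * h powr (- 2 * \<theta>))"
  proof -
   have "C * h powr (- 2 * \<theta>) = V * 2 ^ ?d * h powr (- 2 * \<theta>) / (1 - q1) + V * 2 powr D * h powr (- 2 * \<theta>) / (1 - q2)"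
    by (simp add: C_def distrib_right)
   then show ?thesis using V q by (simp add: ennreal_plus)
  qed
  finally show ?thesis .
 qed
 then show ?thesis using C unfolding D_def by (intro exI[of _ C]) auto
qed

section \<open>Slabs in the unit cube\<close>

lemma interior_unit_cube: "interior (unit_cube :: (real ^ 'n) set) = box 0 (\<chi> i. 1)"
proof -
 have "(unit_cube :: (real ^ 'n) set) = cbox 0 (\<chi> i. 1)" by (auto simp: unit_cube_def mem_box_cart)
 then have "interior (unit_cube :: (real ^ 'n) set) = interior (cbox 0 (\<chi> i. 1))" by (rule arg_cong)
 also have "... = box 0 (\<chi> i. 1)" by (rule interior_cbox)
 finally show ?thesis .
qed

lemma emeasure_interior_unit_cube: "emeasure lborel (interior unit_cube :: (real ^ 'n) set) = 1"
proof -
 have "emeasure lborel (box 0 (\<chi> i. 1) :: (real ^ 'n) set) = ennreal (\<Prod>b\<in>Basis. ((\<chi> i. 1) - 0 :: real ^ 'n) \<bullet> b)"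
  by (rule emeasure_lborel_box) (auto simp: Basis_vec_def inner_axis)
 also have "(\<Prod>b\<in>Basis. ((\<chi> i. 1) - 0 :: real ^ 'n) \<bullet> b) = 1"
  by (rule prod.neutral) (auto simp: Basis_vec_def inner_axis)
 finally show ?thesis by (simp add: interior_unit_cube)
qed

text \<open>A packing argument instead of a rotation: some coordinate of \<omega> is at least
  \<open>1/d\<close> in absolute value. Translating the slab along this axis in steps of
  \<open>\<tau>\<close> gives disjoint copies; about \<open>1 / \<tau>\<close> of them fit into
  \<open>[0,2]^d\<close>, so each has measure at most \<open>2^d * 2 * \<tau>\<close>, and
  \<open>\<tau> <= 4 * r * d\<close>.\<close>

lemma slab_measure:
 fixes \<omega> :: "real ^ 'n"
 assumes \<omega>: "norm \<omega> = 1" and r: "r > 0"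
 shows "emeasure lborel {x \<in> interior unit_cube. \<bar>\<omega> \<bullet> x - c\<bar> <= r} <= ennreal (8 * 2 ^ CARD('n) * real CARD('n) * r)"
proof -
 let ?d = "real CARD('n)"
 let ?S = "{x \<in> interior unit_cube. \<bar>\<omega> \<bullet> x - c\<bar> <= r}"
 have "\<exists>i. 1 / ?d <= \<bar>\<omega> $ i\<bar>"
 proof (rule ccontr)
  assume "\<not> ?thesis"
  then have "!!i. \<bar>\<omega> $ i\<bar> < 1 / ?d" by (auto simp: not_le)
  then have "(\<Sum>i\<in>UNIV. \<bar>\<omega> $ i\<bar>) < (\<Sum>i\<in>(UNIV :: 'n set). 1 / ?d)" by (intro sum_strict_mono) auto
  then show False using norm_le_l1_cart[of \<omega>] \<omega> by simp
 qed
 then obtain i where i: "1 / ?d <= \<bar>\<omega> $ i\<bar>" ..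
 define a where "a = \<bar>\<omega> $ i\<bar>"
 have a: "a > 0" using i by (auto simp: a_def intro: less_le_trans[rotated])
 \<comment> \<open>One step moves \<open>\<omega> \<bullet> x\<close> by \<open>4 * r\<close> in
   absolute value, more than the width \<open>2 * r\<close> of the slab.\<close>
 define \<tau> where "\<tau> = 4 * r / a"
 have \<tau>: "\<tau> > 0" using r a by (simp add: \<tau>_def)
 have \<tau>d: "\<tau> <= 4 * r * ?d" using i r a by (simp add: \<tau>_def a_def[symmetric] field_simps)
 have Sb: "?S \<in> sets borel"
 proof -
  have "{x. \<bar>\<omega> \<bullet> x - c\<bar> <= r} \<in> sets borel" by measurable
  then have "interior unit_cube \<inter> {x. \<bar>\<omega> \<bullet> x - c\<bar> <= r} \<in> sets borel" by (intro sets.Int) auto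
  also have "interior unit_cube \<inter> {x. \<bar>\<omega> \<bullet> x - c\<bar> <= r} = ?S" by auto
  finally show ?thesis .
 qed
 show ?thesis
 proof (cases "\<tau> <= 1")
  \<comment> \<open>If not even one full step fits, the claimed bound exceeds the measure 1 of the
    whole cube.\<close>
  case False
  have "emeasure lborel ?S <= emeasure lborel (interior unit_cube :: (real ^ 'n) set)"
   by (rule emeasure_mono) auto
  also have "... = ennreal 1" by (simp add: emeasure_interior_unit_cube)
  also have "... <= ennreal (8 * 2 ^ CARD('n) * real CARD('n) * r)"
  proof (rule ennreal_leI)
   have "1 <= 4 * r * ?d" using False \<tau>d by simp
   also have "... <= (2 * 2 ^ CARD('n)) * (4 * r * ?d)" 
   proof -
    have "1 <= 2 * (2::real) ^ CARD('n)" using one_le_power[of "2::real" "CARD('n)"] by linarith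
    from mult_right_mono[OF this, of "4 * r * ?d"] show ?thesis using r by simp
   qed
   finally show "1 <= 8 * 2 ^ CARD('n) * real CARD('n) * r" by (simp add: mult_ac)
  qed
  finally show ?thesis .
 next
  case True
  define J where "J = nat \<lfloor>1 / \<tau>\<rfloor>"
  have J: "real J <= 1 / \<tau>" "1 / \<tau> < real J + 1" "J >= 1" using True \<tau> by (auto simp: J_def le_nat_iff le_floor_iff)
  \<comment> \<open>As \<open>J >= 1\<close>, rounding down at most halves the number of
    copies.\<close>
  have J2: "1 / (2 * \<tau>) <= real J" using J by simp
  define T where "T j = (+) ((real j * \<tau>) *\<^sub>R axis i 1) ` ?S" for j :: nat
  have Tm: "T j \<in> sets borel" "emeasure lborel (T j) = emeasure lborel ?S" for j
  proof -
   have T_iff: "x \<in> T j \<longleftrightarrow> x - (real j * \<tau>) *\<^sub>R axis i 1 \<in> ?S" for x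
   proof
    assume "x - (real j * \<tau>) *\<^sub>R axis i 1 \<in> ?S"
    then show "x \<in> T j" unfolding T_def by (rule image_eqI[rotated]) simp
   next
    assume "x \<in> T j"
    then obtain y where "y \<in> ?S" "x = (real j * \<tau>) *\<^sub>R axis i 1 + y" unfolding T_def by blast
    then show "x - (real j * \<tau>) *\<^sub>R axis i 1 \<in> ?S" by simp
   qed
   then have "T j = (%x. x - (real j * \<tau>) *\<^sub>R axis i 1) -` ?S" by blast
   moreover have "(%x. x - (real j * \<tau>) *\<^sub>R axis i 1) -` ?S \<inter> space borel \<in> sets borel"
    by (rule measurable_sets[OF _ Sb]) measurable
   ultimately show Tb: "T j \<in> sets borel" by simp
   have "emeasure lborel (T j) = (\<integral>\<^sup>+x. indicator (T j) x \<partial>lborel)" using Tb by simp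
   also have "... = (\<integral>\<^sup>+x. indicator (T j) (x + (real j * \<tau>) *\<^sub>R axis i 1) \<partial>lborel)"
    using Tb by (intro nn_integral_lborel_translate[symmetric] borel_measurable_indicator)
   also have "... = (\<integral>\<^sup>+x. indicator ?S x \<partial>lborel)"
    by (intro nn_integral_cong) (simp add: indicator_def T_iff)
   finally show "emeasure lborel (T j) = emeasure lborel ?S" using Sb by simp
  qed
  have Tw: "\<bar>\<omega> \<bullet> x - c - real j * \<tau> * \<omega> $ i\<bar> <= r" if "x \<in> T j" for x j
   using that by (auto simp: T_def inner_add_right inner_axis algebra_simps)
  have "disjoint_family_on T {..<J}"
   unfolding disjoint_family_on_def
  proof (intro ballI impI, rule ccontr)
   fix j l assume jl: "j \<in> {..<J}" "l \<in> {..<J}" "j ~= l" "T j \<inter> T l ~= {}"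
   then obtain x where x: "x \<in> T j" "x \<in> T l" by blast
   have "\<bar>real j * \<tau> * \<omega> $ i - real l * \<tau> * \<omega> $ i\<bar> <= 2 * r" using Tw[OF x(1)] Tw[OF x(2)] by linarith
   moreover have "\<bar>real j * \<tau> * \<omega> $ i - real l * \<tau> * \<omega> $ i\<bar> = \<bar>real j - real l\<bar> * (4 * r)"
   proof -
    have "\<bar>real j * \<tau> * \<omega> $ i - real l * \<tau> * \<omega> $ i\<bar> = \<bar>(real j - real l) * (\<tau> * \<omega> $ i)\<bar>" by (simp add: algebra_simps)
    also have "... = \<bar>real j - real l\<bar> * (\<tau> * a)" using \<tau> by (simp add: abs_mult a_def)
    also have "\<tau> * a = 4 * r" using a by (simp add: \<tau>_def)
    finally show ?thesis .
   qed
   moreover have "1 <= \<bar>real j - real l\<bar>" using jl(3) by linarith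
   then have "4 * r <= \<bar>real j - real l\<bar> * (4 * r)" using r by simp
   ultimately show False using r by linarith
  qed
  then have "(\<Sum>j<J. emeasure lborel (T j)) = emeasure lborel (\<Union>j<J. T j)"
   using Tm by (intro sum_emeasure) auto
  also have "... <= emeasure lborel (cbox 0 (\<chi> i. 2) :: (real ^ 'n) set)"
  proof (rule emeasure_mono)
   show "(\<Union>j<J. T j) \<subseteq> cbox 0 (\<chi> i. 2)"
   proof clarify
    fix j x assume j: "j < J" and "x \<in> T j"
    then obtain y where y: "y \<in> interior unit_cube" "x = (real j * \<tau>) *\<^sub>R axis i 1 + y" by (auto simp: T_def)
    have "real j * \<tau> <= real J * \<tau>" using j \<tau> by simp
    also have "... <= 1" using J(1) \<tau> by (simp add: field_simps)
    finally have "real j * \<tau> <= 1" .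
    have "0 <= x $ l \<and> x $ l <= 2" for l
    proof -
     have "0 < y $ l" "y $ l < 1" using y(1) by (auto simp: interior_unit_cube mem_box_cart)
     moreover have "0 <= real j * \<tau>" using \<tau> by simp
     ultimately show ?thesis using \<open>real j * \<tau> <= 1\<close> by (cases "l = i") (simp_all add: y(2) axis_def)
    qed
    then show "x \<in> cbox 0 (\<chi> i. 2)" by (simp add: mem_box_cart)
   qed
  qed simp
  also have "... = ennreal (2 ^ CARD('n))"
  proof -
   have "emeasure lborel (cbox 0 (\<chi> i. 2) :: (real ^ 'n) set) = ennreal (\<Prod>b\<in>Basis. ((\<chi> i. 2) - 0 :: real ^ 'n) \<bullet> b)"
    by (rule emeasure_lborel_cbox) (auto simp: Basis_vec_def inner_axis)
   also have "(\<Prod>b\<in>Basis. ((\<chi> i. 2) - 0 :: real ^ 'n) \<bullet> b) = (\<Prod>b\<in>(Basis :: (real ^ 'n) set). 2)"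
    by (rule prod.cong) (auto simp: Basis_vec_def inner_axis)
   also have "... = 2 ^ CARD('n)" by simp
   finally show ?thesis .
  qed
  finally have le: "of_nat J * emeasure lborel ?S <= ennreal (2 ^ CARD('n))" by (simp add: Tm)
  have "emeasure lborel ?S = ennreal (1 / real J) * (of_nat J * emeasure lborel ?S)"
   using J(3) by (simp add: mult.assoc[symmetric] ennreal_of_nat_eq_real_of_nat flip: ennreal_mult)
  also have "... <= ennreal (1 / real J) * ennreal (2 ^ CARD('n))" using le by (rule mult_left_mono) simp
  also have "... = ennreal (2 ^ CARD('n) / real J)" by (simp flip: ennreal_mult)
  also have "... <= ennreal (8 * 2 ^ CARD('n) * real CARD('n) * r)"
  proof (rule ennreal_leI)
   have "1 / real J <= 2 * \<tau>" using J2 J(3) \<tau> by (simp add: field_simps)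
   also have "... <= 8 * ?d * r" using \<tau>d by simp
   finally have "2 ^ CARD('n) * (1 / real J) <= 2 ^ CARD('n) * (8 * ?d * r)" by (rule mult_left_mono) simp
   then show "2 ^ CARD('n) / real J <= 8 * 2 ^ CARD('n) * real CARD('n) * r" by (simp add: mult_ac)
  qed
  finally show ?thesis .
 qed
qed

text \<open>Substituting \<open>y = x + z\<close> turns the Gagliardo integral into an integral of
  the squared L^2 modulus of continuity of \<open>G\<close> against
  \<open>norm z powr (- (d + 2 * \<theta>))\<close>. The exponent \<open>p\<close> will be 2 for
  Lipschitz profiles and 1 for profiles with jumps.\<close>

lemma slobodeckij_sq_bound:
 assumes th: "0 < \<theta>" "2 * \<theta> < real p"
 shows "\<exists>C\<ge>0. \<forall>U (G :: real ^ 'n => complex) K w. U \<in> sets borel --> G \<in> borel_measurable borel --> K >= 0 --> w > 0 -->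
   (\<forall>z. z ~= 0 --> (\<integral>\<^sup>+x. esq (G x - G (x + z)) * indicator U x * indicator U (x + z) \<partial>lborel) <= ennreal (K * min 1 (norm z / w) ^ p)) -->
   slobodeckij_sq \<theta> U G <= ennreal (C * K * w powr (- 2 * \<theta>))"
proof -
 obtain C where C: "C >= 0" "!!h. h > 0 ==> (\<integral>\<^sup>+z. ennreal (norm z powr (- (real CARD('n) + 2 * \<theta>)) * min 1 (norm z / h) ^ p) \<partial>(lborel :: (real ^ 'n) measure))
   <= ennreal (C * h powr (- 2 * \<theta>))"
  using radial_integral_bound[OF th] by blast
 define D where "D = real CARD('n) + 2 * \<theta>"
 have "slobodeckij_sq \<theta> U G <= ennreal (C * K * w powr (- 2 * \<theta>))"
  if U[measurable]: "U \<in> sets borel" and G[measurable]: "G \<in> borel_measurable borel" and K: "K >= 0" and w: "w > 0"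
   and le: "!!z. z ~= 0 ==> (\<integral>\<^sup>+x. esq (G x - G (x + z)) * indicator U x * indicator U (x + z) \<partial>lborel) <= ennreal (K * min 1 (norm z / w) ^ p)"
  for U and G :: "real ^ 'n => complex" and K w
 proof -
  define f where "f x y = ennreal ((cmod (G x - G y))\<^sup>2 / norm (x - y) powr D) * indicator U y * indicator U x" for x y
  have fm: "(%(x, z). f x (z + x)) \<in> borel_measurable (lborel \<Otimes>\<^sub>M lborel)" unfolding f_def by measurable
  have fm1: "f x \<in> borel_measurable borel" for x unfolding f_def by measurable
  let ?z0 = "%z. norm z powr (- D) * min 1 (norm z / w) ^ p"
  have "slobodeckij_sq \<theta> U G = (\<integral>\<^sup>+x. \<integral>\<^sup>+y. f x y \<partial>lborel \<partial>lborel)"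
   unfolding slobodeckij_sq_def nn_set_integral_lebesgue f_def D_def by (simp add: nn_integral_multc)
  also have "... = (\<integral>\<^sup>+x. \<integral>\<^sup>+z. f x (z + x) \<partial>lborel \<partial>lborel)"
   by (simp add: nn_integral_lborel_translate[OF fm1])
  also have "... = (\<integral>\<^sup>+z. \<integral>\<^sup>+x. f x (z + x) \<partial>lborel \<partial>lborel)"
   by (rule lborel_pair.Fubini'[symmetric]) (rule fm)
  also have "... <= (\<integral>\<^sup>+z. ennreal K * ennreal (?z0 z) \<partial>(lborel :: (real ^ 'n) measure))"
  proof (rule nn_integral_mono)
   fix z :: "real ^ 'n"
   show "(\<integral>\<^sup>+x. f x (z + x) \<partial>lborel) <= ennreal K * ennreal (?z0 z)"
   proof (cases "z = 0")
    case False
    have "f x (z + x) = ennreal (norm z powr (- D)) * (esq (G x - G (x + z)) * indicator U x * indicator U (x + z))" for x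
     by (simp add: f_def powr_minus divide_inverse ennreal_mult' mult_ac add.commute)
    then have "(\<integral>\<^sup>+x. f x (z + x) \<partial>lborel) = ennreal (norm z powr (- D)) * (\<integral>\<^sup>+x. esq (G x - G (x + z)) * indicator U x * indicator U (x + z) \<partial>lborel)"
     by (simp add: nn_integral_cmult)
    also have "... <= ennreal (norm z powr (- D)) * ennreal (K * min 1 (norm z / w) ^ p)"
     using le[OF False] by (rule mult_left_mono) simp
    also have "... = ennreal K * ennreal (?z0 z)"
     using K w by (subst (1 2) ennreal_mult[symmetric]) (simp_all add: mult_ac)
    finally show ?thesis .
   qed (simp add: f_def)
  qed
  also have "... = ennreal K * (\<integral>\<^sup>+z. ennreal (?z0 z) \<partial>(lborel :: (real ^ 'n) measure))"
   by (rule nn_integral_cmult) measurable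
  also have "... <= ennreal K * ennreal (C * w powr (- 2 * \<theta>))"
   using C(2)[OF w] unfolding D_def by (rule mult_left_mono) simp
  also have "... = ennreal (C * K * w powr (- 2 * \<theta>))"
   using K C(1) by (subst ennreal_mult[symmetric]) (simp_all add: mult_ac)
  finally show ?thesis .
 qed
 then show ?thesis using C(1) by (intro exI[of _ C] conjI allI impI) simp_all
qed

definition relu_comb :: "nat => nat => (nat => real) => (nat => real) => real => real" where
 "relu_comb n k \<gamma> \<beta> t = (\<Sum>i<n. \<gamma> i * relu_pow k (t - \<beta> i))"

lemma relu_comb_measurable [measurable]: "relu_comb n k \<gamma> \<beta> \<in> borel_measurable borel"
 unfolding relu_comb_def by measurable

text \<open>Differentiate the identity in \<open>y\<close>. Thus the derivatives of a localized
  combination are localized as well.\<close>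

lemma moments_lower:
 fixes \<gamma> \<beta> :: "nat => real"
 assumes "!!y. (\<Sum>i<n. \<gamma> i * (y - \<beta> i) ^ k) = 0" "j <= k"
 shows "(\<Sum>i<n. \<gamma> i * (y - \<beta> i) ^ (k - j)) = 0"
 using assms(2)
proof (induction j arbitrary: y)
 case (Suc j)
 define l where "l = k - Suc j"
 have kl: "k - j = Suc l" using Suc.prems by (simp add: l_def)
 let ?z0 = "%i y. \<Sum>i<n. \<gamma> i * (real (Suc l) * (y - \<beta> i) ^ l)"
 have "((%y. \<Sum>i<n. \<gamma> i * (y - \<beta> i) ^ Suc l) has_real_derivative (?z0 i y)) (at y)"
  by (auto intro!: derivative_eq_intros DERIV_sum simp: algebra_simps simp del: power_Suc)
 moreover have "(%y. \<Sum>i<n. \<gamma> i * (y - \<beta> i) ^ Suc l) = (%y. 0)" using Suc kl by (auto simp del: power_Suc)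
 ultimately have "((%y. 0) has_real_derivative (?z0 i y)) (at y)" by simp
 then have "(?z0 i y) = 0"
  by (rule DERIV_unique) simp
 then have "real (Suc l) * (\<Sum>i<n. \<gamma> i * (y - \<beta> i) ^ l) = 0"
  by (simp add: sum_distrib_left mult_ac)
 then show ?case by (simp add: l_def)
qed (use assms in simp)

text \<open>Left of all knots every term vanishes; right of them every truncated power is a full
  power and the moment identity cancels the sum. So the combination lives within \<open>w\<close> of
  \<open>b\<close>, where each term is at most \<open>\<Gamma> * (2 * w) ^ k\<close>. For
  \<open>k = 0\<close> it is constant between knots: if the values at \<open>s\<close> and
  \<open>t\<close> differ, a knot separates them.\<close>

lemma relu_comb_properties:
 fixes \<gamma> \<beta> :: "nat => real"
 assumes mom: "!!y. (\<Sum>i<n. \<gamma> i * (y - \<beta> i) ^ k) = 0" and w: "w > 0"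
  and \<gamma>: "!!i. i < n ==> \<bar>\<gamma> i\<bar> <= \<Gamma>" and \<beta>: "!!i. i < n ==> \<bar>\<beta> i - b\<bar> <= w" and \<Gamma>: "\<Gamma> >= 0"
 shows relu_comb_support: "\<bar>t - b\<bar> > w ==> relu_comb n k \<gamma> \<beta> t = 0"
  and relu_comb_bound: "\<bar>relu_comb n k \<gamma> \<beta> t\<bar> <= real n * \<Gamma> * (2 * w) ^ k"
  and relu_comb_lipschitz: "k >= 1 ==> \<bar>relu_comb n k \<gamma> \<beta> s - relu_comb n k \<gamma> \<beta> t\<bar> <= real n * \<Gamma> * (real k * (2 * w) ^ (k - 1)) * \<bar>s - t\<bar>"
  and relu_comb_step: "k = 0 ==> relu_comb n k \<gamma> \<beta> s ~= relu_comb n k \<gamma> \<beta> t ==> \<exists>i<n. \<bar>s - \<beta> i\<bar> <= \<bar>s - t\<bar>"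
proof -
 let ?u = "relu_comb n k \<gamma> \<beta>"
 have left: "?u t = 0" if "t <= b - w" for t
  unfolding relu_comb_def
 proof (intro sum.neutral ballI)
  fix i assume "i \<in> {..<n}"
  then have "t - \<beta> i <= 0" using \<beta>[of i] that by auto
  then show "\<gamma> i * relu_pow k (t - \<beta> i) = 0" by (simp add: relu_pow_def)
 qed
 \<comment> \<open>At the end point \<open>b + w\<close> a knot may give \<open>0 ^ k\<close>, which
   agrees with the truncated power only for \<open>k >= 1\<close>.\<close>
 have right: "?u t = 0" if "t > b + w \<or> (t >= b + w \<and> k >= 1)" for t
 proof -
  have "?u t = (\<Sum>i<n. \<gamma> i * (t - \<beta> i) ^ k)" unfolding relu_comb_def
  proof (rule sum.cong[OF refl])
   fix i assume "i \<in> {..<n}"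
   then have "t - \<beta> i > 0 \<or> (t - \<beta> i >= 0 \<and> k >= 1)" using \<beta>[of i] that by auto
   then show "\<gamma> i * relu_pow k (t - \<beta> i) = \<gamma> i * (t - \<beta> i) ^ k" by (auto simp: relu_pow_def)
  qed
  then show ?thesis using mom by simp
 qed
 show supp: "?u t = 0" if "\<bar>t - b\<bar> > w" for t using left[of t] right[of t] that by (auto simp: abs_if split: if_splits)
 show "\<bar>?u t\<bar> <= real n * \<Gamma> * (2 * w) ^ k"
 proof (cases "\<bar>t - b\<bar> > w")
  case False
  have "\<bar>?u t\<bar> <= (\<Sum>i<n. \<bar>\<gamma> i * relu_pow k (t - \<beta> i)\<bar>)" unfolding relu_comb_def by (rule sum_abs)
  also have "... <= (\<Sum>i<n. \<Gamma> * (2 * w) ^ k)"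
  proof (rule sum_mono)
   fix i assume i: "i \<in> {..<n}"
   have "\<bar>relu_pow k (t - \<beta> i)\<bar> <= (2 * w) ^ k" using False \<beta>[of i] i by (intro relu_pow_abs_le) auto
   then show "\<bar>\<gamma> i * relu_pow k (t - \<beta> i)\<bar> <= \<Gamma> * (2 * w) ^ k"
    unfolding abs_mult using \<gamma>[of i] i \<Gamma> by (intro mult_mono) auto
  qed
  finally show ?thesis by simp
 qed (use supp \<Gamma> w in auto)
 show "\<bar>?u s - ?u t\<bar> <= real n * \<Gamma> * (real k * (2 * w) ^ (k - 1)) * \<bar>s - t\<bar>" if k: "k >= 1" for s t
 proof -
  \<comment> \<open>Both functions vanish at the end points of the support, so the arguments may be clamped to it.\<close>
  define cl where "cl t = max (b - w) (min t (b + w))" for t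
  have clu: "?u (cl t) = ?u t" for t
  proof -
   consider "t <= b - w" | "t >= b + w" | "b - w < t" "t < b + w" by linarith
   then show ?thesis
    by cases (use left[of t] left[of "b - w"] right[of t] right[of "b + w"] k w in \<open>auto simp: cl_def max_def min_def\<close>)
  qed
  have cll: "\<bar>cl s - cl t\<bar> <= \<bar>s - t\<bar>" unfolding cl_def by auto
  have clb: "\<bar>cl t - b\<bar> <= w" for t unfolding cl_def using w by auto
  obtain j where j: "k = Suc j" using k by (cases k) auto
  have "\<bar>?u (cl s) - ?u (cl t)\<bar> <= (\<Sum>i<n. \<bar>\<gamma> i * (relu_pow k (cl s - \<beta> i) - relu_pow k (cl t - \<beta> i))\<bar>)"
   unfolding relu_comb_def by (simp add: sum_subtractf[symmetric] right_diff_distrib[symmetric] sum_abs)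
  also have "... <= (\<Sum>i<n. \<Gamma> * (real k * (2 * w) ^ (k - 1) * \<bar>s - t\<bar>))"
  proof (rule sum_mono)
   fix i assume i: "i \<in> {..<n}"
   have "\<bar>relu_pow (Suc j) (cl s - \<beta> i) - relu_pow (Suc j) (cl t - \<beta> i)\<bar> <= real (Suc j) * (2 * w) ^ j * \<bar>(cl s - \<beta> i) - (cl t - \<beta> i)\<bar>"
    using clb[of s] clb[of t] \<beta>[of i] i by (intro relu_pow_lipschitz) auto
   also have "... <= real (Suc j) * (2 * w) ^ j * \<bar>s - t\<bar>"
    using cll w by (intro mult_left_mono) auto
   finally show "\<bar>\<gamma> i * (relu_pow k (cl s - \<beta> i) - relu_pow k (cl t - \<beta> i))\<bar> <= \<Gamma> * (real k * (2 * w) ^ (k - 1) * \<bar>s - t\<bar>)"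
    unfolding abs_mult using \<gamma>[of i] i \<Gamma> by (intro mult_mono) (auto simp: j)
  qed
  finally show ?thesis by (simp add: clu mult.assoc)
 qed
 show "\<exists>i<n. \<bar>s - \<beta> i\<bar> <= \<bar>s - t\<bar>" if k: "k = 0" and ne: "?u s ~= ?u t" for s t
 proof -
  have "\<exists>i<n. \<gamma> i * relu_pow k (s - \<beta> i) ~= \<gamma> i * relu_pow k (t - \<beta> i)"
  proof (rule ccontr)
   assume "\<not> ?thesis"
   then have "?u s = ?u t" unfolding relu_comb_def by (intro sum.cong) auto
   then show False using ne by simp
  qed
  then obtain i where "i < n" "relu_pow k (s - \<beta> i) ~= relu_pow k (t - \<beta> i)" by auto
  then have "\<bar>s - \<beta> i\<bar> <= \<bar>s - t\<bar>" by (auto simp: relu_pow_def k split: if_splits)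
  then show ?thesis using \<open>i < n\<close> by blast
 qed
qed

lemma abs_prod_power_le_1:
 fixes \<omega> :: "real ^ 'n"
 assumes "norm \<omega> = 1"
 shows "\<bar>\<Prod>i\<in>UNIV. (\<omega> $ i) ^ \<alpha> i\<bar> <= 1"
proof -
 have "\<bar>\<omega> $ i\<bar> <= 1" for i using component_le_norm_cart[of \<omega> i] assms by simp
 then show ?thesis unfolding abs_prod by (intro prod_le_1) (auto simp: power_abs power_le_one)
qed

section \<open>Energy of a profile supported in one slab\<close>

lemma L2_sq_ridge_bound:
 fixes \<omega> :: "real ^ 'n"
 assumes \<omega>: "norm \<omega> = 1" and w: "w > 0" and g: "g \<in> borel_measurable borel"
  and supp: "!!t. \<bar>t - b\<bar> > w ==> g t = 0" and bd: "!!t. \<bar>g t\<bar> <= B"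
 shows "L2_sq (interior unit_cube) (%x. complex_of_real (g (\<omega> \<bullet> x))) <= ennreal (8 * 2 ^ CARD('n) * real CARD('n) * (B\<^sup>2 * w))"
proof -
 let ?S = "{x \<in> interior unit_cube. \<bar>\<omega> \<bullet> x - b\<bar> <= w}"
 have B: "B >= 0" using bd[of 0] by simp
 have Sb: "?S \<in> sets borel"
 proof -
  have "{x. \<bar>\<omega> \<bullet> x - b\<bar> <= w} \<in> sets borel" by measurable
  then have "interior unit_cube \<inter> {x. \<bar>\<omega> \<bullet> x - b\<bar> <= w} \<in> sets borel" by (intro sets.Int) auto
  also have "interior unit_cube \<inter> {x. \<bar>\<omega> \<bullet> x - b\<bar> <= w} = ?S" by auto
  finally show ?thesis .
 qed
 have "(g (\<omega> \<bullet> x))\<^sup>2 <= B\<^sup>2" for x using bd[of "\<omega> \<bullet> x"] B by (simp add: abs_le_square_iff[symmetric])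
 then have "L2_sq (interior unit_cube) (%x. complex_of_real (g (\<omega> \<bullet> x))) <= (\<integral>\<^sup>+x. ennreal (B\<^sup>2) * indicator ?S x \<partial>lborel)"
  unfolding L2_sq_def nn_set_integral_lebesgue
  by (intro nn_integral_mono) (use supp in \<open>auto simp: indicator_def intro!: ennreal_leI\<close>)
 also have "... = ennreal (B\<^sup>2) * emeasure lborel ?S"
  using Sb by (intro nn_integral_cmult_indicator) simp
 also have "... <= ennreal (B\<^sup>2) * ennreal (8 * 2 ^ CARD('n) * real CARD('n) * w)"
  by (intro mult_left_mono slab_measure \<omega> w) simp
 also have "... = ennreal (8 * 2 ^ CARD('n) * real CARD('n) * (B\<^sup>2 * w))"
  using w by (subst ennreal_mult[symmetric]) (simp_all add: mult_ac)
 finally show ?thesis .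
qed

text \<open>Two mechanisms. A Lipschitz profile changes by at most \<open>B * norm z / w\<close>, on
  two slabs of width about \<open>w\<close>, which gives exponent 2. A profile with finitely many
  jumps changes by up to \<open>2 * B\<close>, but only on slabs of width about
  \<open>norm z\<close> around the \<open>n\<close> knots: here the measure is small and not the
  height, hence exponent 1.\<close>

lemma ridge_difference_bound:
 fixes \<omega> :: "real ^ 'n"
 assumes \<omega>: "norm \<omega> = 1" and w: "w > 0" and g: "g \<in> borel_measurable borel"
  and supp: "!!t. \<bar>t - b\<bar> > w ==> g t = 0" and bd: "!!t. \<bar>g t\<bar> <= B"
  and reg: "(p = 2 \<and> (\<forall>s t. \<bar>g s - g t\<bar> <= B / w * \<bar>s - t\<bar>)) \<or> (p = 1 \<and> (\<forall>s t. g s ~= g t --> (\<exists>i<n. \<bar>s - \<beta> i\<bar> <= \<bar>s - t\<bar>)))"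
  and n: "n >= 1" and z: "z ~= 0"
 shows "(\<integral>\<^sup>+x. esq (complex_of_real (g (\<omega> \<bullet> x)) - complex_of_real (g (\<omega> \<bullet> (x + z)))) * indicator (interior unit_cube) x * indicator (interior unit_cube) (x + z) \<partial>lborel)
   <= ennreal ((8 * 2 ^ CARD('n) * real CARD('n)) * (8 * real n) * (B\<^sup>2 * w) * min 1 (norm z / w) ^ p)"
proof -
 define c where "c = 8 * 2 ^ CARD('n) * real CARD('n)"
 have c: "c > 0" by (simp add: c_def)
 let ?U = "interior unit_cube :: (real ^ 'n) set"
 have B: "B >= 0" using bd[of 0] by simp
 define S where "S a r = {x \<in> ?U. \<bar>\<omega> \<bullet> x - a\<bar> <= r}" for a r
 have Sb[measurable]: "S a r \<in> sets borel" for a r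
 proof -
  have "{x. \<bar>\<omega> \<bullet> x - a\<bar> <= r} \<in> sets borel" by measurable
  then have "?U \<inter> {x. \<bar>\<omega> \<bullet> x - a\<bar> <= r} \<in> sets borel" by (intro sets.Int) auto
  also have "?U \<inter> {x. \<bar>\<omega> \<bullet> x - a\<bar> <= r} = S a r" by (auto simp: S_def)
  finally show ?thesis .
 qed
 have Sm: "(\<integral>\<^sup>+x. indicator (S a r) x \<partial>lborel) <= ennreal (c * r)" if "r > 0" for a r
  using slab_measure[OF \<omega> that, of a] Sb[of a r] by (simp add: S_def c_def)
 define d where "d x = g (\<omega> \<bullet> x) - g (\<omega> \<bullet> (x + z))" for x
 have \<omega>z: "\<bar>\<omega> \<bullet> z\<bar> <= norm z" using Cauchy_Schwarz_ineq2[of \<omega> z] \<omega> by simp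
 let ?I = "\<integral>\<^sup>+x. ennreal ((d x)\<^sup>2) * indicator ?U x * indicator ?U (x + z) \<partial>lborel"
 \<comment> \<open>A nonzero difference forces \<open>x\<close> or \<open>x + z\<close> into the
   slab that supports the profile.\<close>
 have I1: "?I <= ennreal (2 * c * (Q * w))" if Q: "Q >= 0" "!!x. (d x)\<^sup>2 <= Q" for Q
 proof -
  let ?z0 = "%x. \<integral>\<^sup>+x. indicator (S b w) x \<partial>lborel"
  have "?I <= (\<integral>\<^sup>+x. ennreal Q * (indicator (S b w) x + indicator (S b w) (x + z)) \<partial>lborel)"
  proof (rule nn_integral_mono)
   fix x
   show "ennreal ((d x)\<^sup>2) * indicator ?U x * indicator ?U (x + z) <= ennreal Q * (indicator (S b w) x + indicator (S b w) (x + z))"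
   proof (cases "x \<in> ?U \<and> x + z \<in> ?U \<and> d x ~= 0")
    case True
    then have "x \<in> S b w \<or> x + z \<in> S b w" using supp unfolding d_def S_def by (force simp: not_less[symmetric])
    then have "(1::ennreal) <= indicator (S b w) x + indicator (S b w) (x + z)"
     by (auto simp: indicator_def add_increasing add_increasing2)
    then have "ennreal Q * 1 <= ennreal Q * (indicator (S b w) x + indicator (S b w) (x + z))" by (rule mult_left_mono) simp
    moreover have "ennreal ((d x)\<^sup>2) * indicator ?U x * indicator ?U (x + z) <= ennreal Q * 1"
     using True Q(2)[of x] by (simp add: ennreal_leI)
    ultimately show ?thesis by (rule order_trans[rotated])
   qed (auto simp: indicator_def)
  qed
  also have "... = ennreal Q * ((?z0 x) + (\<integral>\<^sup>+x. indicator (S b w) (x + z) \<partial>lborel))"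
   by (simp add: nn_integral_cmult nn_integral_add)
  also have "(\<integral>\<^sup>+x. indicator (S b w) (x + z) \<partial>lborel) = (?z0 x)"
   by (intro nn_integral_lborel_translate borel_measurable_indicator Sb)
  also have "ennreal Q * ((?z0 x) + (?z0 x)) <= ennreal Q * (ennreal (c * w) + ennreal (c * w))"
   by (intro mult_left_mono add_mono Sm w) simp
  also have "... = ennreal (2 * c * (Q * w))"
   using Q(1) c w by (subst ennreal_plus[symmetric], simp, simp, subst ennreal_mult[symmetric]) (auto simp: algebra_simps)
  finally show ?thesis .
 qed
 have d2: "\<bar>d x\<bar> <= 2 * B" for x
  using bd[of "\<omega> \<bullet> x"] bd[of "\<omega> \<bullet> (x + z)"] unfolding d_def by linarith
 have "?I <= ennreal (c * (8 * real n) * (B\<^sup>2 * w) * min 1 (norm z / w) ^ p)"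
  using reg
 proof (elim disjE conjE)
  assume p: "p = 2" and lip: "\<forall>s t. \<bar>g s - g t\<bar> <= B / w * \<bar>s - t\<bar>"
  have "\<bar>d x\<bar> <= 2 * B * min 1 (norm z / w)" for x
  proof (cases "norm z / w >= 1")
   case False
   have "\<bar>d x\<bar> <= B / w * \<bar>\<omega> \<bullet> x - \<omega> \<bullet> (x + z)\<bar>" unfolding d_def using lip by blast
   also have "... <= B / w * norm z" using \<omega>z B w by (intro mult_left_mono) (auto simp: inner_add_right)
   also have "... = B * (norm z / w)" by simp
   also have "... <= 2 * B * (norm z / w)" using B w by (intro mult_right_mono) auto
   finally show ?thesis using False by simp
  qed (use d2 in simp)
  then have "(d x)\<^sup>2 <= (2 * B * min 1 (norm z / w))\<^sup>2" for x
   using power_mono[of "\<bar>d x\<bar>" "2 * B * min 1 (norm z / w)" 2] by simp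
  then have "?I <= ennreal (2 * c * ((2 * B * min 1 (norm z / w))\<^sup>2 * w))" by (intro I1) auto
  also have "2 * c * ((2 * B * min 1 (norm z / w))\<^sup>2 * w) = (c * 8 * (B\<^sup>2 * w) * min 1 (norm z / w) ^ p) * 1"
   by (simp add: p power_mult_distrib)
  also have "ennreal ... <= ennreal ((c * 8 * (B\<^sup>2 * w) * min 1 (norm z / w) ^ p) * real n)"
   using n c w B by (intro ennreal_leI mult_left_mono mult_nonneg_nonneg zero_le_power) auto
  finally show ?thesis by (simp add: mult_ac)
 next
  assume p: "p = 1" and st: "\<forall>s t. g s ~= g t --> (\<exists>i<n. \<bar>s - \<beta> i\<bar> <= \<bar>s - t\<bar>)"
  have d2': "(d x)\<^sup>2 <= (2 * B)\<^sup>2" for x using power_mono[OF d2[of x], of 2] by simp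
  show ?thesis
  proof (cases "norm z / w >= 1")
   case True
   have "?I <= ennreal (2 * c * ((2 * B)\<^sup>2 * w))" using d2' by (intro I1) auto
   also have "2 * c * ((2 * B)\<^sup>2 * w) = (c * 8 * (B\<^sup>2 * w)) * 1" by (simp add: power_mult_distrib)
   also have "ennreal ... <= ennreal (c * 8 * (B\<^sup>2 * w) * real n)"
    using n c w by (intro ennreal_leI mult_left_mono) auto
   finally show ?thesis using True by (simp add: mult_ac)
  next
   case False
   have nz: "norm z > 0" using z by simp
   let ?z1 = "%i x. \<Sum>i<n. indicator (S (\<beta> i) (norm z)) x"
   have "?I <= (\<integral>\<^sup>+x. ennreal ((2 * B)\<^sup>2) * (?z1 i x) \<partial>lborel)"
   proof (rule nn_integral_mono)
    fix x
    show "ennreal ((d x)\<^sup>2) * indicator ?U x * indicator ?U (x + z) <= ennreal ((2 * B)\<^sup>2) * (?z1 i x)"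
    proof (cases "x \<in> ?U \<and> d x ~= 0")
     case True
     then obtain i where i: "i < n" "\<bar>\<omega> \<bullet> x - \<beta> i\<bar> <= \<bar>\<omega> \<bullet> x - \<omega> \<bullet> (x + z)\<bar>"
      using st unfolding d_def by force
     then have "x \<in> S (\<beta> i) (norm z)" using True \<omega>z by (simp add: S_def inner_add_right)
     then have "(1::ennreal) = indicator (S (\<beta> i) (norm z)) x" by simp
     also have "... <= (?z1 i x)" using i(1) by (intro member_le_sum) auto
     finally have "ennreal ((2 * B)\<^sup>2) * 1 <= ennreal ((2 * B)\<^sup>2) * (?z1 i x)"
      by (rule mult_left_mono) simp
     moreover have "ennreal ((d x)\<^sup>2) * indicator ?U x * indicator ?U (x + z) <= ennreal ((2 * B)\<^sup>2) * 1"
      using True d2'[of x] by (auto simp: ennreal_leI indicator_def)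
     ultimately show ?thesis by (rule order_trans[rotated])
    qed (auto simp: indicator_def)
   qed
   also have "... = ennreal ((2 * B)\<^sup>2) * (\<Sum>i<n. \<integral>\<^sup>+x. indicator (S (\<beta> i) (norm z)) x \<partial>lborel)"
    by (subst nn_integral_cmult) (auto simp: nn_integral_sum)
   also have "... <= ennreal ((2 * B)\<^sup>2) * (\<Sum>i<n. ennreal (c * norm z))"
    by (intro mult_left_mono sum_mono Sm nz) simp
   also have "... = ennreal ((2 * B)\<^sup>2 * (real n * (c * norm z)))"
    using c by (simp add: ennreal_mult' ennreal_of_nat_eq_real_of_nat)
   also have "... <= ennreal (c * (8 * real n) * (B\<^sup>2 * w) * min 1 (norm z / w) ^ p)"
   proof (rule ennreal_leI)
    have "c * (8 * real n) * (B\<^sup>2 * w) * min 1 (norm z / w) ^ p = 2 * ((2 * B)\<^sup>2 * (real n * (c * norm z)))"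
     using False w by (simp add: p power_mult_distrib)
    moreover have "0 <= (2 * B)\<^sup>2 * (real n * (c * norm z))" using c by (intro mult_nonneg_nonneg) auto
    ultimately show "(2 * B)\<^sup>2 * (real n * (c * norm z)) <= c * (8 * real n) * (B\<^sup>2 * w) * min 1 (norm z / w) ^ p" by linarith
   qed
   finally show ?thesis .
  qed
 qed
 then show ?thesis unfolding d_def c_def by (simp flip: of_real_diff)
qed

text \<open>A scaling count. A derivative of order \<open>j\<close> has height about
  \<open>w^(k-j)\<close> on a slab of width \<open>w\<close>, so its squared L^2 norm is about
  \<open>w^(2(k-j)+1)\<close>; the fractional part of \<open>m\<close> costs another
  \<open>w^(-2 frac m)\<close> at top order. Lower orders carry an extra \<open>w^(2(m-j))\<close>,
  which stays bounded since \<open>w <= W\<close>.\<close>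

lemma sobolev_energy_relu_comb:
 fixes k n :: nat and m W \<Gamma> :: real
 assumes m: "0 <= m" "m < real k + 1/2" and W: "W > 0" and \<Gamma>: "\<Gamma> >= 0" and n: "n >= 1"
 shows "\<exists>C\<ge>0. \<forall>(\<omega> :: real ^ 'n) b w \<gamma> \<beta>. norm \<omega> = 1 --> 0 < w --> w <= W -->
   (\<forall>y. (\<Sum>i<n. \<gamma> i * (y - \<beta> i) ^ k) = 0) --> (\<forall>i<n. \<bar>\<gamma> i\<bar> <= \<Gamma>) --> (\<forall>i<n. \<bar>\<beta> i - b\<bar> <= w) -->
   sobolev_energy m (interior unit_cube) (%\<alpha> x. complex_of_real (\<Sum>i<n. \<gamma> i * ridge_deriv \<alpha> k \<omega> (- \<beta> i) x))
    <= ennreal (C * w powr (2 * (real k - m) + 1))"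
proof -
 let ?J = "nat \<lfloor>m\<rfloor>"
 define c where "c = 8 * 2 ^ CARD('n) * real CARD('n)"
 have c: "c > 0" by (simp add: c_def)
 have Jm: "real ?J <= m" "m < real ?J + 1" using m(1) by linarith+
 have "real ?J < real k + 1" using Jm m(2) by linarith
 then have Jk: "?J <= k" by linarith
 have frac: "frac m = m - real ?J" using m(1) by (simp add: frac_def)
 \<comment> \<open>If the top order \<open>?J\<close> equals \<open>k\<close> the derivative jumps
   and exponent 1 is the right one; then \<open>2 * frac m < 1\<close> is the hypothesis
   \<open>m < k + 1/2\<close>.\<close>
 define p :: nat where "p = (if ?J < k then 2 else 1)"
 have p: "2 * frac m < real p"
 proof (cases "?J < k")
  case True
  define r where "r = real ?J"
  have "m - r < 1" using Jm(2) by (simp add: r_def)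
  then have "2 * (m - r) < 2" by simp
  then show ?thesis using True unfolding frac p_def r_def by simp
 next
  case False
  then have "real ?J = real k" using Jk by simp
  then have "m - real ?J < 1 / 2" using m(2) by simp
  then have "2 * (m - real ?J) < 1" by simp
  then show ?thesis using False unfolding frac p_def by simp
 qed
 define A where "A = (fact k * real n * \<Gamma> * (real k + 1) * 2 ^ k)\<^sup>2"
 have A: "A >= 0" by (simp add: A_def)
 have "\<exists>C1\<ge>0. m \<notin> \<int> --> (\<forall>U (G :: real ^ 'n => complex) K w. U \<in> sets borel --> G \<in> borel_measurable borel --> K >= 0 --> w > 0 -->
   (\<forall>z. z ~= 0 --> (\<integral>\<^sup>+x. esq (G x - G (x + z)) * indicator U x * indicator U (x + z) \<partial>lborel) <= ennreal (K * min 1 (norm z / w) ^ p)) -->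
   slobodeckij_sq (frac m) U G <= ennreal (C1 * K * w powr (- 2 * frac m)))"
 proof (cases "m \<in> \<int>")
  case False
  then have "0 < frac m" by (simp add: frac_gt_0_iff)
  from slobodeckij_sq_bound[OF this p, where 'n = 'n] show ?thesis by blast
 qed auto
 then obtain C1 where C1: "C1 >= 0" and slob: "!!U (G :: real ^ 'n => complex) K w. m \<notin> \<int> ==> U \<in> sets borel ==> G \<in> borel_measurable borel ==> K >= 0 ==> w > 0 ==>
   (!!z. z ~= 0 ==> (\<integral>\<^sup>+x. esq (G x - G (x + z)) * indicator U x * indicator U (x + z) \<partial>lborel) <= ennreal (K * min 1 (norm z / w) ^ p)) ==>
   slobodeckij_sq (frac m) U G <= ennreal (C1 * K * w powr (- 2 * frac m))"
  by (elim exE conjE) (rule that, assumption, simp)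
 \<comment> \<open>Bounds \<open>w^(2(m-j))\<close> for all \<open>w <= W\<close> and
   \<open>0 <= j <= m\<close>, whether \<open>W\<close> is below 1 or not.\<close>
 define W1 where "W1 = max 1 W powr (2 * m)"
 have W1: "W1 >= 0" by (simp add: W1_def)
 let ?NJ = "real (card {\<alpha> :: 'n => nat. multi_index_order \<alpha> <= ?J})"
 let ?NK = "real (card {\<alpha> :: 'n => nat. multi_index_order \<alpha> = ?J})"
 define C where "C = ?NJ * (c * (A * W1)) + ?NK * (C1 * (c * (8 * real n) * A))"
 have C: "C >= 0" unfolding C_def using c A W1 C1 by (intro add_nonneg_nonneg mult_nonneg_nonneg) auto
 have "sobolev_energy m (interior unit_cube) (%\<alpha> x. complex_of_real (\<Sum>i<n. \<gamma> i * ridge_deriv \<alpha> k \<omega> (- \<beta> i) x))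
    <= ennreal (C * w powr (2 * (real k - m) + 1))"
  if \<omega>: "norm \<omega> = 1" and w: "0 < w" "w <= W" and mom: "!!y. (\<Sum>i<n. \<gamma> i * (y - \<beta> i) ^ k) = 0"
   and \<gamma>: "!!i. i < n ==> \<bar>\<gamma> i\<bar> <= \<Gamma>" and \<beta>: "!!i. i < n ==> \<bar>\<beta> i - b\<bar> <= w"
  for \<omega> :: "real ^ 'n" and b w \<gamma> \<beta>
 proof -
  let ?U = "interior unit_cube :: (real ^ 'n) set"
  let ?w = "w powr (2 * (real k - m) + 1)"
  define Q :: "('n => nat) => real" where "Q \<alpha> = (\<Prod>i\<in>UNIV. (\<omega> $ i) ^ \<alpha> i) * (fact k / fact (k - multi_index_order \<alpha>))" for \<alpha> :: "'n => nat"
  define g where "g \<alpha> t = Q \<alpha> * relu_comb n (k - multi_index_order \<alpha>) \<gamma> \<beta> t" for \<alpha> t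
  have H: "complex_of_real (\<Sum>i<n. \<gamma> i * ridge_deriv \<alpha> k \<omega> (- \<beta> i) x) = complex_of_real (g \<alpha> (\<omega> \<bullet> x))" for \<alpha> x
  proof -
   have "(\<Sum>i<n. \<gamma> i * ridge_deriv \<alpha> k \<omega> (- \<beta> i) x) = g \<alpha> (\<omega> \<bullet> x)"
    unfolding g_def relu_comb_def sum_distrib_left ridge_deriv_def Q_def by (intro sum.cong refl) simp
   then show ?thesis by simp
  qed
  have Q: "\<bar>Q \<alpha>\<bar> <= fact k" for \<alpha>
  proof -
   have "\<bar>Q \<alpha>\<bar> <= 1 * fact k"
    unfolding Q_def abs_mult by (intro mult_mono abs_prod_power_le_1 \<omega>) (auto simp: divide_le_eq mult_le_cancel_left1)
   then show ?thesis by simp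
  qed
  have gm: "g \<alpha> \<in> borel_measurable borel" for \<alpha> unfolding g_def by measurable
  have mom': "(\<Sum>i<n. \<gamma> i * (y - \<beta> i) ^ (k - j)) = 0" if "j <= k" for j y
   by (rule moments_lower[OF mom that])
  \<comment> \<open>With the factor \<open>real k + 1\<close>, \<open>B j\<close> bounds the height
    and \<open>B j / w\<close> bounds the Lipschitz constant.\<close>
  define B where "B j = fact k * real n * \<Gamma> * (real k + 1) * (2 * w) ^ (k - j)" for j
  have B0: "B j >= 0" for j unfolding B_def using \<Gamma> w by simp
  have g0: "g \<alpha> t = 0" if "multi_index_order \<alpha> <= k" "\<bar>t - b\<bar> > w" for \<alpha> t
   unfolding g_def using relu_comb_support[OF mom'[OF that(1)] w(1) \<gamma> \<beta> \<Gamma> that(2)] by simp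
  have gB: "\<bar>g \<alpha> t\<bar> <= B (multi_index_order \<alpha>)" if "multi_index_order \<alpha> <= k" for \<alpha> t
  proof -
   let ?z1 = "real n * \<Gamma> * (2 * w) ^ (k - multi_index_order \<alpha>)"
   have "\<bar>g \<alpha> t\<bar> <= fact k * ?z1"
    unfolding g_def abs_mult using Q by (intro mult_mono relu_comb_bound[OF mom'[OF that] w(1) \<gamma> \<beta> \<Gamma>]) auto
   also have "... = (fact k * ?z1) * 1" by simp
   also have "... <= (fact k * ?z1) * (real k + 1)"
    using \<Gamma> w by (intro mult_left_mono) auto
   finally show ?thesis by (simp add: B_def mult_ac)
  qed
  have Bw: "(B j)\<^sup>2 * w <= A * w powr (2 * (real k - real j) + 1)" if "j <= k" for j
  proof -
   have "B j <= (fact k * real n * \<Gamma> * (real k + 1) * 2 ^ k) * w ^ (k - j)"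
   proof -
    have "(2::real) ^ (k - j) <= 2 ^ k" by (rule power_increasing) auto
    then have "(fact k * real n * \<Gamma> * (real k + 1) * w ^ (k - j)) * 2 ^ (k - j) <= (fact k * real n * \<Gamma> * (real k + 1) * w ^ (k - j)) * 2 ^ k"
     using \<Gamma> w by (intro mult_left_mono) auto
    then show ?thesis by (simp add: B_def power_mult_distrib mult_ac)
   qed
   then have "(B j)\<^sup>2 <= A * (w ^ (k - j))\<^sup>2"
    unfolding A_def power_mult_distrib[symmetric] by (rule power_mono) (rule B0)
   then have "(B j)\<^sup>2 * w <= A * (w ^ (k - j))\<^sup>2 * w" using w by (intro mult_right_mono) auto
   also have "(w ^ (k - j))\<^sup>2 = w powr (2 * (real k - real j))"
   proof -
    have "(w ^ (k - j))\<^sup>2 = w powr real ((k - j) * 2)" unfolding powr_realpow[OF w(1)] by (rule power_mult[symmetric])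
    also have "real ((k - j) * 2) = 2 * (real k - real j)" using that by (simp add: of_nat_diff)
    finally show ?thesis .
   qed
   finally show ?thesis using w by (simp add: powr_add mult.assoc)
  qed
  have L2: "L2_sq ?U (%x. complex_of_real (g \<alpha> (\<omega> \<bullet> x))) <= ennreal (c * (A * W1) * ?w)" if a: "multi_index_order \<alpha> <= ?J" for \<alpha>
  proof -
   let ?j = "multi_index_order \<alpha>"
   have jk: "?j <= k" using a Jk by (rule order_trans)
   have "real ?j <= real ?J" using a by (simp only: of_nat_le_iff)
   then have jm: "real ?j <= m" using Jm(1) by (rule order_trans)
   have "L2_sq ?U (%x. complex_of_real (g \<alpha> (\<omega> \<bullet> x))) <= ennreal (c * ((B ?j)\<^sup>2 * w))"
    unfolding c_def by (rule L2_sq_ridge_bound[OF \<omega> w(1) gm g0[OF jk] gB[OF jk]])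
   also have "... <= ennreal (c * (A * W1) * ?w)"
   proof (rule ennreal_leI)
    have "w powr (2 * (real k - real ?j) + 1) = w powr (2 * (m - real ?j)) * ?w"
     using w by (simp add: algebra_simps flip: powr_add)
    also have "w powr (2 * (m - real ?j)) <= W1"
    proof -
     have "w powr (2 * (m - real ?j)) <= max 1 W powr (2 * (m - real ?j))" using w jm by (intro powr_mono2) auto
     also have "... <= W1" unfolding W1_def by (intro powr_mono) auto
     finally show ?thesis .
    qed
    then have "w powr (2 * (m - real ?j)) * ?w <= W1 * ?w" by (intro mult_right_mono) auto
    finally have "A * w powr (2 * (real k - real ?j) + 1) <= A * (W1 * ?w)" using A by (intro mult_left_mono)
    then have "(B ?j)\<^sup>2 * w <= A * (W1 * ?w)" using Bw[OF jk] by simp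
    then have "c * ((B ?j)\<^sup>2 * w) <= c * (A * (W1 * ?w))" using c by (intro mult_left_mono) auto
    then show "c * ((B ?j)\<^sup>2 * w) <= c * (A * W1) * ?w" by (simp add: mult.assoc)
   qed
   finally show ?thesis .
  qed
  let ?z0 = "%n. C1 * (c * (8 * real n) * A) * ?w"
  have SL: "slobodeckij_sq (frac m) ?U (%x. complex_of_real (g \<alpha> (\<omega> \<bullet> x))) <= ennreal (?z0 n)"
   if a: "multi_index_order \<alpha> = ?J" and mi: "m \<notin> \<int>" for \<alpha>
  proof -
   have jk: "multi_index_order \<alpha> <= k" using a Jk by simp
   have reg: "(p = 2 \<and> (\<forall>s t. \<bar>g \<alpha> s - g \<alpha> t\<bar> <= B ?J / w * \<bar>s - t\<bar>)) \<or> (p = 1 \<and> (\<forall>s t. g \<alpha> s ~= g \<alpha> t --> (\<exists>i<n. \<bar>s - \<beta> i\<bar> <= \<bar>s - t\<bar>)))"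
   proof (cases "?J < k")
    case True
    then have kj: "k - ?J >= 1" by simp
    have "\<bar>g \<alpha> s - g \<alpha> t\<bar> <= B ?J / w * \<bar>s - t\<bar>" for s t
    proof -
     have "\<bar>g \<alpha> s - g \<alpha> t\<bar> = \<bar>Q \<alpha>\<bar> * \<bar>relu_comb n (k - ?J) \<gamma> \<beta> s - relu_comb n (k - ?J) \<gamma> \<beta> t\<bar>"
      by (simp add: g_def a abs_mult flip: right_diff_distrib)
     also have "... <= fact k * (real n * \<Gamma> * (real (k - ?J) * (2 * w) ^ (k - ?J - 1)) * \<bar>s - t\<bar>)"
      using Q by (intro mult_mono relu_comb_lipschitz[OF mom'[OF Jk] w(1) \<gamma> \<beta> \<Gamma> kj]) auto
     also have "... = (fact k * real n * \<Gamma> * (2 * w) ^ (k - ?J - 1) * \<bar>s - t\<bar>) * real (k - ?J)" by (simp add: mult_ac)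
     also have "... <= (fact k * real n * \<Gamma> * (2 * w) ^ (k - ?J - 1) * \<bar>s - t\<bar>) * (2 * (real k + 1))"
      using \<Gamma> w by (intro mult_left_mono mult_nonneg_nonneg) auto
     also have "... = B ?J / w * \<bar>s - t\<bar>"
     proof -
      obtain l where "k - ?J = Suc l" using kj by (cases "k - ?J") auto
      then show ?thesis using w by (simp add: B_def)
     qed
     finally show ?thesis .
    qed
    then show ?thesis using True by (simp add: p_def)
   next
    case False
    then have kj: "k - ?J = 0" by simp
    have "\<exists>i<n. \<bar>s - \<beta> i\<bar> <= \<bar>s - t\<bar>" if "g \<alpha> s ~= g \<alpha> t" for s t
    proof (rule relu_comb_step[OF mom'[OF Jk] w(1) \<gamma> \<beta> \<Gamma> kj])
     show "relu_comb n (k - ?J) \<gamma> \<beta> s ~= relu_comb n (k - ?J) \<gamma> \<beta> t" using that by (auto simp: g_def a)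
    qed
    then show ?thesis using False by (simp add: p_def)
   qed
   have K0: "0 <= c * (8 * real n) * ((B ?J)\<^sup>2 * w)" using c w by simp
   have "slobodeckij_sq (frac m) ?U (%x. complex_of_real (g \<alpha> (\<omega> \<bullet> x))) <= ennreal (C1 * (c * (8 * real n) * ((B ?J)\<^sup>2 * w)) * w powr (- 2 * frac m))"
   proof (rule slob[OF mi _ _ K0 w(1)])
    show "(%x. complex_of_real (g \<alpha> (\<omega> \<bullet> x))) \<in> borel_measurable borel" using gm[of \<alpha>] by measurable
    show "(\<integral>\<^sup>+x. esq (complex_of_real (g \<alpha> (\<omega> \<bullet> x)) - complex_of_real (g \<alpha> (\<omega> \<bullet> (x + z)))) * indicator ?U x * indicator ?U (x + z) \<partial>lborel)
     <= ennreal (c * (8 * real n) * ((B ?J)\<^sup>2 * w) * min 1 (norm z / w) ^ p)" if "z ~= 0" for z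
     unfolding c_def by (rule ridge_difference_bound[OF \<omega> w(1) gm g0[OF jk] _ reg n that]) (use gB[OF jk] a in auto)
   qed simp
   also have "... <= ennreal (?z0 n)"
   proof (rule ennreal_leI)
    have "(B ?J)\<^sup>2 * w * w powr (- 2 * frac m) <= A * w powr (2 * (real k - real ?J) + 1) * w powr (- 2 * frac m)"
     by (intro mult_right_mono Bw Jk) auto
    also have "... = A * ?w" using w by (simp add: frac algebra_simps flip: powr_add)
    finally have "(C1 * (c * (8 * real n))) * ((B ?J)\<^sup>2 * w * w powr (- 2 * frac m)) <= (C1 * (c * (8 * real n))) * (A * ?w)"
     using C1 c by (intro mult_left_mono) auto
    then show "C1 * (c * (8 * real n) * ((B ?J)\<^sup>2 * w)) * w powr (- 2 * frac m) <= C1 * (c * (8 * real n) * A) * ?w"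
     by (simp add: mult_ac)
   qed
   finally show ?thesis .
  qed
  have "sobolev_energy m ?U (%\<alpha> x. complex_of_real (\<Sum>i<n. \<gamma> i * ridge_deriv \<alpha> k \<omega> (- \<beta> i) x))
   <= ennreal (?NJ * (c * (A * W1) * ?w)) + ennreal (?NK * (?z0 n))"
   unfolding sobolev_energy_def H
  proof (rule add_mono)
   have "(\<Sum>\<alpha> | multi_index_order \<alpha> <= ?J. L2_sq ?U (%x. complex_of_real (g \<alpha> (\<omega> \<bullet> x)))) <= (\<Sum>\<alpha> :: 'n => nat | multi_index_order \<alpha> <= ?J. ennreal (c * (A * W1) * ?w))"
    by (intro sum_mono L2) simp
   then show "(\<Sum>\<alpha> | multi_index_order \<alpha> <= ?J. L2_sq ?U (%x. complex_of_real (g \<alpha> (\<omega> \<bullet> x)))) <= ennreal (?NJ * (c * (A * W1) * ?w))"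
    by (simp add: ennreal_mult' ennreal_of_nat_eq_real_of_nat)
   have "(\<Sum>\<alpha> | multi_index_order \<alpha> = ?J. slobodeckij_sq (frac m) ?U (%x. complex_of_real (g \<alpha> (\<omega> \<bullet> x)))) <= (\<Sum>\<alpha> :: 'n => nat | multi_index_order \<alpha> = ?J. ennreal (?z0 n))" if "m \<notin> \<int>"
    using that by (intro sum_mono SL) auto
   then show "(if m \<in> \<int> then 0 else \<Sum>\<alpha> | multi_index_order \<alpha> = ?J. slobodeckij_sq (frac m) ?U (%x. complex_of_real (g \<alpha> (\<omega> \<bullet> x)))) <= ennreal (?NK * (?z0 n))"
    by (simp add: ennreal_mult' ennreal_of_nat_eq_real_of_nat)
  qed
  also have "... = ennreal (?NJ * (c * (A * W1) * ?w) + ?NK * (?z0 n))"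
   using c A W1 C1 by (intro ennreal_plus[symmetric] mult_nonneg_nonneg) auto
  also have "?NJ * (c * (A * W1) * ?w) + ?NK * (?z0 n) = C * ?w"
   by (simp add: C_def distrib_right mult.assoc)
  finally show ?thesis .
 qed
 note main = this
 show ?thesis
 proof (intro exI[of _ C] conjI allI impI C)
  fix \<omega> :: "real ^ 'n" and b w \<gamma> \<beta>
  assume "norm \<omega> = 1" "0 < w" "w <= W" "\<forall>y. (\<Sum>i<n. \<gamma> i * (y - \<beta> i) ^ k) = 0"
   "\<forall>i<n. \<bar>\<gamma> i\<bar> <= \<Gamma>" "\<forall>i<n. \<bar>\<beta> i - b\<bar> <= w"
  then show "sobolev_energy m (interior unit_cube) (%\<alpha> x. complex_of_real (\<Sum>i<n. \<gamma> i * ridge_deriv \<alpha> k \<omega> (- \<beta> i) x))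
    <= ennreal (C * w powr (2 * (real k - m) + 1))"
   by (intro main[where b = b]) blast+
 qed
qed

section \<open>Spline representations of exponentials\<close>

text \<open>Coefficients of the backward difference of order \<open>n\<close> with step 1.\<close>

definition alt_binom :: "nat => nat => real" where
 "alt_binom n j = (-1) ^ j * real (n choose j)"

lemma alt_binom_pascal:
 fixes f :: "real => real"
 shows "(\<Sum>j<Suc (Suc n). alt_binom (Suc n) j * f (y - real j)) =
  (\<Sum>j<Suc n. alt_binom n j * f (y - real j)) - (\<Sum>j<Suc n. alt_binom n j * f (y - 1 - real j))"
proof -
 let ?z0 = "%j. \<Sum>j<Suc n. alt_binom n (Suc j) * f (y - real (Suc j))"
 have "(\<Sum>j<Suc (Suc n). alt_binom (Suc n) j * f (y - real j)) =
   f y + (\<Sum>j<Suc n. alt_binom (Suc n) (Suc j) * f (y - real (Suc j)))"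
  by (subst sum.lessThan_Suc_shift) (simp add: alt_binom_def)
 also have "(\<Sum>j<Suc n. alt_binom (Suc n) (Suc j) * f (y - real (Suc j))) =
   (?z0 j) - (\<Sum>j<Suc n. alt_binom n j * f (y - 1 - real j))"
  unfolding sum_subtractf[symmetric] by (intro sum.cong refl) (simp add: alt_binom_def algebra_simps)
 also have "(?z0 j) = (\<Sum>j<Suc n. alt_binom n j * f (y - real j)) - f y"
 proof -
  have "(\<Sum>j<Suc (Suc n). alt_binom n j * f (y - real j)) = f y + (?z0 j)"
   by (subst sum.lessThan_Suc_shift) (simp add: alt_binom_def)
  moreover have "(\<Sum>j<Suc (Suc n). alt_binom n j * f (y - real j)) = (\<Sum>j<Suc n. alt_binom n j * f (y - real j))"
   by (simp add: alt_binom_def)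
  ultimately show ?thesis by simp
 qed
 finally show ?thesis by simp
qed

text \<open>A difference of order \<open>n\<close> annihilates polynomials of degree below
  \<open>n\<close>. In the last case of the induction, where the degree equals the old order,
  \<open>D k\<close> has zero derivative by the induction hypothesis, so it is constant and its
  first difference vanishes.\<close>

lemma alt_binom_moments:
 assumes "k < n"
 shows "(\<Sum>j<Suc n. alt_binom n j * (y - real j) ^ k) = 0"
 using assms
proof (induction n arbitrary: k y)
 case (Suc n)
 define D where "D k y = (\<Sum>j<Suc n. alt_binom n j * (y - real j) ^ k)" for k y
 have step: "(\<Sum>j<Suc (Suc n). alt_binom (Suc n) j * (y - real j) ^ k) = D k y - D k (y - 1)"
  unfolding D_def by (rule alt_binom_pascal[where f = "%t. t ^ k"])
 show ?case
 proof (cases "k < n")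
  case True
  then show ?thesis unfolding step D_def by (simp only: Suc.IH diff_self)
 next
  case False
  then have k: "k = n" using Suc.prems by simp
  have "(D k has_real_derivative 0) (at y)" for y
  proof (cases k)
   case 0
   then show ?thesis by (simp add: D_def[abs_def])
  next
   case (Suc l)
   have "(D k has_real_derivative (\<Sum>j<Suc n. alt_binom n j * (real k * (y - real j) ^ l))) (at y)"
    unfolding D_def[abs_def] Suc
    by (auto intro!: derivative_eq_intros DERIV_sum simp: algebra_simps simp del: power_Suc sum.lessThan_Suc)
   also have "(\<Sum>j<Suc n. alt_binom n j * (real k * (y - real j) ^ l)) = real k * (\<Sum>j<Suc n. alt_binom n j * (y - real j) ^ l)"
    by (simp only: sum_distrib_left mult_ac)
   also have "... = 0" using Suc.IH[of l y] k Suc by simp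
   finally show ?thesis .
  qed
  then have "D k y = D k (y - 1)" by (intro DERIV_isconst_all) blast
  then show ?thesis unfolding step by simp
 qed
qed simp

lemma alt_binom_abs_le: "\<bar>alt_binom n j\<bar> <= 2 ^ n"
proof (cases "j <= n")
 case True
 have "real (n choose j) <= real (2 ^ n)" using binomial_le_pow2[of n j] by (rule of_nat_mono)
 then show ?thesis by (simp add: alt_binom_def abs_mult)
qed (simp add: alt_binom_def binomial_eq_0)

text \<open>The Fourier transform at \<theta> of the uniform density on
  \<open>{0..\<delta>}\<close>. For \<open>\<delta> = 1\<close> its powers are, up to a factor, the
  transforms of B-splines; for \<open>\<delta> = 1 / p\<close> it is the multiplier of the averaging
  in the frequency expansion.\<close>

definition avg_exp :: "real => real => complex" where
 "avg_exp \<delta> \<theta> = (LINT u:{0..\<delta>}|lborel. iexp (- (\<theta> * u))) / of_real \<delta>"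

lemma set_integrable_bounded_Icc:
 fixes f :: "real => 'a::{banach, second_countable_topology}"
 assumes [measurable]: "f \<in> borel_measurable borel" and "!!x. x \<in> {a..b} ==> norm (f x) <= B"
 shows "set_integrable lborel {a..b} f"
 unfolding set_integrable_def
proof (rule Bochner_Integration.integrable_bound)
 show "integrable lborel (%x. indicator {a..b} x * B)"
  by (intro integrable_mult_left integrable_real_indicator) (auto simp: emeasure_lborel_Icc_eq)
 have "norm (indicator {a..b} x *\<^sub>R f x) <= norm (indicator {a..b} x * B)" for x
  using assms(2)[of x] order_trans[OF norm_ge_zero assms(2)[of x]] by (cases "x \<in> {a..b}") auto
 then show "AE x in lborel. norm (indicator {a..b} x *\<^sub>R f x) <= norm (indicator {a..b} x * B)" by simp
qed simp

lemma iexp_measurable [measurable]: "(%x. iexp x) \<in> borel_measurable borel"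
 by (intro borel_measurable_continuous_onI continuous_intros)

text \<open>The integrand stays within \<open>\<bar>\<theta>\<bar> * u\<close> of 1. The bound
  controls the divisions by powers of \<open>avg_exp\<close>, both in \<open>spline_weight\<close>
  and in \<open>frame_coeff\<close>.\<close>

lemma avg_exp_lower:
 assumes \<delta>: "\<delta> > 0" and le: "\<bar>\<theta>\<bar> * \<delta> <= 1"
 shows "cmod (avg_exp \<delta> \<theta>) >= 1 / 2"
proof -
 have s1: "set_integrable lborel {0..\<delta>} (%u. iexp (- (\<theta> * u)))" by (rule set_integrable_bounded_Icc[where B = 1]) auto
 have s2: "set_integrable lborel {0..\<delta>} (%u. 1 :: complex)" by (rule set_integrable_bounded_Icc[where B = 1]) auto
 have one: "(LINT u:{0..\<delta>}|lborel. 1 :: complex) = of_real \<delta>"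
  using \<delta> by (simp add: set_lebesgue_integral_def scaleR_conv_of_real)
 have b: "cmod (iexp (- (\<theta> * u)) - 1) <= \<bar>\<theta>\<bar> * u" if "u \<in> {0..\<delta>}" for u
  using iexp_approx1[of "- (\<theta> * u)" 0] that by (simp add: abs_mult)
 have int_id: "(LINT u:{0..\<delta>}|lborel. \<bar>\<theta>\<bar> * u) = \<bar>\<theta>\<bar> * (\<delta>\<^sup>2 / 2)"
 proof -
  have "(LBINT u. u * indicator {0..\<delta>} u) = \<delta>\<^sup>2 / 2 - 0\<^sup>2 / 2"
   by (rule integral_FTC_Icc_real) (use \<delta> in \<open>auto intro!: derivative_eq_intros\<close>)
  then have "(LINT u:{0..\<delta>}|lborel. u) = \<delta>\<^sup>2 / 2" by (simp add: set_lebesgue_integral_def mult.commute)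
  then show ?thesis by simp
 qed
 have s3: "set_integrable lborel {0..\<delta>} (%u. \<bar>\<theta>\<bar> * u)" by (rule set_integrable_bounded_Icc[where B = "\<bar>\<theta>\<bar> * \<delta>"]) (auto simp: abs_mult intro!: mult_left_mono)
 let ?z0 = "%u. LINT u:{0..\<delta>}|lborel. iexp (- (\<theta> * u))"
 have "cmod ((?z0 u) - of_real \<delta>) = cmod (LINT u:{0..\<delta>}|lborel. iexp (- (\<theta> * u)) - 1)"
  using set_integral_diff(2)[OF s1 s2] one by simp
 also have "... <= (LINT u:{0..\<delta>}|lborel. cmod (iexp (- (\<theta> * u)) - 1))"
  by (rule set_integral_norm_bound[OF set_integral_diff(1)[OF s1 s2]])
 also have "... <= (LINT u:{0..\<delta>}|lborel. \<bar>\<theta>\<bar> * u)"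
  by (rule set_integral_mono[OF set_integrable_norm[OF set_integral_diff(1)[OF s1 s2]] s3 b])
 also have "... = (\<bar>\<theta>\<bar> * \<delta>) * \<delta> / 2" unfolding int_id by (simp add: power2_eq_square)
 also have "... <= \<delta> / 2" using le \<delta> by simp
 finally have "cmod ((?z0 u) - of_real \<delta>) <= \<delta> / 2" .
 then have "cmod (?z0 u) >= \<delta> / 2"
  using norm_triangle_ineq2[of "of_real \<delta> :: complex" "of_real \<delta> - (?z0 u)"] \<delta>
  by (simp add: norm_minus_commute)
 then show ?thesis using \<delta> by (simp add: avg_exp_def norm_divide field_simps)
qed

text \<open>\<open>fact k\<close> times the cardinal B-spline of degree \<open>k\<close> with knots
  \<open>0, ..., k + 1\<close>, written as a difference of order \<open>k + 1\<close> of the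
  truncated power.\<close>

definition bspline :: "nat => real => real" where
 "bspline k u = relu_comb (k + 2) k (alt_binom (Suc k)) real u"

lemma bspline_measurable [measurable]: "bspline k \<in> borel_measurable borel"
 unfolding bspline_def[abs_def] by measurable

lemma bspline_support: "u <= 0 \<or> u > real k + 1 ==> bspline k u = 0"
proof (elim disjE)
 assume "u <= 0"
 then show ?thesis by (simp add: bspline_def relu_comb_def relu_pow_def)
next
 assume u: "u > real k + 1"
 have "bspline k u = (\<Sum>j<Suc (Suc k). alt_binom (Suc k) j * (u - real j) ^ k)"
  unfolding bspline_def relu_comb_def by (rule sum.cong) (use u in \<open>auto simp: relu_pow_def\<close>)
 then show ?thesis using alt_binom_moments[of k "Suc k" u] by simp
qed

lemma bspline_bounded: "\<exists>B\<ge>0. \<forall>u. \<bar>bspline k u\<bar> <= B"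
proof -
 have "\<bar>bspline k u\<bar> <= real (k + 2) * 2 ^ Suc k * (2 * (real k + 1)) ^ k" for u
  unfolding bspline_def
  by (rule relu_comb_bound[where b = 0])
   (use alt_binom_moments[of k "Suc k"] in \<open>auto simp: alt_binom_abs_le simp del: sum.lessThan_Suc power_Suc\<close>)
 then show ?thesis by (intro exI[of _ "real (k + 2) * 2 ^ Suc k * (2 * (real k + 1)) ^ k"]) auto
qed

lemma integral_relu_pow:
 "(LINT v:{0..1}|lborel. relu_pow k (s - v)) = (relu_pow (Suc k) s - relu_pow (Suc k) (s - 1)) / real (Suc k)"
proof -
 have si: "set_integrable lborel {0..1} (%v. relu_pow k (s - v))"
  by (rule set_integrable_bounded_Icc[where B = "(\<bar>s\<bar> + 1) ^ k"]) (auto intro!: relu_pow_abs_le)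
 have cont: "continuous_on {0..1} (%v. - relu_pow (Suc k) (s - v) / real (Suc k))"
  unfolding relu_pow_Suc by (intro continuous_intros) auto
 have "((%v. relu_pow k (s - v)) has_integral (- relu_pow (Suc k) (s - 1) / real (Suc k)) - (- relu_pow (Suc k) (s - 0) / real (Suc k))) {0..1}"
 \<comment> \<open>The point \<open>s\<close> is exempted, where the antiderivative may have a
   kink.\<close>
 proof (rule fundamental_theorem_of_calculus_interior_strong[where S = "{s}"])
  fix v assume "v \<in> {0<..<1} - {s}"
  then have "s - v ~= 0" by simp
  have "((%v. relu_pow (Suc k) (s - v)) has_real_derivative real (Suc k) * relu_pow k (s - v) * (- 1)) (at v)"
   by (rule DERIV_chain2[where f = "relu_pow (Suc k)" and g = "%v. s - v", OF relu_pow_DERIV[OF \<open>s - v ~= 0\<close>]]) (auto intro!: derivative_eq_intros)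
  from DERIV_cdivide[OF DERIV_minus[OF this], of "real (Suc k)"]
  show "((%v. - relu_pow (Suc k) (s - v) / real (Suc k)) has_vector_derivative relu_pow k (s - v)) (at v)"
   by (simp add: has_real_derivative_iff_has_vector_derivative)
 qed (use cont in auto)
 then have "integral {0..1} (%v. relu_pow k (s - v)) = (relu_pow (Suc k) s - relu_pow (Suc k) (s - 1)) / real (Suc k)"
  by (simp add: integral_unique diff_divide_distrib)
 then show ?thesis using set_borel_integral_eq_integral(2)[OF si] by simp
qed

text \<open>The recursion by convolution with the indicator of \<open>{0..1}\<close>: integration
  raises the degree of the truncated power and produces a first difference, which
  \<open>alt_binom_pascal\<close> absorbs into a difference of the next order.\<close>

lemma bspline_Suc: "bspline (Suc k) u = real (Suc k) * (LINT v:{0..1}|lborel. bspline k (u - v))"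
proof -
 have si: "set_integrable lborel {0..1} (%v. alt_binom (Suc k) j * relu_pow k ((u - real j) - v))" for j
  by (intro set_integrable_mult_right set_integrable_bounded_Icc[where B = "(\<bar>u - real j\<bar> + 1) ^ k"]) (auto intro!: relu_pow_abs_le)
 let ?z0 = "%j. relu_pow (Suc k) (u - real j) - relu_pow (Suc k) (u - real j - 1)"
 have "(LINT v:{0..1}|lborel. bspline k (u - v)) = (LINT v:{0..1}|lborel. \<Sum>j<k + 2. alt_binom (Suc k) j * relu_pow k ((u - real j) - v))"
  by (simp add: bspline_def relu_comb_def algebra_simps)
 also have "... = (\<Sum>j<k + 2. LINT v:{0..1}|lborel. alt_binom (Suc k) j * relu_pow k ((u - real j) - v))"
  using si unfolding set_lebesgue_integral_def set_integrable_def scaleR_sum_right by (intro Bochner_Integration.integral_sum) auto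
 also have "... = (\<Sum>j<k + 2. alt_binom (Suc k) j * ((?z0 j) / real (Suc k)))"
  by (simp only: set_integral_mult_right integral_relu_pow)
 finally have int: "(LINT v:{0..1}|lborel. bspline k (u - v)) = (\<Sum>j<k + 2. alt_binom (Suc k) j * ((?z0 j) / real (Suc k)))" .
 have "real (Suc k) * (LINT v:{0..1}|lborel. bspline k (u - v)) =
   (\<Sum>j<k + 2. alt_binom (Suc k) j * (?z0 j))"
  unfolding int sum_distrib_left by (intro sum.cong refl) (simp del: of_nat_Suc)
 also have "... = (\<Sum>j<Suc (Suc k). alt_binom (Suc k) j * relu_pow (Suc k) (u - real j)) - (\<Sum>j<Suc (Suc k). alt_binom (Suc k) j * relu_pow (Suc k) (u - 1 - real j))"
  by (simp add: sum_subtractf right_diff_distrib algebra_simps)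
 also have "... = (\<Sum>j<Suc (Suc (Suc k)). alt_binom (Suc (Suc k)) j * relu_pow (Suc k) (u - real j))"
  by (rule alt_binom_pascal[symmetric])
 also have "... = bspline (Suc k) u" by (simp add: bspline_def relu_comb_def)
 finally show ?thesis by simp
qed

text \<open>Each convolution in \<open>bspline_Suc\<close> multiplies the Fourier transform by
  \<open>avg_exp 1 \<theta>\<close>.\<close>

lemma integral_bspline_iexp:
 "(LINT u|lborel. of_real (bspline k u) * iexp (- (\<theta> * u))) = fact k * avg_exp 1 \<theta> ^ Suc k"
proof (induction k)
 case 0
 have "(LINT u|lborel. of_real (bspline 0 u) * iexp (- (\<theta> * u))) = (LINT u:{0..1}|lborel. iexp (- (\<theta> * u)))"
  unfolding set_lebesgue_integral_def
 proof (rule integral_cong_AE)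
  \<comment> \<open>\<open>bspline 0\<close> is the indicator of the half-open interval from 0 to 1,
    which misses the point 0.\<close>
  have "AE u in lborel. u ~= (0::real)" by (rule AE_lborel_singleton)
  then show "AE u in lborel. complex_of_real (bspline 0 u) * iexp (- (\<theta> * u)) = indicator {0..1} u *\<^sub>R iexp (- (\<theta> * u))"
   by eventually_elim (auto simp: bspline_def relu_comb_def alt_binom_def relu_pow_def indicator_def numeral_2_eq_2)
 qed simp_all
 then show ?case by (simp add: avg_exp_def)
next
 case (Suc k)
 define Z where "Z = (LINT u|lborel. of_real (bspline k u) * iexp (- (\<theta> * u)))"
 obtain B where B: "B >= 0" "!!u. \<bar>bspline k u\<bar> <= B" using bspline_bounded[of k] by blast
 let ?f = "%u v. indicator {0..1} v *\<^sub>R (complex_of_real (bspline k (u - v)) * iexp (- (\<theta> * u)))"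
 have int: "integrable (lborel \<Otimes>\<^sub>M lborel) (%(u, v). ?f u v)"
 proof (rule Bochner_Integration.integrable_bound)
  have "emeasure (lborel \<Otimes>\<^sub>M lborel) ({0..real k + 2} \<times> {0..1::real}) < \<infinity>"
   by (subst lborel.emeasure_pair_measure_Times) (auto simp: ennreal_mult_less_top)
  then show "integrable (lborel \<Otimes>\<^sub>M lborel) (%p. indicator ({0..real k + 2} \<times> {0..1::real}) p * B)"
   by (intro integrable_mult_left integrable_real_indicator) (auto intro!: pair_measureI)
  show "AE p in lborel \<Otimes>\<^sub>M lborel. norm (case p of (u, v) => ?f u v) <= norm (indicator ({0..real k + 2} \<times> {0..1::real}) p * B)"
  proof (rule AE_I2)
   fix p :: "real \<times> real"
   obtain u v where p: "p = (u, v)" by force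
   show "norm (case p of (u, v) => ?f u v) <= norm (indicator ({0..real k + 2} \<times> {0..1::real}) p * B)"
    using B bspline_support[of "u - v" k] by (cases "v \<in> {0..1} \<and> u \<in> {0..real k + 2}") (auto simp: p norm_mult indicator_def)
  qed
 qed measurable
 have in1: "(LINT v|lborel. ?f u v) = of_real (bspline (Suc k) u / real (Suc k)) * iexp (- (\<theta> * u))" for u
 proof -
  have "(LINT v|lborel. ?f u v) = (LINT v|lborel. complex_of_real (indicator {0..1} v *\<^sub>R bspline k (u - v)) * iexp (- (\<theta> * u)))"
   by (intro Bochner_Integration.integral_cong refl) (simp add: scaleR_conv_of_real)
  also have "... = complex_of_real (LINT v:{0..1}|lborel. bspline k (u - v)) * iexp (- (\<theta> * u))"
   unfolding set_lebesgue_integral_def by (simp only: integral_mult_left_zero integral_complex_of_real)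
  finally show ?thesis by (simp add: bspline_Suc del: of_nat_Suc)
 qed
 have in2: "(LINT u|lborel. ?f u v) = indicator {0..1} v *\<^sub>R iexp (- (\<theta> * v)) * Z" for v
 proof -
  have "(LINT u|lborel. complex_of_real (bspline k (u - v)) * iexp (- (\<theta> * u))) = (LINT u|lborel. complex_of_real (bspline k ((u + v) - v)) * iexp (- (\<theta> * (u + v))))"
   by (rule integral_lborel_translate[symmetric]) measurable
  also have "... = (LINT u|lborel. iexp (- (\<theta> * v)) * (complex_of_real (bspline k u) * iexp (- (\<theta> * u))))"
   by (intro Bochner_Integration.integral_cong refl) (simp add: algebra_simps exp_add[symmetric])
  also have "... = iexp (- (\<theta> * v)) * Z" unfolding Z_def by (rule integral_mult_right_zero)
  finally show ?thesis by simp
 qed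
 have "(LINT u|lborel. (LINT v|lborel. ?f u v)) = (LINT v|lborel. (LINT u|lborel. ?f u v))"
  by (rule lborel_pair.Fubini_integral[symmetric, OF int])
 then have "(LINT u|lborel. of_real (bspline (Suc k) u / real (Suc k)) * iexp (- (\<theta> * u))) = (LINT v|lborel. indicator {0..1} v *\<^sub>R iexp (- (\<theta> * v)) * Z)"
  unfolding in1 in2 .
 also have "... = avg_exp 1 \<theta> * Z"
  unfolding avg_exp_def set_lebesgue_integral_def integral_mult_left_zero by simp
 also have "(LINT u|lborel. of_real (bspline (Suc k) u / real (Suc k)) * iexp (- (\<theta> * u))) = (LINT u|lborel. (of_real (bspline (Suc k) u) * iexp (- (\<theta> * u))) / of_nat (Suc k))"
  by (intro Bochner_Integration.integral_cong refl) simp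
 also have "... = (LINT u|lborel. of_real (bspline (Suc k) u) * iexp (- (\<theta> * u))) / of_nat (Suc k)"
  by (rule integral_divide_zero)
 finally have "(LINT u|lborel. of_real (bspline (Suc k) u) * iexp (- (\<theta> * u))) = of_nat (Suc k) * (avg_exp 1 \<theta> * Z)"
  by (simp add: field_simps del: of_nat_Suc)
 also have "Z = fact k * avg_exp 1 \<theta> ^ Suc k" unfolding Z_def by (rule Suc.IH)
 finally show ?case by (simp add: mult_ac)
qed

text \<open>Exponentials are eigenfunctions of convolution with a B-spline; wherever the eigenvalue
  is nonzero it can be divided out.\<close>

lemma bspline_reproduces_iexp:
 "(LINT b|lborel. of_real (bspline k (t - b)) * iexp (\<theta> * b)) = fact k * avg_exp 1 \<theta> ^ Suc k * iexp (\<theta> * t)"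
proof -
 have "(LINT b|lborel. of_real (bspline k (t - b)) * iexp (\<theta> * b)) = (LINT u|lborel. of_real (bspline k u) * iexp (\<theta> * (t - u)))"
  using lborel_integral_real_affine[of "-1" "%b. of_real (bspline k (t - b)) * iexp (\<theta> * b)" t] by simp
 also have "... = (LINT u|lborel. iexp (\<theta> * t) * (of_real (bspline k u) * iexp (- (\<theta> * u))))"
  by (intro Bochner_Integration.integral_cong refl) (simp add: algebra_simps exp_add[symmetric])
 also have "... = iexp (\<theta> * t) * (fact k * avg_exp 1 \<theta> ^ Suc k)"
  unfolding integral_bspline_iexp[symmetric] by (rule integral_mult_right_zero)
 finally show ?thesis by (simp add: mult_ac)
qed

abbreviation spline_comb ::
  "nat => (nat => real => real) => (nat => real => real) => real => real => real" where
 "spline_comb k \<gamma> \<beta> b \<equiv> relu_comb (k + 2) k (%i. \<gamma> i b) (%i. \<beta> i b)"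

text \<open>For each shift \<open>b\<close>, \<open>\<gamma>\<close> and \<open>\<beta>\<close> give
  \<open>k + 2\<close> neurons whose combination is localized to
  \<open>\<bar>t - b\<bar> <= w\<close> by the moment condition; \<open>R b\<close> is the weight of
  the shift in an integral over \<open>b\<close>. This integral will be sampled, so \<open>A\<close>
  and \<open>w\<close> determine the variance.\<close>

definition spline_data ::
  "nat => real => real => real => real => (real => complex) => (nat => real => real) => (nat => real => real) => bool" where
 "spline_data k L \<Gamma> A w R \<gamma> \<beta> \<longleftrightarrow>
   R \<in> borel_measurable borel \<and> (\<forall>i. \<gamma> i \<in> borel_measurable borel \<and> \<beta> i \<in> borel_measurable borel) \<and>
   (\<forall>b. cmod (R b) <= A) \<and> (\<forall>b. b \<notin> {- L..L} --> R b = 0) \<and>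
   (\<forall>b. \<forall>i<k + 2. \<bar>\<gamma> i b\<bar> <= \<Gamma>) \<and> (\<forall>b. \<forall>i<k + 2. \<bar>\<beta> i b - b\<bar> <= w) \<and>
   (\<forall>b y. (\<Sum>i<k + 2. \<gamma> i b * (y - \<beta> i b) ^ k) = 0)"

abbreviation pure_spline_rep :: "nat => real => real => real => real => real => real => bool" where
 "pure_spline_rep k T \<omega> L \<Gamma> A w \<equiv> \<exists>R \<gamma> \<beta>. spline_data k L \<Gamma> A w R \<gamma> \<beta> \<and>
   (\<forall>t. \<bar>t\<bar> <= T --> iexp (\<omega> * t) = (LINT b|lborel. R b * of_real (spline_comb k \<gamma> \<beta> b t)))"

text \<open>The finite sum of \<open>Q\<close> neurons is used in full, without sampling, hence the
  bound on their number.\<close>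

abbreviation spline_rep :: "nat => real => real => real => real => real => real => real => bool" where
 "spline_rep k T \<omega> L \<Gamma> A w B \<equiv> \<exists>R \<gamma> \<beta> Q c \<tau>. spline_data k L \<Gamma> A w R \<gamma> \<beta> \<and> real Q <= B \<and>
   (\<forall>t. \<bar>t\<bar> <= T --> iexp (\<omega> * t) = (\<Sum>q<Q. c q * of_real (relu_pow k (t - \<tau> q))) + (LINT b|lborel. R b * of_real (spline_comb k \<gamma> \<beta> b t)))"

abbreviation cis_spline_rep :: "nat => real => real => real => real => real => real => real => bool" where
 "cis_spline_rep k T \<omega> L \<Gamma> A w B \<equiv> \<exists>R \<gamma> \<beta> Q c \<tau>. spline_data k L \<Gamma> A w R \<gamma> \<beta> \<and> real Q <= B \<and>
   (\<forall>t. \<bar>t\<bar> <= T --> cis (\<omega> * t) = (\<Sum>q<Q. c q * of_real (relu_pow k (t - \<tau> q))) + (LINT b|lborel. R b * of_real (spline_comb k \<gamma> \<beta> b t)))"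

lemma relu_comb_alt_binom:
 assumes "M > 0"
 shows "relu_comb (k + 2) k (alt_binom (Suc k)) (%i. b + real i / M) t = bspline k (M * (t - b)) / M ^ k"
proof -
 have "relu_pow k (M * s) = M ^ k * relu_pow k s" for s
  using assms by (auto simp: relu_pow_def power_mult_distrib zero_less_mult_iff)
 moreover have "M * (t - b) - real i = M * (t - (b + real i / M))" for i using assms by (simp add: algebra_simps)
 ultimately have "bspline k (M * (t - b)) = M ^ k * relu_comb (k + 2) k (alt_binom (Suc k)) (%i. b + real i / M) t"
  unfolding bspline_def relu_comb_def sum_distrib_left by (intro sum.cong refl) simp
 then show ?thesis using assms by simp
qed

text \<open>The weight with which B-splines of width about \<open>1 / M\<close> reproduce the
  exponential. Of \<open>M ^ Suc k\<close>, one factor is the change of variables in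
  \<open>b\<close>, and \<open>M ^ k\<close> undoes the scaling of
  \<open>relu_comb_alt_binom\<close>.\<close>

definition spline_weight :: "nat => real => real => real => real => complex" where
 "spline_weight k L M \<omega> b =
   indicator {- L..L} b *\<^sub>R (of_real (M ^ Suc k) / (fact k * avg_exp 1 (\<omega> / M) ^ Suc k) * iexp (\<omega> * b))"

lemma spline_weight_measurable [measurable]: "spline_weight k L M \<omega> \<in> borel_measurable borel"
 unfolding spline_weight_def[abs_def] by measurable

lemma spline_weight_bound:
 assumes "1 <= M" "0 <= \<omega>" "\<omega> <= M"
 shows "cmod (spline_weight k L M \<omega> b) <= 2 ^ Suc k * M ^ Suc k"
proof -
 let ?z0 = "avg_exp 1 (\<omega> / M)"
 have "cmod ?z0 >= 1 / 2" using assms by (intro avg_exp_lower) auto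
 then have "(1 / 2) ^ Suc k <= cmod ?z0 ^ Suc k" by (intro power_mono) auto
 moreover have "(1 / 2 :: real) ^ Suc k > 0" by simp
 ultimately have p0: "cmod ?z0 ^ Suc k > 0" by linarith
 with \<open>(1 / 2) ^ Suc k <= cmod (avg_exp 1 (\<omega> / M)) ^ Suc k\<close>
 have p: "cmod ?z0 ^ Suc k > 0" "1 / cmod ?z0 ^ Suc k <= 2 ^ Suc k"
  by (simp_all add: divide_le_eq le_divide_eq power_one_over mult.commute del: power_Suc)
 have "cmod (spline_weight k L M \<omega> b) <= M ^ Suc k / (fact k * cmod ?z0 ^ Suc k)"
  using assms by (cases "b \<in> {- L..L}") (auto simp: spline_weight_def norm_mult norm_divide norm_power simp del: power_Suc)
 also have "... = (M ^ Suc k * (1 / fact k)) * (1 / cmod ?z0 ^ Suc k)" by simp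
 also have "... <= (M ^ Suc k * 1) * 2 ^ Suc k"
  using p assms by (intro mult_mono) (auto simp: divide_le_eq simp del: power_Suc)
 finally show ?thesis by (simp add: mult_ac)
qed

text \<open>\<open>bspline_reproduces_iexp\<close> at frequency \<open>\<omega> / M <= 1\<close>,
  rescaled. Cutting \<open>b\<close> off at \<open>L\<close> loses nothing: for
  \<open>\<bar>t\<bar> <= T\<close> the splines that do not vanish at \<open>t\<close> have
  \<open>t - b\<close> between 0 and \<open>(k + 1) / M\<close>.\<close>

lemma iexp_spline:
 assumes M: "1 <= M" "0 <= \<omega>" "\<omega> <= M" and t: "\<bar>t\<bar> <= T" and L: "L >= T + real k + 1"
 shows "iexp (\<omega> * t) = (LINT b|lborel. spline_weight k L M \<omega> b *
   of_real (relu_comb (k + 2) k (alt_binom (Suc k)) (%i. b + real i / M) t))"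
proof -
 define c where "c = fact k * avg_exp 1 (\<omega> / M) ^ Suc k"
 have "cmod (avg_exp 1 (\<omega> / M)) >= 1 / 2" using M by (intro avg_exp_lower) auto
 then have "avg_exp 1 (\<omega> / M) ~= 0" by auto
 then have c: "c ~= 0" by (simp add: c_def)
 have M0: "M > 0" using M by simp
 let ?z0 = "%i b. relu_comb (k + 2) k (alt_binom (Suc k)) (%i. b + real i / M) t"
 have "c * iexp (\<omega> / M * (M * t)) = (LINT b|lborel. of_real (bspline k (M * t - b)) * iexp (\<omega> / M * b))"
  unfolding c_def by (rule bspline_reproduces_iexp[symmetric])
 also have "... = \<bar>M\<bar> *\<^sub>R (LINT b|lborel. of_real (bspline k (M * t - (0 + M * b))) * iexp (\<omega> / M * (0 + M * b)))"
  by (rule lborel_integral_real_affine) (use M0 in simp)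
 also have "... = (LINT b|lborel. of_real M * (of_real (bspline k (M * (t - b))) * iexp (\<omega> * b)))"
  using M0 by (simp add: scaleR_conv_of_real right_diff_distrib)
 also have "... = (LINT b|lborel. c * (spline_weight k L M \<omega> b * of_real (?z0 i b)))"
 proof (rule Bochner_Integration.integral_cong[OF refl])
  fix b
  show "of_real M * (of_real (bspline k (M * (t - b))) * iexp (\<omega> * b)) = c * (spline_weight k L M \<omega> b * of_real (?z0 i b))"
  proof (cases "b \<in> {- L..L}")
   case True
   then have "spline_weight k L M \<omega> b = of_real (M ^ Suc k) / c * iexp (\<omega> * b)"
    by (simp add: spline_weight_def c_def del: power_Suc)
   then show ?thesis using c M0 unfolding relu_comb_alt_binom[OF M0] by simp
  next
   case False
   have "M * (t - b) <= 0 \<or> M * (t - b) > real k + 1"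
   proof (cases "b >= t")
    case bt: False
    then have "b < - L" using False t L by auto
    then have "real k + 1 < 1 * (t - b)" using t L by auto
    also have "... <= M * (t - b)" using M bt by (intro mult_right_mono) auto
    finally show ?thesis ..
   qed (use M0 in \<open>simp add: mult_le_0_iff\<close>)
   then have "bspline k (M * (t - b)) = 0" by (rule bspline_support)
   then show ?thesis using False by (simp add: spline_weight_def)
  qed
 qed
 also have "... = c * (LINT b|lborel. spline_weight k L M \<omega> b * of_real (?z0 i b))"
  by (rule integral_mult_right_zero)
 finally show ?thesis using c M0 by simp
qed

text \<open>The case without explicit neurons: the width is tied to \<open>M\<close>, hence to the
  frequency.\<close>

lemma spline_high:
 fixes T :: real
 assumes "T >= 0"
 shows "\<exists>C>0. \<exists>L>0. \<exists>\<Gamma>\<ge>0. \<forall>\<omega> M. 1 <= M --> 0 <= \<omega> --> \<omega> <= M -->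
   (pure_spline_rep k T \<omega> L \<Gamma> (C * M ^ Suc k) ((real k + 1) / M))"
proof -
 define L where "L = T + real k + 1"
 have L: "L > 0" using assms by (simp add: L_def)
 have "spline_data k L (2 ^ Suc k) (2 ^ Suc k * M ^ Suc k) ((real k + 1) / M) (spline_weight k L M \<omega>) (%i b. alt_binom (Suc k) i) (%i b. b + real i / M)"
  if M: "1 <= M" "0 <= \<omega>" "\<omega> <= M" for \<omega> M
  unfolding spline_data_def
 proof (intro conjI allI impI)
  fix b show "cmod (spline_weight k L M \<omega> b) <= 2 ^ Suc k * M ^ Suc k" by (rule spline_weight_bound[OF M])
  show "spline_weight k L M \<omega> b = 0" if "b \<notin> {- L..L}" using that by (simp add: spline_weight_def)
  show "\<bar>alt_binom (Suc k) i\<bar> <= 2 ^ Suc k" for i by (rule alt_binom_abs_le)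
  show "\<bar>b + real i / M - b\<bar> <= (real k + 1) / M" if "i < k + 2" for i using that M by (auto simp: divide_right_mono)
  fix y
  have "(y - (b + real i / M)) ^ k = (M * (y - b) - real i) ^ k / M ^ k" for i
   using M by (simp flip: power_divide) (simp add: field_simps)
  then have "(\<Sum>i<k + 2. alt_binom (Suc k) i * (y - (b + real i / M)) ^ k) = (\<Sum>i<Suc (Suc k). alt_binom (Suc k) i * (M * (y - b) - real i) ^ k) / M ^ k"
   unfolding sum_divide_distrib by (intro sum.cong) auto
  then show "(\<Sum>i<k + 2. alt_binom (Suc k) i * (y - (b + real i / M)) ^ k) = 0"
   using alt_binom_moments[of k "Suc k" "M * (y - b)"] by simp
 qed measurable
 moreover have "iexp (\<omega> * t) = (LINT b|lborel. spline_weight k L M \<omega> b * of_real (relu_comb (k + 2) k (alt_binom (Suc k)) (%i. b + real i / M) t))"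
  if "1 <= M" "0 <= \<omega>" "\<omega> <= M" "\<bar>t\<bar> <= T" for \<omega> M t
  using that by (rule iexp_spline) (simp add: L_def)
 ultimately have "pure_spline_rep k T \<omega> L (2 ^ Suc k) (2 ^ Suc k * M ^ Suc k) ((real k + 1) / M)"
  if "1 <= M" "0 <= \<omega>" "\<omega> <= M" for \<omega> M
  using that by (intro exI[of _ "spline_weight k L M \<omega>"] exI[of _ "%i b. alt_binom (Suc k) i"] exI[of _ "%i b. b + real i / M"] conjI allI impI)
 note main = this
 show ?thesis
 proof (rule exI[of _ "2 ^ Suc k"], rule conjI, simp, rule exI[of _ L], rule conjI, rule L, rule exI[of _ "2 ^ Suc k"], rule conjI, simp, intro allI impI)
  fix \<omega> M :: real assume "1 <= M" "0 <= \<omega>" "\<omega> <= M"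
  then show "pure_spline_rep k T \<omega> L (2 ^ Suc k) (2 ^ Suc k * M ^ Suc k) ((real k + 1) / M)"
   by (rule main)
 qed
qed

definition lagrange_basis :: "nat => nat => real => real" where
 "lagrange_basis k i y = (\<Prod>l\<in>{..k} - {i}. (y - real l) / (real i - real l))"

lemma lagrange_basis_measurable [measurable]: "lagrange_basis k i \<in> borel_measurable borel"
 unfolding lagrange_basis_def[abs_def] by measurable

lemma lagrange_basis_bound:
 assumes "0 <= y" "y <= 1"
 shows "\<bar>lagrange_basis k i y\<bar> <= (real k + 1) ^ (k + 1)"
proof -
 have "\<bar>lagrange_basis k i y\<bar> <= (\<Prod>l\<in>{..k} - {i}. real k + 1)"
  unfolding lagrange_basis_def abs_prod
 proof (rule prod_mono, intro conjI)
  fix l assume l: "l \<in> {..k} - {i}"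
  then have "1 <= \<bar>real i - real l\<bar>" by auto
  moreover have "\<bar>y - real l\<bar> <= real k + 1" using assms l by auto
  ultimately show "\<bar>(y - real l) / (real i - real l)\<bar> <= real k + 1"
   using mult_mono[of 1 "\<bar>real i - real l\<bar>" "\<bar>y - real l\<bar>" "real k + 1"] frac_le[of "real k + 1" "\<bar>y - real l\<bar>" 1 "\<bar>real i - real l\<bar>"]
   by (simp add: abs_divide)
 qed simp
 also have "... = (real k + 1) ^ card ({..k} - {i})" by simp
 also have "... <= (real k + 1) ^ (k + 1)"
  using card_mono[of "{..k}" "{..k} - {i}"] by (intro power_increasing) auto
 finally show ?thesis .
qed

text \<open>Both sides are polynomials of degree at most \<open>k\<close> in \<open>y\<close> that
  agree at the \<open>k + 1\<close> nodes.\<close>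

lemma lagrange_interpolation_power:
 "(\<Sum>i\<le>k. lagrange_basis k i y * (z - real i) ^ k) = (z - y) ^ k"
proof -
 let ?z0 = "%l i. \<Prod>l\<in>{..k} - {i}. smult (1 / (real i - real l)) [:- real l, 1:]"
 \<comment> \<open>Here \<open>z\<close> is fixed: \<open>[:z, -1:] ^ k\<close> is
   \<open>(z - x) ^ k\<close> as a polynomial in \<open>x\<close>.\<close>
 define p where "p = (\<Sum>i\<le>k. smult ((z - real i) ^ k) (?z0 l i)) - [:z, -1:] ^ k"
 have ev: "poly p x = (\<Sum>i\<le>k. lagrange_basis k i x * (z - real i) ^ k) - (z - x) ^ k" for x
  by (simp add: p_def poly_sum poly_prod lagrange_basis_def mult.commute diff_divide_distrib)
 have root: "poly p (real j) = 0" if "j <= k" for j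
 proof -
  have "lagrange_basis k i (real j) = (if i = j then 1 else 0)" if "i <= k" for i
  proof (cases "i = j")
   case True
   then show ?thesis by (auto simp: lagrange_basis_def intro!: prod.neutral)
  next
   case False
   have "lagrange_basis k i (real j) = 0"
    unfolding lagrange_basis_def
   proof (rule prod_zero)
    show "\<exists>l\<in>{..k} - {i}. (real j - real l) / (real i - real l) = 0"
     by (rule bexI[of _ j]) (use False \<open>j <= k\<close> in auto)
   qed simp
   then show ?thesis using False by simp
  qed
  then have "(\<Sum>i\<le>k. lagrange_basis k i (real j) * (z - real i) ^ k) = (\<Sum>i\<le>k. if i = j then (z - real j) ^ k else 0)"
   by (intro sum.cong) auto
  then show ?thesis using that by (simp add: ev)
 qed
 have "degree p <= k"
  unfolding p_def
 proof (intro degree_diff_le degree_sum_le)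
  show "degree ([:z, - 1:] ^ k) <= k" using degree_power_le[of "[:z, -1:]" k] by simp
 next
  fix i assume "i \<in> {..k}"
  have "degree (?z0 l i) <= (\<Sum>l\<in>{..k} - {i}. degree (smult (1 / (real i - real l)) [:- real l, 1:]))"
   using degree_prod_sum_le[of "{..k} - {i}" "%l. smult (1 / (real i - real l)) [:- real l, 1:]"] by (simp add: comp_def)
  also have "... <= (\<Sum>l\<in>{..k} - {i}. 1)" by (intro sum_mono) simp
  also have "... = k" using \<open>i \<in> {..k}\<close> by simp
  finally show "degree (smult ((z - real i) ^ k) (?z0 l i)) <= k"
   by (rule order_trans[OF degree_smult_le])
 qed simp
 have "p = 0"
 proof (rule ccontr)
  assume "p ~= 0"
  have "real ` {..k} \<subseteq> {x. poly p x = 0}" using root by auto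
  then have "card (real ` {..k}) <= card {x. poly p x = 0}" using poly_roots_finite[OF \<open>p ~= 0\<close>] by (intro card_mono)
  also have "... <= degree p" using \<open>p ~= 0\<close> by (rule card_poly_roots_bound)
  finally show False using \<open>degree p <= k\<close> by (simp add: card_image)
 qed
 then show ?thesis using ev[of y] by simp
qed

text \<open>The integral of \<open>iexp_spline\<close> is first rewritten with the single kernel
  \<open>relu_pow k (t - b)\<close> and a new weight \<open>R\<close>. For fixed \<open>t\<close>
  this kernel, as a function of \<open>b\<close>, is replaced by its Lagrange interpolant of degree
  \<open>k\<close> on the grid of spacing \<open>1 / N\<close>. The interpolant uses only grid
  knots, of which there are \<open>O(N)\<close>, so its integral is an explicit network. The
  remainder has knots within \<open>(k + 1) / N\<close> of \<open>b\<close>, and its moments vanish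
  because interpolation reproduces \<open>(z - b) ^ k\<close>. The width becomes
  \<open>1 / N\<close> while the weight keeps the size \<open>M ^ Suc k\<close>.\<close>

lemma spline_low:
 fixes T :: real
 assumes T: "T >= 0"
 shows "\<exists>C>0. \<exists>L>0. \<exists>\<Gamma>\<ge>0. \<forall>\<omega> M (N::nat). 1 <= M --> 0 <= \<omega> --> \<omega> <= M --> 1 <= N -->
   (spline_rep k T \<omega> L \<Gamma> (C * M ^ Suc k) ((real k + 1) / real N) (C * real N))"
proof -
 define L0 where "L0 = T + real k + 1"
 \<comment> \<open>Room for the shifts \<open>j / M <= k + 1\<close> of the weight in
   \<open>R\<close>.\<close>
 define L where "L = L0 + real k + 1"
 have L: "L > 0" using T by (simp add: L_def L0_def)
 define \<Gamma> where "\<Gamma> = (real k + 1) ^ (k + 1)"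
 have \<Gamma>: "\<Gamma> >= 1" unfolding \<Gamma>_def by (rule one_le_power) simp
 \<comment> \<open>The first entry serves the bound on \<open>R\<close>, the second the number
   \<open>2 * P + 1\<close> of grid knots.\<close>
 define C where "C = max (real (k + 2) * 2 ^ Suc k * 2 ^ Suc k) (2 * (L + real k + 2) + 1)"
 have C: "C > 0" using L by (simp add: C_def less_max_iff_disj)
 have "spline_rep k T \<omega> L \<Gamma> (C * M ^ Suc k) ((real k + 1) / real N) (C * real N)"
  if M: "1 <= M" "0 <= \<omega>" "\<omega> <= M" and N: "1 <= N" for \<omega> M and N :: nat
 proof -
  let ?Rh = "spline_weight k L0 M \<omega>"
  \<comment> \<open>The translation by \<open>j / M\<close> is moved from the B-spline to the
    weight, which leaves the plain kernel \<open>relu_pow k (t - b)\<close>.\<close>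
  define R where "R b = (\<Sum>j<k + 2. of_real (alt_binom (Suc k) j) * ?Rh (b - real j / M))" for b
  have Rm[measurable]: "R \<in> borel_measurable borel" unfolding R_def by measurable
  have Rb: "cmod (R b) <= C * M ^ Suc k" for b
  proof -
   have "cmod (R b) <= (\<Sum>j<k + 2. 2 ^ Suc k * (2 ^ Suc k * M ^ Suc k))"
    unfolding R_def
    by (intro order_trans[OF norm_sum] sum_mono; unfold norm_mult norm_of_real; intro mult_mono alt_binom_abs_le spline_weight_bound M) auto
   also have "... = (real (k + 2) * 2 ^ Suc k * 2 ^ Suc k) * M ^ Suc k" by (simp add: mult_ac)
   also have "... <= C * M ^ Suc k" unfolding C_def using M by (intro mult_right_mono) auto
   finally show ?thesis .
  qed
  have R0: "R b = 0" if "b \<notin> {- L..L}" for b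
   unfolding R_def
  proof (intro sum.neutral ballI)
   fix j assume "j \<in> {..<k + 2}"
   then have "0 <= real j / M" "real j / M <= real k + 1"
    using M frac_le[of "real k + 1" "real j" 1 M] by auto
   then have "b - real j / M \<notin> {- L0..L0}" using that by (auto simp: L_def)
   then show "of_real (alt_binom (Suc k) j) * ?Rh (b - real j / M) = 0" by (simp add: spline_weight_def)
  qed
  have intR: "integrable lborel (%b. R b * of_real (f b))" if f: "f \<in> borel_measurable borel" and fb: "!!b. b \<in> {- L..L} ==> \<bar>f b\<bar> <= B" for f B
  proof -
   have "set_integrable lborel {- L..L} (%b. R b * of_real (f b))"
   proof (rule set_integrable_bounded_Icc[where B = "C * M ^ Suc k * B"])
    show "(%b. R b * of_real (f b)) \<in> borel_measurable borel" using f by measurable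
    show "norm (R b * of_real (f b)) <= C * M ^ Suc k * B" if "b \<in> {- L..L}" for b
     unfolding norm_mult norm_of_real using fb[OF that] Rb[of b] C M by (intro mult_mono) auto
   qed
   moreover have "indicator {- L..L} b *\<^sub>R (R b * of_real (f b)) = R b * of_real (f b)" for b
    using R0[of b] by (cases "b \<in> {- L..L}") auto
   ultimately show ?thesis unfolding set_integrable_def by (simp only:)
  qed
  \<comment> \<open>The position of \<open>b\<close> in its grid cell, in units of the cell
    length.\<close>
  define y where "y b = b * real N - of_int \<lfloor>b * real N\<rfloor>" for b
  have y: "0 <= y b" "y b <= 1" for b unfolding y_def by linarith+
  have ym[measurable]: "y \<in> borel_measurable borel" unfolding y_def by measurable
  \<comment> \<open>Index 0 is the kernel itself; the indices \<open>Suc l\<close> subtract its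
    interpolation at the \<open>k + 1\<close> grid points that start at the left end of the cell of
    \<open>b\<close>.\<close>
  define \<gamma> where "\<gamma> i b = (case i of 0 => 1 | Suc l => - lagrange_basis k l (y b))" for i b
  define \<beta> where "\<beta> i b = (case i of 0 => b | Suc l => (of_int \<lfloor>b * real N\<rfloor> + real l) / real N)" for i b
  let ?z2 = "%b N i. of_int \<lfloor>b * real N\<rfloor> + real i"
  have mom: "(\<Sum>i<k + 2. \<gamma> i b * (z - \<beta> i b) ^ k) = 0" for b z
  proof -
   let ?z6 = "%N. z * real N - of_int \<lfloor>b * real N\<rfloor>"
   have "(\<Sum>i<k + 2. \<gamma> i b * (z - \<beta> i b) ^ k) = (z - b) ^ k - (\<Sum>i\<le>k. lagrange_basis k i (y b) * (z - (?z2 b N i) / real N) ^ k)"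
    unfolding add_2_eq_Suc' sum.lessThan_Suc_shift[of _ "Suc k"] by (simp add: \<gamma>_def \<beta>_def lessThan_Suc_atMost sum_negf del: sum.lessThan_Suc sum.atMost_Suc)
   also have "(z - (?z2 b N i) / real N) = ((?z6 N) - real i) / real N" for i
    using N by (simp add: field_simps)
   then have "(\<Sum>i\<le>k. lagrange_basis k i (y b) * (z - (?z2 b N i) / real N) ^ k) =
     (\<Sum>i\<le>k. lagrange_basis k i (y b) * ((?z6 N) - real i) ^ k) / real N ^ k"
    by (simp only: power_divide sum_divide_distrib times_divide_eq_right)
   also have "... = ((?z6 N) - y b) ^ k / real N ^ k" by (simp only: lagrange_interpolation_power)
   also have "... = (z - b) ^ k"
   proof -
    have "(?z6 N) - y b = (z - b) * real N" by (simp add: y_def algebra_simps)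
    then show ?thesis using N by (simp add: power_mult_distrib)
   qed
   finally show ?thesis by simp
  qed
  have data: "spline_data k L \<Gamma> (C * M ^ Suc k) ((real k + 1) / real N) R \<gamma> \<beta>"
   unfolding spline_data_def
  proof (intro conjI allI impI)
   show "R \<in> borel_measurable borel" by (rule Rm)
   show "\<gamma> i \<in> borel_measurable borel" for i unfolding \<gamma>_def by (cases i) auto
   show "\<beta> i \<in> borel_measurable borel" for i unfolding \<beta>_def by (cases i) auto
   show "cmod (R b) <= C * M ^ Suc k" for b by (rule Rb)
   show "R b = 0" if "b \<notin> {- L..L}" for b using that by (rule R0)
   show "\<bar>\<gamma> i b\<bar> <= \<Gamma>" for i b
    using \<Gamma> lagrange_basis_bound[OF y] unfolding \<gamma>_def \<Gamma>_def by (cases i) auto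
   show "\<bar>\<beta> i b - b\<bar> <= (real k + 1) / real N" if "i < k + 2" for i b
   proof (cases i)
    case (Suc l)
    have "\<beta> i b - b = (real l - y b) / real N" using N by (simp add: \<beta>_def y_def Suc field_simps)
    moreover have "\<bar>real l - y b\<bar> <= real k + 1" using y[of b] that Suc by auto
    ultimately show ?thesis by (simp add: abs_divide divide_right_mono)
   qed (simp add: \<beta>_def)
   show "(\<Sum>i<k + 2. \<gamma> i b * (z - \<beta> i b) ^ k) = 0" for b z by (rule mom)
  qed
  \<comment> \<open>The grid indices from \<open>- P\<close> to \<open>P\<close> contain every knot
    that occurs for \<open>b\<close> in \<open>{- L..L}\<close>: the left end of the cell of
    \<open>b\<close> and the \<open>k\<close> grid points after it.\<close>
  define P where "P = \<lceil>L * real N\<rceil> + int k + 1"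
  define p where "p q = int q - P" for q :: nat
  define Q where "Q = nat (2 * P + 1)"
  have "0 <= L * real N" using L by simp
  then have P: "P >= 1" unfolding P_def by linarith
  have QN: "real Q <= C * real N"
  proof -
   have "real_of_int P <= L * real N + 1 + (real k + 1)" unfolding P_def by linarith
   also have "L * real N + 1 + (real k + 1) = L * real N + (real k + 2) * 1" by simp
   also have "... <= L * real N + (real k + 2) * real N" using N by (intro add_left_mono mult_left_mono) auto
   finally have "2 * real_of_int P + 1 <= (2 * (L + real k + 2) + 1) * real N" using N by (simp add: algebra_simps)
   also have "... <= C * real N" unfolding C_def by (intro mult_right_mono) auto
   finally show ?thesis using P by (simp add: Q_def)
  qed
  \<comment> \<open>The total interpolation weight that \<open>b\<close> gives to the grid knot
    \<open>q\<close>; integrated against \<open>R\<close> it becomes the outer coefficient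
    \<open>c q\<close>.\<close>
  define w where "w q b = (\<Sum>i\<le>k. if \<lfloor>b * real N\<rfloor> + int i = p q then lagrange_basis k i (y b) else 0)" for q b
  have wm[measurable]: "w q \<in> borel_measurable borel" for q unfolding w_def by measurable
  have wb: "\<bar>w q b\<bar> <= (real k + 1) * \<Gamma>" for q b
  proof -
   have "\<bar>w q b\<bar> <= (\<Sum>i\<le>k. \<Gamma>)"
    unfolding w_def \<Gamma>_def by (intro order_trans[OF sum_abs] sum_mono) (use lagrange_basis_bound[OF y] in auto)
   then show ?thesis by (simp add: algebra_simps)
  qed
  let ?z3 = "%t q. t - of_int (p q) / real N"
  let ?z4 = "%i b t. \<Sum>i\<le>k. lagrange_basis k i (y b) * relu_pow k (t - (?z2 b N i) / real N)"
  have interp: "(?z4 i b t) = (\<Sum>q<Q. w q b * relu_pow k (?z3 t q))"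
   if b: "b \<in> {- L..L}" for b t
  proof -
   have "(\<Sum>q<Q. w q b * relu_pow k (?z3 t q)) = (\<Sum>q<Q. \<Sum>i\<le>k. if \<lfloor>b * real N\<rfloor> + int i = p q then lagrange_basis k i (y b) * relu_pow k (?z3 t q) else 0)"
    unfolding w_def sum_distrib_right by (intro sum.cong refl) simp
   also have "... = (\<Sum>i\<le>k. \<Sum>q<Q. if \<lfloor>b * real N\<rfloor> + int i = p q then lagrange_basis k i (y b) * relu_pow k (?z3 t q) else 0)"
    by (rule sum.swap)
   also have "... = (?z4 i b t)"
   proof (rule sum.cong[OF refl])
    fix i assume i: "i \<in> {..k}"
    define q where "q = nat (\<lfloor>b * real N\<rfloor> + int i + P)"
    have bN: "- (L * real N) <= b * real N" "b * real N <= L * real N"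
     using b mult_right_mono[of "- L" b "real N"] mult_right_mono[of b L "real N"] by auto
    have f1: "- \<lceil>L * real N\<rceil> <= \<lfloor>b * real N\<rfloor>" using bN(1) by linarith
    have f2: "\<lfloor>b * real N\<rfloor> <= \<lceil>L * real N\<rceil>" using bN(2) by linarith
    have q: "int q = \<lfloor>b * real N\<rfloor> + int i + P" unfolding q_def using f1 by (simp add: P_def)
    have qQ: "q < Q" using q f2 i unfolding Q_def P_def by simp
    have "(\<lfloor>b * real N\<rfloor> + int i = p q') \<longleftrightarrow> q' = q" for q' unfolding p_def using q by auto
    then have "(\<Sum>q'<Q. if \<lfloor>b * real N\<rfloor> + int i = p q' then lagrange_basis k i (y b) * relu_pow k (t - of_int (p q') / real N) else 0)
      = lagrange_basis k i (y b) * relu_pow k (?z3 t q)"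
     using qQ by simp
    also have "real_of_int (p q) = of_int \<lfloor>b * real N\<rfloor> + real i" using q by (simp add: p_def)
    finally show "(\<Sum>q'<Q. if \<lfloor>b * real N\<rfloor> + int i = p q' then lagrange_basis k i (y b) * relu_pow k (t - of_int (p q') / real N) else 0) =
      lagrange_basis k i (y b) * relu_pow k (t - (?z2 b N i) / real N)" .
   qed
   finally show ?thesis by simp
  qed
  define c where "c q = (LINT b|lborel. R b * of_real (w q b))" for q
  let ?z7 = "%b t. spline_comb k \<gamma> \<beta> b t"
  have "iexp (\<omega> * t) = (\<Sum>q<Q. c q * of_real (relu_pow k (?z3 t q))) +
     (LINT b|lborel. R b * of_real (?z7 b t))" if t: "\<bar>t\<bar> <= T" for t
  proof -
   have rb: "\<bar>relu_pow k (t - b)\<bar> <= (T + L) ^ k" if "b \<in> {- L..L}" for b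
    using that t by (intro relu_pow_abs_le) auto
   have iR: "integrable lborel (%b. R b * of_real (relu_pow k (t - b)))" by (rule intR[OF _ rb]) measurable
   have iw: "integrable lborel (%b. R b * of_real (w q b))" for q by (rule intR[OF wm wb])
   let ?z0 = "%j b. alt_binom (Suc k) j * relu_pow k (t - (b + real j / M))"
   have ij: "integrable lborel (%b. ?Rh b * of_real (?z0 j b))" for j
   proof -
    have "set_integrable lborel {- L0..L0} (%b. ?Rh b * of_real (?z0 j b))"
    proof (rule set_integrable_bounded_Icc)
     show "norm (?Rh b * of_real (?z0 j b)) <= (2 ^ Suc k * M ^ Suc k) * (2 ^ Suc k * (T + L0 + real j / M) ^ k)" if "b \<in> {- L0..L0}" for b
     proof -
      have jm: "0 <= real j / M" using M by simp
      have "- L0 <= b" "b <= L0" using that by auto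
      then have "\<bar>t - (b + real j / M)\<bar> <= T + L0 + real j / M" using t jm by linarith
      then have "\<bar>relu_pow k (t - (b + real j / M))\<bar> <= (T + L0 + real j / M) ^ k" by (rule relu_pow_abs_le)
      then show ?thesis
       unfolding norm_mult norm_of_real abs_mult
       by (intro mult_mono spline_weight_bound M alt_binom_abs_le) (use M in auto)
     qed
    qed measurable
    moreover have "indicator {- L0..L0} b *\<^sub>R (?Rh b * of_real (?z0 j b)) = ?Rh b * of_real (?z0 j b)" for b
     by (cases "b \<in> {- L0..L0}") (auto simp: spline_weight_def)
    ultimately show ?thesis unfolding set_integrable_def by (simp only:)
   qed
   let ?z5 = "%j b. of_real (alt_binom (Suc k) j) * ?Rh (b - real j / M)"
   have ij': "integrable lborel (%b. (?z5 j b) * of_real (relu_pow k (t - b)))" for j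
   proof -
    have "integrable lborel (%b. ?Rh (- (real j / M) + 1 * b) * of_real (alt_binom (Suc k) j * relu_pow k (t - ((- (real j / M) + 1 * b) + real j / M))))"
     by (rule lborel_integrable_real_affine[OF ij]) simp
    then show ?thesis by (simp add: mult_ac)
   qed
   let ?z1 = "%q b. \<Sum>q<Q. (R b * of_real (w q b)) * of_real (relu_pow k (?z3 t q))"
   have "iexp (\<omega> * t) = (LINT b|lborel. ?Rh b * of_real (relu_comb (k + 2) k (alt_binom (Suc k)) (%i. b + real i / M) t))"
    by (rule iexp_spline[OF M t]) (simp add: L0_def)
   also have "... = (LINT b|lborel. (\<Sum>j<k + 2. ?Rh b * of_real (?z0 j b)))"
    unfolding relu_comb_def of_real_sum sum_distrib_left ..
   also have "... = (\<Sum>j<k + 2. (LINT b|lborel. ?Rh b * of_real (?z0 j b)))"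
    by (intro Bochner_Integration.integral_sum ij)
   also have "... = (\<Sum>j<k + 2. (LINT b|lborel. (?z5 j b) * of_real (relu_pow k (t - b))))"
   proof (rule sum.cong[OF refl])
    fix j
    have "(LINT b|lborel. ?Rh b * of_real (?z0 j b)) =
     (LINT b|lborel. ?Rh (b + (- (real j / M))) * of_real (alt_binom (Suc k) j * relu_pow k (t - ((b + (- (real j / M))) + real j / M))))"
     by (rule integral_lborel_translate[symmetric]) measurable
    then show "(LINT b|lborel. ?Rh b * of_real (?z0 j b)) = (LINT b|lborel. (?z5 j b) * of_real (relu_pow k (t - b)))"
     by (simp add: mult_ac)
   qed
   also have "... = (LINT b|lborel. (\<Sum>j<k + 2. (?z5 j b) * of_real (relu_pow k (t - b))))"
    by (intro Bochner_Integration.integral_sum[symmetric] ij')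
   also have "... = (LINT b|lborel. R b * of_real (relu_pow k (t - b)))"
    by (intro Bochner_Integration.integral_cong refl) (simp only: R_def sum_distrib_right)
   also have "... = (LINT b|lborel. (?z1 q b) + R b * of_real (?z7 b t))"
   proof (rule Bochner_Integration.integral_cong[OF refl])
    fix b
    show "R b * of_real (relu_pow k (t - b)) = (?z1 q b) + R b * of_real (?z7 b t)"
    proof (cases "b \<in> {- L..L}")
     case True
     have "spline_comb k \<gamma> \<beta> b t = relu_pow k (t - b) - (?z4 i b t)"
      unfolding relu_comb_def add_2_eq_Suc' sum.lessThan_Suc_shift[of _ "Suc k"] by (simp add: \<gamma>_def \<beta>_def lessThan_Suc_atMost sum_negf del: sum.lessThan_Suc sum.atMost_Suc)
     then have e: "relu_pow k (t - b) = (\<Sum>q<Q. w q b * relu_pow k (?z3 t q)) + spline_comb k \<gamma> \<beta> b t"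
      using interp[OF True, of t] by simp
     show ?thesis unfolding e of_real_add of_real_sum of_real_mult distrib_left sum_distrib_left by (simp only: mult.assoc)
    qed (use R0 in simp)
   qed
   also have "... = (LINT b|lborel. (?z1 q b)) + (LINT b|lborel. R b * of_real (?z7 b t))"
   proof (rule Bochner_Integration.integral_add)
    show "integrable lborel (%b. \<Sum>q<Q. (R b * of_real (w q b)) * of_real (relu_pow k (?z3 t q)))"
     by (intro Bochner_Integration.integrable_sum integrable_mult_left iw)
    have cm: "(%b. spline_comb k \<gamma> \<beta> b t) \<in> borel_measurable borel"
    proof -
     have [measurable]: "\<gamma> i \<in> borel_measurable borel" "\<beta> i \<in> borel_measurable borel" for i
      using data by (auto simp: spline_data_def)
     show ?thesis unfolding relu_comb_def by measurable
    qed
    show "integrable lborel (%b. R b * of_real (?z7 b t))"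
     by (rule intR[OF cm relu_comb_bound[OF mom, where w = "(real k + 1) / real N" and \<Gamma> = \<Gamma>]])
      (use data N \<Gamma> in \<open>auto simp: spline_data_def\<close>)
   qed
   also have "(LINT b|lborel. (?z1 q b)) = (\<Sum>q<Q. c q * of_real (relu_pow k (?z3 t q)))"
    unfolding c_def by (subst Bochner_Integration.integral_sum) (simp_all add: iw del: of_real_mult)
   finally show ?thesis .
  qed
  then show ?thesis
   by (intro exI[of _ R] exI[of _ \<gamma>] exI[of _ \<beta>] exI[of _ Q] exI[of _ c] exI[of _ "%q. of_int (p q) / real N"] conjI data QN allI impI)
 qed
 note main = this
 have \<Gamma>0: "\<Gamma> >= 0" using \<Gamma> by simp
 show ?thesis
  by (rule exI[of _ C], rule conjI, rule C, rule exI[of _ L], rule conjI, rule L, rule exI[of _ \<Gamma>], rule conjI, rule \<Gamma>0, intro allI impI, rule main)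
qed

section \<open>Expansion in integer frequencies\<close>

lemma has_vector_derivative_iexp_scaled:
 "((%u. iexp (c * u)) has_vector_derivative (\<i> * of_real c * iexp (c * u))) (at u within S)"
proof -
 have "((%u. iexp (c * u)) has_vector_derivative c *\<^sub>R (\<i> * iexp (c * u))) (at u within S)"
  by (rule vector_diff_chain_within[unfolded comp_def, OF _ has_vector_derivative_iexp])
   (auto intro!: derivative_eq_intros simp: has_real_derivative_iff_has_vector_derivative[symmetric])
 then show ?thesis by (simp add: scaleR_conv_of_real mult_ac)
qed

lemma integral_iexp_scaled:
 assumes "c ~= 0" "a <= b"
 shows "(LINT u:{a..b}|lborel. iexp (c * u)) = (iexp (c * b) - iexp (c * a)) / (\<i> * of_real c)"
proof -
 have "((%u. iexp (c * u) / (\<i> * of_real c)) has_vector_derivative iexp (c * u)) (at u within {a..b})" for u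
  using has_vector_derivative_divide[OF has_vector_derivative_iexp_scaled[of c u "{a..b}"], of "\<i> * of_real c"] assms(1) by simp
 moreover have "continuous_on {a..b} (%u. iexp (c * u))" by (intro continuous_intros)
 ultimately have "(LINT u|lborel. indicator {a..b} u *\<^sub>R iexp (c * u)) = iexp (c * b) / (\<i> * of_real c) - iexp (c * a) / (\<i> * of_real c)"
  by (intro integral_FTC_Icc assms(2)) auto
 then show ?thesis by (simp add: set_lebesgue_integral_def diff_divide_distrib)
qed

lemma cis_measurable [measurable]: "cis \<in> borel_measurable borel"
 unfolding cis_conv_exp[abs_def] by (rule iexp_measurable)

lemma integral_cis_scaled:
 assumes "c ~= 0" "a <= b"
 shows "(LINT u:{a..b}|lborel. cis (c * u)) = (cis (c * b) - cis (c * a)) / (\<i> * of_real c)"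
 using integral_iexp_scaled[OF assms] by (simp add: cis_conv_exp)

lemma set_integrable_cis_scaled: "set_integrable lborel {a..b} (%u. cis (c * u))"
 by (rule set_integrable_bounded_Icc[where B = 1]) auto

lemma set_integral_sum:
 fixes f :: "'i => 'a => 'b::{banach, second_countable_topology}"
 assumes "!!i. i \<in> I ==> set_integrable M S (f i)"
 shows "(LINT x:S|M. (\<Sum>i\<in>I. f i x)) = (\<Sum>i\<in>I. (LINT x:S|M. f i x))"
 unfolding set_lebesgue_integral_def scaleR_sum_right
 by (rule Bochner_Integration.integral_sum) (rule assms[unfolded set_integrable_def])

lemma integral_cis_int:
 "(LINT t:{- pi..pi}|lborel. cis (of_int j * t)) = (if j = 0 then 2 * of_real pi else 0)"
proof (cases "j = 0")
 case False
 have "cis (of_int j * pi) = cis (of_int j * (- pi)) * cis (2 * pi * of_int j)"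
  unfolding cis_mult by (rule arg_cong[where f = cis]) (simp add: algebra_simps)
 also have "cis (2 * pi * of_int j) = 1" by (rule cis_multiple_2pi) simp
 finally show ?thesis using False integral_cis_scaled[of "of_int j" "- pi" pi] by simp
qed (simp add: set_lebesgue_integral_def scaleR_conv_of_real)

lemma cmod_cis_diff: "cmod (cis x - cis y) = 2 * \<bar>sin ((x - y) / 2)\<bar>"
proof -
 have "cis x - cis y = cis ((x + y) / 2) * (cis ((x - y) / 2) - cis (- ((x - y) / 2)))"
  by (simp only: right_diff_distrib cis_mult) (simp add: field_simps)
 also have "cis ((x - y) / 2) - cis (- ((x - y) / 2)) = 2 * \<i> * of_real (sin ((x - y) / 2))"
  by (simp add: complex_eq_iff)
 finally show ?thesis by (simp add: norm_mult)
qed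

text \<open>Third-order Taylor bound, with \<open>2.1^2 / 6 < 3/4\<close>. The range is that of
  \<open>(t - t0) / 2\<close> for \<open>\<bar>t\<bar> <= pi\<close> and
  \<open>\<bar>t0\<bar> <= 1\<close>.\<close>

lemma abs_sin_lower:
 fixes x :: real
 assumes "\<bar>x\<bar> <= 2.1"
 shows "\<bar>x\<bar> / 4 <= \<bar>sin x\<bar>"
proof -
 have "\<bar>sin x - x\<bar> <= \<bar>x\<bar> ^ 3 / 6"
 proof -
  have 1: "(\<Sum>m<3. sin_coeff m * x ^ m) = x" by (simp add: numeral_3_eq_3 sin_coeff_def)
  have 2: "inverse (fact 3) = (1 / 6 :: real)" by (simp add: fact_numeral)
  show ?thesis using Maclaurin_sin_bound[of x 3, unfolded 1 2] by simp
 qed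
 also have "\<bar>x\<bar> ^ 3 / 6 = \<bar>x\<bar> * (\<bar>x\<bar>\<^sup>2 / 6)" by (simp add: power3_eq_cube power2_eq_square)
 also have "... <= \<bar>x\<bar> * (2.1\<^sup>2 / 6)" using assms by (intro mult_left_mono divide_right_mono power_mono) auto
 also have "... <= \<bar>x\<bar> * (3 / 4)" by (intro mult_left_mono) (auto simp: power2_eq_square)
 finally show ?thesis by linarith
qed

text \<open>Expand the nonnegative integral of \<open>|g - P|^2\<close> for the partial Fourier sum
  \<open>P\<close>. It serves as a Riemann-Lebesgue lemma that also bounds the coefficients
  uniformly.\<close>

lemma bessel_inequality:
 fixes g :: "real => complex"
 assumes gm: "g \<in> borel_measurable borel" and gb: "!!t. t \<in> {- pi..pi} ==> cmod (g t) <= B"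
  and fin: "finite A"
 defines "G \<equiv> %j::int. (LINT t:{- pi..pi}|lborel. g t * cis (- (of_int j * t))) / (2 * of_real pi)"
 shows "(\<Sum>j\<in>A. (cmod (G j))\<^sup>2) <= B\<^sup>2"
proof -
 let ?I = "{- pi..pi}"
 note gm[measurable]
 have B: "B >= 0" using order_trans[OF norm_ge_zero gb[of 0]] by simp
 define P where "P t = (\<Sum>j\<in>A. G j * cis (of_int j * t))" for t
 have Pm[measurable]: "P \<in> borel_measurable borel" unfolding P_def by measurable
 have Pb: "cmod (P t) <= (\<Sum>j\<in>A. cmod (G j))" for t
  unfolding P_def by (intro order_trans[OF norm_sum] sum_mono) (simp add: norm_mult)
 have siP: "set_integrable lborel ?I (%t. f t * cis (c * t))" if "f \<in> borel_measurable borel" "!!t. t \<in> ?I ==> cmod (f t) <= K" for f c K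
  by (rule set_integrable_bounded_Icc[where B = K]) (use that in \<open>auto simp: norm_mult\<close>)
 have inner: "(LINT t:?I|lborel. f t * cnj (P t)) = (\<Sum>j\<in>A. cnj (G j) * (LINT t:?I|lborel. f t * cis (- (of_int j * t))))"
  if f: "f \<in> borel_measurable borel" "!!t. t \<in> ?I ==> cmod (f t) <= K" for f K
 proof -
  have "(LINT t:?I|lborel. f t * cnj (P t)) = (LINT t:?I|lborel. (\<Sum>j\<in>A. cnj (G j) * (f t * cis (- of_int j * t))))"
   by (simp add: P_def cis_cnj sum_distrib_left mult_ac)
  also have "... = (\<Sum>j\<in>A. (LINT t:?I|lborel. cnj (G j) * (f t * cis (- of_int j * t))))"
   by (intro set_integral_sum set_integrable_mult_right siP[OF f])
  finally show ?thesis by simp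
 qed
 have ip: "(LINT t:?I|lborel. P t * cis (- (of_int j * t))) = (if j \<in> A then 2 * of_real pi * G j else 0)" for j
 proof -
  have "(LINT t:?I|lborel. P t * cis (- (of_int j * t))) = (LINT t:?I|lborel. (\<Sum>l\<in>A. G l * cis (of_int (l - j) * t)))"
   unfolding P_def sum_distrib_right mult.assoc cis_mult by (simp add: left_diff_distrib)
  also have "... = (\<Sum>l\<in>A. (LINT t:?I|lborel. G l * cis (of_int (l - j) * t)))"
   by (intro set_integral_sum set_integrable_mult_right set_integrable_cis_scaled)
  also have "... = (\<Sum>l\<in>A. if l = j then 2 * of_real pi * G j else 0)"
   by (intro sum.cong refl) (simp only: set_integral_mult_right integral_cis_int, auto)
  finally show ?thesis using fin by simp
 qed
 define S where "S = (\<Sum>j\<in>A. (cmod (G j))\<^sup>2)"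
 have cc: "cnj z * z = of_real ((cmod z)\<^sup>2)" for z :: complex by (simp only: complex_norm_square mult.commute)
 have gP: "(LINT t:?I|lborel. g t * cnj (P t)) = of_real (2 * pi * S)"
 proof -
  have "(LINT t:?I|lborel. g t * cnj (P t)) = (\<Sum>j\<in>A. cnj (G j) * (2 * of_real pi * G j))"
   by (rule trans[OF inner[OF gm gb]], assumption, intro sum.cong refl, simp add: G_def)
  also have "... = (\<Sum>j\<in>A. of_real (2 * pi) * (cnj (G j) * G j))" by (intro sum.cong refl) simp
  finally show ?thesis by (simp only: cc S_def of_real_mult of_real_sum sum_distrib_left)
 qed
 have PP: "(LINT t:?I|lborel. P t * cnj (P t)) = of_real (2 * pi * S)"
 proof -
  have "(LINT t:?I|lborel. P t * cnj (P t)) = (\<Sum>j\<in>A. of_real (2 * pi) * (cnj (G j) * G j))"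
   by (rule trans[OF inner[OF Pm Pb]], intro sum.cong refl) (simp add: ip)
  then show ?thesis by (simp only: cc S_def of_real_mult of_real_sum sum_distrib_left)
 qed
 have si: "set_integrable lborel ?I (%t. u t * cnj (v t))"
  if "u \<in> borel_measurable borel" "v \<in> borel_measurable borel" "!!t. t \<in> ?I ==> cmod (u t) <= K" "!!t. t \<in> ?I ==> cmod (v t) <= K'" for u v K K'
 proof (rule set_integrable_bounded_Icc[where B = "K * K'"])
  show "(%t. u t * cnj (v t)) \<in> borel_measurable borel"
  proof -
   note [measurable] = that(1,2)
   have [measurable]: "cnj \<in> borel_measurable borel" by (intro borel_measurable_continuous_onI continuous_intros)
   show ?thesis by measurable
  qed
  fix t assume t: "t \<in> ?I"
  show "norm (u t * cnj (v t)) <= K * K'"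
   unfolding norm_mult complex_mod_cnj
   by (rule mult_mono[OF that(3)[OF t] that(4)[OF t]]) (use order_trans[OF norm_ge_zero that(3)[OF t]] in auto)
 qed
 note i1 = si[OF gm gm gb gb] and i2 = si[OF gm Pm gb Pb] and i3 = si[OF Pm Pm Pb Pb]
 have re: "set_integrable lborel ?I (%t. Re (f t))" "(LINT t:?I|lborel. Re (f t)) = Re (LINT t:?I|lborel. f t)" if "set_integrable lborel ?I f" for f :: "real => complex"
 proof -
  have "integrable lborel (%t. Re (indicator ?I t *\<^sub>R f t))" "(LINT t|lborel. Re (indicator ?I t *\<^sub>R f t)) = Re (LINT t|lborel. indicator ?I t *\<^sub>R f t)"
   using that unfolding set_integrable_def by (intro integrable_Re, simp, intro integral_Re, simp)
  then show "set_integrable lborel ?I (%t. Re (f t))" "(LINT t:?I|lborel. Re (f t)) = Re (LINT t:?I|lborel. f t)"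
   by (simp_all add: set_integrable_def set_lebesgue_integral_def)
 qed
 have "0 <= (LINT t:?I|lborel. (cmod (g t - P t))\<^sup>2)"
  unfolding set_lebesgue_integral_def by (intro Bochner_Integration.integral_nonneg_AE) auto
 also have "(%t. (cmod (g t - P t))\<^sup>2) = (%t. Re (g t * cnj (g t)) - 2 * Re (g t * cnj (P t)) + Re (P t * cnj (P t)))"
  unfolding cmod_power2 by (rule ext) (simp add: power2_eq_square algebra_simps)
 also have "(LINT t:?I|lborel. Re (g t * cnj (g t)) - 2 * Re (g t * cnj (P t)) + Re (P t * cnj (P t))) = (LINT t:?I|lborel. Re (g t * cnj (g t))) - 2 * (LINT t:?I|lborel. Re (g t * cnj (P t))) + (LINT t:?I|lborel. Re (P t * cnj (P t)))"
  using re(1)[OF i1] set_integrable_mult_right[OF re(1)[OF i2], of 2] re(1)[OF i3]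
  by (simp only: set_integral_add(2) set_integral_diff set_integral_mult_right)
 also have "(LINT t:?I|lborel. Re (g t * cnj (P t))) = 2 * pi * S" by (simp only: re(2)[OF i2] gP Re_complex_of_real)
 also have "(LINT t:?I|lborel. Re (P t * cnj (P t))) = 2 * pi * S" by (simp only: re(2)[OF i3] PP Re_complex_of_real)
 also have "(LINT t:?I|lborel. Re (g t * cnj (g t))) <= (LINT t:?I|lborel. B\<^sup>2)"
 proof (rule set_integral_mono[OF re(1)[OF i1]])
  show "set_integrable lborel ?I (%t. B\<^sup>2)" by (rule set_integrable_bounded_Icc[where B = "B\<^sup>2"]) auto
  fix t assume "t \<in> ?I"
  then have "(cmod (g t))\<^sup>2 <= B\<^sup>2" using gb by (intro power_mono) auto
  moreover have "Re (g t * cnj (g t)) = (cmod (g t))\<^sup>2" unfolding cmod_power2 by (simp add: power2_eq_square)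
  ultimately show "Re (g t * cnj (g t)) <= B\<^sup>2" by simp
 qed
 also have "(LINT t:?I|lborel. B\<^sup>2) = 2 * pi * B\<^sup>2" by (simp add: set_lebesgue_integral_def)
 finally have "2 * pi * S <= 2 * pi * B\<^sup>2" by simp
 then show ?thesis unfolding S_def by simp
qed

text \<open>The Fourier coefficient of \<open>cis (\<theta> * t)\<close> on
  \<open>{- pi..pi}\<close>, that is
  \<open>sin (pi * (\<theta> - j)) / (pi * (\<theta> - j))\<close>, read as 1 when
  \<open>j = \<theta>\<close>.\<close>

definition sinc_coeff :: "real => int => complex" where
 "sinc_coeff \<theta> j = (LINT t:{- pi..pi}|lborel. cis ((\<theta> - of_int j) * t)) / (2 * of_real pi)"

lemma sinc_coeff_bound: "cmod (sinc_coeff \<theta> j) <= 1"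
proof -
 have "cmod (LINT t:{- pi..pi}|lborel. cis ((\<theta> - of_int j) * t)) <= (LINT t:{- pi..pi}|lborel. cmod (cis ((\<theta> - of_int j) * t)))"
  by (rule set_integral_norm_bound[OF set_integrable_cis_scaled])
 also have "... = 2 * pi" by (simp add: set_lebesgue_integral_def)
 finally show ?thesis by (simp add: sinc_coeff_def norm_divide divide_le_eq)
qed

text \<open>Pointwise convergence by Chernoff's argument: dividing by \<open>cis t - cis t0\<close> makes the partial sums telescope.\<close>

lemma sinc_partial_sums:
 assumes \<theta>: "\<bar>\<theta>\<bar> <= 1 / 2" and t0: "\<bar>t0\<bar> <= 1"
 shows "(%J::nat. \<Sum>j\<in>{- int J..int J}. sinc_coeff \<theta> j * cis (of_int j * t0)) \<longlonglongrightarrow> cis (\<theta> * t0)"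
  and "cmod (\<Sum>j\<in>{- int J..int J}. sinc_coeff \<theta> j * cis (of_int j * t0)) <= 5"
proof -
 let ?I = "{- pi..pi}"
 let ?z0 = "%t. cis (\<theta> * t) - cis (\<theta> * t0)"
 \<comment> \<open>The default value \<open>0 / 0 = 0\<close> at \<open>t0\<close> keeps
   \<open>g\<close> bounded there.\<close>
 define g where "g t = (?z0 t) / (cis t - cis t0)" for t
 have gm[measurable]: "g \<in> borel_measurable borel" unfolding g_def by measurable
 have den: "cmod (cis t - cis t0) >= \<bar>t - t0\<bar> / 4" if "t \<in> ?I" for t
 proof -
  have "pi <= 3.2" using pi_approx(2) by simp
  then have "t - t0 <= 4.2" "t0 - t <= 4.2" using that t0 by auto
  then have "\<bar>t - t0\<bar> <= 4.2" by linarith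
  then have "\<bar>(t - t0) / 2\<bar> <= 2.1" by simp
  from abs_sin_lower[OF this] show ?thesis by (simp add: cmod_cis_diff)
 qed
 have num: "cmod (?z0 t) <= \<bar>t - t0\<bar> / 2" for t
 proof -
  have "cmod (?z0 t) <= 2 * \<bar>(\<theta> * t - \<theta> * t0) / 2\<bar>"
   unfolding cmod_cis_diff by (intro mult_left_mono abs_sin_x_le_abs_x) auto
  also have "... = \<bar>\<theta>\<bar> * \<bar>t - t0\<bar>" by (simp add: abs_mult flip: right_diff_distrib)
  also have "... <= 1 / 2 * \<bar>t - t0\<bar>" using \<theta> by (intro mult_right_mono) auto
  finally show ?thesis by simp
 qed
 have ne: "cis t - cis t0 ~= 0" if "t \<in> ?I" "t ~= t0" for t
  using den[OF that(1)] that(2) by auto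
 have gb: "cmod (g t) <= 2" if "t \<in> ?I" for t
 proof (cases "t = t0")
  case False
  have "cmod (?z0 t) <= 2 * cmod (cis t - cis t0)" using num[of t] den[OF that] by linarith
  then show ?thesis using ne[OF that False] by (simp add: g_def norm_divide divide_le_eq)
 qed (simp add: g_def)
 define G where "G j = (LINT t:?I|lborel. g t * cis (- (of_int j * t))) / (2 * of_real pi)" for j :: int
 have Gsum: "(\<Sum>j\<in>A. (cmod (G j))\<^sup>2) <= 4" if "finite A" for A
  using bessel_inequality[OF gm gb that] by (simp add: G_def)
 have Gb: "cmod (G j) <= 2" for j
 proof -
  have "(cmod (G j))\<^sup>2 <= 2\<^sup>2" using Gsum[of "{j}"] by simp
  then show ?thesis by (rule power2_le_imp_le) simp
 qed
 have G0: "(%n. G (f n)) \<longlonglongrightarrow> 0" if f: "inj f" for f :: "nat => int"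
 proof -
  have "summable (%n. (cmod (G (f n)))\<^sup>2)"
  proof (rule summableI_nonneg_bounded)
   fix n
   have "(\<Sum>i<n. (cmod (G (f i)))\<^sup>2) = (\<Sum>j\<in>f ` {..<n}. (cmod (G j))\<^sup>2)"
    using f by (subst sum.reindex) (auto intro: inj_on_subset)
   also have "... <= 4" by (rule Gsum) simp
   finally show "(\<Sum>i<n. (cmod (G (f i)))\<^sup>2) <= 4" .
  qed simp
  then have "(%n. (cmod (G (f n)))\<^sup>2) \<longlonglongrightarrow> 0" by (rule summable_LIMSEQ_zero)
  then have "(%n. sqrt ((cmod (G (f n)))\<^sup>2)) \<longlonglongrightarrow> sqrt 0" by (rule tendsto_real_sqrt)
  then have "(%n. cmod (G (f n))) \<longlonglongrightarrow> 0" by simp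
  then show ?thesis by (rule tendsto_norm_zero_cancel)
 qed
 have si: "set_integrable lborel ?I (%t. g t * cis (c * t))" for c
  by (rule set_integrable_bounded_Icc[where B = 2]) (use gb in \<open>auto simp: norm_mult\<close>)
 let ?z1 = "%j. if j = 0 then cis (\<theta> * t0) else 0"
 \<comment> \<open>Fourier coefficients of the identity \<open>cis (\<theta> * t) - cis (\<theta> *
   t0) = g t * (cis t - cis t0)\<close>; multiplication by \<open>cis t\<close> shifts the index by
   one.\<close>
 have tel: "sinc_coeff \<theta> j - (?z1 j) = G (j - 1) - cis t0 * G j" for j
 proof -
  let ?z2 = "%j t. (\<theta> - of_int j) * t"
  let ?z5 = "%t lborel j. LINT t:?I|lborel. g t * cis (- of_int j * t)"
  let ?z6 = "%j t. - of_int (j - 1) * t"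
  have "(LINT t:?I|lborel. g t * cis (?z6 j t)) - cis t0 * (?z5 t lborel j)
   = (LINT t:?I|lborel. g t * cis (?z6 j t) - cis t0 * (g t * cis (- of_int j * t)))"
   unfolding set_integral_mult_right[symmetric] by (intro set_integral_diff(2)[symmetric] set_integrable_mult_right si)
  also have "... = (LINT t:?I|lborel. cis (?z2 j t) - cis (\<theta> * t0) * cis (of_int (- j) * t))"
   unfolding set_lebesgue_integral_def
  proof (rule integral_cong_AE)
   show "(%t. indicator ?I t *\<^sub>R (g t * cis (?z6 j t) - cis t0 * (g t * cis (- of_int j * t)))) \<in> borel_measurable lborel" by measurable
   show "(%t. indicator ?I t *\<^sub>R (cis (?z2 j t) - cis (\<theta> * t0) * cis (of_int (- j) * t))) \<in> borel_measurable lborel" by measurable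
   have "AE t in lborel. t ~= t0" by (rule AE_lborel_singleton)
   then show "AE t in lborel. indicator ?I t *\<^sub>R (g t * cis (?z6 j t) - cis t0 * (g t * cis (- of_int j * t))) = indicator ?I t *\<^sub>R (cis (?z2 j t) - cis (\<theta> * t0) * cis (of_int (- j) * t))"
   proof eventually_elim
    case (elim t)
    show ?case
    proof (cases "t \<in> ?I")
     case True
     have "cis (?z6 j t) = cis t * cis (- of_int j * t)" unfolding cis_mult by (simp add: algebra_simps)
     then have "g t * cis (?z6 j t) - cis t0 * (g t * cis (- of_int j * t)) = (g t * (cis t - cis t0)) * cis (- of_int j * t)"
      by (simp add: algebra_simps)
     also have "g t * (cis t - cis t0) = cis (\<theta> * t) - cis (\<theta> * t0)" using ne[OF True elim] by (simp add: g_def)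
     also have "(?z0 t) * cis (- of_int j * t) = cis (?z2 j t) - cis (\<theta> * t0) * cis (of_int (- j) * t)"
     proof -
      have "cis (?z2 j t) = cis (\<theta> * t) * cis (- of_int j * t)" unfolding cis_mult by (simp add: algebra_simps)
      then show ?thesis by (simp add: left_diff_distrib)
     qed
     finally show ?thesis by simp
    qed simp
   qed
  qed
  also have "... = (LINT t:?I|lborel. cis (?z2 j t)) - cis (\<theta> * t0) * (LINT t:?I|lborel. cis (of_int (- j) * t))"
   by (subst set_integral_diff(2)) (simp_all only: set_integral_mult_right set_integrable_cis_scaled set_integrable_mult_right)
  finally have "(LINT t:?I|lborel. g t * cis (?z6 j t)) - cis t0 * (?z5 t lborel j)
    = (LINT t:?I|lborel. cis (?z2 j t)) - cis (\<theta> * t0) * (if j = 0 then 2 * of_real pi else 0)"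
   unfolding integral_cis_int by simp
  then have eq: "((LINT t:?I|lborel. g t * cis (?z6 j t)) - cis t0 * (?z5 t lborel j)) / (2 * of_real pi)
    = ((LINT t:?I|lborel. cis (?z2 j t)) - cis (\<theta> * t0) * (if j = 0 then 2 * of_real pi else 0)) / (2 * of_real pi)"
   by (rule arg_cong)
  have Ge: "G j = (?z5 t lborel j) / (2 * of_real pi)" for j by (simp add: G_def)
  have "G (j - 1) - cis t0 * G j = ((LINT t:?I|lborel. g t * cis (?z6 j t)) - cis t0 * (?z5 t lborel j)) / (2 * of_real pi)"
   unfolding Ge by (simp only: diff_divide_distrib times_divide_eq_right)
  also note eq
  also have "((LINT t:?I|lborel. cis (?z2 j t)) - cis (\<theta> * t0) * (if j = 0 then 2 * of_real pi else 0)) / (2 * of_real pi) = sinc_coeff \<theta> j - (?z1 j)"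
   unfolding sinc_coeff_def by (cases "j = 0") (simp_all add: diff_divide_distrib)
  finally show ?thesis by simp
 qed
 let ?z3 = "%j J. \<Sum>j\<in>{- int J..int J}. sinc_coeff \<theta> j * cis (of_int j * t0)"
 let ?z4 = "%J. of_int (int J + 1) * t0"
 \<comment> \<open>After multiplication by \<open>cis (j * t0)\<close> the sum telescopes and only
   two boundary coefficients remain. They tend to zero, and \<open>1 + 2 + 2\<close> is the uniform
   bound.\<close>
 have sum_eq: "(?z3 j J) = cis (\<theta> * t0) + (G (- int J - 1) * cis (of_int (- int J) * t0) - G (int J) * cis (?z4 J))" for J
 proof -
  have "(?z3 j J) - cis (\<theta> * t0) = (\<Sum>j\<in>{- int J..int J}. (sinc_coeff \<theta> j - (?z1 j)) * cis (of_int j * t0))"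
  proof -
   have "(\<Sum>j\<in>{- int J..int J}. (?z1 j) * cis (of_int j * t0)) = (\<Sum>j\<in>{- int J..int J}. if j = 0 then cis (\<theta> * t0) else 0)"
    by (intro sum.cong) auto
   then show ?thesis by (simp add: left_diff_distrib sum_subtractf)
  qed
  also have "... = (\<Sum>j\<in>{- int J..int J}. G (j - 1) * cis (of_int j * t0) - G j * cis (of_int (j + 1) * t0))"
  proof (rule sum.cong[OF refl])
   fix j
   have "cis (of_int (j + 1) * t0) = cis t0 * cis (of_int j * t0)" unfolding cis_mult by (simp add: algebra_simps)
   then show "(sinc_coeff \<theta> j - (?z1 j)) * cis (of_int j * t0) = G (j - 1) * cis (of_int j * t0) - G j * cis (of_int (j + 1) * t0)"
    unfolding tel by (simp add: algebra_simps)
  qed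
  also have "... = G (- int J - 1) * cis (of_int (- int J) * t0) - G (int J) * cis (?z4 J)"
  proof (induction J)
   case (Suc J)
   have "{- int (Suc J)..int (Suc J)} = insert (- int J - 1) (insert (int J + 1) {- int J..int J})" by auto
   then have "(\<Sum>j\<in>{- int (Suc J)..int (Suc J)}. G (j - 1) * cis (of_int j * t0) - G j * cis (of_int (j + 1) * t0)) =
    (G (- int J - 1 - 1) * cis (of_int (- int J - 1) * t0) - G (- int J - 1) * cis (of_int (- int J - 1 + 1) * t0)) +
    ((G (int J + 1 - 1) * cis (?z4 J) - G (int J + 1) * cis (of_int (int J + 1 + 1) * t0)) +
    (\<Sum>j\<in>{- int J..int J}. G (j - 1) * cis (of_int j * t0) - G j * cis (of_int (j + 1) * t0)))"
    by simp
   also have "... = G (- int (Suc J) - 1) * cis (of_int (- int (Suc J)) * t0) - G (int (Suc J)) * cis (of_int (int (Suc J) + 1) * t0)"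
   proof -
    have e: "- int J - 1 = - int (Suc J)" "int J + 1 = int (Suc J)" by auto
    have e': "- int (Suc J) + 1 = - int J" by simp
    show ?thesis unfolding Suc.IH e e' by simp
   qed
   finally show ?case .
  qed simp
  finally show ?thesis by (simp add: algebra_simps)
 qed
 show "cmod (?z3 j J) <= 5"
 proof -
  have "cmod (G (- int J - 1) * cis (of_int (- int J) * t0) - G (int J) * cis (?z4 J)) <= 2 + 2"
   by (intro order_trans[OF norm_triangle_ineq4] add_mono) (simp_all only: norm_mult norm_cis mult_1_right Gb)
  moreover have "cmod (cis (\<theta> * t0)) = 1" by simp
  ultimately show ?thesis unfolding sum_eq using norm_triangle_ineq[of "cis (\<theta> * t0)" "G (- int J - 1) * cis (of_int (- int J) * t0) - G (int J) * cis (?z4 J)"]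
   by linarith
 qed
 have l1: "(%J::nat. G (- int J - 1) * cis (of_int (- int J) * t0)) \<longlonglongrightarrow> 0"
 proof (rule tendsto_norm_zero_cancel)
  have "(%J::nat. cmod (G (- int J - 1))) \<longlonglongrightarrow> 0" by (intro tendsto_norm_zero G0) (auto simp: inj_def)
  then show "(%J::nat. cmod (G (- int J - 1) * cis (of_int (- int J) * t0))) \<longlonglongrightarrow> 0" by (simp add: norm_mult)
 qed
 have l2: "(%J::nat. G (int J) * cis (?z4 J)) \<longlonglongrightarrow> 0"
 proof (rule tendsto_norm_zero_cancel)
  have "(%J::nat. cmod (G (int J))) \<longlonglongrightarrow> 0" by (intro tendsto_norm_zero G0) (auto simp: inj_def)
  then show "(%J::nat. cmod (G (int J) * cis (?z4 J))) \<longlonglongrightarrow> 0" by (simp add: norm_mult)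
 qed
 show "(%J::nat. \<Sum>j\<in>{- int J..int J}. sinc_coeff \<theta> j * cis (of_int j * t0)) \<longlonglongrightarrow> cis (\<theta> * t0)"
  unfolding sum_eq using tendsto_add[OF tendsto_const[of "cis (\<theta> * t0)"] tendsto_diff[OF l1 l2]] by simp
qed

lemma avg_exp_cis: "avg_exp \<delta> \<theta> = (LINT u:{0..\<delta>}|lborel. cis (- (\<theta> * u))) / of_real \<delta>"
 by (simp add: avg_exp_def cis_conv_exp)

text \<open>Averaging over a window of length \<open>\<delta>\<close> multiplies every exponential by \<^term>\<open>avg_exp\<close>, which improves the decay of the coefficients.\<close>

lemma averaged_partial_sums:
 assumes \<theta>: "\<bar>\<theta>\<bar> <= 1 / 2" and \<delta>: "\<delta> > 0" and t: "- 1 + real p * \<delta> <= t" "t <= 1"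
 shows "(%J::nat. \<Sum>j\<in>{- int J..int J}. sinc_coeff \<theta> j * avg_exp \<delta> (of_int j) ^ p * cis (of_int j * t)) \<longlonglongrightarrow> avg_exp \<delta> \<theta> ^ p * cis (\<theta> * t)"
  and "cmod (\<Sum>j\<in>{- int J..int J}. sinc_coeff \<theta> j * avg_exp \<delta> (of_int j) ^ p * cis (of_int j * t)) <= 5"
proof -
 define S where "S p J t = (\<Sum>j\<in>{- int J..int J}. sinc_coeff \<theta> j * avg_exp \<delta> (of_int j) ^ p * cis (of_int j * t))" for p J t
 have Sm[measurable]: "S p J \<in> borel_measurable borel" for p J unfolding S_def by measurable
 have sh: "(LINT u:{0..\<delta>}|lborel. cis (c * (t - u))) = of_real \<delta> * (avg_exp \<delta> c * cis (c * t))" for c t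
 proof -
  have "(LINT u:{0..\<delta>}|lborel. cis (c * (t - u))) = (LINT u:{0..\<delta>}|lborel. cis (c * t) * cis (- (c * u)))"
   unfolding cis_mult by (simp add: right_diff_distrib)
  then show ?thesis using \<delta> by (simp add: avg_exp_cis)
 qed
 have sic: "set_integrable lborel {0..\<delta>} (%u. cis (c * (t - u)))" for c t by (rule set_integrable_bounded_Icc[where B = 1]) auto
 \<comment> \<open>Averaging the partial sums over \<open>t - u\<close> inserts one more factor
   \<open>avg_exp\<close> in every term.\<close>
 have step: "of_real \<delta> * S (Suc p) J t = (LINT u:{0..\<delta>}|lborel. S p J (t - u))" for p J t
 proof -
  have "(LINT u:{0..\<delta>}|lborel. S p J (t - u)) = (\<Sum>j\<in>{- int J..int J}. (LINT u:{0..\<delta>}|lborel. (sinc_coeff \<theta> j * avg_exp \<delta> (of_int j) ^ p) * cis (of_int j * (t - u))))"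
   unfolding S_def by (intro set_integral_sum set_integrable_mult_right sic)
  also have "... = of_real \<delta> * S (Suc p) J t"
   unfolding S_def sum_distrib_left by (intro sum.cong refl) (simp add: sh)
  finally show ?thesis by simp
 qed
 have "(\<forall>J. cmod (S p J t) <= 5) \<and> (%J. S p J t) \<longlonglongrightarrow> avg_exp \<delta> \<theta> ^ p * cis (\<theta> * t)"
  if "- 1 + real p * \<delta> <= t" "t <= 1" for p t
  using that
 proof (induction p arbitrary: t)
  case 0
  then have "\<bar>t\<bar> <= 1" by auto
  then show ?case using sinc_partial_sums[OF \<theta>, of t] by (simp add: S_def)
 next
  case (Suc p)
  \<comment> \<open>Averaging looks back by up to \<open>\<delta>\<close>, so each round shortens
    the interval of validity at its left end.\<close>
  have tu: "- 1 + real p * \<delta> <= t - u" "t - u <= 1" if "u \<in> {0..\<delta>}" for u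
   using Suc.prems that by (auto simp: algebra_simps)
  note IH = Suc.IH[OF tu]
  have si: "set_integrable lborel {0..\<delta>} (%u. S p J (t - u))" for J
   by (rule set_integrable_bounded_Icc[where B = 5]) (use IH in auto)
  have b: "cmod (S (Suc p) J t) <= 5" for J
  proof -
   have "\<delta> * cmod (S (Suc p) J t) = cmod (LINT u:{0..\<delta>}|lborel. S p J (t - u))"
    unfolding step[symmetric] norm_mult using \<delta> by simp
   also have "... <= (LINT u:{0..\<delta>}|lborel. cmod (S p J (t - u)))" by (rule set_integral_norm_bound[OF si])
   also have "... <= (LINT u:{0..\<delta>}|lborel. 5)"
    by (rule set_integral_mono[OF set_integrable_norm[OF si]]) (use IH in \<open>auto intro: set_integrable_bounded_Icc[where B = 5]\<close>)
   also have "... = \<delta> * 5" using \<delta> by (simp add: set_lebesgue_integral_def)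
   finally show ?thesis using \<delta> by simp
  qed
  let ?z0 = "%u. avg_exp \<delta> \<theta> ^ p * cis (\<theta> * (t - u))"
  have "(%J. LINT u|lborel. indicator {0..\<delta>} u *\<^sub>R S p J (t - u)) \<longlonglongrightarrow> (LINT u|lborel. indicator {0..\<delta>} u *\<^sub>R (?z0 u))"
  proof (rule integral_dominated_convergence[where w = "%u. indicator {0..\<delta>} u * 5"])
   show "integrable lborel (%u. indicator {0..\<delta>} u * 5 :: real)"
    by (intro integrable_mult_left integrable_real_indicator) (auto simp: emeasure_lborel_Icc_eq)
   show "AE u in lborel. (%J. indicator {0..\<delta>} u *\<^sub>R S p J (t - u)) \<longlonglongrightarrow> indicator {0..\<delta>} u *\<^sub>R (?z0 u)"
   proof (rule AE_I2)
    fix u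
    show "(%J. indicator {0..\<delta>} u *\<^sub>R S p J (t - u)) \<longlonglongrightarrow> indicator {0..\<delta>} u *\<^sub>R (?z0 u)"
     by (cases "u \<in> {0..\<delta>}") (use IH[of u] in simp_all)
   qed
   show "AE u in lborel. norm (indicator {0..\<delta>} u *\<^sub>R S p J (t - u)) <= indicator {0..\<delta>} u * 5" for J
    using IH by (intro AE_I2) (auto simp: indicator_def)
  qed measurable
  then have "(%J. of_real \<delta> * S (Suc p) J t) \<longlonglongrightarrow> of_real \<delta> * (avg_exp \<delta> \<theta> ^ Suc p * cis (\<theta> * t))"
  proof -
   have "(LINT u|lborel. indicator {0..\<delta>} u *\<^sub>R (?z0 u)) = avg_exp \<delta> \<theta> ^ p * (LINT u:{0..\<delta>}|lborel. cis (\<theta> * (t - u)))"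
    by (simp flip: set_lebesgue_integral_def)
   also have "... = of_real \<delta> * (avg_exp \<delta> \<theta> ^ Suc p * cis (\<theta> * t))" by (simp add: sh)
   finally show ?thesis
    using \<open>(%J. LINT u|lborel. indicator {0..\<delta>} u *\<^sub>R S p J (t - u)) \<longlonglongrightarrow> (LINT u|lborel. indicator {0..\<delta>} u *\<^sub>R (avg_exp \<delta> \<theta> ^ p * cis (\<theta> * (t - u))))\<close>
    unfolding step set_lebesgue_integral_def by simp
  qed
  from tendsto_divide[OF this tendsto_const[of "of_real \<delta>"]] b \<delta> show ?case by simp
 qed
 from this[OF t] show "(%J::nat. \<Sum>j\<in>{- int J..int J}. sinc_coeff \<theta> j * avg_exp \<delta> (of_int j) ^ p * cis (of_int j * t)) \<longlonglongrightarrow> avg_exp \<delta> \<theta> ^ p * cis (\<theta> * t)"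
  and "cmod (\<Sum>j\<in>{- int J..int J}. sinc_coeff \<theta> j * avg_exp \<delta> (of_int j) ^ p * cis (of_int j * t)) <= 5"
  by (auto simp: S_def)
qed

lemma avg_exp_int_bound:
 assumes \<delta>: "\<delta> > 0"
 shows "cmod (avg_exp \<delta> c) <= 1" and "c ~= 0 ==> cmod (avg_exp \<delta> c) <= 2 / (\<delta> * \<bar>c\<bar>)"
proof -
 have "set_integrable lborel {0..\<delta>} (%u. cis (- (c * u)))" by (rule set_integrable_bounded_Icc[where B = 1]) auto
 then have "cmod (LINT u:{0..\<delta>}|lborel. cis (- (c * u))) <= (LINT u:{0..\<delta>}|lborel. cmod (cis (- (c * u))))"
  by (rule set_integral_norm_bound)
 also have "... = \<delta>" using \<delta> by (simp add: set_lebesgue_integral_def)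
 finally show "cmod (avg_exp \<delta> c) <= 1" using \<delta> by (simp add: avg_exp_cis norm_divide)
 assume c: "c ~= 0"
 have "avg_exp \<delta> c = (cis (- c * \<delta>) - cis (- c * 0)) / (\<i> * of_real (- c)) / of_real \<delta>"
  using integral_cis_scaled[of "- c" 0 \<delta>] c \<delta> by (simp add: avg_exp_cis)
 then have "cmod (avg_exp \<delta> c) = cmod (cis (- c * \<delta>) - cis (- c * 0)) / (\<delta> * \<bar>c\<bar>)"
  using \<delta> by (simp add: norm_divide norm_mult mult.commute)
 also have "... <= 2 / (\<delta> * \<bar>c\<bar>)"
  using \<delta> norm_triangle_ineq4[of "cis (- c * \<delta>)" "cis (- c * 0)"] by (intro divide_right_mono) auto
 finally show "cmod (avg_exp \<delta> c) <= 2 / (\<delta> * \<bar>c\<bar>)" .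
qed

lemma avg_exp_measurable [measurable]: "avg_exp \<delta> \<in> borel_measurable borel"
 unfolding avg_exp_cis[abs_def] set_lebesgue_integral_def by measurable

text \<open>The coefficient of \<open>cis (j * t)\<close> in the expansion of
  \<open>cis (\<eta> * t)\<close> on \<open>{0..1}\<close>: \<nu> is an integer nearest to \<eta>,
  and dividing by the multiplier at \<open>\<eta> - \<nu>\<close> undoes the averaging. With
  \<open>\<delta> = 1 / p\<close> the \<open>p\<close> averagings use up exactly the part
  \<open>{- 1..0}\<close> of the interval \<open>{- 1..1}\<close> of
  \<open>sinc_partial_sums\<close>.\<close>

definition frame_coeff :: "nat => real => int => complex" where
 "frame_coeff p \<eta> j = (let \<nu> = \<lfloor>\<eta> + 1 / 2\<rfloor>; \<delta> = 1 / real p in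
   sinc_coeff (\<eta> - of_int \<nu>) (j - \<nu>) * (avg_exp \<delta> (of_int (j - \<nu>)) / avg_exp \<delta> (\<eta> - of_int \<nu>)) ^ p)"

lemma frame_coeff_measurable [measurable]: "(%\<eta>. frame_coeff p \<eta> j) \<in> borel_measurable borel"
proof -
 let ?n = "%\<eta>::real. \<lfloor>\<eta> + 1 / 2\<rfloor>"
 have n: "?n \<in> measurable borel (count_space UNIV)"
  by (rule measurable_compose[OF _ measurable_real_floor]) simp
 have f: "(%\<eta>. \<eta> - real_of_int (?n \<eta>)) \<in> borel_measurable borel"
  by (intro borel_measurable_diff measurable_compose[OF _ borel_measurable_real_floor]) simp_all
 have s: "(%\<theta>. sinc_coeff \<theta> i) \<in> borel_measurable borel" for i
  unfolding sinc_coeff_def set_lebesgue_integral_def by measurable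
 have 1: "(%\<eta>. sinc_coeff (\<eta> - of_int (?n \<eta>)) (j - ?n \<eta>)) \<in> borel_measurable borel"
  by (rule measurable_compose_countable[where f = "%\<nu> \<eta>. sinc_coeff (\<eta> - of_int (?n \<eta>)) (j - \<nu>)", OF _ n]) (rule measurable_compose[OF f s])
 have 2: "(%\<eta>. avg_exp \<delta> (of_int (j - ?n \<eta>))) \<in> borel_measurable borel" for \<delta>
  by (rule measurable_compose[OF n]) simp
 show ?thesis unfolding frame_coeff_def Let_def
  by (intro borel_measurable_times borel_measurable_power borel_measurable_divide 1 2 measurable_compose[OF f avg_exp_measurable])
qed

abbreviation inv_sq :: "int => real" where
 "inv_sq j \<equiv> 1 / (1 + \<bar>of_int j\<bar>)\<^sup>2"

text \<open>With \<open>m = 1 + \<bar>j - \<nu>\<bar>\<close>, each factor of the averaging quotient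
  is at most \<open>8 * p / m\<close>: the numerator is at most \<open>4 * p / m\<close>, the
  denominator at least 1/2. As \<open>p >= s + 2\<close>, the weight \<open>m powr s\<close> still
  leaves the summable \<open>1 / m^2\<close>.\<close>

lemma frame_coeff_bound:
 assumes p: "real p >= s + 2" "s >= 0"
 shows "cmod (frame_coeff p \<eta> j) * (1 + \<bar>of_int j - \<eta>\<bar>) powr s <= (8 * real p) ^ p * (inv_sq (j - \<lfloor>\<eta> + 1 / 2\<rfloor>)) * 2 powr s"
proof -
 define \<nu> where "\<nu> = \<lfloor>\<eta> + 1 / 2\<rfloor>"
 define \<theta> where "\<theta> = \<eta> - of_int \<nu>"
 define l where "l = j - \<nu>"
 define \<delta> where "\<delta> = 1 / real p"
 have p2: "real p >= 2" "p >= 1" using p by auto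
 then have \<delta>: "\<delta> > 0" "\<delta> <= 1" by (auto simp: \<delta>_def)
 have \<theta>: "\<bar>\<theta>\<bar> <= 1 / 2" unfolding \<theta>_def \<nu>_def by linarith
 define m where "m = 1 + \<bar>of_int l :: real\<bar>"
 have m: "m >= 1" by (simp add: m_def)
 have "\<bar>\<theta>\<bar> * \<delta> <= 1 * 1" using \<theta> \<delta> by (intro mult_mono) auto
 then have low: "cmod (avg_exp \<delta> \<theta>) >= 1 / 2" using \<delta> by (intro avg_exp_lower) auto
 have "cmod (avg_exp \<delta> (of_int l)) <= 4 * real p / m"
 proof (cases "l = 0")
  case True
  then show ?thesis using avg_exp_int_bound(1)[OF \<delta>(1), of 0] p2 by (simp add: m_def)
 next
  case False
  then have l1: "1 <= \<bar>of_int l :: real\<bar>" by linarith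
  have "cmod (avg_exp \<delta> (of_int l)) <= 2 / (\<delta> * \<bar>of_int l\<bar>)" using avg_exp_int_bound(2)[OF \<delta>(1), of "of_int l"] False by simp
  also have "... = 2 * real p / \<bar>of_int l\<bar>" using p2 by (simp add: \<delta>_def)
  also have "... <= 4 * real p / m"
   using l1 p2 by (simp add: m_def divide_simps)
  finally show ?thesis .
 qed
 then have "cmod (avg_exp \<delta> (of_int l) / avg_exp \<delta> \<theta>) <= (4 * real p / m) / (1 / 2)"
  unfolding norm_divide using low m by (intro frac_le) auto
 then have "cmod (avg_exp \<delta> (of_int l) / avg_exp \<delta> \<theta>) ^ p <= (8 * real p / m) ^ p" by (intro power_mono) auto
 then have c: "cmod (frame_coeff p \<eta> j) <= 1 * (8 * real p / m) ^ p"
  unfolding frame_coeff_def Let_def \<nu>_def[symmetric] \<theta>_def[symmetric] l_def[symmetric] \<delta>_def[symmetric] norm_mult norm_power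
  by (intro mult_mono sinc_coeff_bound) auto
 have "1 + \<bar>of_int j - \<eta>\<bar> <= 2 * m" using \<theta> unfolding m_def l_def \<theta>_def by (auto simp: abs_if split: if_splits)
 then have "(1 + \<bar>of_int j - \<eta>\<bar>) powr s <= (2 * m) powr s" by (rule powr_mono2[OF p(2), rotated]) simp
 also have "... = 2 powr s * m powr s" by (rule powr_mult)
 finally have w: "(1 + \<bar>of_int j - \<eta>\<bar>) powr s <= 2 powr s * m powr s" .
 have "cmod (frame_coeff p \<eta> j) * (1 + \<bar>of_int j - \<eta>\<bar>) powr s <= (1 * (8 * real p / m) ^ p) * (2 powr s * m powr s)"
  using m by (intro mult_mono c w) auto
 also have "... = (8 * real p) ^ p * (m powr s / m ^ p) * 2 powr s" by (simp add: power_divide)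
 also have "m powr s / m ^ p = m powr (s - real p)" using m by (simp add: powr_diff powr_realpow)
 also have "(8 * real p) ^ p * m powr (s - real p) * 2 powr s <= (8 * real p) ^ p * m powr (- 2) * 2 powr s"
  using p m by (intro mult_right_mono mult_left_mono powr_mono) auto
 also have "m powr (- 2) = 1 / m\<^sup>2"
  using m powr_realpow[of m 2] by (simp add: powr_minus divide_inverse)
 finally show ?thesis unfolding m_def l_def \<nu>_def .
qed

section \<open>Summation over the integers\<close>

lemma nn_integral_count_space_int_shift:
 fixes f :: "int => ennreal"
 shows "(\<integral>\<^sup>+j. f (j - k) \<partial>count_space UNIV) = (\<integral>\<^sup>+j. f j \<partial>count_space UNIV)"
proof -
 have "bij_betw (%j. j - k) UNIV UNIV" by (rule bij_betw_byWitness[where f' = "%j. j + k"]) auto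
 then show ?thesis by (rule nn_integral_bij_count_space)
qed

lemma finite_sum_inverse_square_int: "(\<integral>\<^sup>+j. ennreal (inv_sq j) \<partial>count_space (UNIV :: int set)) < \<infinity>"
proof -
 have s: "summable (%n. 1 / (1 + real n)\<^sup>2)"
  using summable_Suc_iff[of "%n. inverse (real n ^ 2)"] inverse_power_summable[of 2, where 'a = real] by (simp add: divide_inverse add.commute)
 let ?z0 = "%j. \<integral>\<^sup>+j. ennreal (1 / (1 + real j)\<^sup>2) \<partial>count_space (UNIV :: nat set)"
 have h: "(?z0 j) < \<infinity>"
  unfolding nn_integral_count_space_nat by (subst suminf_ennreal2[OF _ s]) simp_all
 let ?z1 = "%n. %n. - int n"
 have U: "(UNIV :: int set) = range int \<union> range (?z1 n)"
 proof -
  have "j \<in> range int \<union> range (?z1 n)" for j :: int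
  proof (cases j rule: int_cases2)
   case (nonneg n)
   then show ?thesis by (intro UnI1 image_eqI[of _ _ n]) simp_all
  next
   case (nonpos n)
   then show ?thesis by (intro UnI2 image_eqI[of _ _ n]) simp_all
  qed
  then show ?thesis by (intro equalityI subsetI UNIV_I)
 qed
 have img: "(\<integral>\<^sup>+j. ennreal (inv_sq j) \<partial>count_space (range f)) = (?z0 j)"
  if "inj f" "!!n. \<bar>f n\<bar> = int n" for f :: "nat => int"
 proof -
  have "bij_betw f UNIV (range f)" by (rule inj_on_imp_bij_betw[OF that(1)])
  from nn_integral_bij_count_space[OF this, of "%j. ennreal (inv_sq j)"]
  have "(\<integral>\<^sup>+j. ennreal (inv_sq j) \<partial>count_space (range f)) = (\<integral>\<^sup>+n. ennreal (1 / (1 + \<bar>of_int (f n)\<bar>)\<^sup>2) \<partial>count_space UNIV)" by (rule sym)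
  also have "(%n. \<bar>of_int (f n)\<bar>) = real"
  proof
   fix n
   have "real_of_int \<bar>f n\<bar> = real n" by (simp only: that(2) of_int_of_nat_eq)
   then show "\<bar>of_int (f n)\<bar> = real n" by simp
  qed
  finally show ?thesis .
 qed
 have i2: "(\<integral>\<^sup>+j. ennreal (inv_sq j) \<partial>count_space (range (?z1 n))) = (?z0 j)"
  by (rule img) (simp_all add: inj_def)
 have "(\<integral>\<^sup>+j. ennreal (inv_sq j) \<partial>count_space (UNIV :: int set)) <=
  (\<integral>\<^sup>+j. ennreal (inv_sq j) * indicator (range int) j + ennreal (inv_sq j) * indicator (range (?z1 n)) j \<partial>count_space UNIV)"
 proof (rule nn_integral_mono)
  fix j :: int
  have "j \<in> range int \<or> j \<in> range (?z1 n)" using UNIV_I[of j] unfolding U Un_iff .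
  then show "ennreal (inv_sq j) <= ennreal (inv_sq j) * indicator (range int) j + ennreal (inv_sq j) * indicator (range (?z1 n)) j"
  proof
   assume "j \<in> range int"
   then have "indicator (range int) j = (1 :: ennreal)" by (rule indicator_simps)
   then show ?thesis by (simp only: mult_1_right) (rule add_increasing2, simp_all)
  next
   assume "j \<in> range (?z1 n)"
   then have "indicator (range (?z1 n)) j = (1 :: ennreal)" by (rule indicator_simps)
   then show ?thesis by (simp only: mult_1_right) (rule add_increasing, simp_all)
  qed
 qed
 also have "... = (\<integral>\<^sup>+j. ennreal (inv_sq j) \<partial>count_space (range int)) + (\<integral>\<^sup>+j. ennreal (inv_sq j) \<partial>count_space (range (?z1 n)))"
  unfolding nn_integral_count_space_indicator[unfolded NO_MATCH_def, OF TrueI, of "range int"] nn_integral_count_space_indicator[unfolded NO_MATCH_def, OF TrueI, of "range (?z1 n)"]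
  by (rule nn_integral_add) simp_all
 also have "... < \<infinity>" unfolding img[of int, OF inj_on_of_nat abs_of_nat] using h i2 by simp
 finally show ?thesis .
qed

text \<open>Shifting by the nearest integer reduces to \<open>averaged_partial_sums\<close> with
  \<open>\<bar>\<theta>\<bar> <= 1/2\<close>. That lemma speaks of symmetric partial sums; the
  absolute summability from \<open>frame_coeff_bound\<close> identifies their limit with the
  integral over the counting measure.\<close>

lemma exponential_frame:
 fixes s :: real
 assumes s: "s >= 0"
 shows "\<exists>p K. K >= 0 \<and> (\<forall>\<eta>. (\<integral>\<^sup>+j. ennreal (cmod (frame_coeff p \<eta> j) * (1 + \<bar>of_int j - \<eta>\<bar>) powr s) \<partial>count_space UNIV) <= ennreal K) \<and>
   (\<forall>\<eta> t. 0 <= t --> t <= 1 --> integrable (count_space UNIV) (frame_coeff p \<eta>) \<and>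
    (LINT j|count_space UNIV. frame_coeff p \<eta> j * cis (of_int j * t)) = cis (\<eta> * t))"
proof -
 define p where "p = nat \<lceil>s + 2\<rceil>"
 have p: "real p >= s + 2" unfolding p_def by linarith
 have p1: "p >= 1" using p s by linarith
 define \<Sigma> where "\<Sigma> = (\<integral>\<^sup>+j. ennreal (inv_sq j) \<partial>count_space (UNIV :: int set))"
 have \<Sigma>: "\<Sigma> < \<infinity>" unfolding \<Sigma>_def by (rule finite_sum_inverse_square_int)
 define K where "K = (8 * real p) ^ p * 2 powr s * enn2real \<Sigma>"
 have K: "K >= 0" by (simp add: K_def)
 let ?z1 = "%\<eta> j. cmod (frame_coeff p \<eta> j) * (1 + \<bar>of_int j - \<eta>\<bar>) powr s"
 let ?z4 = "%j \<eta>. \<integral>\<^sup>+j. ennreal (?z1 \<eta> j) \<partial>count_space UNIV"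
 have bd: "(?z4 j \<eta>) <= ennreal K" for \<eta>
 proof -
  let ?z2 = "%j. inv_sq (j - \<lfloor>\<eta> + 1 / 2\<rfloor>)"
  let ?z3 = "(8 * real p) ^ p * 2 powr s"
  have "(?z4 j \<eta>)
    <= (\<integral>\<^sup>+j. ennreal ?z3 * ennreal (?z2 j) \<partial>count_space UNIV)"
  proof (rule nn_integral_mono)
   fix j
   have "ennreal (?z1 \<eta> j) <= ennreal ((8 * real p) ^ p * (?z2 j) * 2 powr s)"
    by (intro ennreal_leI frame_coeff_bound p s)
   also have "... = ennreal ?z3 * ennreal (?z2 j)"
    by (subst ennreal_mult[symmetric]) (simp_all add: mult_ac)
   finally show "ennreal (?z1 \<eta> j) <= ennreal ?z3 * ennreal (?z2 j)" .
  qed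
  also have "... = ennreal ?z3 * \<Sigma>"
   unfolding \<Sigma>_def using nn_integral_count_space_int_shift[of "%j. ennreal (inv_sq j)"] by (subst nn_integral_cmult) simp_all
  also have "\<Sigma> = ennreal (enn2real \<Sigma>)" using \<Sigma> by simp
  also have "ennreal ?z3 * ennreal (enn2real \<Sigma>) = ennreal K"
   unfolding K_def by (rule ennreal_mult[symmetric]) simp_all
  finally show ?thesis .
 qed
 have int: "integrable (count_space UNIV) (frame_coeff p \<eta>)" for \<eta>
 proof (rule integrableI_bounded)
  have "(\<integral>\<^sup>+j. ennreal (cmod (frame_coeff p \<eta> j)) \<partial>count_space UNIV) <= (?z4 j \<eta>)"
  proof (intro nn_integral_mono ennreal_leI)
   fix j :: int
   have "1 <= (1 + \<bar>of_int j - \<eta>\<bar>) powr s" using s by (intro ge_one_powr_ge_zero) auto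
   then show "cmod (frame_coeff p \<eta> j) <= cmod (frame_coeff p \<eta> j) * (1 + \<bar>of_int j - \<eta>\<bar>) powr s"
    using mult_left_mono[of 1 _ "cmod (frame_coeff p \<eta> j)"] by simp
  qed
  also note bd[of \<eta>]
  also have "ennreal K < \<infinity>" by simp
  finally show "(\<integral>\<^sup>+j. ennreal (cmod (frame_coeff p \<eta> j)) \<partial>count_space UNIV) < \<infinity>" .
 qed simp
 have rep: "(LINT j|count_space UNIV. frame_coeff p \<eta> j * cis (of_int j * t)) = cis (\<eta> * t)" if t: "0 <= t" "t <= 1" for \<eta> t
 proof -
  define \<nu> where "\<nu> = \<lfloor>\<eta> + 1 / 2\<rfloor>"
  define \<theta> where "\<theta> = \<eta> - of_int \<nu>"
  define \<delta> where "\<delta> = 1 / real p"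
  have \<delta>: "\<delta> > 0" "\<delta> <= 1" "real p * \<delta> = 1" using p1 by (auto simp: \<delta>_def)
  have \<theta>: "\<bar>\<theta>\<bar> <= 1 / 2" unfolding \<theta>_def \<nu>_def by linarith
  have "\<bar>\<theta>\<bar> * \<delta> <= 1 * 1" using \<theta> \<delta> by (intro mult_mono) auto
  then have "cmod (avg_exp \<delta> \<theta>) >= 1 / 2" using \<delta> by (intro avg_exp_lower) auto
  then have a0: "avg_exp \<delta> \<theta> ~= 0" by auto
  let ?f = "%j. frame_coeff p \<eta> j * cis (of_int j * t)"
  have fi: "integrable (count_space UNIV) ?f"
   by (rule Bochner_Integration.integrable_bound[OF int[of \<eta>]]) (auto simp: norm_mult)
  define A where "A J = {\<nu> - int J..\<nu> + int J}" for J
  have lim1: "(%J. LINT j|count_space UNIV. indicator (A J) j *\<^sub>R ?f j) \<longlonglongrightarrow> (LINT j|count_space UNIV. ?f j)"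
  proof (rule integral_dominated_convergence[where w = "%j. norm (?f j)"])
   show "AE j in count_space UNIV. (%J. indicator (A J) j *\<^sub>R ?f j) \<longlonglongrightarrow> ?f j"
   proof (rule AE_I2, rule tendsto_eventually)
    fix j
    show "\<forall>\<^sub>F J in sequentially. indicator (A J) j *\<^sub>R ?f j = ?f j"
     using eventually_ge_at_top[of "nat \<bar>j - \<nu>\<bar>"] by eventually_elim (auto simp: A_def indicator_def)
   qed
  qed (use fi in \<open>auto simp: indicator_def\<close>)
  let ?z0 = "cis (of_int \<nu> * t) / avg_exp \<delta> \<theta> ^ p"
  have eqJ: "(LINT j|count_space UNIV. indicator (A J) j *\<^sub>R ?f j) = (\<Sum>j\<in>{- int J..int J}. sinc_coeff \<theta> j * avg_exp \<delta> (of_int j) ^ p * cis (of_int j * t)) * ?z0" for J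
  proof -
   have "(LINT j|count_space UNIV. indicator (A J) j *\<^sub>R ?f j) = (\<Sum>j\<in>A J. ?f j)"
   proof (subst lebesgue_integral_count_space_finite_support)
    show "finite {j \<in> UNIV. indicator (A J) j *\<^sub>R ?f j ~= 0}"
     by (rule finite_subset[of _ "A J"]) (auto simp: A_def indicator_def split: if_splits)
    show "(\<Sum>j | j \<in> UNIV \<and> indicator (A J) j *\<^sub>R ?f j ~= 0. indicator (A J) j *\<^sub>R ?f j) = (\<Sum>j\<in>A J. ?f j)"
     by (rule sum.mono_neutral_cong_left) (auto simp: A_def indicator_def split: if_splits)
   qed
   also have "... = (\<Sum>j\<in>{- int J..int J}. ?f (j + \<nu>))"
    by (rule sum.reindex_bij_witness[where i = "%j. j + \<nu>" and j = "%j. j - \<nu>"]) (auto simp: A_def)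
   also have "... = (\<Sum>j\<in>{- int J..int J}. sinc_coeff \<theta> j * avg_exp \<delta> (of_int j) ^ p * cis (of_int j * t) * ?z0)"
   proof (rule sum.cong[OF refl])
    fix j
    have "cis (of_int (j + \<nu>) * t) = cis (of_int j * t) * cis (of_int \<nu> * t)" unfolding cis_mult by (simp add: algebra_simps)
    then show "?f (j + \<nu>) = sinc_coeff \<theta> j * avg_exp \<delta> (of_int j) ^ p * cis (of_int j * t) * ?z0"
     unfolding frame_coeff_def Let_def \<nu>_def[symmetric] \<theta>_def[symmetric] \<delta>_def[symmetric] by (simp add: power_divide)
   qed
   finally show ?thesis by (simp only: sum_distrib_right)
  qed
  have lim2: "(%J. (\<Sum>j\<in>{- int J..int J}. sinc_coeff \<theta> j * avg_exp \<delta> (of_int j) ^ p * cis (of_int j * t)) * ?z0) \<longlonglongrightarrow> (avg_exp \<delta> \<theta> ^ p * cis (\<theta> * t)) * ?z0"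
   by (intro tendsto_mult tendsto_const averaged_partial_sums(1) \<theta> \<delta>(1)) (use \<delta>(3) t in auto)
  have "(LINT j|count_space UNIV. ?f j) = (avg_exp \<delta> \<theta> ^ p * cis (\<theta> * t)) * ?z0"
   by (rule LIMSEQ_unique[OF lim1[unfolded eqJ] lim2])
  also have "... = cis (\<theta> * t) * cis (of_int \<nu> * t)" using a0 by simp
  also have "... = cis (\<eta> * t)" unfolding cis_mult by (simp add: \<theta>_def algebra_simps)
  finally show ?thesis .
 qed
 show ?thesis using K bd int rep by (intro exI[of _ p] exI[of _ K] conjI allI impI)
qed

section \<open>Tensor products: from the interval to the cube\<close>

definition lattice_vec :: "('n => int) => real ^ 'n" where
 "lattice_vec \<nu> = (\<chi> l. of_int (\<nu> l))"

abbreviation lattice_wt :: "('n::finite => int) => real" where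
 "lattice_wt \<nu> \<equiv> 1 + norm (lattice_vec \<nu>)"

abbreviation lattice_series :: "(('n::finite => int) => complex) => real ^ 'n => complex" where
 "lattice_series a x \<equiv> (LINT \<nu>|count_space UNIV. a \<nu> * cis (lattice_vec \<nu> \<bullet> x))"

abbreviation lattice_norm :: "real => (('n::finite => int) => complex) => ennreal" where
 "lattice_norm s a \<equiv> (\<integral>\<^sup>+\<nu>. ennreal (cmod (a \<nu>) * lattice_wt \<nu> powr s) \<partial>count_space UNIV)"

text \<open>The factor \<open>2 * pi\<close> translates the convention of \<open>fourier\<close>
  into that of the integer frequencies.\<close>

definition frame_coeffs :: "nat => real ^ 'n => ('n => int) => complex" where
 "frame_coeffs p \<xi> \<nu> = (\<Prod>l\<in>UNIV. frame_coeff p (2 * pi * (\<xi> $ l)) (\<nu> l))"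

lemma frame_coeffs_measurable [measurable]: "(%\<xi>. frame_coeffs p \<xi> \<nu>) \<in> borel_measurable borel"
 unfolding frame_coeffs_def
 by (intro borel_measurable_prod measurable_compose[OF _ frame_coeff_measurable] borel_measurable_times borel_measurable_const borel_measurable_continuous_onI continuous_intros)

abbreviation wave :: "real ^ 'n => real ^ 'n => complex" where
 "wave \<xi> x \<equiv> cis (2 * pi * (\<xi> \<bullet> x))"

abbreviation wave_cnj :: "real ^ 'n => real ^ 'n => complex" where
 "wave_cnj \<xi> x \<equiv> cis (- (2 * pi * (\<xi> \<bullet> x)))"

lemma one_plus_sum_le_prod:
 fixes f :: "'i => real"
 assumes "finite A" "!!i. i \<in> A ==> 0 <= f i"
 shows "1 + sum f A <= (\<Prod>i\<in>A. 1 + f i)"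
 using assms
proof (induction A rule: finite_induct)
 case (insert i A)
 have "1 + (f i + sum f A) <= (1 + f i) * (1 + sum f A)"
  using mult_nonneg_nonneg[of "f i" "sum f A"] insert.prems sum_nonneg[of A f] by (simp add: algebra_simps)
 also have "... <= (1 + f i) * (\<Prod>i\<in>A. 1 + f i)"
  using insert.IH insert.prems by (intro mult_left_mono) auto
 finally show ?case using insert.hyps by simp
qed simp

text \<open>Splits the weight at \<nu> into the weight at \<xi> and one-dimensional weights of the
  distances \<open>\<nu> l - 2 * pi * (\<xi> $ l)\<close>, so that the one-dimensional bounds can be
  multiplied. The constant 7 exceeds \<open>2 * pi\<close>.\<close>

lemma one_plus_norm_le_prod:
 fixes \<xi> :: "real ^ 'n"
 shows "1 + norm (lattice_vec \<nu>) <= 7 * (1 + norm \<xi>) * (\<Prod>l\<in>UNIV. 1 + \<bar>of_int (\<nu> l) - 2 * pi * (\<xi> $ l)\<bar>)"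
proof -
 let ?a = "%l. \<bar>of_int (\<nu> l) - 2 * pi * (\<xi> $ l)\<bar>"
 have pi: "2 * pi <= 7" using pi_approx(2) by simp
 have "norm (lattice_vec \<nu>) <= norm ((2 * pi) *\<^sub>R \<xi>) + norm (lattice_vec \<nu> - (2 * pi) *\<^sub>R \<xi>)"
  by (rule norm_triangle_sub)
 also have "norm ((2 * pi) *\<^sub>R \<xi>) <= 7 * norm \<xi>" using pi by (simp add: mult_right_mono)
 also have "norm (lattice_vec \<nu> - (2 * pi) *\<^sub>R \<xi>) <= (\<Sum>l\<in>UNIV. ?a l)"
  by (rule order_trans[OF norm_le_l1_cart]) (simp add: lattice_vec_def)
 finally have 1: "1 + norm (lattice_vec \<nu>) <= 1 + 7 * norm \<xi> + (\<Sum>l\<in>UNIV. ?a l)" by simp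
 define S where "S = (\<Sum>l\<in>UNIV. ?a l)"
 have S: "0 <= S" unfolding S_def by (rule sum_nonneg) simp
 have "1 + 7 * norm \<xi> + S <= 7 * (1 + norm \<xi>) * (1 + S)"
 proof -
  have "7 * (1 + norm \<xi>) * (1 + S) = 7 + 7 * norm \<xi> + 7 * S + 7 * (norm \<xi> * S)" by (simp add: algebra_simps)
  moreover have "0 <= norm \<xi> * S" using S by simp
  ultimately show ?thesis using S by linarith
 qed
 also have "... <= 7 * (1 + norm \<xi>) * (\<Prod>l\<in>UNIV. 1 + ?a l)"
  unfolding S_def by (intro mult_left_mono one_plus_sum_le_prod) simp_all
 finally show ?thesis using 1 by (simp add: S_def)
qed

lemma nn_integral_prod_count_space:
 fixes g :: "'n::finite => int => real"
 assumes "!!l j. g l j >= 0" "!!l. (\<integral>\<^sup>+j. ennreal (g l j) \<partial>count_space UNIV) <= ennreal K" "K >= 0"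
 shows "(\<integral>\<^sup>+\<nu>. ennreal (\<Prod>l\<in>UNIV. g l (\<nu> l)) \<partial>count_space UNIV) <= ennreal (K ^ CARD('n))"
proof -
 have i: "integrable (count_space UNIV) (g l)" for l
  by (rule integrableI_bounded) (use assms(1) order.strict_trans1[OF assms(2)[of l]] in \<open>simp_all add: abs_of_nonneg\<close>)
 have U: "PiE UNIV (%_. UNIV) = (UNIV :: ('n => int) set)" by auto
 have as: "Infinite_Set_Sum.abs_summable_on (g l) UNIV" for l unfolding abs_summable_on_def by (rule i)
 have ip: "integrable (count_space UNIV) (%\<nu>. \<Prod>l\<in>UNIV. g l (\<nu> l))"
  using abs_summable_on_prod_PiE[OF finite_class.finite_UNIV, of "%_. UNIV" g] as unfolding U abs_summable_on_def by simp
 have e: "(LINT \<nu>|count_space UNIV. (\<Prod>l\<in>UNIV. g l (\<nu> l))) = (\<Prod>l\<in>UNIV. (LINT j|count_space UNIV. g l j))"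
  using infsetsum_prod_PiE[OF finite_class.finite_UNIV, of "%_. UNIV" g] as unfolding U infsetsum_def by simp
 have le: "(LINT j|count_space UNIV. g l j) <= K" for l
 proof -
  have "ennreal (LINT j|count_space UNIV. g l j) <= ennreal K"
   using assms(2)[of l] nn_integral_eq_integral[OF i[of l]] assms(1) by simp
  then show ?thesis using assms(3) by simp
 qed
 have "(\<integral>\<^sup>+\<nu>. ennreal (\<Prod>l\<in>UNIV. g l (\<nu> l)) \<partial>count_space UNIV) = ennreal (\<Prod>l\<in>UNIV. (LINT j|count_space UNIV. g l j))"
  unfolding e[symmetric] by (rule nn_integral_eq_integral[OF ip]) (auto intro!: prod_nonneg assms(1))
 also have "... <= ennreal (\<Prod>l\<in>(UNIV :: 'n set). K)"
  by (intro ennreal_leI prod_mono conjI le Bochner_Integration.integral_nonneg assms(1))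
 finally show ?thesis by simp
qed

lemma cis_sum: "finite A ==> cis (\<Sum>l\<in>A. f l) = (\<Prod>l\<in>A. cis (f l))"
 by (induction A rule: finite_induct) (simp_all add: cis_mult[symmetric])

text \<open>Absolute summability in every coordinate turns the product of the one-dimensional series
  into one series over the lattice.\<close>

lemma cube_exponential_frame:
 fixes s :: real
 assumes s: "s >= 0"
 shows "\<exists>p K. K >= 0 \<and>
   (\<forall>\<xi> :: real ^ 'n. lattice_norm s (frame_coeffs p \<xi>) <= ennreal (K * (1 + norm \<xi>) powr s)) \<and>
   (\<forall>(\<xi> :: real ^ 'n) x. x \<in> unit_cube -->
    lattice_series (frame_coeffs p \<xi>) x = wave \<xi> x)"
proof -
 obtain p K where K: "K >= 0"
  and bd: "!!\<eta>. (\<integral>\<^sup>+j. ennreal (cmod (frame_coeff p \<eta> j) * (1 + \<bar>of_int j - \<eta>\<bar>) powr s) \<partial>count_space UNIV) <= ennreal K"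
  and rep: "!!\<eta> t. 0 <= t ==> t <= 1 ==> integrable (count_space UNIV) (frame_coeff p \<eta>) \<and>
    (LINT j|count_space UNIV. frame_coeff p \<eta> j * cis (of_int j * t)) = cis (\<eta> * t)"
  using exponential_frame[OF s] by (elim exE conjE) (rule that, assumption, rule spec, assumption, rule mp, rule mp, rule spec, rule spec, assumption)
 have "lattice_norm s (frame_coeffs p \<xi>) <= ennreal (7 powr s * K ^ CARD('n) * (1 + norm \<xi>) powr s)" for \<xi> :: "real ^ 'n"
 proof -
  let ?g = "%l j. cmod (frame_coeff p (2 * pi * (\<xi> $ l)) j) * (1 + \<bar>of_int j - 2 * pi * (\<xi> $ l)\<bar>) powr s"
  let ?c = "7 powr s * (1 + norm \<xi>) powr s"
  have pt: "cmod (frame_coeffs p \<xi> \<nu>) * lattice_wt \<nu> powr s <= ?c * (\<Prod>l\<in>UNIV. ?g l (\<nu> l))" for \<nu>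
  proof -
   let ?z0 = "%l. \<Prod>l\<in>UNIV. (1 + \<bar>of_int (\<nu> l) - 2 * pi * (\<xi> $ l)\<bar>) powr s"
   have "lattice_wt \<nu> powr s <= (7 * (1 + norm \<xi>) * (\<Prod>l\<in>UNIV. 1 + \<bar>of_int (\<nu> l) - 2 * pi * (\<xi> $ l)\<bar>)) powr s"
    by (intro powr_mono2 s one_plus_norm_le_prod) simp
   also have "... = ?c * (?z0 l)"
   proof -
    have "(\<Prod>l\<in>UNIV. 1 + \<bar>of_int (\<nu> l) - 2 * pi * (\<xi> $ l)\<bar>) powr s = (?z0 l)"
     by (rule prod_powr_distrib)
    then show ?thesis by (simp only: powr_mult)
   qed
   finally have "cmod (frame_coeffs p \<xi> \<nu>) * lattice_wt \<nu> powr s <= cmod (frame_coeffs p \<xi> \<nu>) * (?c * (?z0 l))"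
    by (rule mult_left_mono) simp
   also have "... = ?c * (\<Prod>l\<in>UNIV. ?g l (\<nu> l))"
    unfolding frame_coeffs_def prod_norm[symmetric] prod.distrib by (simp only: mult_ac)
   finally show ?thesis .
  qed
  have "lattice_norm s (frame_coeffs p \<xi>) <= (\<integral>\<^sup>+\<nu>. ennreal ?c * ennreal (\<Prod>l\<in>UNIV. ?g l (\<nu> l)) \<partial>count_space UNIV)"
   by (intro nn_integral_mono order_trans[OF ennreal_leI[OF pt]]) (simp add: ennreal_mult'[symmetric])
  also have "... = ennreal ?c * (\<integral>\<^sup>+\<nu>. ennreal (\<Prod>l\<in>UNIV. ?g l (\<nu> l)) \<partial>count_space UNIV)" by (rule nn_integral_cmult) simp
  also have "... <= ennreal ?c * ennreal (K ^ CARD('n))"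
   by (intro mult_left_mono nn_integral_prod_count_space bd K) simp_all
  also have "... = ennreal (7 powr s * K ^ CARD('n) * (1 + norm \<xi>) powr s)"
   by (subst ennreal_mult'[symmetric]) (simp_all add: K mult_ac)
  finally show ?thesis .
 qed
 moreover have "lattice_series (frame_coeffs p \<xi>) x = wave \<xi> x"
  if x: "x \<in> unit_cube" for \<xi> x :: "real ^ 'n"
 proof -
  let ?h = "%l j. frame_coeff p (2 * pi * (\<xi> $ l)) j * cis (of_int j * x $ l)"
  have xl: "0 <= x $ l" "x $ l <= 1" for l using x by (auto simp: unit_cube_def)
  have U: "PiE UNIV (%_. UNIV) = (UNIV :: ('n => int) set)" by auto
  have as: "Infinite_Set_Sum.abs_summable_on (?h l) UNIV" for l
   unfolding abs_summable_on_def
   by (rule Bochner_Integration.integrable_bound[OF rep[OF xl[of l], THEN conjunct1, of "2 * pi * (\<xi> $ l)"]]) (simp_all add: norm_mult)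
  have "frame_coeffs p \<xi> \<nu> * cis (lattice_vec \<nu> \<bullet> x) = (\<Prod>l\<in>UNIV. ?h l (\<nu> l))" for \<nu>
   unfolding frame_coeffs_def prod.distrib by (simp add: inner_vec_def lattice_vec_def cis_sum)
  then have "lattice_series (frame_coeffs p \<xi>) x = (LINT \<nu>|count_space UNIV. (\<Prod>l\<in>UNIV. ?h l (\<nu> l)))" by simp
  also have "... = (\<Prod>l\<in>UNIV. (LINT j|count_space UNIV. ?h l j))"
   using infsetsum_prod_PiE[OF finite_class.finite_UNIV, of "%_. UNIV" ?h] as unfolding U infsetsum_def by simp
  also have "... = (\<Prod>l\<in>UNIV. cis (2 * pi * (\<xi> $ l) * x $ l))"
   by (intro prod.cong refl) (rule rep[OF xl, THEN conjunct2])
  also have "... = cis (\<Sum>l\<in>UNIV. 2 * pi * (\<xi> $ l) * x $ l)" by (simp add: cis_sum)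
  also have "(\<Sum>l\<in>UNIV. 2 * pi * (\<xi> $ l) * x $ l) = 2 * pi * (\<xi> \<bullet> x)"
   by (simp add: inner_vec_def sum_distrib_left mult_ac)
  finally show ?thesis .
 qed
 ultimately show ?thesis using K
  by (intro exI[of _ p] exI[of _ "7 powr s * K ^ CARD('n)"] conjI allI impI) simp_all
qed

section \<open>Fourier inversion\<close>

text \<open>Lebesgue measure on \<open>real ^ 'n\<close> is built as a product over
  \<open>Basis\<close>; \<open>ix\<close> reads off the coordinate that belongs to a basis
  vector.\<close>

lemma lborel_integral_prod_components:
 fixes f :: "'n::finite => real => complex"
 assumes f: "!!l. integrable lborel (f l)"
 shows "integrable (lborel :: (real ^ 'n) measure) (%x. \<Prod>l\<in>UNIV. f l (x $ l))"
  and "(LINT x|(lborel :: (real ^ 'n) measure). (\<Prod>l\<in>UNIV. f l (x $ l))) = (\<Prod>l\<in>UNIV. LINT t|lborel. f l t)"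
proof -
 interpret product_sigma_finite "%_. lborel :: real measure" by standard
 let ?B = "Basis :: (real ^ 'n) set"
 define ix where "ix b = (THE l::'n. b = axis l 1)" for b :: "real ^ 'n"
 have ix: "ix (axis l 1) = l" for l unfolding ix_def by (rule the_equality) (auto simp: axis_eq_axis)
 have B: "?B = range (%l. axis l 1)" by (auto simp: Basis_vec_def)
 have inj: "inj (%l::'n. axis l (1::real))" by (auto simp: inj_def axis_eq_axis)
 have re: "(\<Prod>l\<in>UNIV. h l) = (\<Prod>b\<in>?B. h (ix b))" for h :: "'n => complex"
  unfolding B by (subst prod.reindex[OF inj]) (simp add: ix)
 note f[THEN borel_measurable_integrable, measurable]
 have m: "(%x :: real ^ 'n. \<Prod>l\<in>UNIV. f l (x $ l)) \<in> borel_measurable borel"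
 proof (intro borel_measurable_prod)
  fix l
  have "(%x :: real ^ 'n. x $ l) \<in> borel_measurable borel" by (intro borel_measurable_continuous_onI continuous_intros)
  then show "(%x :: real ^ 'n. f l (x $ l)) \<in> borel_measurable borel" by measurable
 qed
 have T: "(%x :: real ^ 'n => real. \<Sum>b\<in>?B. x b *\<^sub>R b) \<in> measurable (\<Pi>\<^sub>M b\<in>?B. lborel) borel" by measurable
 have c: "(\<Prod>l\<in>UNIV. f l ((\<Sum>b\<in>?B. x b *\<^sub>R b) $ l)) = (\<Prod>b\<in>?B. f (ix b) (x b))" for x :: "real ^ 'n => real"
 proof -
  have "(\<Sum>b\<in>?B. x b *\<^sub>R b) $ l = x (axis l 1)" for l
  proof -
   have "(\<Sum>b\<in>?B. x b *\<^sub>R b) $ l = (\<Sum>b\<in>?B. x b *\<^sub>R b) \<bullet> axis l 1" by (simp add: inner_axis)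
   also have "... = x (axis l 1)" by (subst inner_sum_left_Basis) (auto simp: Basis_vec_def)
   finally show ?thesis .
  qed
  then show ?thesis unfolding re by (intro prod.cong refl) (auto simp: B ix)
 qed
 have ip: "integrable (\<Pi>\<^sub>M b\<in>?B. lborel) (%x. \<Prod>b\<in>?B. f (ix b) (x b))"
  by (intro product_integrable_prod f) simp
 show "integrable (lborel :: (real ^ 'n) measure) (%x. \<Prod>l\<in>UNIV. f l (x $ l))"
  unfolding lborel_eq[where 'a = "real ^ 'n"] by (subst integrable_distr_eq[OF T m]) (simp only: c ip)
 have "(LINT x|(lborel :: (real ^ 'n) measure). (\<Prod>l\<in>UNIV. f l (x $ l))) = (\<Prod>b\<in>?B. LINT t|lborel. f (ix b) t)"
  unfolding lborel_eq[where 'a = "real ^ 'n"] integral_distr[OF T m] c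
  by (intro product_integral_prod f) simp
 then show "(LINT x|(lborel :: (real ^ 'n) measure). (\<Prod>l\<in>UNIV. f l (x $ l))) = (\<Prod>l\<in>UNIV. LINT t|lborel. f l t)"
  unfolding re by simp
qed

text \<open>The characteristic function of the standard normal distribution at
  \<open>z / \<epsilon>\<close>, after substituting
  \<open>u = 2 * pi * \<epsilon> * t\<close>.\<close>

lemma gaussian_fourier:
 assumes e: "\<epsilon> > 0"
 shows "integrable lborel (%t. of_real (exp (- (2 * pi * \<epsilon> * t)\<^sup>2 / 2)) * cis (2 * pi * t * z))"
  and "(LINT t|lborel. of_real (exp (- (2 * pi * \<epsilon> * t)\<^sup>2 / 2)) * cis (2 * pi * t * z)) = of_real (normal_density 0 \<epsilon> z)"
proof -
 let ?c = "2 * pi * \<epsilon>"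
 let ?f = "%u. std_normal_density u *\<^sub>R cis (z / \<epsilon> * u)"
 have c: "?c > 0" using e by simp
 have e0: "\<epsilon> ~= 0" using e by simp
 have i0: "integrable lborel ?f"
  by (rule Bochner_Integration.integrable_bound[OF integrable_std_normal_moment[of 0]]) (auto simp: abs_of_nonneg)
 let ?z0 = "- (z / \<epsilon>)\<^sup>2 / 2"
 have "char std_normal_distribution (z / \<epsilon>) = (LINT u|lborel. ?f u)"
  unfolding char_def by (subst integral_density) (simp_all add: cis_conv_exp)
 then have 1: "(LINT u|lborel. ?f u) = of_real (exp ?z0)" unfolding char_std_normal_distribution by simp
 have g: "of_real (exp (- (?c * t)\<^sup>2 / 2)) * cis (2 * pi * t * z) = of_real (sqrt (2 * pi)) * ?f (0 + ?c * t)" for t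
 proof -
  have e0: "\<epsilon> ~= 0" using e by simp
  have "z / \<epsilon> * (?c * t) = 2 * pi * t * z" using e0 by simp
  then show ?thesis by (simp only: add_0) (simp add: std_normal_density_def scaleR_conv_of_real)
 qed
 have i1: "integrable lborel (%t. ?f (0 + ?c * t))" by (rule lborel_integrable_real_affine[OF i0]) (use e0 in simp)
 show "integrable lborel (%t. of_real (exp (- (?c * t)\<^sup>2 / 2)) * cis (2 * pi * t * z))"
  unfolding g by (intro integrable_mult_right i1)
 have "of_real (exp ?z0) = of_real ?c * (LINT t|lborel. ?f (0 + ?c * t))"
 proof -
  have "?c ~= 0" using e0 by simp
  from lborel_integral_real_affine[OF this, of ?f 0, unfolded 1 abs_of_pos[OF c]]
  show ?thesis by (simp only: scaleR_conv_of_real)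
 qed
 then have "(LINT t|lborel. ?f (0 + ?c * t)) = of_real (exp ?z0 / ?c)"
  using e0 by (simp only: of_real_divide eq_divide_eq mult.commute) simp
 then have "(LINT t|lborel. of_real (exp (- (?c * t)\<^sup>2 / 2)) * cis (2 * pi * t * z)) = of_real (sqrt (2 * pi) * (exp ?z0 / ?c))"
  unfolding g by (simp only: integral_mult_right_zero of_real_mult)
 also have "sqrt (2 * pi) * (exp ?z0 / ?c) = normal_density 0 \<epsilon> z"
 proof -
  have "sqrt (2 * pi) / ?c = 1 / sqrt (2 * pi * \<epsilon>\<^sup>2)"
  proof -
   have "sqrt (2 * pi * \<epsilon>\<^sup>2) = sqrt (2 * pi) * \<epsilon>" using e by (simp add: real_sqrt_mult)
   moreover have "?c = sqrt (2 * pi) * (sqrt (2 * pi) * \<epsilon>)" using e by simp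
   moreover have "sqrt (2 * pi) ~= 0" by simp
   ultimately show ?thesis using e by (simp only: divide_simps) simp
  qed
  moreover have "- (z / \<epsilon>)\<^sup>2 / 2 = - (z - 0)\<^sup>2 / (2 * \<epsilon>\<^sup>2)" by (simp add: power_divide)
  moreover have "sqrt (2 * pi) * (exp ?z0 / ?c) = sqrt (2 * pi) / ?c * exp ?z0" by simp
  ultimately show ?thesis unfolding normal_density_def by simp
 qed
 finally show "(LINT t|lborel. of_real (exp (- (?c * t)\<^sup>2 / 2)) * cis (2 * pi * t * z)) = of_real (normal_density 0 \<epsilon> z)" .
qed

lemma gaussian_window:
 assumes e: "\<epsilon> > 0"
 shows "0 <= (LINT x:{a<..<b}|lborel. normal_density 0 \<epsilon> (x - y))" "(LINT x:{a<..<b}|lborel. normal_density 0 \<epsilon> (x - y)) <= 1"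
  and "(LINT x:{a<..<b}|lborel. normal_density 0 \<epsilon> (x - y)) = (LINT u|lborel. std_normal_density u * indicator {a<..<b} (y + \<epsilon> * u))"
proof -
 have nd: "normal_density 0 \<epsilon> (x - y) = normal_density y \<epsilon> x" for x by (simp add: normal_density_def)
 have i: "integrable lborel (normal_density y \<epsilon>)" by (rule integrable_normal_density[OF e])
 let ?z1 = "%x a. LINT x:{a<..<b}|lborel. normal_density 0 \<epsilon> (x - y)"
 let ?z2 = "%x a. LINT x|lborel. indicator {a<..<b} x * normal_density y \<epsilon> x"
 have eq: "(?z1 x a) = (?z2 x a)"
  by (simp add: set_lebesgue_integral_def nd)
 show "0 <= (?z1 x a)" unfolding eq by (intro Bochner_Integration.integral_nonneg) simp
 have "(?z2 x a) <= (LINT x|lborel. normal_density y \<epsilon> x)"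
  by (intro integral_mono i Bochner_Integration.integrable_bound[OF i]) (auto simp: indicator_def)
 then show "(?z1 x a) <= 1" unfolding eq using integral_normal_density[OF e, of y] by simp
 let ?z0 = "%a u. indicator {a<..<b} (y + \<epsilon> * u) * normal_density y \<epsilon> (y + \<epsilon> * u)"
 have "(?z2 x a) = \<epsilon> * (LINT u|lborel. indicator {a<..<b} (y + \<epsilon> * u) * normal_density y \<epsilon> (y + \<epsilon> * u))"
  using lborel_integral_real_affine[of \<epsilon> "%x. indicator {a<..<b} x * normal_density y \<epsilon> x" y] e by simp
 also have "... = (LINT u|lborel. \<epsilon> * (?z0 a u))" by simp
 also have "(%u. \<epsilon> * (?z0 a u)) = (%u. std_normal_density u * indicator {a<..<b} (y + \<epsilon> * u))"
 proof
  fix u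
  have "\<epsilon> * normal_density y \<epsilon> (y + \<epsilon> * u) = std_normal_density u"
   unfolding normal_density_def std_normal_density_def using e by (simp add: real_sqrt_mult power_mult_distrib)
  then show "\<epsilon> * (?z0 a u) = std_normal_density u * indicator {a<..<b} (y + \<epsilon> * u)"
   by (simp add: mult_ac)
 qed
 finally show "(?z1 x a) = (LINT u|lborel. std_normal_density u * indicator {a<..<b} (y + \<epsilon> * u))" unfolding eq .
qed

text \<open>In the form \<open>gaussian_window(3)\<close> the small parameter sits inside the
  indicator, which is continuous away from the end points, so dominated convergence applies.\<close>

lemma gaussian_window_limit:
 assumes y: "y ~= a" "y ~= b"
 shows "(%n. LINT x:{a<..<b}|lborel. normal_density 0 (1 / real (Suc n)) (x - y)) \<longlonglongrightarrow> indicator {a<..<b} y"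
proof -
 have i: "integrable lborel std_normal_density" using integrable_std_normal_moment[of 0] by simp
 have z: "(%n. y + 1 / real (Suc n) * u) \<longlonglongrightarrow> y" for u
  using tendsto_add[OF tendsto_const[of y] tendsto_mult[OF LIMSEQ_inverse_real_of_nat tendsto_const[of u]]] by (simp add: divide_inverse)
 have "(%n. LINT u|lborel. std_normal_density u * indicator {a<..<b} (y + 1 / real (Suc n) * u)) \<longlonglongrightarrow> (LINT u|lborel. std_normal_density u * indicator {a<..<b} y)"
 proof (rule integral_dominated_convergence[where w = std_normal_density])
  show "AE u in lborel. (%n. std_normal_density u * indicator {a<..<b} (y + 1 / real (Suc n) * u)) \<longlonglongrightarrow> std_normal_density u * indicator {a<..<b} y"
  proof (intro AE_I2 tendsto_mult tendsto_const tendsto_eventually)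
   fix u
   consider "y < a" | "a < y \<and> y < b" | "b < y" using y by linarith
   then show "\<forall>\<^sub>F n in sequentially. indicator {a<..<b} (y + 1 / real (Suc n) * u) = (indicator {a<..<b} y :: real)"
   proof cases
    case 1
    show ?thesis using order_tendstoD(2)[OF z[of u] 1] by eventually_elim (use 1 in auto)
   next
    case 2
    then show ?thesis using order_tendstoD(2)[OF z[of u], of b] order_tendstoD(1)[OF z[of u], of a] by (auto elim: eventually_elim2)
   next
    case 3
    show ?thesis using order_tendstoD(1)[OF z[of u] 3] by eventually_elim (use 3 in auto)
   qed
  qed
  show "AE u in lborel. norm (std_normal_density u * indicator {a<..<b} (y + 1 / real (Suc n) * u)) <= std_normal_density u" for n
   by (intro AE_I2) (auto simp: indicator_def)
 qed (use i in auto)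
 moreover have "(LINT u|lborel. std_normal_density u * indicator {a<..<b} y) = indicator {a<..<b} y"
  using integral_std_normal_moment_even[of 0] by simp
 ultimately show ?thesis by (simp add: gaussian_window(3))
qed

lemma (in pair_sigma_finite) integrable_pair_bounded_by_prod:
 fixes f :: "'a => complex" and g :: "'b => complex" and k :: "'a \<times> 'b => complex"
 assumes f: "integrable M1 f" and g: "integrable M2 g" and k: "k \<in> borel_measurable (M1 \<Otimes>\<^sub>M M2)"
  and b: "!!x y. cmod (k (x, y)) <= cmod (f x) * cmod (g y)"
 shows "integrable (M1 \<Otimes>\<^sub>M M2) k"
proof (rule integrableI_bounded[OF k])
 note [measurable] = k borel_measurable_integrable[OF f] borel_measurable_integrable[OF g]
 have "(\<integral>\<^sup>+z. ennreal (norm (k z)) \<partial>(M1 \<Otimes>\<^sub>M M2)) = (\<integral>\<^sup>+x. \<integral>\<^sup>+y. ennreal (norm (k (x, y))) \<partial>M2 \<partial>M1)"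
  by (rule M2.nn_integral_fst[symmetric]) measurable
 also have "... <= (\<integral>\<^sup>+x. \<integral>\<^sup>+y. ennreal (cmod (f x)) * ennreal (cmod (g y)) \<partial>M2 \<partial>M1)"
  by (intro nn_integral_mono) (simp add: b ennreal_mult'[symmetric])
 also have "... = (\<integral>\<^sup>+x. ennreal (cmod (f x)) * (\<integral>\<^sup>+y. ennreal (cmod (g y)) \<partial>M2) \<partial>M1)"
  by (intro nn_integral_cong nn_integral_cmult) measurable
 also have "... = (\<integral>\<^sup>+x. ennreal (cmod (f x)) \<partial>M1) * (\<integral>\<^sup>+y. ennreal (cmod (g y)) \<partial>M2)"
  by (rule nn_integral_multc) measurable
 also have "... < \<infinity>"
  using f g by (simp add: integrable_iff_bounded ennreal_mult_less_top)
 finally show "(\<integral>\<^sup>+z. ennreal (norm (k z)) \<partial>(M1 \<Otimes>\<^sub>M M2)) < \<infinity>" .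
qed

lemma continuous_imp_borel_pair:
 fixes f :: "'a::euclidean_space \<times> 'b::euclidean_space => complex"
 assumes "continuous_on UNIV f" shows "f \<in> borel_measurable (lborel \<Otimes>\<^sub>M lborel)"
 using borel_measurable_continuous_onI[OF assms] unfolding lborel_prod by simp

lemma continuous_on_cis [continuous_intros]: "continuous_on S f ==> continuous_on S (%x. cis (f x))"
 unfolding cis_conv_exp by (intro continuous_intros)

text \<open>The Fourier transform of \<open>gauss_kernel\<close>; as \<epsilon> tends to 0 it tends
  to 1 pointwise, while the kernel concentrates at the origin.\<close>

definition gauss_cutoff :: "real => real ^ 'n => real" where
 "gauss_cutoff \<epsilon> \<xi> = (\<Prod>l\<in>UNIV. exp (- (2 * pi * \<epsilon> * (\<xi> $ l))\<^sup>2 / 2))"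

definition gauss_kernel :: "real => real ^ 'n => real" where
 "gauss_kernel \<epsilon> z = (\<Prod>l\<in>UNIV. normal_density 0 \<epsilon> (z $ l))"

lemma gauss_cutoff_bounds: "0 <= gauss_cutoff \<epsilon> \<xi>" "gauss_cutoff \<epsilon> \<xi> <= 1"
 unfolding gauss_cutoff_def by (auto intro!: prod_nonneg prod_le_1)

lemma gauss_kernel_bounds:
 fixes z :: "real ^ 'n"
 assumes "\<epsilon> > 0"
 shows "0 <= gauss_kernel \<epsilon> z" "gauss_kernel \<epsilon> z <= (1 / sqrt (2 * pi * \<epsilon>\<^sup>2)) ^ CARD('n)"
proof -
 let ?z0 = "2 * pi * \<epsilon>\<^sup>2"
 have nd: "normal_density 0 \<epsilon> t <= 1 / sqrt ?z0" for t
 proof -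
  have "exp (- (t - 0)\<^sup>2 / (2 * \<epsilon>\<^sup>2)) <= 1" by simp
  then have "1 / sqrt ?z0 * exp (- (t - 0)\<^sup>2 / (2 * \<epsilon>\<^sup>2)) <= 1 / sqrt ?z0 * 1"
   by (intro mult_left_mono) simp_all
  then show ?thesis unfolding normal_density_def by simp
 qed
 show "0 <= gauss_kernel \<epsilon> z" unfolding gauss_kernel_def by (intro prod_nonneg) simp
 have "gauss_kernel \<epsilon> z <= (\<Prod>l\<in>(UNIV :: 'n set). 1 / sqrt ?z0)"
  unfolding gauss_kernel_def by (intro prod_mono conjI nd) simp
 then show "gauss_kernel \<epsilon> z <= (1 / sqrt ?z0) ^ CARD('n)" by simp
qed

lemma continuous_on_gauss_kernel [continuous_intros]:
 "\<epsilon> > 0 ==> continuous_on S f ==> continuous_on S (%x. gauss_kernel \<epsilon> (f x))"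
 unfolding gauss_kernel_def normal_density_def by (intro continuous_intros) auto

lemma continuous_on_gauss_cutoff [continuous_intros]:
 "continuous_on S f ==> continuous_on S (%x. gauss_cutoff \<epsilon> (f x))"
 unfolding gauss_cutoff_def by (intro continuous_intros) auto

lemma gaussian_fourier_vec:
 fixes z :: "real ^ 'n"
 assumes e: "\<epsilon> > 0"
 shows "integrable lborel (%\<xi>. of_real (gauss_cutoff \<epsilon> \<xi>) * wave \<xi> z)"
  and "(LINT \<xi>|lborel. of_real (gauss_cutoff \<epsilon> \<xi>) * wave \<xi> z) = of_real (gauss_kernel \<epsilon> z)"
proof -
 let ?f = "%l t. of_real (exp (- (2 * pi * \<epsilon> * t)\<^sup>2 / 2)) * cis (2 * pi * t * (z $ l))"
 have eq: "of_real (gauss_cutoff \<epsilon> \<xi>) * wave \<xi> z = (\<Prod>l\<in>UNIV. ?f l (\<xi> $ l))" for \<xi> :: "real ^ 'n"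
 proof -
  have "2 * pi * (\<xi> \<bullet> z) = (\<Sum>l\<in>UNIV. 2 * pi * (\<xi> $ l) * (z $ l))" by (simp add: inner_vec_def sum_distrib_left mult_ac)
  then show ?thesis unfolding gauss_cutoff_def prod.distrib of_real_prod by (simp only: cis_sum[OF finite_class.finite_UNIV])
 qed
 note p = lborel_integral_prod_components[where f = ?f, OF gaussian_fourier(1)[OF e]]
 show "integrable lborel (%\<xi>. of_real (gauss_cutoff \<epsilon> \<xi>) * wave \<xi> z)" unfolding eq by (rule p(1))
 show "(LINT \<xi>|lborel. of_real (gauss_cutoff \<epsilon> \<xi>) * wave \<xi> z) = of_real (gauss_kernel \<epsilon> z)"
  unfolding eq p(2) gaussian_fourier(2)[OF e] gauss_kernel_def of_real_prod by (rule refl)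
qed

section \<open>Gaussian mollification of boxes\<close>

lemma indicator_box_cart:
 fixes a b x :: "real ^ 'n"
 shows "indicator (box a b) x = (\<Prod>l\<in>UNIV. indicator {a $ l<..<b $ l} (x $ l) :: real)"
proof (cases "x \<in> box a b")
 case False
 then obtain l where l: "x $ l \<notin> {a $ l<..<b $ l}" by (auto simp: mem_box_cart)
 have "(\<Prod>l\<in>UNIV. indicator {a $ l<..<b $ l} (x $ l) :: real) = 0"
  by (rule prod_zero) (use l in \<open>auto intro!: exI[of _ l] simp: indicator_def\<close>)
 then show ?thesis using False by simp
qed (simp add: mem_box_cart)

lemma gauss_kernel_box:
 fixes y a b :: "real ^ 'n"
 assumes e: "\<epsilon> > 0"
 shows "(LINT x:box a b|lborel. complex_of_real (gauss_kernel \<epsilon> (x - y))) = of_real (\<Prod>l\<in>UNIV. (LINT t:{a $ l<..<b $ l}|lborel. normal_density 0 \<epsilon> (t - y $ l)))"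
proof -
 let ?f = "%l t. complex_of_real (indicator {a $ l<..<b $ l} t * normal_density 0 \<epsilon> (t - y $ l))"
 have nd: "normal_density 0 \<epsilon> (t - y $ l) = normal_density (y $ l) \<epsilon> t" for t l by (simp add: normal_density_def)
 have "integrable lborel (%t. indicator {a $ l<..<b $ l} t * normal_density 0 \<epsilon> (t - y $ l))" for l
  unfolding nd by (rule Bochner_Integration.integrable_bound[OF integrable_normal_density[OF e, of "y $ l"]]) (auto simp: indicator_def)
 then have i: "integrable lborel (?f l)" for l by (rule integrable_of_real)
 have "indicator (box a b) x *\<^sub>R complex_of_real (gauss_kernel \<epsilon> (x - y)) = (\<Prod>l\<in>UNIV. ?f l (x $ l))" for x
  unfolding indicator_box_cart gauss_kernel_def scaleR_conv_of_real of_real_prod[symmetric] of_real_mult[symmetric] prod.distrib[symmetric] by simp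
 then have "(LINT x:box a b|lborel. complex_of_real (gauss_kernel \<epsilon> (x - y))) = (LINT x|(lborel :: (real ^ 'n) measure). (\<Prod>l\<in>UNIV. ?f l (x $ l)))"
  unfolding set_lebesgue_integral_def by simp
 also have "... = (\<Prod>l\<in>UNIV. (LINT t|lborel. ?f l t))" by (rule lborel_integral_prod_components(2)[OF i])
 finally show ?thesis by (simp only: set_lebesgue_integral_def real_scaleR_def integral_complex_of_real of_real_prod)
qed

lemma AE_component_neq: "AE y :: real ^ 'n in lborel. y $ l ~= c"
proof -
 have "negligible {y :: real ^ 'n. y \<bullet> axis l 1 = c}" by (rule negligible_standard_hyperplane) (auto simp: Basis_vec_def)
 then have "negligible {y :: real ^ 'n. y $ l = c}" by (simp add: inner_axis)
 then have "AE y :: real ^ 'n in lebesgue. y $ l ~= c"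
  using AE_not_in[of "{y :: real ^ 'n. y $ l = c}" lebesgue] by (simp add: negligible_iff_null_sets)
 then show ?thesis by (subst (asm) AE_completion_iff) 
qed

lemma indicator_box_limit:
 fixes a b y :: "real ^ 'n"
 assumes y: "!!l. y $ l ~= a $ l" "!!l. y $ l ~= b $ l"
 shows "(%n. LINT x:box a b|lborel. complex_of_real (gauss_kernel (1 / real (Suc n)) (x - y))) \<longlonglongrightarrow> of_real (indicator (box a b) y)"
proof -
 have k: "(LINT x:box a b|lborel. complex_of_real (gauss_kernel (1 / real (Suc n)) (x - y))) = of_real (\<Prod>l\<in>UNIV. (LINT t:{a $ l<..<b $ l}|lborel. normal_density 0 (1 / real (Suc n)) (t - y $ l)))" for n
  by (rule gauss_kernel_box) simp
 show ?thesis unfolding k indicator_box_cart by (intro tendsto_of_real tendsto_prod gaussian_window_limit y)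
qed

lemma gauss_kernel_box_bound:
 fixes y a b :: "real ^ 'n"
 assumes e: "\<epsilon> > 0"
 shows "cmod (LINT x:box a b|lborel. complex_of_real (gauss_kernel \<epsilon> (x - y))) <= 1"
 unfolding gauss_kernel_box[OF e] norm_of_real abs_prod
 by (intro prod_le_1 conjI abs_ge_zero) (simp only: abs_of_nonneg[OF gaussian_window(1)[OF e]] gaussian_window(2)[OF e])

text \<open>Gaussian summability, tested against boxes. The regularised inverse transform
  \<open>u n\<close> converges to \<open>h\<close> by dominated convergence, and by Fubini it is the
  convolution of \<open>g\<close> with \<open>gauss_kernel\<close>. Integrated over a box, the
  kernel can be moved onto the indicator of the box, where its limit is known pointwise off the
  faces; so \<open>g\<close> and \<open>h\<close> have equal integrals over all boxes.\<close>

theorem fourier_inversion_on_box: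
 fixes g :: "real ^ 'n => complex"
 defines "F \<equiv> %\<xi>. LINT y|lborel. g y * wave_cnj \<xi> y"
 assumes g: "integrable lborel g" and F: "integrable lborel F"
 shows "AE x in lborel. x \<in> box c d --> g x = (LINT \<xi>|lborel. F \<xi> * wave \<xi> x)"
proof -
 define h where "h x = (LINT \<xi>|lborel. F \<xi> * wave \<xi> x)" for x
 note [measurable] = borel_measurable_integrable[OF g] borel_measurable_integrable[OF F]
 have iF: "integrable lborel (%\<xi>. F \<xi> * wave \<xi> x)" for x
  by (rule Bochner_Integration.integrable_bound[OF F]) (auto simp: norm_mult)
 have hm[measurable]: "h \<in> borel_measurable borel" unfolding h_def by measurable
 define B where "B = (LINT \<xi>|lborel. cmod (F \<xi>))"
 let ?z2 = "%n \<xi>. gauss_cutoff (1 / real (Suc n)) \<xi>"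
 define u where "u n x = (LINT \<xi>|lborel. of_real (?z2 n \<xi>) * (F \<xi> * wave \<xi> x))" for n x
 have cm[measurable]: "gauss_cutoff \<epsilon> \<in> borel_measurable borel" for \<epsilon> :: real
  using continuous_on_gauss_cutoff[OF continuous_on_id, of UNIV \<epsilon>] by (rule borel_measurable_continuous_onI)
 have um[measurable]: "u n \<in> borel_measurable borel" for n unfolding u_def by measurable
 have cb: "cmod (of_real (gauss_cutoff \<epsilon> \<xi>) * z) <= cmod z" for \<epsilon> \<xi> z
  using gauss_cutoff_bounds[of \<epsilon> \<xi>] mult_right_mono[of "gauss_cutoff \<epsilon> \<xi>" 1 "cmod z"] by (simp add: norm_mult)
 have iu: "integrable lborel (%\<xi>. of_real (gauss_cutoff \<epsilon> \<xi>) * (F \<xi> * wave \<xi> x))" for \<epsilon> x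
  by (rule Bochner_Integration.integrable_bound[OF iF]) (auto intro: cb)
 have ub: "cmod (u n x) <= B" for n x
  unfolding u_def B_def
  by (intro order_trans[OF integral_norm_bound] integral_mono integrable_norm iu F order_trans[OF cb]) (simp add: norm_mult)
 have hb: "cmod (h x) <= B" for x
  unfolding h_def B_def
  by (intro order_trans[OF integral_norm_bound] integral_mono integrable_norm iF F) (simp add: norm_mult)
 have lim: "(%n. u n x) \<longlonglongrightarrow> h x" for x
  unfolding u_def h_def
 proof (rule integral_dominated_convergence[where w = "%\<xi>. cmod (F \<xi>)"])
  show "AE \<xi> in lborel. (%n. of_real (?z2 n \<xi>) * (F \<xi> * wave \<xi> x)) \<longlonglongrightarrow> F \<xi> * wave \<xi> x"
  proof (rule AE_I2)
   fix \<xi> :: "real ^ 'n"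
   have "(%n. 1 / real (Suc n)) \<longlonglongrightarrow> 0" using LIMSEQ_inverse_real_of_nat by (simp add: divide_inverse)
   then have "(%n. gauss_cutoff (1 / real (Suc n)) \<xi>) \<longlonglongrightarrow> (\<Prod>l\<in>(UNIV :: 'n set). exp (- (2 * pi * 0 * (\<xi> $ l))\<^sup>2 / 2))"
    unfolding gauss_cutoff_def by (intro tendsto_intros) auto
   then have "(%n. complex_of_real (?z2 n \<xi>)) \<longlonglongrightarrow> of_real 1" by (intro tendsto_of_real) simp
   from tendsto_mult[OF this tendsto_const[of "F \<xi> * wave \<xi> x"]]
   show "(%n. of_real (?z2 n \<xi>) * (F \<xi> * wave \<xi> x)) \<longlonglongrightarrow> F \<xi> * wave \<xi> x" by simp
  qed
  show "AE \<xi> in lborel. norm (of_real (?z2 n \<xi>) * (F \<xi> * wave \<xi> x)) <= cmod (F \<xi>)" for n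
   by (intro AE_I2 order_trans[OF cb]) (simp add: norm_mult)
 qed (use F in auto)
 let ?z0 = "%lborel. lborel \<Otimes>\<^sub>M lborel"
 have conv: "u n x = (LINT y|lborel. g y * of_real (gauss_kernel (1 / real (Suc n)) (x - y)))" for n x
 proof -
  let ?\<epsilon> = "1 / real (Suc n)"
  let ?z1 = "%\<xi> y. of_real (gauss_cutoff ?\<epsilon> \<xi>) * wave \<xi> (x - y)"
  let ?k = "%(y, \<xi>). g y * (?z1 \<xi> y)"
  have kc: "(%(y :: real ^ 'n, \<xi> :: real ^ 'n). of_real (gauss_cutoff ?\<epsilon> \<xi>) * wave \<xi> (x - y)) \<in> borel_measurable (?z0 lborel)"
   by (rule continuous_imp_borel_pair) (unfold case_prod_unfold, intro continuous_intros)
  have "(%z :: (real ^ 'n) \<times> (real ^ 'n). g (fst z)) \<in> borel_measurable (?z0 lborel)" by measurable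
  from borel_measurable_times[OF this kc] have km: "?k \<in> borel_measurable (?z0 lborel)" by (simp add: case_prod_unfold)
  have ik: "integrable (?z0 lborel) ?k"
   by (rule lborel_pair.integrable_pair_bounded_by_prod[OF g gaussian_fourier_vec(1)[of ?\<epsilon> 0] km]) (simp_all add: norm_mult)
  have "u n x = (LINT \<xi>|lborel. (LINT y|lborel. g y * (?z1 \<xi> y)))"
  proof -
   have "of_real (gauss_cutoff ?\<epsilon> \<xi>) * (F \<xi> * wave \<xi> x) = (LINT y|lborel. g y * (?z1 \<xi> y))" for \<xi>
   proof -
    have "wave \<xi> (x - y) = wave_cnj \<xi> y * wave \<xi> x" for y
     unfolding cis_mult by (simp add: inner_diff_right algebra_simps)
    then have "(LINT y|lborel. g y * (?z1 \<xi> y)) = (LINT y|lborel. (of_real (gauss_cutoff ?\<epsilon> \<xi>) * wave \<xi> x) * (g y * wave_cnj \<xi> y))"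
     by (simp only: mult_ac)
    then show ?thesis unfolding integral_mult_right_zero F_def by (simp only: mult_ac)
   qed
   then show ?thesis unfolding u_def by simp
  qed
  also have "... = (LINT y|lborel. (LINT \<xi>|lborel. g y * (?z1 \<xi> y)))"
   using lborel_pair.Fubini_integral[OF ik] by simp
  also have "... = (LINT y|lborel. g y * of_real (gauss_kernel ?\<epsilon> (x - y)))"
  proof -
   have e0: "?\<epsilon> > 0" by simp
   show ?thesis unfolding integral_mult_right_zero gaussian_fourier_vec(2)[OF e0] by (rule refl)
  qed
  finally show ?thesis .
 qed
 have eq: "(LINT x:box a b|lborel. g x) = (LINT x:box a b|lborel. h x)" for a b
 proof (rule LIMSEQ_unique)
  have bi: "integrable lborel (%x :: real ^ 'n. indicator (box a b) x * B)"
   by (intro integrable_mult_left integrable_real_indicator) (simp_all add: emeasure_bounded_finite[OF bounded_box, unfolded infinity_ennreal_def])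
  show "(%n. LINT x:box a b|lborel. u n x) \<longlonglongrightarrow> (LINT x:box a b|lborel. h x)"
   unfolding set_lebesgue_integral_def
  proof (rule integral_dominated_convergence[OF _ _ bi])
   show "AE x in lborel. (%n. indicator (box a b) x *\<^sub>R u n x) \<longlonglongrightarrow> indicator (box a b) x *\<^sub>R h x"
    by (intro AE_I2 tendsto_scaleR tendsto_const lim)
   show "AE x in lborel. norm (indicator (box a b) x *\<^sub>R u n x) <= indicator (box a b) x * B" for n
    using ub by (intro AE_I2) (auto simp: indicator_def)
  qed measurable
  have e: "(LINT x:box a b|lborel. u n x) = (LINT y|lborel. g y * (LINT x:box a b|lborel. of_real (gauss_kernel (1 / real (Suc n)) (x - y))))" for n
  proof -
   let ?\<epsilon> = "1 / real (Suc n)"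
   let ?k = "%(x, y). indicator (box a b) x *\<^sub>R (g y * of_real (gauss_kernel ?\<epsilon> (x - y)))"
   let ?c = "(1 / sqrt (2 * pi * ?\<epsilon>\<^sup>2)) ^ CARD('n)"
   have e0: "?\<epsilon> > 0" by simp
   have kc: "(%(x :: real ^ 'n, y :: real ^ 'n). complex_of_real (gauss_kernel ?\<epsilon> (x - y))) \<in> borel_measurable (?z0 lborel)"
    by (rule continuous_imp_borel_pair) (unfold case_prod_unfold, intro continuous_intros e0)
   have "(%z :: (real ^ 'n) \<times> (real ^ 'n). indicator (box a b) (fst z) *\<^sub>R g (snd z)) \<in> borel_measurable (?z0 lborel)" by measurable
   from borel_measurable_times[OF this kc] have km: "?k \<in> borel_measurable (?z0 lborel)" by (simp add: case_prod_unfold)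
   have ic: "integrable lborel (%x :: real ^ 'n. complex_of_real (indicator (box a b) x * ?c))"
    by (intro integrable_of_real integrable_mult_left integrable_real_indicator) (simp_all add: emeasure_bounded_finite[OF bounded_box, unfolded infinity_ennreal_def])
   have ik: "integrable (?z0 lborel) ?k"
   proof (rule lborel_pair.integrable_pair_bounded_by_prod[OF ic g km])
    fix x y :: "real ^ 'n"
    have "cmod (g y) * gauss_kernel ?\<epsilon> (x - y) <= cmod (g y) * ?c"
     by (intro mult_left_mono gauss_kernel_bounds(2)[OF e0] norm_ge_zero)
    moreover have "\<bar>gauss_kernel ?\<epsilon> (x - y)\<bar> = gauss_kernel ?\<epsilon> (x - y)" by (rule abs_of_nonneg[OF gauss_kernel_bounds(1)[OF e0]])
    moreover have "0 <= ?c" by simp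
    ultimately show "cmod (?k (x, y)) <= cmod (complex_of_real (indicator (box a b) x * ?c)) * cmod (g y)"
     by (simp only: case_prod_conv norm_scaleR norm_mult norm_of_real abs_mult) (simp add: indicator_def mult.commute)
   qed
   have "(LINT x:box a b|lborel. u n x) = (LINT x|lborel. (LINT y|lborel. indicator (box a b) x *\<^sub>R (g y * of_real (gauss_kernel ?\<epsilon> (x - y)))))"
    unfolding set_lebesgue_integral_def conv by simp
   also have "... = (LINT y|lborel. (LINT x|lborel. indicator (box a b) x *\<^sub>R (g y * of_real (gauss_kernel ?\<epsilon> (x - y)))))"
    using lborel_pair.Fubini_integral[OF ik] by simp
   also have "... = (LINT y|lborel. g y * (LINT x:box a b|lborel. of_real (gauss_kernel ?\<epsilon> (x - y))))"
    unfolding set_lebesgue_integral_def by (simp only: mult_scaleR_right[symmetric] integral_mult_right_zero)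
   finally show ?thesis .
  qed
  have "(%n. LINT y|lborel. g y * (LINT x:box a b|lborel. of_real (gauss_kernel (1 / real (Suc n)) (x - y)))) \<longlonglongrightarrow> (LINT y|lborel. g y * of_real (indicator (box a b) y))"
  proof (rule integral_dominated_convergence[where w = "%y. cmod (g y)"])
   have gm: "(%y. LINT x:box a b|lborel. complex_of_real (gauss_kernel (1 / real (Suc n)) (x - y))) \<in> borel_measurable borel" for n
   proof -
    have e0: "1 / real (Suc n) > 0" by simp
    have kc: "(%(y :: real ^ 'n, x :: real ^ 'n). complex_of_real (gauss_kernel (1 / real (Suc n)) (x - y))) \<in> borel_measurable (?z0 lborel)"
     by (rule continuous_imp_borel_pair) (unfold case_prod_unfold, intro continuous_intros e0)
    have "(%z :: (real ^ 'n) \<times> (real ^ 'n). indicator (box a b) (snd z) :: real) \<in> borel_measurable (?z0 lborel)" by measurable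
    from borel_measurable_scaleR[OF this kc] have "(%(y, x). indicator (box a b) x *\<^sub>R complex_of_real (gauss_kernel (1 / real (Suc n)) (x - y))) \<in> borel_measurable (?z0 lborel)"
     by (simp add: case_prod_unfold)
    from lborel.borel_measurable_lebesgue_integral[OF this] show ?thesis by (simp add: set_lebesgue_integral_def)
   qed
   show "(%y. g y * (LINT x:box a b|lborel. of_real (gauss_kernel (1 / real (Suc n)) (x - y)))) \<in> borel_measurable lborel" for n
    using gm[of n] by simp
   \<comment> \<open>The limit of the mollified indicator is known off the faces of the box, which
     are null.\<close>
   have "AE y in lborel. \<forall>l. y $ l ~= a $ l" "AE y in lborel. \<forall>l. y $ l ~= b $ l" by (simp_all add: AE_all_countable AE_component_neq)
   then show "AE y in lborel. (%n. g y * (LINT x:box a b|lborel. of_real (gauss_kernel (1 / real (Suc n)) (x - y)))) \<longlonglongrightarrow> g y * of_real (indicator (box a b) y)"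
    by eventually_elim (intro tendsto_mult tendsto_const indicator_box_limit, simp_all)
   show "AE y in lborel. norm (g y * (LINT x:box a b|lborel. of_real (gauss_kernel (1 / real (Suc n)) (x - y)))) <= cmod (g y)" for n
   proof (rule AE_I2)
    fix y
    have "cmod (LINT x:box a b|lborel. complex_of_real (gauss_kernel (1 / real (Suc n)) (x - y))) <= 1" by (rule gauss_kernel_box_bound) simp
    from mult_left_mono[OF this, of "cmod (g y)"] show "norm (g y * (LINT x:box a b|lborel. of_real (gauss_kernel (1 / real (Suc n)) (x - y)))) <= cmod (g y)"
     by (simp add: norm_mult)
   qed
  qed (use g in auto)
  then show "(%n. LINT x:box a b|lborel. u n x) \<longlonglongrightarrow> (LINT x:box a b|lborel. g x)"
   unfolding e set_lebesgue_integral_def[of _ _ g] scaleR_conv_of_real by (simp only: mult.commute)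
 qed
 have ig: "set_integrable lborel (box a b) g" for a b
  unfolding set_integrable_def by (rule integrable_mult_indicator[OF _ g]) simp
 have ih: "set_integrable lborel (box a b) h" for a b
  unfolding set_integrable_def
 proof (rule Bochner_Integration.integrable_bound)
  show "integrable lborel (%x :: real ^ 'n. indicator (box a b) x * B)"
   by (intro integrable_mult_left integrable_real_indicator) (simp_all add: emeasure_bounded_finite[OF bounded_box, unfolded infinity_ennreal_def])
  show "AE x in lborel. norm (indicator (box a b) x *\<^sub>R h x) <= norm (indicator (box a b) x * B)"
   using order_trans[OF norm_ge_zero hb] hb by (intro AE_I2) (auto simp: indicator_def)
 qed measurable
 \<comment> \<open>\<open>h\<close> is known to be bounded but at this point not to be integrable,
   hence the restriction to a bounded box.\<close>
 let ?f = "%x. indicator (box c d) x *\<^sub>R (g x - h x)"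
 have "AE x in lborel. ?f x = 0"
 proof (rule integral_zero_on_boxes_imp_AE_zero)
  show "integrable lborel ?f" using set_integral_diff(1)[OF ig ih, of c d] unfolding set_integrable_def .
  fix a b :: "real ^ 'n"
  obtain a' b' where ab: "box a b \<inter> box c d = box a' b'"
  proof (rule that)
   show "box a b \<inter> box c d = box (\<chi> i. max (a $ i) (c $ i)) (\<chi> i. min (b $ i) (d $ i))"
    by (auto simp: mem_box_cart)
  qed
  have "(LINT x:box a b|lborel. ?f x) = (LINT x:box a' b'|lborel. g x - h x)"
   unfolding set_lebesgue_integral_def ab[symmetric] by (simp add: indicator_inter_arith)
  also have "... = 0" using set_integral_diff(2)[OF ig ih, of a' b'] eq[of a' b'] by simp
  finally show "(LINT x:box a b|lborel. ?f x) = 0" .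
 qed
 then show ?thesis unfolding h_def[symmetric] by eventually_elim (auto simp: indicator_def split: if_splits)
qed

section \<open>Lattice expansion of Barron functions\<close>

lemma fourier_eq_lborel:
 fixes g :: "real ^ 'n => complex"
 assumes fe: "integrable lebesgue fe" and g: "integrable lborel g" "AE x in lebesgue. fe x = g x"
 shows "fourier fe \<xi> = (LINT y|lborel. g y * wave_cnj \<xi> y)"
proof -
 have e: "exp (- 2 * of_real pi * \<i> * of_real t) = cis (- (2 * pi * t))" for t by (simp add: cis_conv_exp mult_ac)
 have cm: "(%x. wave_cnj \<xi> x) \<in> borel_measurable borel"
  by (intro borel_measurable_continuous_onI continuous_intros)
 have m: "(%x. g x * wave_cnj \<xi> x) \<in> borel_measurable lborel"
  using borel_measurable_times[OF borel_measurable_integrable[OF g(1)], of "%x. wave_cnj \<xi> x"] cm by simp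
 have cl: "(%x. wave_cnj \<xi> x) \<in> borel_measurable lebesgue" using cm by (intro measurable_completion) simp
 have "fourier fe \<xi> = (LINT x|lebesgue. g x * wave_cnj \<xi> x)"
  unfolding fourier_def e
 proof (rule integral_cong_AE)
  show "(%x. fe x * wave_cnj \<xi> x) \<in> borel_measurable lebesgue"
   by (intro borel_measurable_times borel_measurable_integrable[OF fe] cl)
  show "(%x. g x * wave_cnj \<xi> x) \<in> borel_measurable lebesgue" by (rule measurable_completion[OF m])
  show "AE x in lebesgue. fe x * wave_cnj \<xi> x = g x * wave_cnj \<xi> x"
   using g(2) by eventually_elim simp
 qed
 also have "... = (LINT y|lborel. g y * wave_cnj \<xi> y)" by (rule integral_completion[OF m])
 finally show ?thesis .
qed

lemma sigma_finite_count_space_lattice: "sigma_finite_measure (count_space (UNIV :: ('n::finite => int) set))"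
 by (rule sigma_finite_measure_count_space_countable) simp

lemma measurable_pair_countable2:
 fixes f :: "'a \<times> 'c::countable => 'b"
 assumes "!!y. (%x. f (x, y)) \<in> measurable N K"
 shows "f \<in> measurable (N \<Otimes>\<^sub>M count_space UNIV) K"
 using assms
 by (intro measurable_compose_countable[where f = "%a b. f (fst b, a)" and g = snd, simplified]) (auto intro: measurable_compose[OF measurable_fst])

text \<open>Insert the expansion of each wave into the inversion formula and exchange sum and
  integral: \<open>a \<nu>\<close> is the integral of the transform against
  \<open>frame_coeffs p \<xi> \<nu>\<close>. The claim concerns a single extension, since the
  infimum in the Barron norm may not be attained.\<close>

lemma lattice_expansion:
 fixes s :: real
 assumes s: "s >= 0"
 shows "\<exists>C\<ge>0. \<forall>fe :: real ^ 'n => complex. integrable lebesgue fe -->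
  (\<integral>\<^sup>+\<xi>. ennreal ((1 + norm \<xi>) powr s * cmod (fourier fe \<xi>)) \<partial>lebesgue) < \<infinity> -->
  (\<exists>a. lattice_norm s a
     <= ennreal C * (\<integral>\<^sup>+\<xi>. ennreal ((1 + norm \<xi>) powr s * cmod (fourier fe \<xi>)) \<partial>lebesgue) \<and>
    (AE x in lborel. x \<in> interior unit_cube --> fe x = lattice_series a x))"
proof -
 obtain p K where K: "K >= 0"
  and bd: "\<forall>\<xi> :: real ^ 'n. lattice_norm s (frame_coeffs p \<xi>) <= ennreal (K * (1 + norm \<xi>) powr s)"
  and rep: "\<forall>(\<xi> :: real ^ 'n) x. x \<in> unit_cube -->
    lattice_series (frame_coeffs p \<xi>) x = wave \<xi> x"
  using cube_exponential_frame[OF s, where 'n = 'n] by (elim exE conjE) (rule that)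
 show ?thesis
 proof (intro exI[of _ K] conjI K allI impI)
  fix fe :: "real ^ 'n => complex"
  assume fe: "integrable lebesgue fe"
  let ?I = "\<integral>\<^sup>+\<xi>. ennreal ((1 + norm \<xi>) powr s * cmod (fourier fe \<xi>)) \<partial>lebesgue"
  let ?M = "%\<nu> :: 'n => int. lattice_wt \<nu>"
  let ?cs = "count_space (UNIV :: ('n => int) set)"
  assume I: "?I < \<infinity>"
  obtain g where g: "integrable lborel g" "AE x in lebesgue. fe x = g x"
   using lebesgue_integrable_imp_borel[OF fe] by (elim exE conjE) (rule that)
  note [measurable] = borel_measurable_integrable[OF g(1)]
  define F where "F \<xi> = (LINT y|lborel. g y * wave_cnj \<xi> y)" for \<xi>
  have F: "fourier fe = F" by (rule ext) (simp only: F_def fourier_eq_lborel[OF fe g])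
  have Fm[measurable]: "F \<in> borel_measurable borel"
  proof -
   have c: "(%(\<xi> :: real ^ 'n, y :: real ^ 'n). wave_cnj \<xi> y) \<in> borel_measurable (lborel \<Otimes>\<^sub>M lborel)"
    by (rule continuous_imp_borel_pair) (unfold case_prod_unfold, intro continuous_intros)
   have "(%z :: (real ^ 'n) \<times> (real ^ 'n). g (snd z)) \<in> borel_measurable (lborel \<Otimes>\<^sub>M lborel)" by measurable
   from borel_measurable_times[OF this c]
   have "(%(\<xi>, y). g y * wave_cnj \<xi> y) \<in> borel_measurable (lborel \<Otimes>\<^sub>M lborel)" by (simp add: case_prod_unfold)
   from lborel.borel_measurable_lebesgue_integral[OF this] show ?thesis by (simp add: F_def[abs_def])
  qed
  let ?z2 = "%\<xi>. (1 + norm \<xi>) powr s * cmod (F \<xi>)"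
  have Ieq: "?I = (\<integral>\<^sup>+\<xi>. ennreal (?z2 \<xi>) \<partial>lborel)"
   unfolding F by (rule nn_integral_completion) measurable
  interpret PS: pair_sigma_finite "lborel :: (real ^ 'n) measure" ?cs
   by (intro pair_sigma_finite.intro sigma_finite_count_space_lattice lborel.sigma_finite_measure_axioms)
  have one: "1 <= (1 + norm v) powr s" for v :: "real ^ 'n" using s by (intro ge_one_powr_ge_zero) auto
  have iF: "integrable lborel F"
  proof (rule integrableI_bounded)
   have "(\<integral>\<^sup>+\<xi>. ennreal (norm (F \<xi>)) \<partial>lborel) <= (\<integral>\<^sup>+\<xi>. ennreal (?z2 \<xi>) \<partial>lborel)"
    using one by (intro nn_integral_mono ennreal_leI) (simp add: mult_le_cancel_right1)
   also have "... < \<infinity>" using I unfolding Ieq .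
   finally show "(\<integral>\<^sup>+\<xi>. ennreal (norm (F \<xi>)) \<partial>lborel) < \<infinity>" .
  qed simp
  define a where "a \<nu> = (LINT \<xi>|lborel. F \<xi> * frame_coeffs p \<xi> \<nu>)" for \<nu>
  let ?z3 = "%lborel. lborel \<Otimes>\<^sub>M ?cs"
  have pm[measurable]: "(%(\<xi>, \<nu>). F \<xi> * frame_coeffs p \<xi> \<nu>) \<in> borel_measurable (?z3 lborel)"
   by (rule measurable_pair_countable2) (simp_all, measurable)
  let ?z4 = "%\<xi> \<nu>. F \<xi> * frame_coeffs p \<xi> \<nu>"
  let ?z0 = "%\<xi> \<nu>. cmod (?z4 \<xi> \<nu>) * ?M \<nu> powr s"
  let ?z1 = "%\<nu> \<xi> lborel. \<integral>\<^sup>+\<nu>. \<integral>\<^sup>+\<xi>. ennreal (?z0 \<xi> \<nu>) \<partial>lborel \<partial>?cs"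
  \<comment> \<open>By Tonelli, one estimate that gives the bound on the lattice norm, the
    integrability in the definition of \<open>a\<close> and the hypothesis of Fubini for the series.
    The arguments of \<open>?z1\<close> are dummies.\<close>
  have T: "(?z1 \<nu> \<xi> lborel) <= ennreal K * ?I"
  proof -
   have m: "(%(\<xi>, \<nu>). ennreal (?z0 \<xi> \<nu>)) \<in> borel_measurable (?z3 lborel)"
    by (rule measurable_pair_countable2) (simp_all, measurable)
   have "(?z1 \<nu> \<xi> lborel) = (\<integral>\<^sup>+\<xi>. \<integral>\<^sup>+\<nu>. ennreal (?z0 \<xi> \<nu>) \<partial>?cs \<partial>lborel)"
    by (rule PS.Fubini'[OF m])
   also have "... <= (\<integral>\<^sup>+\<xi>. ennreal K * ennreal (?z2 \<xi>) \<partial>lborel)"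
   proof (rule nn_integral_mono)
    fix \<xi> :: "real ^ 'n"
    have "(\<integral>\<^sup>+\<nu>. ennreal (?z0 \<xi> \<nu>) \<partial>?cs) = (\<integral>\<^sup>+\<nu>. ennreal (cmod (F \<xi>)) * ennreal (cmod (frame_coeffs p \<xi> \<nu>) * ?M \<nu> powr s) \<partial>?cs)"
     by (intro nn_integral_cong) (simp add: norm_mult ennreal_mult'[symmetric] mult.assoc)
    also have "... = ennreal (cmod (F \<xi>)) * lattice_norm s (frame_coeffs p \<xi>)"
     by (rule nn_integral_cmult) simp
    also have "... <= ennreal (cmod (F \<xi>)) * ennreal (K * (1 + norm \<xi>) powr s)"
     by (intro mult_left_mono bd[rule_format]) simp
    also have "... = ennreal K * ennreal (?z2 \<xi>)"
     using K by (simp add: ennreal_mult'[symmetric] mult_ac)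
    finally show "(\<integral>\<^sup>+\<nu>. ennreal (?z0 \<xi> \<nu>) \<partial>?cs) <= ennreal K * ennreal (?z2 \<xi>)" .
   qed
   also have "... = ennreal K * ?I" unfolding Ieq by (rule nn_integral_cmult) measurable
   finally show ?thesis .
  qed
  have fin: "ennreal K * ?I < \<infinity>" using I by (simp add: ennreal_mult_less_top)
  have ia: "integrable lborel (%\<xi>. F \<xi> * frame_coeffs p \<xi> \<nu>)" for \<nu>
  proof (rule integrableI_bounded)
   have "(\<integral>\<^sup>+\<xi>. ennreal (norm (?z4 \<xi> \<nu>)) \<partial>lborel) <= (\<integral>\<^sup>+\<xi>. ennreal (?z0 \<xi> \<nu>) \<partial>lborel)"
    using one[of "lattice_vec \<nu>"] by (intro nn_integral_mono ennreal_leI) (simp add: mult_le_cancel_left1)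
   also have "... = (\<integral>\<^sup>+\<nu>'\<in>{\<nu>}. (\<integral>\<^sup>+\<xi>. ennreal (cmod (F \<xi> * frame_coeffs p \<xi> \<nu>') * ?M \<nu>' powr s) \<partial>lborel) \<partial>?cs)"
    by (subst nn_integral_indicator_singleton) simp_all
   also have "... <= (\<integral>\<^sup>+\<nu>'. (\<integral>\<^sup>+\<xi>. ennreal (cmod (F \<xi> * frame_coeffs p \<xi> \<nu>') * ?M \<nu>' powr s) \<partial>lborel) \<partial>?cs)"
    by (intro nn_integral_mono) (simp add: indicator_def)
   also note T
   also note fin
   finally show "(\<integral>\<^sup>+\<xi>. ennreal (norm (?z4 \<xi> \<nu>)) \<partial>lborel) < \<infinity>" .
  qed measurable
  show "\<exists>a. lattice_norm s a <= ennreal K * ?I \<and>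
    (AE x in lborel. x \<in> interior unit_cube --> fe x = lattice_series a x)"
  proof (intro exI[of _ a] conjI)
   have "lattice_norm s a <= (?z1 \<nu> \<xi> lborel)"
   proof (rule nn_integral_mono)
    fix \<nu>
    have "ennreal (cmod (a \<nu>) * ?M \<nu> powr s) = ennreal (cmod (a \<nu>)) * ennreal (?M \<nu> powr s)" by (rule ennreal_mult) simp_all
    also have "... <= (\<integral>\<^sup>+\<xi>. ennreal (cmod (?z4 \<xi> \<nu>)) \<partial>lborel) * ennreal (?M \<nu> powr s)"
     unfolding a_def by (intro mult_right_mono integral_norm_bound_ennreal[OF ia]) simp
    also have "... = (\<integral>\<^sup>+\<xi>. ennreal (cmod (?z4 \<xi> \<nu>)) * ennreal (?M \<nu> powr s) \<partial>lborel)"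
     by (rule nn_integral_multc[symmetric]) measurable
    also have "... = (\<integral>\<^sup>+\<xi>. ennreal (?z0 \<xi> \<nu>) \<partial>lborel)"
     by (intro nn_integral_cong ennreal_mult[symmetric]) simp_all
    finally show "ennreal (cmod (a \<nu>) * ?M \<nu> powr s) <= (\<integral>\<^sup>+\<xi>. ennreal (?z0 \<xi> \<nu>) \<partial>lborel)" .
   qed
   then show "lattice_norm s a <= ennreal K * ?I" using T by (rule order_trans)
   have inv: "AE x in lborel. x \<in> interior unit_cube --> g x = (LINT \<xi>|lborel. F \<xi> * wave \<xi> x)"
    using fourier_inversion_on_box[OF g(1) iF[unfolded F_def], of 0 "\<chi> i. 1"] unfolding F_def interior_unit_cube .
   have "AE x in lborel. fe x = g x" using g(2) by (simp add: AE_completion_iff)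
   with inv show "AE x in lborel. x \<in> interior unit_cube --> fe x = lattice_series a x"
   proof (eventually_elim, intro impI)
    fix x :: "real ^ 'n"
    assume *: "x \<in> interior unit_cube --> g x = (LINT \<xi>|lborel. F \<xi> * wave \<xi> x)" "fe x = g x" "x \<in> interior unit_cube"
    then have x: "x \<in> unit_cube" using interior_subset by (rule_tac subsetD)
    let ?k = "%(\<xi>, \<nu>). F \<xi> * frame_coeffs p \<xi> \<nu> * cis (lattice_vec \<nu> \<bullet> x)"
    have km: "?k \<in> borel_measurable (?z3 lborel)"
     by (rule measurable_pair_countable2) (simp_all, measurable)
    have ik: "integrable (?z3 lborel) ?k"
    proof (rule integrableI_bounded[OF km])
     have nm: "(%z. ennreal (norm (?k z))) \<in> borel_measurable (?z3 lborel)" using km by measurable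
     have "(\<integral>\<^sup>+z. ennreal (norm (?k z)) \<partial>(?z3 lborel)) = (\<integral>\<^sup>+\<nu>. \<integral>\<^sup>+\<xi>. ennreal (norm (?k (\<xi>, \<nu>))) \<partial>lborel \<partial>?cs)"
      by (rule PS.nn_integral_snd[symmetric]) (use nm in simp)
     also have "... <= (?z1 \<nu> \<xi> lborel)"
     proof (intro nn_integral_mono ennreal_leI)
      fix \<nu> \<xi>
      show "norm (?k (\<xi>, \<nu>)) <= cmod (?z4 \<xi> \<nu>) * ?M \<nu> powr s"
       using mult_left_mono[OF one[of "lattice_vec \<nu>"] norm_ge_zero[of "F \<xi> * frame_coeffs p \<xi> \<nu>"]] by (simp add: norm_mult)
     qed
     also note T
     also note fin
     finally show "(\<integral>\<^sup>+z. ennreal (norm (?k z)) \<partial>(?z3 lborel)) < \<infinity>" .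
    qed
    have "fe x = (LINT \<xi>|lborel. F \<xi> * wave \<xi> x)" using * by simp
    also have "... = (LINT \<xi>|lborel. (LINT \<nu>|?cs. F \<xi> * frame_coeffs p \<xi> \<nu> * cis (lattice_vec \<nu> \<bullet> x)))"
    proof -
     have "(LINT \<nu>|?cs. F \<xi> * frame_coeffs p \<xi> \<nu> * cis (lattice_vec \<nu> \<bullet> x)) = F \<xi> * wave \<xi> x" for \<xi>
      unfolding mult.assoc[of "F \<xi>"] integral_mult_right_zero rep[rule_format, OF x] by (rule refl)
     then show ?thesis by simp
    qed
    also have "... = (LINT \<nu>|?cs. (LINT \<xi>|lborel. F \<xi> * frame_coeffs p \<xi> \<nu> * cis (lattice_vec \<nu> \<bullet> x)))"
     by (rule PS.Fubini_integral[OF ik, symmetric])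
    also have "... = lattice_series a x"
     unfolding integral_mult_left_zero a_def by (rule refl)
    finally show "fe x = lattice_series a x" .
   qed
  qed
 qed
qed

section \<open>Allocation of neurons to frequencies\<close>

lemma card_lattice_ball:
 assumes r: "r >= 1"
 shows "finite {\<nu> :: 'n::finite => int. lattice_wt \<nu> <= r}"
  and "real (card {\<nu> :: 'n => int. lattice_wt \<nu> <= r}) <= (3 * r) ^ CARD('n)"
proof -
 let ?K = "\<lfloor>r\<rfloor>"
 let ?P = "PiE (UNIV :: 'n set) (%_. {- ?K..?K})"
 have sub: "{\<nu> :: 'n => int. lattice_wt \<nu> <= r} \<subseteq> ?P"
 proof (intro subsetI PiE_I)
  fix \<nu> :: "'n => int" and l
  assume "\<nu> \<in> {\<nu>. lattice_wt \<nu> <= r}"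
  then have "\<bar>(lattice_vec \<nu> :: real ^ 'n) $ l\<bar> <= r"
   using component_le_norm_cart[of "lattice_vec \<nu> :: real ^ 'n" l] by simp
  then have "\<bar>real_of_int (\<nu> l)\<bar> <= r" by (simp add: lattice_vec_def)
  then have "of_int \<bar>\<nu> l\<bar> <= r" by simp
  then have "\<bar>\<nu> l\<bar> <= ?K" by (simp only: le_floor_iff)
  then show "\<nu> l \<in> {- ?K..?K}" by auto
 qed auto
 have fP: "finite ?P" by (intro finite_PiE) auto
 show "finite {\<nu> :: 'n => int. lattice_wt \<nu> <= r}" by (rule finite_subset[OF sub fP])
 have "real (card {\<nu> :: 'n => int. lattice_wt \<nu> <= r}) <= real (card ?P)"
  using card_mono[OF fP sub] by simp
 also have "card ?P = card {- ?K..?K} ^ CARD('n)" by (subst card_PiE) simp_all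
 also have "real (card {- ?K..?K} ^ CARD('n)) = real (card {- ?K..?K}) ^ CARD('n)" by simp
 also have "... <= (3 * r) ^ CARD('n)"
 proof (rule power_mono)
  have "0 <= ?K" using r by simp
  then have "real (card {- ?K..?K}) = 2 * of_int ?K + 1" by simp
  also have "... <= 3 * r" using r of_int_floor_le[of r] by linarith
  finally show "real (card {- ?K..?K}) <= 3 * r" .
 qed simp
 finally show "real (card {\<nu> :: 'n => int. lattice_wt \<nu> <= r}) <= (3 * r) ^ CARD('n)" .
qed

text \<open>The shell where the weight lies between \<open>2^j\<close> and \<open>2^(j+1)\<close>
  has at most \<open>6^d * 2^(j d)\<close> points by \<open>card_lattice_ball\<close>, and on it the
  power is \<open>2^(j e)\<close> up to a factor \<open>2 powr \<bar>e\<bar>\<close>.\<close>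

lemma lattice_dyadic_sum:
 shows "\<exists>C>0. \<forall>R\<ge>1. (\<Sum>\<nu>::'n::finite=>int | lattice_wt \<nu> <= R. lattice_wt \<nu> powr e)
   <= C * (\<Sum>j\<le>nat \<lfloor>log 2 R\<rfloor>. (2 powr (e + real CARD('n))) ^ j)"
proof (intro exI[of _ "2 powr \<bar>e\<bar> * 6 ^ CARD('n)"] conjI allI impI)
 fix R :: real
 assume R: "R >= 1"
 let ?d = "CARD('n)"
 let ?M = "%\<nu> :: 'n => int. lattice_wt \<nu>"
 let ?S = "{\<nu>. ?M \<nu> <= R}"
 let ?J = "nat \<lfloor>log 2 R\<rfloor>"
 define g where "g \<nu> = nat \<lfloor>log 2 (?M \<nu>)\<rfloor>" for \<nu>
 have M1: "?M \<nu> >= 1" for \<nu> by simp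
 have gM: "2 ^ g \<nu> <= ?M \<nu>" "?M \<nu> <= 2 * 2 ^ g \<nu>" for \<nu>
 proof -
  have l0: "0 <= log 2 (?M \<nu>)" by (subst zero_le_log_cancel_iff) (simp_all add: add_pos_nonneg)
  have r: "real (g \<nu>) = of_int \<lfloor>log 2 (?M \<nu>)\<rfloor>" unfolding g_def using l0 by simp
  have Mp: "0 < ?M \<nu>" by (rule less_le_trans[OF zero_less_one M1])
  have e: "2 powr (log 2 (?M \<nu>)) = ?M \<nu>" using Mp by (intro powr_log_cancel) simp_all
  have "2 powr real (g \<nu>) <= 2 powr (log 2 (?M \<nu>))" unfolding r by (intro powr_mono of_int_floor_le) simp
  then show "2 ^ g \<nu> <= ?M \<nu>" unfolding e by (simp add: powr_realpow)
  have "2 powr (log 2 (?M \<nu>)) <= 2 powr (1 + real (g \<nu>))" unfolding r by (intro powr_mono) (linarith, simp)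
  also have "... = 2 * 2 ^ g \<nu>" unfolding powr_add by (simp add: powr_realpow)
  finally show "?M \<nu> <= 2 * 2 ^ g \<nu>" unfolding e .
 qed
 have fin: "finite ?S" by (rule card_lattice_ball(1)[OF R])
 have gJ: "g ` ?S \<subseteq> {..?J}"
  unfolding g_def using R by (auto intro!: nat_mono floor_mono log_mono order.strict_trans2[OF zero_less_one] simp del: log_le_cancel_iff)
 let ?z0 = "2 powr (e + real ?d)"
 have "(\<Sum>\<nu>\<in>?S. ?M \<nu> powr e) = (\<Sum>j\<le>?J. \<Sum>\<nu> | \<nu> \<in> ?S \<and> g \<nu> = j. ?M \<nu> powr e)"
  by (rule sum.group[symmetric]) (use fin gJ in auto)
 also have "... <= (\<Sum>j\<le>?J. 2 powr \<bar>e\<bar> * 6 ^ ?d * ?z0 ^ j)"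
 proof (rule sum_mono)
  fix j
  let ?T = "{\<nu>. \<nu> \<in> ?S \<and> g \<nu> = j}"
  have r1: "(1 :: real) <= 2 * 2 ^ j" by (rule order_trans[of _ "2 * 1"]) (simp, intro mult_left_mono, simp_all)
  have t: "?M \<nu> powr e <= 2 powr \<bar>e\<bar> * (2 ^ j) powr e" if "\<nu> \<in> ?T" for \<nu>
  proof (cases "e >= 0")
   case True
   have "?M \<nu> powr e <= (2 * 2 ^ j) powr e" using gM[of \<nu>] that True by (intro powr_mono2) auto
   then show ?thesis using True by (simp add: powr_mult)
  next
   case False
   have "?M \<nu> powr e <= (2 ^ j) powr e" using gM[of \<nu>] that False by (intro powr_mono2') auto
   also have "... <= 2 powr \<bar>e\<bar> * (2 ^ j) powr e" using mult_right_mono[of 1 "2 powr \<bar>e\<bar>" "(2 ^ j) powr e"] by (simp add: ge_one_powr_ge_zero)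
   finally show ?thesis .
  qed
  have "?T \<subseteq> {\<nu>. ?M \<nu> <= 2 * 2 ^ j}" using gM by auto
  then have "real (card ?T) <= (3 * (2 * 2 ^ j)) ^ ?d"
   using card_lattice_ball[OF r1, where 'n = 'n] card_mono[of "{\<nu>. ?M \<nu> <= 2 * 2 ^ j}" ?T]
   by (meson of_nat_mono order_trans)
  then have c: "real (card ?T) <= 6 ^ ?d * (2 ^ j) ^ ?d" by (simp add: power_mult_distrib)
  let ?z1 = "2 powr \<bar>e\<bar> * (2 ^ j) powr e"
  have "(\<Sum>\<nu>\<in>?T. ?M \<nu> powr e) <= real (card ?T) * ?z1"
   by (rule sum_bounded_above) (rule t)
  also have "... <= 6 ^ ?d * (2 ^ j) ^ ?d * ?z1" by (intro mult_right_mono c) simp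
  also have "(2 ^ j) powr e * (2 ^ j) ^ ?d = ?z0 ^ j"
   by (simp add: powr_realpow[symmetric] powr_powr powr_add[symmetric] algebra_simps)
  then have "6 ^ ?d * (2 ^ j) ^ ?d * ?z1 = 2 powr \<bar>e\<bar> * 6 ^ ?d * ?z0 ^ j"
   by (simp only: mult_ac)
  finally show "(\<Sum>\<nu>\<in>?T. ?M \<nu> powr e) <= 2 powr \<bar>e\<bar> * 6 ^ ?d * ?z0 ^ j" .
 qed
 finally show "(\<Sum>\<nu>\<in>?S. ?M \<nu> powr e) <= 2 powr \<bar>e\<bar> * 6 ^ ?d * (\<Sum>j\<le>?J. ?z0 ^ j)"
  unfolding sum_distrib_left .
qed simp

text \<open>In this and the next two lemmas the ratio of the geometric sum is above, equal to and
  below 1, so the last shell dominates, all shells count equally, or the first one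
  dominates.\<close>

lemma lattice_power_sum_pos:
 assumes \<delta>: "\<delta> > 0"
 shows "\<exists>C>0. \<forall>R\<ge>1. (\<Sum>\<nu>::'n::finite=>int | lattice_wt \<nu> <= R. lattice_wt \<nu> powr (\<delta> - real CARD('n))) <= C * R powr \<delta>"
proof -
 obtain C where C: "C > 0" "\<forall>R\<ge>1. (\<Sum>\<nu>::'n::finite=>int | lattice_wt \<nu> <= R. lattice_wt \<nu> powr (\<delta> - real CARD('n)))
   <= C * (\<Sum>j\<le>nat \<lfloor>log 2 R\<rfloor>. (2 powr (\<delta> - real CARD('n) + real CARD('n))) ^ j)"
  using lattice_dyadic_sum[of "\<delta> - real CARD('n)", where 'n = 'n] by (elim exE conjE) (rule that)
 define r where "r = 2 powr \<delta>"
 have r: "r > 1" unfolding r_def using \<delta> by simp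
 show ?thesis
 proof (intro exI[of _ "C * (r / (r - 1))"] conjI allI impI)
  show "0 < C * (r / (r - 1))" using C(1) r by simp
  fix R :: real assume R: "R >= 1"
  let ?J = "nat \<lfloor>log 2 R\<rfloor>"
  have J: "real ?J <= log 2 R" using R by simp
  have "(\<Sum>j\<le>?J. r ^ j) = (r ^ Suc ?J - 1) / (r - 1)"
   using geometric_sum[of r "Suc ?J"] r unfolding lessThan_Suc_atMost by simp
  also have "... <= r ^ Suc ?J / (r - 1)" using r by (intro divide_right_mono) auto
  also have "... = r / (r - 1) * r ^ ?J" by simp
  also have "... <= r / (r - 1) * R powr \<delta>"
  proof (rule mult_left_mono)
   have "r ^ ?J = 2 powr (\<delta> * real ?J)" unfolding r_def by (simp add: powr_powr[symmetric] powr_realpow)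
   also have "... <= 2 powr (\<delta> * log 2 R)" using J \<delta> by (intro powr_mono mult_left_mono) auto
   also have "... = (2 powr log 2 R) powr \<delta>" by (simp add: powr_powr mult.commute)
   also have "2 powr log 2 R = R" using R by simp
   finally show "r ^ ?J <= R powr \<delta>" .
  qed (use r in simp)
  finally have "C * (\<Sum>j\<le>?J. r ^ j) <= C * (r / (r - 1) * R powr \<delta>)" using C(1) by (intro mult_left_mono) auto
  with C(2)[rule_format, OF R] show "(\<Sum>\<nu>::'n::finite=>int | lattice_wt \<nu> <= R. lattice_wt \<nu> powr (\<delta> - real CARD('n))) <= C * (r / (r - 1)) * R powr \<delta>"
   unfolding diff_add_cancel r_def[symmetric] by (simp only: mult.assoc)
 qed
qed

lemma lattice_power_sum_zero:
 "\<exists>C>0. \<forall>R\<ge>1. (\<Sum>\<nu>::'n::finite=>int | lattice_wt \<nu> <= R. lattice_wt \<nu> powr (- real CARD('n))) <= C * (1 + log 2 R)"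
proof -
 let ?z0 = "%j R. \<Sum>j\<le>nat \<lfloor>log 2 R\<rfloor>. (2 powr (- real CARD('n) + real CARD('n))) ^ j"
 obtain C where C: "C > 0" "\<forall>R\<ge>1. (\<Sum>\<nu>::'n::finite=>int | lattice_wt \<nu> <= R. lattice_wt \<nu> powr (- real CARD('n)))
   <= C * (?z0 j R)"
  using lattice_dyadic_sum[of "- real CARD('n)", where 'n = 'n] by (elim exE conjE) (rule that)
 show ?thesis
 proof (intro exI[of _ C] conjI allI impI C(1))
  fix R :: real assume R: "R >= 1"
  have "(?z0 j R) = 1 + real (nat \<lfloor>log 2 R\<rfloor>)" by simp
  also have "... <= 1 + log 2 R" using R by simp
  finally have "C * (?z0 j R) <= C * (1 + log 2 R)"
   using C(1) by (intro mult_left_mono) auto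
  with C(2)[rule_format, OF R] show "(\<Sum>\<nu>::'n::finite=>int | lattice_wt \<nu> <= R. lattice_wt \<nu> powr (- real CARD('n))) <= C * (1 + log 2 R)"
   by (rule order_trans)
 qed
qed

lemma lattice_power_sum_neg:
 assumes \<delta>: "\<delta> > 0"
 shows "\<exists>C>0. \<forall>R\<ge>1. (\<Sum>\<nu>::'n::finite=>int | lattice_wt \<nu> <= R. lattice_wt \<nu> powr (- \<delta> - real CARD('n))) <= C"
proof -
 obtain C where C: "C > 0" "\<forall>R\<ge>1. (\<Sum>\<nu>::'n::finite=>int | lattice_wt \<nu> <= R. lattice_wt \<nu> powr (- \<delta> - real CARD('n)))
   <= C * (\<Sum>j\<le>nat \<lfloor>log 2 R\<rfloor>. (2 powr (- \<delta> - real CARD('n) + real CARD('n))) ^ j)"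
  using lattice_dyadic_sum[of "- \<delta> - real CARD('n)", where 'n = 'n] by (elim exE conjE) (rule that)
 define r where "r = 2 powr (- \<delta>)"
 have r: "r > 0" "r < 1" unfolding r_def using \<delta> by (simp_all add: powr_less_one)
 show ?thesis
 proof (intro exI[of _ "C * (1 / (1 - r))"] conjI allI impI)
  show "0 < C * (1 / (1 - r))" using C(1) r by simp
  fix R :: real assume R: "R >= 1"
  let ?J = "nat \<lfloor>log 2 R\<rfloor>"
  have "(\<Sum>j\<le>?J. r ^ j) = (1 - r ^ Suc ?J) / (1 - r)"
   using r by (subst sum_gp0) simp
  also have "... <= 1 / (1 - r)" using r by (intro divide_right_mono) auto
  finally have "C * (\<Sum>j\<le>?J. r ^ j) <= C * (1 / (1 - r))" using C(1) by (intro mult_left_mono) auto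
  with C(2)[rule_format, OF R] show "(\<Sum>\<nu>::'n::finite=>int | lattice_wt \<nu> <= R. lattice_wt \<nu> powr (- \<delta> - real CARD('n))) <= C * (1 / (1 - r))"
   unfolding diff_add_cancel r_def[symmetric] by (rule order_trans)
 qed
qed

text \<open>For \<open>x >= 2\<close> the logarithm may be below 1, but \<open>2 * ln x\<close> is
  not; the constant pays for raising the exponent of the logarithm.\<close>

lemma ln_powr_le:
 fixes x :: real
 assumes "x >= 2" "a <= q"
 shows "ln x powr a <= 2 powr (q - a) * ln x powr q"
proof -
 have "ln 2 <= ln x" using assms(1) by simp
 moreover have "1 / 2 <= ln (2 :: real)" using ln_ge_iff[of 2 "1/2"] exp_le_cancel_iff exp_half_le2 by simp
 ultimately have l: "1 <= 2 * ln x" by linarith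
 then have lp: "0 < ln x" by linarith
 have "1 <= (2 * ln x) powr (q - a)" using l assms(2) by (intro ge_one_powr_ge_zero) auto
 then have "1 * ln x powr a <= (2 * ln x) powr (q - a) * ln x powr a" by (intro mult_right_mono) auto
 also have "... = 2 powr (q - a) * (ln x powr (q - a) * ln x powr a)" by (simp add: powr_mult)
 also have "ln x powr (q - a) * ln x powr a = ln x powr q" by (simp add: powr_add[symmetric])
 finally show ?thesis by simp
qed

text \<open>With \<open>N = A * M powr (1 - \<sigma> / \<kappa>)\<close> neurons at weight
  \<open>M\<close>, the error \<open>M powr (\<kappa> - \<sigma>) * N powr (- \<kappa>)\<close> is
  \<open>A powr (- \<kappa>)\<close> at all low frequencies, and \<open>R powr (- \<sigma>)\<close>
  bounds the high ones, where \<open>R = x powr (1 / (d + 1))\<close>. The conjuncts are these two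
  errors and the neuron budget. In the budget sum the shell \<open>j\<close> has size
  \<open>2 powr (j * (d + 1 - \<sigma> / \<kappa>))\<close>, and the sign of that exponent is the
  case distinction.\<close>

lemma neuron_profile:
 fixes \<kappa> \<sigma> :: real
 defines "\<tau> \<equiv> min (\<sigma> / (real CARD('n) + 1)) \<kappa>"
  and "q \<equiv> (if \<sigma> < (real CARD('n) + 1) * \<kappa> then 0 else if \<sigma> > (real CARD('n) + 1) * \<kappa> then 1 else 1 + \<kappa>)"
 assumes \<kappa>: "\<kappa> > 0" and \<sigma>: "\<sigma> >= 0"
 shows "\<exists>C>0. \<forall>x\<ge>2. \<exists>A>0. A powr (- \<kappa>) <= C * (x powr (- \<tau>) * ln x powr q) \<and>
   (x powr (1 / (real CARD('n) + 1))) powr (- \<sigma>) <= C * (x powr (- \<tau>) * ln x powr q) \<and>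
   A * (\<Sum>\<nu>::'n::finite=>int | lattice_wt \<nu> <= x powr (1 / (real CARD('n) + 1)). lattice_wt \<nu> powr (1 - \<sigma> / \<kappa>)) <= C * x"
proof -
 let ?d = "real CARD('n)"
 let ?S = "%R e. (\<Sum>\<nu>::'n::finite=>int | lattice_wt \<nu> <= R. lattice_wt \<nu> powr e)"
 have d: "?d + 1 > 0" by simp
 have R1: "1 <= x powr (1 / (?d + 1))" if "x >= 2" for x using that by (intro ge_one_powr_ge_zero) auto
 have RR: "(x powr (1 / (?d + 1))) powr (- \<sigma>) = x powr (- (\<sigma> / (?d + 1)))" for x by (simp add: powr_powr)
 consider (sub) "\<sigma> < (?d + 1) * \<kappa>" | (super) "\<sigma> > (?d + 1) * \<kappa>" | (crit) "\<sigma> = (?d + 1) * \<kappa>" by linarith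
 then show ?thesis
 proof cases
  case sub
  then have \<tau>: "\<tau> = \<sigma> / (?d + 1)" and q: "q = 0"
   unfolding \<tau>_def q_def using d by (simp_all add: min_def divide_le_eq mult.commute)
  define \<delta> where "\<delta> = ?d + 1 - \<sigma> / \<kappa>"
  have \<delta>: "\<delta> > 0" unfolding \<delta>_def using sub \<kappa> by (simp add: divide_less_eq)
  obtain C where C: "C > 0" "\<forall>R\<ge>1. ?S R (\<delta> - ?d) <= C * R powr \<delta>"
   using lattice_power_sum_pos[OF \<delta>, where 'n = 'n] by (elim exE conjE) (rule that)
  show ?thesis
  proof (rule exI[of _ "max 1 C"], intro conjI allI impI)
   fix x :: real assume x: "x >= 2"
   let ?R = "x powr (1 / (?d + 1))"
   have E: "x powr (- \<tau>) * ln x powr q = x powr (- (\<sigma> / (?d + 1)))" unfolding \<tau> q using x by simp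
   have Ec: "x powr (- (\<sigma> / (?d + 1))) <= max 1 C * x powr (- (\<sigma> / (?d + 1)))"
    using mult_right_mono[of 1 "max 1 C" "x powr (- (\<sigma> / (?d + 1)))"] by simp
   show "\<exists>A>0. A powr (- \<kappa>) <= max 1 C * (x powr (- \<tau>) * ln x powr q) \<and> ?R powr (- \<sigma>) <= max 1 C * (x powr (- \<tau>) * ln x powr q) \<and> A * ?S ?R (1 - \<sigma> / \<kappa>) <= max 1 C * x"
    unfolding E RR
   \<comment> \<open>This \<open>A\<close> makes both errors equal. It gives \<open>N = R\<close> at
     \<open>M = R\<close>, so the low-frequency construction joins the high-frequency one
     there.\<close>
   proof (intro exI[of _ "?R powr (\<sigma> / \<kappa>)"] conjI Ec)
    show "0 < ?R powr (\<sigma> / \<kappa>)" using x by simp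
    have "(?R powr (\<sigma> / \<kappa>)) powr (- \<kappa>) = x powr (- (\<sigma> / (?d + 1)))" using \<kappa> by (simp add: powr_powr)
    with Ec show "(?R powr (\<sigma> / \<kappa>)) powr (- \<kappa>) <= max 1 C * x powr (- (\<sigma> / (?d + 1)))" by simp
    have "?S ?R (1 - \<sigma> / \<kappa>) <= C * ?R powr \<delta>" using C(2)[rule_format, OF R1[OF x]] by (simp add: \<delta>_def)
    then have "?R powr (\<sigma> / \<kappa>) * ?S ?R (1 - \<sigma> / \<kappa>) <= ?R powr (\<sigma> / \<kappa>) * (C * ?R powr \<delta>)" by (rule mult_left_mono) simp
    also have "... = C * (?R powr (\<sigma> / \<kappa> + \<delta>))" by (simp add: powr_add)
    also have "?R powr (\<sigma> / \<kappa> + \<delta>) = x" unfolding \<delta>_def using x by (simp add: powr_powr)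
    also have "C * x <= max 1 C * x" using x by (intro mult_right_mono) auto
    finally show "?R powr (\<sigma> / \<kappa>) * ?S ?R (1 - \<sigma> / \<kappa>) <= max 1 C * x" .
   qed
  qed simp
 next
  case super
  then have \<tau>: "\<tau> = \<kappa>" and q: "q = 1" and le: "\<kappa> <= \<sigma> / (?d + 1)"
   unfolding \<tau>_def q_def using d by (simp_all add: min_def divide_le_eq pos_le_divide_eq mult.commute)
  define \<delta> where "\<delta> = \<sigma> / \<kappa> - (?d + 1)"
  have \<delta>: "\<delta> > 0" unfolding \<delta>_def using super \<kappa> by (simp add: less_divide_eq)
  obtain C where C: "C > 0" "\<forall>R\<ge>1. ?S R (- \<delta> - ?d) <= C"
   using lattice_power_sum_neg[OF \<delta>, where 'n = 'n] by (elim exE conjE) (rule that)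
  show ?thesis
  proof (rule exI[of _ "max 2 C"], intro conjI allI impI)
   fix x :: real assume x: "x >= 2"
   let ?R = "x powr (1 / (?d + 1))"
   have "1 <= 2 * ln x powr 1" using ln_powr_le[OF x, of 0 1] x by simp
   also have "... <= max 2 C * ln x powr 1" by (intro mult_right_mono) auto
   finally have "x powr (- \<kappa>) * 1 <= x powr (- \<kappa>) * (max 2 C * ln x powr 1)" by (rule mult_left_mono) simp
   then have Ec: "x powr (- \<kappa>) <= max 2 C * (x powr (- \<tau>) * ln x powr q)" unfolding \<tau> q by (simp only: mult_1_right mult_ac)
   show "\<exists>A>0. A powr (- \<kappa>) <= max 2 C * (x powr (- \<tau>) * ln x powr q) \<and> ?R powr (- \<sigma>) <= max 2 C * (x powr (- \<tau>) * ln x powr q) \<and> A * ?S ?R (1 - \<sigma> / \<kappa>) <= max 2 C * x"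
   \<comment> \<open>The sum over the lattice is bounded, so \<open>A\<close> may be of the order of
     the whole budget.\<close>
   proof (intro exI[of _ x] conjI Ec)
    show "0 < x" using x by simp
    have "?R powr (- \<sigma>) <= x powr (- \<kappa>)" unfolding RR using x le by (intro powr_mono) auto
    then show "?R powr (- \<sigma>) <= max 2 C * (x powr (- \<tau>) * ln x powr q)" using Ec by (rule order_trans)
    have "?S ?R (1 - \<sigma> / \<kappa>) <= C" using C(2)[rule_format, OF R1[OF x]] by (simp add: \<delta>_def)
    also have "... <= max 2 C" by simp
    finally have "x * ?S ?R (1 - \<sigma> / \<kappa>) <= x * max 2 C" using x by (intro mult_left_mono) auto
    then show "x * ?S ?R (1 - \<sigma> / \<kappa>) <= max 2 C * x" by (simp only: mult.commute)
   qed
  qed simp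
 next
  case crit
  then have \<tau>: "\<tau> = \<kappa>" and q: "q = 1 + \<kappa>" and \<sigma>\<kappa>: "\<sigma> / \<kappa> = ?d + 1" and le: "\<kappa> = \<sigma> / (?d + 1)"
   unfolding \<tau>_def q_def using d \<kappa> by (simp_all add: min_def)
  obtain C where C: "C > 0" "\<forall>R\<ge>1. ?S R (- ?d) <= C * (1 + log 2 R)"
   using lattice_power_sum_zero[where 'n = 'n] by (elim exE conjE) (rule that)
  define K where "K = max (2 powr (1 + \<kappa>)) (C * 4)"
  have K0: "0 < K" unfolding K_def by (rule less_le_trans[OF _ max.cobounded1]) simp
  have K1: "2 powr (1 + \<kappa>) <= K" "C * 4 <= K" by (simp_all add: K_def)
  have "2 powr (1 :: real) <= 2 powr (1 + \<kappa>)" using \<kappa> by (intro powr_mono) auto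
  then have K2: "2 <= K" using K1(1) by simp
  show ?thesis
  proof (rule exI[of _ K], intro conjI allI impI K0)
   fix x :: real assume x: "x >= 2"
   let ?R = "x powr (1 / (?d + 1))"
   have "ln 2 <= ln x" using x by simp
   moreover have l2: "1 / 2 <= ln (2 :: real)" using ln_ge_iff[of 2 "1/2"] exp_le_cancel_iff exp_half_le2 by simp
   ultimately have lp: "1 / 2 <= ln x" by linarith
   have Ec: "x powr (- \<kappa>) * ln x powr a <= K * (x powr (- \<tau>) * ln x powr q)" if "a = 0 \<or> a = \<kappa>" for a
   proof -
    have "ln x powr a <= 2 powr (1 + \<kappa> - a) * ln x powr (1 + \<kappa>)" using that \<kappa> by (intro ln_powr_le x) auto
    also have "... <= K * ln x powr (1 + \<kappa>)" using that K1(1) K2 by (intro mult_right_mono) auto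
    finally have "x powr (- \<kappa>) * ln x powr a <= x powr (- \<kappa>) * (K * ln x powr (1 + \<kappa>))" by (rule mult_left_mono) simp
    then show ?thesis unfolding \<tau> q by (simp only: mult_ac)
   qed
   show "\<exists>A>0. A powr (- \<kappa>) <= K * (x powr (- \<tau>) * ln x powr q) \<and> ?R powr (- \<sigma>) <= K * (x powr (- \<tau>) * ln x powr q) \<and> A * ?S ?R (1 - \<sigma> / \<kappa>) <= K * x"
   \<comment> \<open>About \<open>ln x\<close> dyadic shells share the budget equally.\<close>
   proof (intro exI[of _ "x / ln x"] conjI)
    show "0 < x / ln x" using x by simp
    have "(x / ln x) powr (- \<kappa>) = x powr (- \<kappa>) * ln x powr \<kappa>" using x lp by (simp add: powr_divide powr_minus_divide)
    then show "(x / ln x) powr (- \<kappa>) <= K * (x powr (- \<tau>) * ln x powr q)" using Ec[of \<kappa>] by simp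
    have "?R powr (- \<sigma>) = x powr (- \<kappa>) * ln x powr 0" unfolding RR le[symmetric] using lp by simp
    then show "?R powr (- \<sigma>) <= K * (x powr (- \<tau>) * ln x powr q)" using Ec[of 0] by simp
    have "log 2 ?R <= log 2 x"
    proof -
     have "?R <= x powr 1" using x by (intro powr_mono) auto
     then show ?thesis using x by simp
    qed
    also have "log 2 x = ln x / ln 2" by (simp add: log_def)
    also have "... <= 2 * ln x"
    proof -
     have "ln x * 1 <= ln x * (2 * ln 2)" using l2 lp by (intro mult_left_mono) auto
     then show ?thesis using l2 by (simp add: divide_le_eq)
    qed
    finally have "1 + log 2 ?R <= 4 * ln x" using lp by linarith
    then have "C * (1 + log 2 ?R) <= C * (4 * ln x)" using C(1) by (intro mult_left_mono) auto
    moreover have "?S ?R (1 - \<sigma> / \<kappa>) <= C * (1 + log 2 ?R)" using C(2)[rule_format, OF R1[OF x]] by (simp add: \<sigma>\<kappa>)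
    ultimately have "?S ?R (1 - \<sigma> / \<kappa>) <= C * (4 * ln x)" by linarith
    then have "x / ln x * ?S ?R (1 - \<sigma> / \<kappa>) <= x / ln x * (C * (4 * ln x))" using x by (intro mult_left_mono) auto
    also have "... = C * 4 * x" using lp by simp
    also have "... <= K * x" using K1(2) x by (intro mult_right_mono) auto
    finally show "x / ln x * ?S ?R (1 - \<sigma> / \<kappa>) <= K * x" .
   qed
  qed
 qed
qed

text \<open>The rate before the factor \<open>x powr (- 1 / 2)\<close> that sampling
  contributes.\<close>

definition approx_rate :: "nat => real => nat => real => real => real" where
 "approx_rate d s k m x = x powr (1 / 2 - rate_exponent d s k m) * ln x powr log_exponent d s k m"

text \<open>\<open>N \<nu>\<close> neurons for each frequency of weight at most \<open>R\<close>, at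
  most \<open>B\<close> in all; \<open>E\<close> bounds the normalised errors. The high-frequency
  condition is the low-frequency one with the weight in place of \<open>N \<nu>\<close>.\<close>

abbreviation allocation :: "nat => real => real => real => real => real => (('n::finite => int) => nat) => bool" where
 "allocation k m s R E B N \<equiv>
   (\<forall>\<nu>. lattice_wt \<nu> <= R --> 1 <= N \<nu> \<and> lattice_wt \<nu> powr (real k + 1 - s) * real (N \<nu>) powr (- (real k - m + 1 / 2)) <= E) \<and>
   (\<forall>\<nu>::'n => int. R < lattice_wt \<nu> --> lattice_wt \<nu> powr (m + 1 / 2 - s) <= E) \<and>
   (\<Sum>\<nu> | lattice_wt \<nu> <= R. real (N \<nu>)) <= B"

text \<open>Rounds the profile of \<open>neuron_profile\<close> up to integers. The rounding adds at
  most one neuron per lattice point, in total at most \<open>(3 * R) ^ d <= 3 ^ d * x\<close> by the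
  choice of the radius.\<close>

lemma neuron_allocation:
 fixes s m :: real and k :: nat
 assumes "m <= s - 1 / 2" "m < real k + 1 / 2"
 shows "\<exists>C>0. \<forall>x\<ge>2. \<exists>N :: ('n::finite => int) => nat.
   allocation k m s (x powr (1 / (real CARD('n) + 1))) (C * approx_rate CARD('n) s k m x) (C * x) N"
proof -
 let ?d = "real CARD('n)"
 define \<kappa> where "\<kappa> = real k - m + 1 / 2"
 define \<sigma> where "\<sigma> = s - m - 1 / 2"
 have \<kappa>: "\<kappa> > 0" and \<sigma>: "\<sigma> >= 0" using assms by (simp_all add: \<kappa>_def \<sigma>_def)
 have crit: "s < critical_smoothness CARD('n) k m \<longleftrightarrow> \<sigma> < (?d + 1) * \<kappa>" "s > critical_smoothness CARD('n) k m \<longleftrightarrow> \<sigma> > (?d + 1) * \<kappa>"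
  unfolding critical_smoothness_def \<kappa>_def[symmetric] \<sigma>_def by linarith+
 have r: "(2 * (s - m) - 1) / (2 * (?d + 1)) = \<sigma> / (?d + 1)"
 proof -
  have "2 * (s - m) - 1 = 2 * \<sigma>" by (simp add: \<sigma>_def)
  then show ?thesis by (simp only: mult_divide_mult_cancel_left_if) simp
 qed
 have rate: "1 / 2 - rate_exponent CARD('n) s k m = - min (\<sigma> / (?d + 1)) \<kappa>"
  unfolding rate_exponent_def r \<kappa>_def by simp
 have le: "log_exponent CARD('n) s k m = (if \<sigma> < (?d + 1) * \<kappa> then 0 else if \<sigma> > (?d + 1) * \<kappa> then 1 else 1 + \<kappa>)"
  unfolding log_exponent_def crit \<kappa>_def by simp
 have ar: "approx_rate CARD('n) s k m x = x powr (- min (\<sigma> / (?d + 1)) \<kappa>) * ln x powr (if \<sigma> < (?d + 1) * \<kappa> then 0 else if \<sigma> > (?d + 1) * \<kappa> then 1 else 1 + \<kappa>)" for x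
  unfolding approx_rate_def rate le by (rule refl)
 obtain C where C: "C > 0" and all: "\<forall>x\<ge>2. \<exists>A>0. A powr (- \<kappa>) <= C * approx_rate CARD('n) s k m x \<and>
   (x powr (1 / (?d + 1))) powr (- \<sigma>) <= C * approx_rate CARD('n) s k m x \<and>
   A * (\<Sum>\<nu>::'n::finite=>int | lattice_wt \<nu> <= x powr (1 / (?d + 1)). lattice_wt \<nu> powr (1 - \<sigma> / \<kappa>)) <= C * x"
  using neuron_profile[OF \<kappa> \<sigma>, where 'n = 'n] unfolding ar[symmetric] by (elim exE conjE) (rule that, assumption, assumption)
 show ?thesis
 proof (rule exI[of _ "C + 3 ^ CARD('n)"], intro conjI allI impI)
  show "0 < C + 3 ^ CARD('n)" using C by (simp add: add_pos_pos)
  fix x :: real assume x: "x >= 2"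
  let ?R = "x powr (1 / (?d + 1))"
  let ?M = "%\<nu> :: 'n => int. lattice_wt \<nu>"
  let ?E = "approx_rate CARD('n) s k m x"
  have E0: "0 <= ?E" by (simp add: approx_rate_def)
  have CE: "C * ?E <= (C + 3 ^ CARD('n)) * ?E" using E0 by (intro mult_right_mono) simp_all
  obtain A where A: "A > 0" "A powr (- \<kappa>) <= C * ?E" "?R powr (- \<sigma>) <= C * ?E"
   "A * (\<Sum>\<nu> | ?M \<nu> <= ?R. ?M \<nu> powr (1 - \<sigma> / \<kappa>)) <= C * x"
   using all[rule_format, OF x] by (elim exE conjE) (rule that)
  define y where "y \<nu> = A * ?M \<nu> powr (1 - \<sigma> / \<kappa>)" for \<nu>
  have Mp: "?M \<nu> > 0" for \<nu> by (simp add: add_pos_nonneg)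
  have y: "y \<nu> > 0" for \<nu> unfolding y_def using A(1) Mp[of \<nu>] by simp
  define N where "N \<nu> = nat \<lceil>y \<nu>\<rceil>" for \<nu>
  have Ny: "y \<nu> <= real (N \<nu>)" "real (N \<nu>) <= y \<nu> + 1" "1 <= N \<nu>" for \<nu>
  proof -
   have "0 < \<lceil>y \<nu>\<rceil>" using y[of \<nu>] by simp
   then have r: "real (N \<nu>) = of_int \<lceil>y \<nu>\<rceil>" unfolding N_def by simp
   have "1 <= N \<nu>" unfolding N_def using \<open>0 < \<lceil>y \<nu>\<rceil>\<close> by linarith
   show "y \<nu> <= real (N \<nu>)" "real (N \<nu>) <= y \<nu> + 1" unfolding r by linarith+
   show "1 <= N \<nu>" by fact
  qed
  show "\<exists>N :: ('n => int) => nat. allocation k m s ?R ((C + 3 ^ CARD('n)) * ?E) ((C + 3 ^ CARD('n)) * x) N"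
  proof (intro exI[of _ N] conjI allI impI Ny(3))
   fix \<nu>
   let ?z0 = "\<kappa> - \<sigma>"
   have "?M \<nu> powr (real k + 1 - s) * real (N \<nu>) powr (- \<kappa>) <= ?M \<nu> powr ?z0 * y \<nu> powr (- \<kappa>)"
   proof (rule mult_mono)
    show "real (N \<nu>) powr (- \<kappa>) <= y \<nu> powr (- \<kappa>)" using y Ny(1) \<kappa> by (intro powr_mono2') auto
    have "\<kappa> - \<sigma> = real k + 1 - s" by (simp add: \<kappa>_def \<sigma>_def)
    then show "?M \<nu> powr (real k + 1 - s) <= ?M \<nu> powr ?z0" by (simp only: order_refl)
   qed simp_all
   also have "... = A powr (- \<kappa>) * (?M \<nu> powr ?z0 * ?M \<nu> powr ((1 - \<sigma> / \<kappa>) * (- \<kappa>)))"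
    unfolding y_def by (simp add: powr_mult powr_powr)
   also have "?M \<nu> powr ?z0 * ?M \<nu> powr ((1 - \<sigma> / \<kappa>) * (- \<kappa>)) = ?M \<nu> powr (?z0 + (1 - \<sigma> / \<kappa>) * (- \<kappa>))" by (rule powr_add[symmetric])
   also have "?z0 + (1 - \<sigma> / \<kappa>) * (- \<kappa>) = 0" using \<kappa> by (simp add: field_simps)
   also have "A powr (- \<kappa>) * ?M \<nu> powr 0 = A powr (- \<kappa>)" using Mp[of \<nu>] by simp
   also note A(2)
   also note CE
   finally show "?M \<nu> powr (real k + 1 - s) * real (N \<nu>) powr (- (real k - m + 1 / 2)) <= (C + 3 ^ CARD('n)) * ?E" unfolding \<kappa>_def .
  next
   fix \<nu> assume h: "?R < ?M \<nu>"
   have "?M \<nu> powr (- \<sigma>) <= ?R powr (- \<sigma>)" using h \<sigma> x by (intro powr_mono2') auto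
   also note A(3)
   also note CE
   finally show "?M \<nu> powr (m + 1 / 2 - s) <= (C + 3 ^ CARD('n)) * ?E" by (simp add: \<sigma>_def diff_diff_eq)
  next
   have R1: "1 <= ?R" using x by (intro ge_one_powr_ge_zero) auto
   have "(\<Sum>\<nu> | ?M \<nu> <= ?R. real (N \<nu>)) <= (\<Sum>\<nu> | ?M \<nu> <= ?R. y \<nu> + 1)" by (intro sum_mono Ny)
   also have "... = A * (\<Sum>\<nu> | ?M \<nu> <= ?R. ?M \<nu> powr (1 - \<sigma> / \<kappa>)) + real (card {\<nu>. ?M \<nu> <= ?R})"
    by (simp add: y_def sum.distrib sum_distrib_left)
   also have "... <= C * x + 3 ^ CARD('n) * x"
   proof (rule add_mono[OF A(4)])
    have "real (card {\<nu>. ?M \<nu> <= ?R}) <= (3 * ?R) ^ CARD('n)" by (rule card_lattice_ball(2)[OF R1])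
    also have "... = 3 ^ CARD('n) * ?R ^ CARD('n)" by (rule power_mult_distrib)
    also have "?R ^ CARD('n) = x powr (?d / (?d + 1))" using x by (simp add: powr_realpow[symmetric] powr_powr)
    also have "x powr (?d / (?d + 1)) <= x powr 1" using x by (intro powr_mono) auto
    also have "x powr 1 = x" using x by simp
    finally show "real (card {\<nu>. ?M \<nu> <= ?R}) <= 3 ^ CARD('n) * x" by simp
   qed
   finally show "(\<Sum>\<nu> | ?M \<nu> <= ?R. real (N \<nu>)) <= (C + 3 ^ CARD('n)) * x" by (simp add: distrib_right)
  qed
 qed
qed

section \<open>Approximation of lattice series\<close>

lemma sobolev_energy_cmult:
 fixes H :: "('n::finite => nat) => real ^ 'n => complex"
 assumes H[measurable]: "!!\<alpha>. H \<alpha> \<in> borel_measurable borel" and U[measurable]: "U \<in> sets borel"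
 shows "sobolev_energy m U (%\<alpha> x. c * H \<alpha> x) = esq c * sobolev_energy m U H"
proof -
 have l2: "L2_sq U (%x. c * H \<alpha> x) = esq c * L2_sq U (H \<alpha>)" for \<alpha>
  unfolding L2_sq_def nn_integral_completion
  by (subst nn_integral_cmult[symmetric]) (auto intro!: nn_integral_cong simp: norm_mult power_mult_distrib ennreal_mult mult_ac)
 have sl: "slobodeckij_sq (frac m) U (%x. c * H \<alpha> x) = esq c * slobodeckij_sq (frac m) U (H \<alpha>)" for \<alpha>
 proof -
  let ?k = "%x y. ennreal ((cmod (H \<alpha> x - H \<alpha> y))\<^sup>2 / norm (x - y) powr (real CARD('n) + 2 * frac m)) * indicator U y"
  have km: "case_prod ?k \<in> borel_measurable (lborel \<Otimes>\<^sub>M lborel)" by measurable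
  have km1: "?k x \<in> borel_measurable lborel" for x by measurable
  have inner: "(\<integral>\<^sup>+y\<in>U. ennreal ((cmod (c * H \<alpha> x - c * H \<alpha> y))\<^sup>2 / norm (x - y) powr (real CARD('n) + 2 * frac m)) \<partial>lborel) = esq c * (\<integral>\<^sup>+y. ?k x y \<partial>lborel)" for x
  proof -
   have "ennreal ((cmod (c * H \<alpha> x - c * H \<alpha> y))\<^sup>2 / norm (x - y) powr (real CARD('n) + 2 * frac m)) * indicator U y = esq c * ?k x y" for y
   proof -
    have "(cmod (c * H \<alpha> x - c * H \<alpha> y))\<^sup>2 = (cmod c)\<^sup>2 * (cmod (H \<alpha> x - H \<alpha> y))\<^sup>2"
     unfolding right_diff_distrib[symmetric] norm_mult power_mult_distrib by (rule refl)
    then show ?thesis by (simp add: ennreal_mult'[symmetric] mult.assoc[symmetric])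
   qed
   then show ?thesis using nn_integral_cmult[OF km1] by simp
  qed
  have m: "(%x. (\<integral>\<^sup>+y. ?k x y \<partial>lborel) * indicator U x) \<in> borel_measurable lborel"
   using lborel.borel_measurable_nn_integral[OF km] by measurable
  show ?thesis
   unfolding slobodeckij_sq_def nn_integral_completion inner
   using nn_integral_cmult[OF m, of "esq c"] by (simp add: mult.assoc)
 qed
 show ?thesis
  unfolding sobolev_energy_def by (simp add: l2 sl sum_distrib_left[symmetric] distrib_left)
qed

text \<open>Slots beyond \<open>card I\<close> get coefficient 0; \<open>v\<close> is an arbitrary
  unit vector, since directions must lie on the sphere even there.\<close>

lemma shallow_network_finite_sum:
 fixes \<omega> :: "'i => real ^ 'n"
 assumes I: "finite I" "card I <= n" and \<omega>: "!!i. i \<in> I ==> norm (\<omega> i) = 1"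
 shows "(%x. \<Sum>i\<in>I. a i * of_real (relu_pow k (\<omega> i \<bullet> x + b i))) \<in> shallow_networks k n"
proof -
 obtain h where h: "bij_betw h {1..card I} I" using ex_bij_betw_nat_finite_1[OF I(1)] by (elim exE)
 define v :: "real ^ 'n" where "v = axis undefined 1"
 let ?C = "card I"
 define a' \<omega>' b' where "a' j = (if j <= ?C then a (h j) else 0)" and "\<omega>' j = (if j <= ?C then \<omega> (h j) else v)" and "b' j = (if j <= ?C then b (h j) else 0)" for j
 have hI: "h j \<in> I" if "j \<in> {1..?C}" for j using h that by (auto simp: bij_betw_def)
 have eq: "(\<Sum>i\<in>I. a i * of_real (relu_pow k (\<omega> i \<bullet> x + b i))) = (\<Sum>j=1..n. a' j * of_real (relu_pow k (\<omega>' j \<bullet> x + b' j)))" for x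
 proof -
  have "(\<Sum>i\<in>I. a i * of_real (relu_pow k (\<omega> i \<bullet> x + b i))) = (\<Sum>j\<in>{1..?C}. a (h j) * of_real (relu_pow k (\<omega> (h j) \<bullet> x + b (h j))))"
   by (rule sum.reindex_bij_betw[OF h, symmetric])
  also have "... = (\<Sum>j\<in>{1..?C}. a' j * of_real (relu_pow k (\<omega>' j \<bullet> x + b' j)))"
   by (intro sum.cong refl) (simp add: a'_def \<omega>'_def b'_def)
  also have "... = (\<Sum>j=1..n. a' j * of_real (relu_pow k (\<omega>' j \<bullet> x + b' j)))"
   by (rule sum.mono_neutral_left) (use I(2) in \<open>auto simp: a'_def\<close>)
  finally show ?thesis .
 qed
 have "\<forall>j\<in>{1..n}. \<omega>' j \<in> sphere 0 1"
  using hI \<omega> by (auto simp: \<omega>'_def v_def)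
 then show ?thesis unfolding eq shallow_networks_def mem_Collect_eq
  by (intro exI[of _ a'] exI[of _ \<omega>'] exI[of _ b'] conjI refl)
qed

lemma shallow_networks_add:
 assumes "f \<in> shallow_networks k n" "g \<in> shallow_networks k n'" "n + n' <= N"
 shows "(%x :: real ^ 'n. f x + g x) \<in> shallow_networks k N"
proof -
 obtain a \<omega> b where f: "f = (%x. \<Sum>i=1..n. a i * of_real (relu_pow k (\<omega> i \<bullet> x + b i)))" and \<omega>: "\<forall>i\<in>{1..n}. \<omega> i \<in> sphere 0 1"
  using assms(1) unfolding shallow_networks_def mem_Collect_eq by (elim exE conjE) (rule that)
 obtain a' \<omega>' b' where g: "g = (%x. \<Sum>i=1..n'. a' i * of_real (relu_pow k (\<omega>' i \<bullet> x + b' i)))" and \<omega>': "\<forall>i\<in>{1..n'}. \<omega>' i \<in> sphere 0 1"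
  using assms(2) unfolding shallow_networks_def mem_Collect_eq by (elim exE conjE) (rule that)
 have "(%x. \<Sum>i\<in>{1..n} <+> {1..n'}. case_sum a a' i * of_real (relu_pow k (case_sum \<omega> \<omega>' i \<bullet> x + case_sum b b' i))) \<in> shallow_networks k N"
  by (rule shallow_network_finite_sum) (use assms(3) \<omega> \<omega>' in \<open>auto simp: card_Plus\<close>)
 then show ?thesis unfolding f g by (simp add: sum.Plus)
qed

lemma spline_data_mono:
 assumes "spline_data k L \<Gamma> A w R \<gamma> \<beta>" "L <= L'" "\<Gamma> <= \<Gamma>'" "A <= A'"
 shows "spline_data k L' \<Gamma>' A' w R \<gamma> \<beta>"
proof -
 have "R b = 0" if "b \<notin> {- L'..L'}" for b using assms(1,2) that by (auto simp: spline_data_def)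
 moreover have "cmod (R b) <= A'" for b using assms(1) order_trans[OF _ assms(4)] unfolding spline_data_def by simp
 moreover have "\<bar>\<gamma> i b\<bar> <= \<Gamma>'" if "i < k + 2" for i b using assms(1) that order_trans[OF _ assms(3)] unfolding spline_data_def by simp
 ultimately show ?thesis using assms(1) unfolding spline_data_def by simp
qed

text \<open>The value \<open>N = 0\<close> encodes the representation without an explicit network part.\<close>

lemma spline_pieces:
 fixes T :: real
 assumes T: "T >= 0"
 shows "\<exists>C>0. \<exists>L>0. \<exists>\<Gamma>\<ge>0. \<forall>\<omega> M (N::nat). 1 <= M --> 0 <= \<omega> --> \<omega> <= M -->
   (cis_spline_rep k T \<omega> L \<Gamma> (C * M ^ Suc k) ((real k + 1) / (if N = 0 then M else real N)) (C * real N))"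
proof -
 obtain C1 L1 \<Gamma>1 where 1: "C1 > 0" "L1 > 0" "\<Gamma>1 >= 0" and h: "\<forall>\<omega> M. 1 <= M --> 0 <= \<omega> --> \<omega> <= M -->
   (pure_spline_rep k T \<omega> L1 \<Gamma>1 (C1 * M ^ Suc k) ((real k + 1) / M))"
  using spline_high[OF T, of k] by (elim exE conjE) (rule that)
 obtain C2 L2 \<Gamma>2 where 2: "C2 > 0" "L2 > 0" "\<Gamma>2 >= 0" and l: "\<forall>\<omega> M (N::nat). 1 <= M --> 0 <= \<omega> --> \<omega> <= M --> 1 <= N -->
   (spline_rep k T \<omega> L2 \<Gamma>2 (C2 * M ^ Suc k) ((real k + 1) / real N) (C2 * real N))"
  using spline_low[OF T, of k] by (elim exE conjE) (rule that)
 show ?thesis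
 proof (rule exI[of _ "max C1 C2"], rule conjI, (use 1 in simp), rule exI[of _ "max L1 L2"], rule conjI, (use 1 in simp), rule exI[of _ "max \<Gamma>1 \<Gamma>2"], rule conjI, (use 1 in simp), intro allI impI)
  fix \<omega> M :: real and N :: nat
  assume M: "1 <= M" "0 <= \<omega>" "\<omega> <= M"
  have A: "C1 * M ^ Suc k <= max C1 C2 * M ^ Suc k" "C2 * M ^ Suc k <= max C1 C2 * M ^ Suc k"
   using M by (intro mult_right_mono; simp)+
  show "cis_spline_rep k T \<omega> (max L1 L2) (max \<Gamma>1 \<Gamma>2) (max C1 C2 * M ^ Suc k) ((real k + 1) / (if N = 0 then M else real N)) (max C1 C2 * real N)"
  proof (cases "N = 0")
   case True
   obtain R \<gamma> \<beta> where sd: "spline_data k L1 \<Gamma>1 (C1 * M ^ Suc k) ((real k + 1) / M) R \<gamma> \<beta>"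
    and rep: "\<forall>t. \<bar>t\<bar> <= T --> iexp (\<omega> * t) = (LINT b|lborel. R b * of_real (spline_comb k \<gamma> \<beta> b t))"
    using h[rule_format, OF M] by (elim exE conjE) (rule that)
   show ?thesis
    unfolding True if_True refl
    by (rule exI[of _ R], rule exI[of _ \<gamma>], rule exI[of _ \<beta>], rule exI[of _ 0], rule exI[of _ "%_. 0"], rule exI[of _ "%_. 0"])
     (use rep spline_data_mono[OF sd max.cobounded1 max.cobounded1 A(1)] in \<open>simp add: cis_conv_exp\<close>)
  next
   case False
   then have N: "1 <= N" by simp
   obtain R \<gamma> \<beta> Q c \<tau> where sd: "spline_data k L2 \<Gamma>2 (C2 * M ^ Suc k) ((real k + 1) / real N) R \<gamma> \<beta>" and Q: "real Q <= C2 * real N"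
    and rep: "\<forall>t. \<bar>t\<bar> <= T --> iexp (\<omega> * t) = (\<Sum>q<Q. c q * of_real (relu_pow k (t - \<tau> q))) + (LINT b|lborel. R b * of_real (spline_comb k \<gamma> \<beta> b t))"
    using l[rule_format, OF M N] by (elim exE conjE) (rule that)
   have Q': "real Q <= max C1 C2 * real N" by (rule order_trans[OF Q], rule mult_right_mono) simp_all
   show ?thesis
    unfolding if_not_P[OF False]
    by (intro exI[of _ R] exI[of _ \<gamma>] exI[of _ \<beta>] exI[of _ Q] exI[of _ c] exI[of _ \<tau>] conjI Q' spline_data_mono[OF sd max.cobounded2 max.cobounded2 A(2)])
     (use rep in \<open>simp only: cis_conv_exp\<close>)
  qed
 qed
qed

text \<open>At frequency 0 any unit vector will do, as it is multiplied by the norm 0.\<close>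

definition lattice_dir :: "('n => int) => real ^ 'n" where
 "lattice_dir \<nu> = (if lattice_vec \<nu> = (0 :: real ^ 'n) then axis undefined 1 else lattice_vec \<nu> /\<^sub>R norm (lattice_vec \<nu> :: real ^ 'n))"

lemma norm_lattice_dir: "norm (lattice_dir \<nu>) = 1"
 by (simp add: lattice_dir_def)

lemma lattice_vec_eq_dir: "lattice_vec \<nu> \<bullet> x = norm (lattice_vec \<nu> :: real ^ 'n) * (lattice_dir \<nu> \<bullet> x)"
 for x :: "real ^ 'n"
 by (simp add: lattice_dir_def)

lemma unit_cube_inner_bound:
 fixes x :: "real ^ 'n"
 assumes "x \<in> unit_cube" "norm \<omega> = 1"
 shows "\<bar>\<omega> \<bullet> x\<bar> <= real CARD('n)"
proof -
 have "\<bar>\<omega> \<bullet> x\<bar> <= norm \<omega> * norm x" by (rule Cauchy_Schwarz_ineq2)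
 also have "... <= (\<Sum>i\<in>UNIV. \<bar>x $ i\<bar>)" using assms(2) norm_le_l1_cart[of x] by simp
 also have "... <= (\<Sum>i\<in>(UNIV :: 'n set). 1)" using assms(1) by (intro sum_mono) (auto simp: unit_cube_def)
 finally show ?thesis by simp
qed

lemma ridge_deriv_0: "ridge_deriv (%_. 0) k \<omega> b x = relu_pow k (\<omega> \<bullet> x + b)"
 by (simp add: ridge_deriv_def multi_index_order_def)

text \<open>\<open>N \<nu> = 0\<close> marks the frequencies without explicit neurons. The size of
  the network consists of the explicit part, paid for by the sum of the \<open>N \<nu>\<close>, and
  the sampled part, paid for by \<open>n\<close>.\<close>

abbreviation series_approximable ::
  "nat => real => real => real => (real ^ 'n => complex) => (('n::finite => int) => complex) => (('n => int) => nat) => real => real => nat => bool" where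
 "series_approximable k m s C f a N E A n \<equiv>
  0 <= E --> 0 < A -->
  lattice_norm s a = ennreal A -->
  (AE x in lborel. x \<in> interior unit_cube --> f x = lattice_series a x) -->
  finite {\<nu>. N \<nu> ~= 0} -->
  (\<forall>\<nu>. N \<nu> = 0 --> lattice_wt \<nu> powr (m + 1 / 2 - s) <= E) -->
  (\<forall>\<nu>. N \<nu> ~= 0 --> lattice_wt \<nu> powr (real k + 1 - s) * real (N \<nu>) powr (- (real k - m + 1 / 2)) <= E) -->
  (\<exists>j fn. fn \<in> shallow_networks k j \<and> real j <= C * (\<Sum>\<nu> | N \<nu> ~= 0. real (N \<nu>)) + C * real n \<and>
   sobolev_norm m (interior unit_cube) (%x. f x - fn x) <= ennreal (C * A * E / sqrt (max 1 (real n))))"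

text \<open>Importance sampling of pairs of a frequency and a shift. Drawing \<nu> with density
  proportional to \<open>|a \<nu>| * M^s\<close>, and the shift uniformly, leaves an amplitude of
  order \<open>A * M^(k+1-s)\<close> in front of a ridge spline of width about \<open>1 / h\<close>,
  whose norm is of order \<open>h^(-\<kappa>)\<close>. The hypotheses say that the product is at
  most \<open>A * E\<close> up to a constant for every pair, which is the uniform bound
  \<open>V\<close> that \<open>sobolev_maurey\<close> requires. The explicit networks are subtracted
  from \<open>f\<close> beforehand.\<close>

lemma lattice_series_approximation:
 fixes m s :: real and k :: nat
 assumes s: "s >= 0" and m: "0 <= m" "m < real k + 1 / 2"
 shows "\<exists>C>0. \<forall>(f :: real ^ 'n => complex) a (N :: ('n => int) => nat) E A n.
  series_approximable k m s C f a N E A n"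
proof -
 define \<kappa> where "\<kappa> = real k - m + 1 / 2"
 have \<kappa>: "\<kappa> > 0" using m by (simp add: \<kappa>_def)
 have T0: "real CARD('n) >= 0" by simp
 obtain Cs L \<Gamma> where Cs: "Cs > 0" and L: "L > 0" and \<Gamma>: "\<Gamma> >= 0" and pieces: "\<forall>\<omega> M (N::nat). 1 <= M --> 0 <= \<omega> --> \<omega> <= M -->
   (cis_spline_rep k (real CARD('n)) \<omega> L \<Gamma> (Cs * M ^ Suc k) ((real k + 1) / (if N = 0 then M else real N)) (Cs * real N))"
  using spline_pieces[OF T0, of k] by (elim exE conjE) (rule that)
 have k1: "real k + 1 > 0" and k2: "k + 2 >= 1" by simp_all
 obtain Ce where Ce: "Ce >= 0" and energy: "\<forall>(\<omega> :: real ^ 'n) b w \<gamma> \<beta>. norm \<omega> = 1 --> 0 < w --> w <= real k + 1 -->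
   (\<forall>y. (\<Sum>i<k + 2. \<gamma> i * (y - \<beta> i) ^ k) = 0) --> (\<forall>i<k + 2. \<bar>\<gamma> i\<bar> <= \<Gamma>) --> (\<forall>i<k + 2. \<bar>\<beta> i - b\<bar> <= w) -->
   sobolev_energy m (interior unit_cube) (%\<alpha> x. complex_of_real (\<Sum>i<k + 2. \<gamma> i * ridge_deriv \<alpha> k \<omega> (- \<beta> i) x))
    <= ennreal (Ce * w powr (2 * (real k - m) + 1))"
  using sobolev_energy_relu_comb[OF m k1 \<Gamma> k2, where 'n = 'n] by (elim exE conjE) (rule that)
 \<comment> \<open>Collects the factors of the bound on \<open>W\<close> and of the energy of a
   spline of width \<open>(k + 1) / h\<close>.\<close>
 define C0 where "C0 = 2 * L * Cs * (real k + 1) powr \<kappa> * sqrt Ce"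
 have C0: "C0 >= 0" unfolding C0_def using L Cs Ce by simp
 define C where "C = C0 + Cs + real k + 2"
 have C: "C > 0" "C0 <= C" "Cs <= C" "real (k + 2) <= C" unfolding C_def using C0 Cs by simp_all
 show ?thesis
 proof (rule exI[of _ C], intro conjI allI impI C(1))
  fix f :: "real ^ 'n => complex" and a and N :: "('n => int) => nat" and E A :: real and n :: nat
  let ?M = "%\<nu> :: 'n => int. lattice_wt \<nu>"
  let ?cs = "count_space (UNIV :: ('n => int) set)"
  let ?U = "interior unit_cube :: (real ^ 'n) set"
  let ?Lb = "lborel :: real measure"
  assume E: "0 <= E" and A: "0 < A" and sumA: "lattice_norm s a = ennreal A"
   and rep: "AE x in lborel. x \<in> ?U --> f x = lattice_series a x"
   and fin: "finite {\<nu>. N \<nu> ~= 0}"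
   and high: "\<forall>\<nu>. N \<nu> = 0 --> ?M \<nu> powr (m + 1 / 2 - s) <= E"
   and low: "\<forall>\<nu>. N \<nu> ~= 0 --> ?M \<nu> powr (real k + 1 - s) * real (N \<nu>) powr (- (real k - m + 1 / 2)) <= E"
  have M1: "1 <= ?M \<nu>" and Mp: "0 < ?M \<nu>" for \<nu> by (simp_all add: add_pos_nonneg)
  have "\<forall>\<nu>. \<exists>R \<gamma> \<beta> Q c \<tau>. spline_data k L \<Gamma> (Cs * ?M \<nu> ^ Suc k) ((real k + 1) / (if N \<nu> = 0 then ?M \<nu> else real (N \<nu>))) R \<gamma> \<beta> \<and> real Q <= Cs * real (N \<nu>) \<and>
    (\<forall>t. \<bar>t\<bar> <= real CARD('n) --> cis (norm (lattice_vec \<nu> :: real ^ 'n) * t) = (\<Sum>q<Q. c q * of_real (relu_pow k (t - \<tau> q))) +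
     (LINT b|lborel. R b * of_real (spline_comb k \<gamma> \<beta> b t)))"
   by (intro allI pieces[rule_format]) simp_all
  then obtain R \<gamma> \<beta> Q c \<tau> where all: "\<forall>\<nu>. spline_data k L \<Gamma> (Cs * ?M \<nu> ^ Suc k) ((real k + 1) / (if N \<nu> = 0 then ?M \<nu> else real (N \<nu>))) (R \<nu>) (\<gamma> \<nu>) (\<beta> \<nu>) \<and> real (Q \<nu>) <= Cs * real (N \<nu>) \<and>
    (\<forall>t. \<bar>t\<bar> <= real CARD('n) --> cis (norm (lattice_vec \<nu> :: real ^ 'n) * t) = (\<Sum>q<Q \<nu>. c \<nu> q * of_real (relu_pow k (t - \<tau> \<nu> q))) +
     (LINT b|lborel. R \<nu> b * of_real (spline_comb k (\<gamma> \<nu>) (\<beta> \<nu>) b t)))"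
   unfolding choice_iff by (elim exE) (rule that)
  \<comment> \<open>The reciprocal width up to the factor \<open>k + 1\<close>: the number of
    neurons if there are any, else the weight of the frequency.\<close>
  define h where "h \<nu> = (if N \<nu> = 0 then ?M \<nu> else real (N \<nu>))" for \<nu>
  have h1: "1 <= h \<nu>" for \<nu> using M1[of \<nu>] by (auto simp: h_def)
  note sd = all[rule_format, THEN conjunct1, unfolded spline_data_def, folded h_def]
  have Rm[measurable]: "R \<nu> \<in> borel_measurable borel" for \<nu> using sd[of \<nu>] by (elim conjE)
  have \<gamma>m[measurable]: "\<gamma> \<nu> i \<in> borel_measurable borel" for \<nu> i using sd[of \<nu>] by (elim conjE allE[of _ i])
  have \<beta>m[measurable]: "\<beta> \<nu> i \<in> borel_measurable borel" for \<nu> i using sd[of \<nu>] by (elim conjE allE[of _ i])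
  have Rb: "cmod (R \<nu> b) <= Cs * ?M \<nu> ^ Suc k" for \<nu> b using sd[of \<nu>] by (elim conjE allE[of _ b])
  have R0: "b \<notin> {- L..L} ==> R \<nu> b = 0" for \<nu> b using sd[of \<nu>] by simp
  have \<gamma>b: "\<forall>i<k + 2. \<bar>\<gamma> \<nu> i b\<bar> <= \<Gamma>" for \<nu> b using sd[of \<nu>] by simp
  have \<beta>b: "\<forall>i<k + 2. \<bar>\<beta> \<nu> i b - b\<bar> <= (real k + 1) / h \<nu>" for \<nu> b using sd[of \<nu>] by simp
  have mom: "\<forall>y. (\<Sum>i<k + 2. \<gamma> \<nu> i b * (y - \<beta> \<nu> i b) ^ k) = 0" for \<nu> b
  proof -
   have "\<forall>b y. (\<Sum>i<k + 2. \<gamma> \<nu> i b * (y - \<beta> \<nu> i b) ^ k) = 0" using sd[of \<nu>] by (elim conjE)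
   then show ?thesis by (rule spec)
  qed
  have Qb: "real (Q \<nu>) <= Cs * real (N \<nu>)" for \<nu> using all by (elim allE[of _ \<nu>] conjE)
  have Q0: "Q \<nu> = 0" if "N \<nu> = 0" for \<nu> using Qb[of \<nu>] that by simp
  have prep: "cis (lattice_vec \<nu> \<bullet> x) = (\<Sum>q<Q \<nu>. c \<nu> q * of_real (relu_pow k (lattice_dir \<nu> \<bullet> x - \<tau> \<nu> q))) +
     (LINT b|lborel. R \<nu> b * of_real (spline_comb k (\<gamma> \<nu>) (\<beta> \<nu>) b (lattice_dir \<nu> \<bullet> x)))" if "x \<in> unit_cube" for x :: "real ^ 'n" and \<nu>
   unfolding lattice_vec_eq_dir using all[rule_format, THEN conjunct2, THEN conjunct2, rule_format, OF unit_cube_inner_bound[OF that norm_lattice_dir]] .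
  \<comment> \<open>The total mass is 1 because \<open>A\<close> is the lattice norm of
    \<open>a\<close>.\<close>
  define dens where "dens z = cmod (a (fst z)) * ?M (fst z) powr s / A * (indicator {- L..L} (snd z) / (2 * L))" for z :: "('n => int) \<times> real"
  have dens0: "0 <= dens z" for z unfolding dens_def using A L by simp
  let ?z1 = "?cs \<Otimes>\<^sub>M ?Lb"
  have densm[measurable]: "dens \<in> borel_measurable ?z1"
   by (rule measurable_pair_measure_countable1) (simp_all add: dens_def)
  define P where "P = density ?z1 (%z. ennreal (dens z))"
  have spP: "space P = UNIV" unfolding P_def by (simp add: space_pair_measure)
  have setsP: "sets P = sets ?z1" unfolding P_def by simp
  have prob: "prob_space P"
  proof
   have "emeasure P (space P) = (\<integral>\<^sup>+z. ennreal (dens z) \<partial>?z1)"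
   proof -
    have "UNIV \<in> sets ?z1" using sets.top[of "?cs \<Otimes>\<^sub>M ?Lb"] by (simp add: space_pair_measure)
    then show ?thesis unfolding spP unfolding P_def by (subst emeasure_density) simp_all
   qed
   also have "... = (\<integral>\<^sup>+\<nu>. \<integral>\<^sup>+b. ennreal (dens (\<nu>, b)) \<partial>?Lb \<partial>?cs)" by (rule lborel.nn_integral_fst[symmetric]) simp
   also have "... = (\<integral>\<^sup>+\<nu>. ennreal (cmod (a \<nu>) * ?M \<nu> powr s) * ennreal (1 / A) \<partial>?cs)"
   proof (rule nn_integral_cong)
    fix \<nu>
    have "(\<integral>\<^sup>+b. ennreal (dens (\<nu>, b)) \<partial>?Lb) = (\<integral>\<^sup>+b. ennreal (cmod (a \<nu>) * ?M \<nu> powr s / A / (2 * L)) * indicator {- L..L} b \<partial>?Lb)"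
     by (intro nn_integral_cong) (simp add: dens_def indicator_def)
    also have "... = ennreal (cmod (a \<nu>) * ?M \<nu> powr s / A / (2 * L)) * ennreal (2 * L)"
     using L by (subst nn_integral_cmult_indicator) simp_all
    also have "... = ennreal (cmod (a \<nu>) * ?M \<nu> powr s) * ennreal (1 / A)"
     using L A by (simp add: ennreal_mult'[symmetric] ennreal_mult[symmetric])
    finally show "(\<integral>\<^sup>+b. ennreal (dens (\<nu>, b)) \<partial>?Lb) = ennreal (cmod (a \<nu>) * ?M \<nu> powr s) * ennreal (1 / A)" .
   qed
   also have "... = ennreal A * ennreal (1 / A)" unfolding sumA[symmetric] by (rule nn_integral_multc) simp
   also have "... = 1" using A by (simp add: ennreal_mult[symmetric])
   finally show "emeasure P (space P) = 1" .
  qed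
  let ?z6 = "%\<nu>. A * (2 * L) * ?M \<nu> powr (- s)"
  \<comment> \<open>Chosen so that
    \<open>dens (\<nu>, b) * W \<nu> b = a \<nu> * R \<nu> b\<close>.\<close>
  define W where "W \<nu> b = of_real (?z6 \<nu>) * sgn (a \<nu>) * R \<nu> b" for \<nu> b
  define G where "G \<alpha> z x = W (fst z) (snd z) * of_real (\<Sum>i<k + 2. \<gamma> (fst z) i (snd z) * ridge_deriv \<alpha> k (lattice_dir (fst z)) (- \<beta> (fst z) i (snd z)) x)"
   for \<alpha> :: "'n => nat" and z :: "('n => int) \<times> real" and x :: "real ^ 'n"
  have G0: "G (%_. 0) z x = W (fst z) (snd z) * of_real (relu_comb (k + 2) k (%i. \<gamma> (fst z) i (snd z)) (%i. \<beta> (fst z) i (snd z)) (lattice_dir (fst z) \<bullet> x))" for z x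
   unfolding G_def relu_comb_def ridge_deriv_0 by simp
  \<comment> \<open>All explicit networks together; the mean of the sampled functions represents
    \<open>f - Pn\<close>.\<close>
  define Pn where "Pn x = (\<Sum>\<nu> | N \<nu> ~= 0. \<Sum>q<Q \<nu>. (a \<nu> * c \<nu> q) * of_real (relu_pow k (lattice_dir \<nu> \<bullet> x + - \<tau> \<nu> q)))" for x :: "real ^ 'n"
  have meas: "case_prod (G \<alpha>) \<in> borel_measurable (P \<Otimes>\<^sub>M lborel)" for \<alpha>
  proof -
   let ?X = "?z1 \<Otimes>\<^sub>M (lborel :: (real ^ 'n) measure)"
   have 1: "(%z. fst (fst z)) \<in> measurable ?X ?cs" by measurable
   have "(%z. G \<alpha> (fst (fst z), snd (fst z)) (snd z)) \<in> borel_measurable ?X"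
    unfolding G_def fst_conv snd_conv
   proof (rule measurable_compose_countable[OF _ 1])
    fix \<nu> :: "'n => int"
    have of_real_m: "(of_real :: real => complex) \<in> borel_measurable borel"
     by (intro borel_measurable_continuous_onI continuous_intros)
    have b: "(%z. snd (fst z)) \<in> measurable ?X borel" by measurable
    have x: "(%z. lattice_dir \<nu> \<bullet> snd z) \<in> borel_measurable ?X"
     by (rule measurable_compose[OF measurable_snd]) simp
    have r: "(%z. ridge_deriv \<alpha> k (lattice_dir \<nu>) (- \<beta> \<nu> i (snd (fst z))) (snd z)) \<in> borel_measurable ?X" for i
     unfolding ridge_deriv_def
     by (intro borel_measurable_times borel_measurable_const measurable_compose[OF _ relu_pow_measurable] borel_measurable_add x borel_measurable_uminus measurable_compose[OF b \<beta>m])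
    have w: "(%z. W \<nu> (snd (fst z))) \<in> borel_measurable ?X"
     unfolding W_def by (intro borel_measurable_times borel_measurable_const measurable_compose[OF b Rm])
    show "(%z. W \<nu> (snd (fst z)) * of_real (\<Sum>i<k + 2. \<gamma> \<nu> i (snd (fst z)) * ridge_deriv \<alpha> k (lattice_dir \<nu>) (- \<beta> \<nu> i (snd (fst z))) (snd z))) \<in> borel_measurable ?X"
     by (intro borel_measurable_times w measurable_compose[OF _ of_real_m] borel_measurable_sum r measurable_compose[OF b \<gamma>m])
   qed
   then have X: "case_prod (G \<alpha>) \<in> borel_measurable ?X" by (simp add: case_prod_unfold)
   have s: "sets (P \<Otimes>\<^sub>M (lborel :: (real ^ 'n) measure)) = sets ?X" by (intro sets_pair_measure_cong setsP refl)
   show ?thesis using X unfolding measurable_cong_sets[OF s refl] .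
  qed
  \<comment> \<open>So every derivative in the energy has order at most \<open>k\<close> and is
    given by \<open>ridge_deriv\<close>.\<close>
  have Jk: "nat \<lfloor>m\<rfloor> <= k"
  proof -
   have "of_int \<lfloor>m\<rfloor> < real k + 1" using of_int_floor_le[of m] m(2) by linarith
   then show ?thesis by linarith
  qed
  have dir0: "lattice_dir \<nu> ~= (0 :: real ^ 'n)" for \<nu>
  proof -
   have "norm (lattice_dir \<nu> :: real ^ 'n) = 1" by (rule norm_lattice_dir)
   then show ?thesis by auto
  qed
  have wd: "has_weak_deriv \<alpha> ?U (G (%_. 0) z) (G \<alpha> z)" if "multi_index_order \<alpha> <= nat \<lfloor>m\<rfloor>" for \<alpha> z
  proof -
   have ak: "multi_index_order \<alpha> <= k" using that Jk by (rule order_trans)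
   show ?thesis
    unfolding G_def[abs_def] of_real_sum of_real_mult ridge_deriv_0
    by (rule has_weak_deriv_cmult, rule has_weak_deriv_sum, rule has_weak_deriv_cmult, rule has_weak_deriv_ridge[OF ak dir0])
  qed
  define V where "V = (C0 * A * E)\<^sup>2"
  \<comment> \<open>One inequality for both kinds of frequencies: with the weight in place of
    \<open>h\<close> the exponents add up to \<open>m + 1/2 - s\<close>.\<close>
  have cost: "?M \<nu> powr (real k + 1 - s) * h \<nu> powr (- \<kappa>) <= E" for \<nu>
  proof (cases "N \<nu> = 0")
   case True
   have "?M \<nu> powr (real k + 1 - s) * ?M \<nu> powr (- \<kappa>) = ?M \<nu> powr (m + 1 / 2 - s)"
    unfolding powr_add[symmetric] \<kappa>_def by (rule arg_cong[where f = "%e. ?M \<nu> powr e"]) simp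
   then show ?thesis using high True by (simp add: h_def)
  next
   case False
   then show ?thesis using low by (simp add: h_def \<kappa>_def)
  qed
  have bound: "sobolev_energy m ?U (%\<alpha>. G \<alpha> z) <= ennreal V" for z
  proof -
   obtain \<nu> b where z: "z = (\<nu>, b)" by (cases z)
   let ?w = "(real k + 1) / h \<nu>"
   \<comment> \<open>As \<open>h >= 1\<close>, the number \<open>k + 1\<close> serves as the upper
     bound on the widths in \<open>energy\<close>.\<close>
   have w: "0 < ?w" "?w <= real k + 1" using h1[of \<nu>] by (simp_all add: divide_le_eq mult_le_cancel_left1)
   let ?e = "sobolev_energy m ?U (%\<alpha> x. complex_of_real (\<Sum>i<k + 2. \<gamma> \<nu> i b * ridge_deriv \<alpha> k (lattice_dir \<nu>) (- \<beta> \<nu> i b) x))"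
   let ?z5 = "Ce * ?w powr (2 * (real k - m) + 1)"
   have e: "?e <= ennreal ?z5"
    by (rule energy[rule_format, where \<omega> = "lattice_dir \<nu>" and b = b and w = ?w and \<gamma> = "%i. \<gamma> \<nu> i b" and \<beta> = "%i. \<beta> \<nu> i b",
      OF norm_lattice_dir w mom[rule_format] \<gamma>b[rule_format] \<beta>b[rule_format]])
   let ?z4 = "sqrt Ce * ?w powr \<kappa>"
   have "sobolev_energy m ?U (%\<alpha>. G \<alpha> z) = esq (W \<nu> b) * ?e"
    unfolding G_def z fst_conv snd_conv by (rule sobolev_energy_cmult) simp_all
   also have "... <= esq (W \<nu> b) * ennreal ?z5" by (rule mult_left_mono[OF e]) simp
   also have "... = ennreal ((cmod (W \<nu> b))\<^sup>2 * ?z5)" using Ce by (simp add: ennreal_mult)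
   also have "(cmod (W \<nu> b))\<^sup>2 * ?z5 = (cmod (W \<nu> b) * ?z4)\<^sup>2"
   proof -
    have "?w powr (2 * (real k - m) + 1) = (?w powr \<kappa>)\<^sup>2"
     unfolding power2_eq_square powr_add[symmetric] \<kappa>_def by (rule arg_cong[where f = "%e. ?w powr e"]) simp
    then show ?thesis using Ce by (simp add: power_mult_distrib)
   qed
   also have "ennreal ((cmod (W \<nu> b) * ?z4)\<^sup>2) <= ennreal V"
    unfolding V_def
   proof (intro ennreal_leI power_mono)
    have sg: "cmod (sgn (a \<nu>)) <= 1" by (simp add: norm_sgn)
    have "cmod (W \<nu> b) = (?z6 \<nu>) * (cmod (sgn (a \<nu>)) * cmod (R \<nu> b))"
     unfolding W_def norm_mult norm_of_real using A L by (simp add: abs_mult)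
    also have "... <= (?z6 \<nu>) * (1 * (Cs * ?M \<nu> ^ Suc k))"
     using A L by (intro mult_left_mono mult_mono sg Rb) simp_all
    finally have Wb: "cmod (W \<nu> b) <= A * (2 * L * Cs) * (?M \<nu> powr (- s) * ?M \<nu> ^ Suc k)" by (simp only: mult_1_left mult_ac)
    have "?M \<nu> powr (- s) * ?M \<nu> ^ Suc k = ?M \<nu> powr (real k + 1 - s)"
    proof -
     have "?M \<nu> ^ Suc k = ?M \<nu> powr real (Suc k)" by (rule powr_realpow[OF Mp, symmetric])
     then show ?thesis unfolding powr_add[symmetric] by (simp add: powr_add[symmetric] algebra_simps)
    qed
    note Wb = Wb[unfolded this]
    have wp: "?w powr \<kappa> = (real k + 1) powr \<kappa> * h \<nu> powr (- \<kappa>)"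
     using h1[of \<nu>] by (simp add: powr_divide powr_minus_divide)
    have "cmod (W \<nu> b) * ?z4 <= (A * (2 * L * Cs) * ?M \<nu> powr (real k + 1 - s)) * ?z4"
     using Ce by (intro mult_right_mono Wb) simp
    also have "... = C0 * A * (?M \<nu> powr (real k + 1 - s) * h \<nu> powr (- \<kappa>))"
     unfolding wp C0_def by (simp only: mult_ac)
    also have "... <= C0 * A * E" using C0 A by (intro mult_left_mono cost) simp
    finally show "cmod (W \<nu> b) * ?z4 <= C0 * A * E" .
    show "0 <= cmod (W \<nu> b) * ?z4" using Ce by simp
   qed
   finally show ?thesis .
  qed
  interpret PS: pair_sigma_finite ?cs ?Lb
   by (intro pair_sigma_finite.intro sigma_finite_count_space_lattice lborel.sigma_finite_measure_axioms)
  have inta: "integrable ?cs a"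
  proof (rule integrableI_bounded)
   have "(\<integral>\<^sup>+\<nu>. ennreal (cmod (a \<nu>)) \<partial>?cs) <= lattice_norm s a"
    using ge_one_powr_ge_zero[OF M1 s] by (intro nn_integral_mono ennreal_leI) (simp add: mult_le_cancel_left1)
   then show "(\<integral>\<^sup>+\<nu>. ennreal (norm (a \<nu>)) \<partial>?cs) < \<infinity>" unfolding sumA by (rule order.strict_trans1) simp
  qed simp
  have rep': "AE x in lborel. x \<in> ?U --> integrable P (%y. G (%_. 0) y x) --> f x - Pn x = (LINT y|P. G (%_. 0) y x)"
   using rep
  proof (eventually_elim, intro impI)
   fix x :: "real ^ 'n"
   assume fx: "x \<in> ?U --> f x = lattice_series a x" and xU: "x \<in> ?U" and ig: "integrable P (%y. G (%_. 0) y x)"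
   have x: "x \<in> unit_cube" using xU interior_subset by (rule_tac subsetD)
   have gm: "(%y. G (%_. 0) y x) \<in> borel_measurable ?z1"
    using borel_measurable_integrable[OF ig] by (simp only: measurable_cong_sets[OF setsP refl])
   have d0: "AE z in ?cs \<Otimes>\<^sub>M ?Lb. 0 <= dens z" by (rule AE_I2) (rule dens0)
   have ig': "integrable ?z1 (%z. dens z *\<^sub>R G (%_. 0) z x)"
    using ig unfolding P_def by (subst (asm) integrable_density[OF gm densm d0])
   let ?z0 = "%q \<nu>. \<Sum>q<Q \<nu>. (a \<nu> * c \<nu> q) * of_real (relu_pow k (lattice_dir \<nu> \<bullet> x + - \<tau> \<nu> q))"
   let ?z8 = "%b \<nu>. LINT b|?Lb. dens (\<nu>, b) *\<^sub>R G (%_. 0) (\<nu>, b) x"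
   have "(LINT y|P. G (%_. 0) y x) = (LINT z|?z1. dens z *\<^sub>R G (%_. 0) z x)"
    unfolding P_def by (rule integral_density[OF gm densm d0])
   also have "... = (LINT \<nu>|?cs. (?z8 b \<nu>))"
    by (rule PS.integral_fst'[symmetric, OF ig'])
   also have "... = (LINT \<nu>|?cs. a \<nu> * cis (lattice_vec \<nu> \<bullet> x) - (?z0 q \<nu>))"
   proof (rule Bochner_Integration.integral_cong[OF refl])
    fix \<nu>
    let ?r = "%b. complex_of_real (spline_comb k (\<gamma> \<nu>) (\<beta> \<nu>) b (lattice_dir \<nu> \<bullet> x))"
    have "dens (\<nu>, b) *\<^sub>R G (%_. 0) (\<nu>, b) x = a \<nu> * (R \<nu> b * ?r b)" for b
    proof (cases "b \<in> {- L..L}")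
     case True
     have MM: "?M \<nu> powr s * ?M \<nu> powr (- s) = 1" unfolding powr_add[symmetric] using Mp[of \<nu>] by simp
     have "dens (\<nu>, b) * (?z6 \<nu>) = cmod (a \<nu>) * (?M \<nu> powr s * ?M \<nu> powr (- s))"
      using True A L by (simp add: dens_def)
     then have d: "dens (\<nu>, b) * (?z6 \<nu>) = cmod (a \<nu>)" unfolding MM by simp
     have sg: "of_real (cmod (a \<nu>)) * sgn (a \<nu>) = a \<nu>"
      by (cases "a \<nu> = 0") (simp_all add: sgn_div_norm scaleR_conv_of_real)
     have "dens (\<nu>, b) *\<^sub>R G (%_. 0) (\<nu>, b) x = of_real (dens (\<nu>, b) * (?z6 \<nu>)) * sgn (a \<nu>) * (R \<nu> b * ?r b)"
      unfolding G0 W_def fst_conv snd_conv scaleR_conv_of_real of_real_mult by (simp only: mult_ac)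
     then show ?thesis unfolding d sg .
    next
     case False
     then show ?thesis using R0[OF False, of \<nu>] by (simp add: dens_def)
    qed
    then have "(?z8 b \<nu>) = a \<nu> * (LINT b|?Lb. R \<nu> b * ?r b)" by (simp only: integral_mult_right_zero)
    also have "(LINT b|?Lb. R \<nu> b * ?r b) = cis (lattice_vec \<nu> \<bullet> x) - (\<Sum>q<Q \<nu>. c \<nu> q * of_real (relu_pow k (lattice_dir \<nu> \<bullet> x - \<tau> \<nu> q)))"
     unfolding prep[OF x] by simp
    finally show "(?z8 b \<nu>) = a \<nu> * cis (lattice_vec \<nu> \<bullet> x) - (?z0 q \<nu>)"
     by (simp add: right_diff_distrib sum_distrib_left mult.assoc)
   qed
   also have "... = lattice_series a x - (LINT \<nu>|?cs. (?z0 q \<nu>))"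
   proof (rule Bochner_Integration.integral_diff)
    show "integrable ?cs (%\<nu>. a \<nu> * cis (lattice_vec \<nu> \<bullet> x))"
     by (rule Bochner_Integration.integrable_bound[OF inta]) (simp_all add: norm_mult)
    show "integrable ?cs (%\<nu>. \<Sum>q<Q \<nu>. (a \<nu> * c \<nu> q) * of_real (relu_pow k (lattice_dir \<nu> \<bullet> x + - \<tau> \<nu> q)))"
    proof (rule integrableI_bounded)
     let ?g = "%\<nu>. (?z0 q \<nu>)"
     have "(\<integral>\<^sup>+\<nu>. ennreal (norm (?g \<nu>)) \<partial>?cs) = (\<Sum>\<nu> | N \<nu> ~= 0. ennreal (norm (?g \<nu>)))"
      by (rule nn_integral_count_space'[OF fin]) (simp_all add: Q0)
     also have "... = ennreal (\<Sum>\<nu> | N \<nu> ~= 0. norm (?g \<nu>))" by (rule sum_ennreal) simp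
     also have "... < \<infinity>" by simp
     finally show "(\<integral>\<^sup>+\<nu>. ennreal (norm (?g \<nu>)) \<partial>?cs) < \<infinity>" .
    qed simp
   qed
   also have "(LINT \<nu>|?cs. (?z0 q \<nu>)) = Pn x"
    unfolding Pn_def
   proof (subst lebesgue_integral_count_space_finite_support)
    let ?g = "%\<nu>. (?z0 q \<nu>)"
    have gz: "N \<nu> ~= 0" if "?g \<nu> ~= 0" for \<nu> using that Q0[of \<nu>] by (cases "N \<nu> = 0") simp_all
    show "finite {\<nu> \<in> UNIV. ?g \<nu> ~= 0}" by (rule finite_subset[OF _ fin]) (intro subsetI CollectI, elim CollectE conjE, rule gz)
    show "(\<Sum>\<nu> | \<nu> \<in> UNIV \<and> ?g \<nu> ~= 0. ?g \<nu>) = (\<Sum>\<nu> | N \<nu> ~= 0. ?g \<nu>)"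
    proof (rule sum.mono_neutral_left[OF fin])
     show "{\<nu>. \<nu> \<in> UNIV \<and> ?g \<nu> ~= 0} \<subseteq> {\<nu>. N \<nu> ~= 0}" by (intro subsetI CollectI, elim CollectE conjE, rule gz)
    qed blast
   qed
   also have "lattice_series a x = f x" using fx xU by simp
   finally show "f x - Pn x = (LINT y|P. G (%_. 0) y x)" by (rule sym)
  qed
  have U1: "emeasure lborel ?U = 1" by (rule emeasure_interior_unit_cube)
  have V0: "V >= 0" by (simp add: V_def)
  obtain y where y: "sobolev_norm m ?U (%x. (f x - Pn x) - (\<Sum>i<n. G (%_. 0) (y i) x) / of_nat n) <= ennreal (sqrt (V / max 1 (real n)))"
  proof -
   have "\<exists>y. (\<forall>i<n. y i \<in> space P) \<and> sobolev_norm m ?U (%x. (f x - Pn x) - (\<Sum>i<n. G (%_. 0) (y i) x) / of_nat n) <= ennreal (sqrt (V / max 1 (real n)))"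
    by (rule sobolev_maurey[where G = G, OF prob open_interior U1 V0]) (rule meas, erule wd, rule bound, rule rep')
   then show ?thesis by (elim exE conjE) (rule that)
  qed
  define j1 where "j1 = (\<Sum>\<nu> | N \<nu> ~= 0. Q \<nu>)"
  have P_net: "Pn \<in> shallow_networks k j1"
  proof -
   let ?I = "Sigma {\<nu>. N \<nu> ~= 0} (%\<nu>. {..<Q \<nu>})"
   have "(%x. \<Sum>i\<in>?I. (a (fst i) * c (fst i) (snd i)) * of_real (relu_pow k (lattice_dir (fst i) \<bullet> x + - \<tau> (fst i) (snd i)))) \<in> shallow_networks k j1"
    by (rule shallow_network_finite_sum) (use fin in \<open>auto simp: j1_def norm_lattice_dir\<close>)
   moreover have "Pn = (%x. \<Sum>i\<in>?I. (a (fst i) * c (fst i) (snd i)) * of_real (relu_pow k (lattice_dir (fst i) \<bullet> x + - \<tau> (fst i) (snd i))))"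
    unfolding Pn_def by (rule ext, subst sum.Sigma) (use fin in \<open>auto simp: case_prod_unfold\<close>)
   ultimately show ?thesis by simp
  qed
  have avg_net: "(%x. (\<Sum>i<n. G (%_. 0) (y i) x) / of_nat n) \<in> shallow_networks k (n * (k + 2))"
  proof -
   let ?I = "{..<n} \<times> {..<k + 2}"
   let ?\<nu> = "%i. fst (y (fst i))" and ?b = "%i. snd (y (fst i))"
   let ?z2 = "%i x. relu_pow k (lattice_dir (?\<nu> i) \<bullet> x + - \<beta> (?\<nu> i) (snd i) (?b i))"
   let ?z3 = "%i. W (?\<nu> i) (?b i) * of_real (\<gamma> (?\<nu> i) (snd i) (?b i)) / of_nat n"
   have "(%x. \<Sum>i\<in>?I. (?z3 i) * of_real (?z2 i x)) \<in> shallow_networks k (n * (k + 2))"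
    by (rule shallow_network_finite_sum) (auto simp: norm_lattice_dir card_cartesian_product)
   moreover have "(\<Sum>i<n. G (%_. 0) (y i) x) / of_nat n = (\<Sum>i\<in>?I. (?z3 i) * of_real (?z2 i x))" for x
   proof -
    have "(\<Sum>i<n. G (%_. 0) (y i) x) / of_nat n = (\<Sum>i<n. \<Sum>l<k + 2. (W (fst (y i)) (snd (y i)) * of_real (\<gamma> (fst (y i)) l (snd (y i))) / of_nat n) * of_real (relu_pow k (lattice_dir (fst (y i)) \<bullet> x + - \<beta> (fst (y i)) l (snd (y i)))))"
     unfolding sum_divide_distrib G_def ridge_deriv_0 of_real_sum sum_distrib_left of_real_mult
     by (intro sum.cong refl) simp
    also have "... = (\<Sum>i\<in>?I. (?z3 i) * of_real (?z2 i x))"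
     by (subst sum.cartesian_product) (simp only: case_prod_unfold)
    finally show ?thesis .
   qed
   ultimately show ?thesis by simp
  qed
  have net: "(%x. Pn x + (\<Sum>i<n. G (%_. 0) (y i) x) / of_nat n) \<in> shallow_networks k (j1 + n * (k + 2))"
   by (rule shallow_networks_add[OF P_net avg_net]) simp
  let ?z7 = "%\<nu> N real. \<Sum>\<nu> | N \<nu> ~= 0. real (N \<nu>)"
  have jb: "real (j1 + n * (k + 2)) <= C * (?z7 \<nu> N real) + C * real n"
  proof -
   have "real j1 <= (\<Sum>\<nu> | N \<nu> ~= 0. Cs * real (N \<nu>))" unfolding j1_def of_nat_sum by (intro sum_mono Qb)
   also have "... = Cs * (?z7 \<nu> N real)" by (rule sum_distrib_left[symmetric])
   also have "... <= C * (?z7 \<nu> N real)" by (intro mult_right_mono C(3) sum_nonneg) simp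
   finally have 1: "real j1 <= C * (?z7 \<nu> N real)" .
   have "real (n * (k + 2)) = real (k + 2) * real n" by (simp only: of_nat_mult mult.commute)
   also have "... <= C * real n" by (intro mult_right_mono C(4)) simp
   finally show ?thesis using 1 by (simp only: of_nat_add add_mono)
  qed
  have err: "sobolev_norm m ?U (%x. f x - (Pn x + (\<Sum>i<n. G (%_. 0) (y i) x) / of_nat n)) <= ennreal (C * A * E / sqrt (max 1 (real n)))"
  proof -
   have "sqrt (V / max 1 (real n)) = C0 * A * E / sqrt (max 1 (real n))"
    unfolding V_def real_sqrt_divide using C0 A E by simp
   also have "... <= C * A * E / sqrt (max 1 (real n))"
    using C(2) A E by (intro divide_right_mono mult_right_mono) simp_all
   finally have "sqrt (V / max 1 (real n)) <= C * A * E / sqrt (max 1 (real n))" .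
   then show ?thesis using order_trans[OF y ennreal_leI] by (simp add: diff_diff_eq)
  qed
  show "\<exists>j fn. fn \<in> shallow_networks k j \<and> real j <= C * (?z7 \<nu> N real) + C * real n \<and>
   sobolev_norm m ?U (%x. f x - fn x) <= ennreal (C * A * E / sqrt (max 1 (real n)))"
   by (intro exI conjI, rule net, rule jb, rule err)
 qed
qed

text \<open>For the degenerate case of vanishing coefficients, which cannot be normalised to a
  probability.\<close>

lemma sobolev_norm_AE_zero:
 assumes "AE x in lborel. x \<in> U --> f x = 0" "open U"
 shows "sobolev_norm m U (f :: real ^ 'n => complex) = 0"
proof -
 have "AE x in lebesgue. x \<in> U --> f x = 0" using assms(1) by (rule AE_completion)
 then have wd: "has_weak_deriv \<alpha> U f (%_. 0)" for \<alpha> using has_weak_deriv_zero by (rule has_weak_deriv_cong_AE)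
 have "sobolev_energy m U (%(_ :: 'n => nat) _. 0) <= ennreal 0"
  by (simp add: sobolev_energy_def L2_sq_def slobodeckij_sq_def)
 then have "sobolev_norm m U f <= ennreal (sqrt 0)" by (intro sobolev_norm_le[OF assms(2) _ wd]) simp_all
 then show ?thesis by simp
qed

section \<open>Rates in terms of the number of neurons\<close>

lemma shallow_networks_mono:
 assumes "f \<in> shallow_networks k j" "j <= n"
 shows "f \<in> shallow_networks k n"
proof -
 obtain a \<omega> b where f: "f = (%x. \<Sum>i=1..j. a i * of_real (relu_pow k (\<omega> i \<bullet> x + b i)))" and \<omega>: "\<forall>i\<in>{1..j}. \<omega> i \<in> sphere 0 1"
  using assms(1) unfolding shallow_networks_def mem_Collect_eq by (elim exE conjE) (rule that)
 show ?thesis unfolding f by (rule shallow_network_finite_sum) (use assms(2) \<omega> in auto)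
qed

lemma rate_exponent_ge_half:
 assumes "m <= s - 1 / 2" "m < real k + 1 / 2"
 shows "rate_exponent d s k m >= 1 / 2"
 using assms by (simp add: rate_exponent_def)

lemma log_exponent_nonneg: "m < real k + 1 / 2 ==> log_exponent d s k m >= 0"
 by (simp add: log_exponent_def)

lemma approx_rate_div_sqrt:
 assumes "x > 0"
 shows "approx_rate d s k m x / sqrt x = x powr (- rate_exponent d s k m) * ln x powr log_exponent d s k m"
proof -
 have "x powr (1 / 2 - rate_exponent d s k m) = x powr (1 / 2) * x powr (- rate_exponent d s k m)"
  unfolding powr_add[symmetric] by simp
 then show ?thesis using assms unfolding approx_rate_def by (simp add: powr_half_sqrt)
qed

abbreviation series_rate ::
  "nat => real => real => real => (real ^ 'n => complex) => (('n::finite => int) => complex) => real => bool" where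
 "series_rate k m s C f a A \<equiv> 0 < A -->
  lattice_norm s a = ennreal A -->
  (AE x in lborel. x \<in> interior unit_cube --> f x = lattice_series a x) -->
  (\<forall>n\<ge>2. \<exists>fn \<in> shallow_networks k n. sobolev_norm m (interior unit_cube) (%x. f x - fn x)
    <= ennreal (C * A * (real n powr (- rate_exponent CARD('n) s k m) * ln (real n) powr log_exponent CARD('n) s k m)))"

text \<open>The construction with parameter \<open>n0\<close> needs at most \<open>C2 * n0\<close>
  neurons, so \<open>n0\<close> is \<open>n / C2\<close> rounded down, and
  \<open>n0 >= n / (2 * C2)\<close> costs only a constant. If this \<open>n0\<close> is below 2,
  then \<open>n\<close> is bounded, the rate is bounded below, and the zero network
  suffices.\<close>

lemma lattice_series_rate:
 fixes m s :: real and k :: nat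
 assumes s: "s >= 1 / 2" and m: "0 <= m" "m <= s - 1 / 2" "m < real k + 1 / 2"
 shows "\<exists>C>0. \<forall>(f :: real ^ 'n => complex) a A. series_rate k m s C f a A"
proof -
 define t where "t = rate_exponent CARD('n) s k m"
 define q where "q = log_exponent CARD('n) s k m"
 have t: "t >= 1 / 2" unfolding t_def by (rule rate_exponent_ge_half[OF m(2,3)])
 have q: "q >= 0" unfolding q_def by (rule log_exponent_nonneg[OF m(3)])
 have s0: "s >= 0" using s by simp
 obtain Ca where Ca: "Ca > 0" and approx: "\<forall>(f :: real ^ 'n => complex) a (N :: ('n => int) => nat) E A n.
  series_approximable k m s Ca f a N E A n"
  using lattice_series_approximation[OF s0 m(1,3), where 'n = 'n] by (elim exE conjE) (rule that)
 obtain Cb where Cb: "Cb > 0" and alloc: "\<forall>x\<ge>2. \<exists>N :: ('n::finite => int) => nat.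
   allocation k m s (x powr (1 / (real CARD('n) + 1))) (Cb * approx_rate CARD('n) s k m x) (Cb * x) N"
  using neuron_allocation[OF m(2,3), where 'n = 'n] by (elim exE conjE) (rule that)
 define C2 where "C2 = max 1 (Ca * (Cb + 1))"
 have C2: "C2 >= 1" "Ca * (Cb + 1) <= C2" by (simp_all add: C2_def)
 \<comment> \<open>\<open>(2 * C2) powr t\<close> pays for passing from \<open>n0\<close> to
   \<open>n\<close>, and \<open>2 powr q\<close> for \<open>ln n\<close> being possibly below 1 when
   \<open>n\<close> is small.\<close>
 define K where "K = Ca * (Cb + 1) * ((2 * C2) powr t * 2 powr q)"
 have K: "K > 0" unfolding K_def using Ca Cb C2(1) by simp
 show ?thesis
 proof (rule exI[of _ K], intro conjI allI impI K)
  fix f :: "real ^ 'n => complex" and a :: "('n => int) => complex" and A :: real and n :: nat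
  let ?M = "%\<nu> :: 'n => int. lattice_wt \<nu>"
  let ?r = "%x. x powr (- t) * ln x powr q"
  assume A: "0 < A" and sumA: "lattice_norm s a = ennreal A"
   and rep: "AE x in lborel. x \<in> interior unit_cube --> f x = lattice_series a x"
   and n2: "2 <= n"
  have x2: "real n >= 2" using n2 by simp
  have net: "\<exists>fn \<in> shallow_networks k n. sobolev_norm m (interior unit_cube) (%x. f x - fn x) <= ennreal (K * A * ?r (real n))"
  proof (cases "2 <= nat \<lfloor>real n / C2\<rfloor>")
   case True
   define n0 where "n0 = nat \<lfloor>real n / C2\<rfloor>"
   have n0: "real n0 >= 2" using True by (simp add: n0_def)
   have "real n / C2 >= 0" using C2(1) by simp
   then have fl: "real n0 <= real n / C2" "real n / C2 - 1 <= real n0" unfolding n0_def by linarith+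
   have le: "C2 * real n0 <= real n" using fl(1) C2(1) by (simp add: pos_le_divide_eq mult.commute)
   have "2 * real n0 >= real n / C2" using fl(2) n0 by linarith
   then have ge: "real n / (2 * C2) <= real n0" by simp
   let ?R = "real n0 powr (1 / (real CARD('n) + 1))"
   define E where "E = Cb * approx_rate CARD('n) s k m (real n0)"
   have E: "0 <= E" unfolding E_def approx_rate_def using Cb by simp
   obtain N :: "('n => int) => nat" where
    N1: "\<forall>\<nu>. ?M \<nu> <= ?R --> 1 <= N \<nu> \<and> ?M \<nu> powr (real k + 1 - s) * real (N \<nu>) powr (- (real k - m + 1 / 2)) <= E"
    and N2: "\<forall>\<nu>. ?R < ?M \<nu> --> ?M \<nu> powr (m + 1 / 2 - s) <= E"
    and N3: "(\<Sum>\<nu> | ?M \<nu> <= ?R. real (N \<nu>)) <= Cb * real n0"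
    using alloc[rule_format, OF n0] unfolding E_def[symmetric] by (elim exE conjE) (rule that)
   \<comment> \<open>\<open>allocation\<close> leaves \<open>N\<close> open outside the ball; zero
     is the mark for high frequencies in \<open>series_approximable\<close>.\<close>
   define N' where "N' \<nu> = (if ?M \<nu> <= ?R then N \<nu> else 0)" for \<nu>
   have N'0: "N' \<nu> ~= 0 \<longleftrightarrow> ?M \<nu> <= ?R" for \<nu> using N1[rule_format, of \<nu>] by (auto simp: N'_def)
   have R1: "1 <= ?R" using n0 by (intro ge_one_powr_ge_zero) auto
   have f1: "finite {\<nu>. N' \<nu> ~= 0}" unfolding N'0 by (rule card_lattice_ball(1)[OF R1])
   have f2: "\<forall>\<nu>. N' \<nu> = 0 --> ?M \<nu> powr (m + 1 / 2 - s) <= E"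
   proof (intro allI impI)
    fix \<nu> assume "N' \<nu> = 0"
    then have "?R < ?M \<nu>" using N'0[of \<nu>] by linarith
    then show "?M \<nu> powr (m + 1 / 2 - s) <= E" by (rule N2[rule_format])
   qed
   have f3: "\<forall>\<nu>. N' \<nu> ~= 0 --> ?M \<nu> powr (real k + 1 - s) * real (N' \<nu>) powr (- (real k - m + 1 / 2)) <= E"
   proof (intro allI impI)
    fix \<nu> assume "N' \<nu> ~= 0"
    then have h: "?M \<nu> <= ?R" unfolding N'0 .
    have "N' \<nu> = N \<nu>" using h by (simp only: N'_def if_True)
    then show "?M \<nu> powr (real k + 1 - s) * real (N' \<nu>) powr (- (real k - m + 1 / 2)) <= E"
     using N1[rule_format, OF h, THEN conjunct2] by (simp only:)
   qed
   obtain j fn where fn: "fn \<in> shallow_networks k j" and j: "real j <= Ca * (\<Sum>\<nu> | N' \<nu> ~= 0. real (N' \<nu>)) + Ca * real n0"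
    and err: "sobolev_norm m (interior unit_cube) (%x. f x - fn x) <= ennreal (Ca * A * E / sqrt (max 1 (real n0)))"
   proof -
    have "\<exists>j fn. fn \<in> shallow_networks k j \<and> real j <= Ca * (\<Sum>\<nu> | N' \<nu> ~= 0. real (N' \<nu>)) + Ca * real n0 \<and>
     sobolev_norm m (interior unit_cube) (%x. f x - fn x) <= ennreal (Ca * A * E / sqrt (max 1 (real n0)))"
     by (rule approx[rule_format, where N = N' and n = n0, OF E A sumA rep f1]) (rule f2[rule_format], assumption, rule f3[rule_format], assumption)
    then show ?thesis by (elim exE conjE) (rule that)
   qed
   have "(\<Sum>\<nu> | N' \<nu> ~= 0. real (N' \<nu>)) = (\<Sum>\<nu> | ?M \<nu> <= ?R. real (N \<nu>))"
    unfolding N'0 by (intro sum.cong refl) (simp add: N'_def)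
   also note N3
   finally have "Ca * (\<Sum>\<nu> | N' \<nu> ~= 0. real (N' \<nu>)) <= Ca * (Cb * real n0)" using Ca by (intro mult_left_mono) auto
   with j have "real j <= Ca * (Cb + 1) * real n0" by (simp add: algebra_simps)
   also have "... <= C2 * real n0" by (intro mult_right_mono C2(2)) simp
   also note le
   finally have jn: "j <= n" by simp
   have "Ca * A * E / sqrt (max 1 (real n0)) = Ca * A * Cb * (approx_rate CARD('n) s k m (real n0) / sqrt (real n0))"
    using n0 by (simp add: E_def)
   also have "approx_rate CARD('n) s k m (real n0) / sqrt (real n0) = ?r (real n0)"
    unfolding t_def q_def by (rule approx_rate_div_sqrt) (use n0 in simp)
   also have "Ca * A * Cb * ?r (real n0) <= Ca * A * (Cb + 1) * (((2 * C2) powr t * real n powr (- t)) * (2 powr q * ln (real n) powr q))"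
   proof (rule mult_mono)
    show "Ca * A * Cb <= Ca * A * (Cb + 1)" using Ca A by (intro mult_left_mono) auto
    show "?r (real n0) <= ((2 * C2) powr t * real n powr (- t)) * (2 powr q * ln (real n) powr q)"
    proof (rule mult_mono)
     have "real n0 powr (- t) <= (real n / (2 * C2)) powr (- t)" using ge t x2 C2(1) by (intro powr_mono2') auto
     also have "... = (2 * C2) powr t * real n powr (- t)" using C2(1) x2 by (simp add: powr_divide powr_minus_divide)
     finally show "real n0 powr (- t) <= (2 * C2) powr t * real n powr (- t)" .
     have "real n0 <= real n" using mult_right_mono[OF C2(1), of "real n0"] le by simp
     then have "ln (real n0) powr q <= ln (real n) powr q" using n0 q by (intro powr_mono2) auto
     also have "... <= 2 powr q * ln (real n) powr q"
      using mult_right_mono[OF ge_one_powr_ge_zero[of 2 q], of "ln (real n) powr q"] q by simp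
     finally show "ln (real n0) powr q <= 2 powr q * ln (real n) powr q" .
    qed simp_all
   qed (use Ca A Cb in simp_all)
   also have "... = K * A * ?r (real n)" unfolding K_def by (simp only: mult_ac)
   finally have le_K: "Ca * A * E / sqrt (max 1 (real n0)) <= K * A * ?r (real n)" .
   show ?thesis
    by (rule bexI[where x = fn, rotated], rule shallow_networks_mono[OF fn jn], rule order_trans[OF err ennreal_leI[OF le_K]])
  next
   case False
   have "real n / C2 >= 0" using C2(1) by simp
   then have "real n / C2 < 2" using False by linarith
   then have small: "real n <= 2 * C2" using C2(1) by (simp add: divide_less_eq)
   have M1: "1 <= ?M \<nu>" for \<nu> by simp
   have f1: "finite {\<nu> :: 'n => int. (0 :: nat) ~= 0}" by simp
   have f2: "?M \<nu> powr (m + 1 / 2 - s) <= 1" for \<nu> using powr_mono[OF _ M1, of "m + 1 / 2 - s" 0 \<nu>] m(2) M1[of \<nu>] by (simp add: powr_zero_eq_one add_pos_nonneg)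
   \<comment> \<open>No explicit neurons and no samples: the size bound forces \<open>j = 0\<close>.
     With \<open>E = 1\<close> the condition on high frequencies amounts to
     \<open>m + 1/2 <= s\<close>.\<close>
   obtain j fn where fn: "fn \<in> shallow_networks k j" and j: "real j <= Ca * (\<Sum>\<nu> :: 'n => int | (0 :: nat) ~= 0. real 0) + Ca * real 0"
    and err: "sobolev_norm m (interior unit_cube) (%x. f x - fn x) <= ennreal (Ca * A * 1 / sqrt (max 1 (real 0)))"
   proof -
    have "\<exists>j fn. fn \<in> shallow_networks k j \<and> real j <= Ca * (\<Sum>\<nu> :: 'n => int | (0 :: nat) ~= 0. real 0) + Ca * real 0 \<and>
     sobolev_norm m (interior unit_cube) (%x. f x - fn x) <= ennreal (Ca * A * 1 / sqrt (max 1 (real 0)))"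
     by (rule approx[rule_format, where N = "%_. 0" and n = 0 and E = 1, OF zero_le_one A sumA rep f1]) (rule f2, simp)
    then show ?thesis by (elim exE conjE) (rule that)
   qed
   have jn: "j <= n" using j by simp
   have "1 * 1 <= ((2 * C2) powr t * real n powr (- t)) * (2 powr q * ln (real n) powr q)"
   proof (rule mult_mono)
    have "real n powr t <= (2 * C2) powr t" using small t by (intro powr_mono2) auto
    then have "real n powr t * real n powr (- t) <= (2 * C2) powr t * real n powr (- t)" by (rule mult_right_mono) simp
    moreover have "real n powr t * real n powr (- t) = 1" unfolding powr_add[symmetric] using x2 by simp
    ultimately show "1 <= (2 * C2) powr t * real n powr (- t)" by simp
    have "ln (real n) > 0" using x2 by simp
    then show "1 <= 2 powr q * ln (real n) powr q" using ln_powr_le[OF x2 q] by simp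
   qed simp_all
   then have big: "1 <= ((2 * C2) powr t * real n powr (- t)) * (2 powr q * ln (real n) powr q)" by simp
   have "Ca * A * 1 / sqrt (max 1 (real 0)) = Ca * A * 1 * 1" by simp
   also have "... <= Ca * A * (Cb + 1) * (((2 * C2) powr t * real n powr (- t)) * (2 powr q * ln (real n) powr q))"
    using Ca A Cb by (intro mult_mono big) simp_all
   also have "... = K * A * ?r (real n)" unfolding K_def by (simp only: mult_ac)
   finally have le_K: "Ca * A * 1 / sqrt (max 1 (real 0)) <= K * A * ?r (real n)" .
   show ?thesis
    by (rule bexI[where x = fn, rotated], rule shallow_networks_mono[OF fn jn], rule order_trans[OF err ennreal_leI[OF le_K]])
  qed
  then show "\<exists>fn \<in> shallow_networks k n. sobolev_norm m (interior unit_cube) (%x. f x - fn x)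
    <= ennreal (K * A * (real n powr (- rate_exponent CARD('n) s k m) * ln (real n) powr log_exponent CARD('n) s k m))"
   unfolding t_def q_def .
 qed
qed

theorem theorem3:
  fixes s m :: real and k :: nat
  assumes "s \<ge> 1/2" and "m \<ge> 0" and "m \<le> s - 1/2" and "m < real k + 1/2"
  shows "\<exists>C>0. \<forall>f \<in> barron_space s (unit_cube :: (real ^ 'n) set). \<forall>n\<ge>2.
           (INF fn \<in> shallow_networks k n.
              sobolev_norm m (interior unit_cube) (\<lambda>x. f x - fn x))
           \<le> ennreal (C * real n powr (- rate_exponent CARD('n) s k m)
                        * ln (real n) powr log_exponent CARD('n) s k m)
             * barron_norm s unit_cube f"
proof -
 have s0: "s >= 0" using assms(1) by simp
 obtain Ke where Ke: "Ke >= 0" and expansion: "\<forall>fe :: real ^ 'n => complex. integrable lebesgue fe -->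
  (\<integral>\<^sup>+\<xi>. ennreal ((1 + norm \<xi>) powr s * cmod (fourier fe \<xi>)) \<partial>lebesgue) < \<infinity> -->
  (\<exists>a. lattice_norm s a
     <= ennreal Ke * (\<integral>\<^sup>+\<xi>. ennreal ((1 + norm \<xi>) powr s * cmod (fourier fe \<xi>)) \<partial>lebesgue) \<and>
    (AE x in lborel. x \<in> interior unit_cube --> fe x = lattice_series a x))"
  using lattice_expansion[OF s0, where 'n = 'n] by (elim exE conjE) (rule that)
 obtain K where K: "K > 0" and rate: "\<forall>(f :: real ^ 'n => complex) a A. series_rate k m s K f a A"
  using lattice_series_rate[OF assms, where 'n = 'n] by (elim exE conjE) (rule that)
 define C where "C = K * (Ke + 1)"
 have C: "C > 0" unfolding C_def using K Ke by simp
 show ?thesis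
 proof (rule exI[of _ C], intro conjI ballI allI impI C)
  fix f :: "real ^ 'n => complex" and n :: nat
  assume n: "2 <= n"
  let ?rn = "real n powr (- rate_exponent CARD('n) s k m) * ln (real n) powr log_exponent CARD('n) s k m"
  let ?X = "INF fn \<in> shallow_networks k n. sobolev_norm m (interior unit_cube) (%x. f x - fn x)"
  let ?I = "%fe. \<integral>\<^sup>+\<xi>. ennreal ((1 + norm \<xi>) powr s * cmod (fourier fe \<xi>)) \<partial>lebesgue"
  have rn: "?rn > 0" using n by simp
  have c: "C * ?rn > 0" using C rn by simp
  have main: "?X <= ennreal (C * ?rn) * ?I fe" if fe: "fe \<in> L1_extensions unit_cube f" for fe
  proof (cases "?I fe < \<infinity>")
   case False
   \<comment> \<open>An extension of infinite energy gives a trivial bound, since the constant in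
     front is positive.\<close>
   then have I: "?I fe = \<top>" by (simp add: less_top[symmetric])
   have "ennreal (C * ?rn) ~= 0" using c by (simp only: ennreal_eq_0_iff not_le)
   then show ?thesis unfolding I by (simp only: ennreal_mult_top if_False top_greatest)
  next
   case True
   have ife: "integrable lebesgue fe" and ext: "AE x in lebesgue. x \<in> unit_cube --> fe x = f x"
    using fe by (simp_all add: L1_extensions_def)
   obtain a where sa: "lattice_norm s a <= ennreal Ke * ?I fe"
    and ra: "AE x in lborel. x \<in> interior unit_cube --> fe x = lattice_series a x"
    using expansion[rule_format, OF ife True] by (elim exE conjE) (rule that)
   have "AE x in lborel. x \<in> unit_cube --> fe x = f x" using ext by (simp add: AE_completion_iff)
   with ra have rf: "AE x in lborel. x \<in> interior unit_cube --> f x = lattice_series a x"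
   proof eventually_elim
    fix x :: "real ^ 'n"
    assume 1: "x \<in> interior unit_cube --> fe x = lattice_series a x" and 2: "x \<in> unit_cube --> fe x = f x"
    show "x \<in> interior unit_cube --> f x = lattice_series a x"
     using 1 2 interior_subset[of "unit_cube :: (real ^ 'n) set"] by auto
   qed
   define S where "S = lattice_norm s a"
   have S: "S <= ennreal Ke * ?I fe" unfolding S_def by (rule sa)
   have "ennreal Ke * ?I fe < \<infinity>" using True by (simp add: ennreal_mult_less_top)
   with S have Sfin: "S < \<infinity>" by (rule order.strict_trans1)
   show ?thesis
   \<comment> \<open>\<open>series_rate\<close> assumes a positive lattice norm; if it vanishes,
     \<open>f\<close> is zero almost everywhere on the open cube and the empty network is
     exact.\<close>
   proof (cases "S = 0")
    case True
    have "AE \<nu> in count_space UNIV. ennreal (cmod (a \<nu>) * lattice_wt \<nu> powr s) = 0"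
     using True unfolding S_def by (subst (asm) nn_integral_0_iff_AE) simp_all
    then have az: "cmod (a \<nu>) * lattice_wt \<nu> powr s = 0" for \<nu>
     by (auto simp: AE_count_space ennreal_eq_0_iff mult_le_0_iff)
    have "lattice_wt \<nu> ~= 0" for \<nu> :: "'n => int" using norm_ge_zero[of "lattice_vec \<nu> :: real ^ 'n"] by linarith
    then have "a \<nu> = 0" for \<nu> using az[of \<nu>] by simp
    then have "AE x in lborel. x \<in> interior unit_cube --> f x = 0" using rf by simp
    moreover have "(%x. f x - (\<Sum>i\<in>({} :: nat set). 0 * of_real (relu_pow k ((axis undefined 1 :: real ^ 'n) \<bullet> x + 0)))) = f" by simp
    ultimately have z: "sobolev_norm m (interior unit_cube) (%x. f x - (\<Sum>i\<in>({} :: nat set). 0 * of_real (relu_pow k ((axis undefined 1 :: real ^ 'n) \<bullet> x + 0)))) = 0"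
     by (simp add: sobolev_norm_AE_zero)
    have "(%x. \<Sum>i\<in>({} :: nat set). 0 * of_real (relu_pow k ((axis undefined 1 :: real ^ 'n) \<bullet> x + 0))) \<in> shallow_networks k n"
     by (rule shallow_network_finite_sum) simp_all
    from INF_lower[OF this, of "%fn. sobolev_norm m (interior unit_cube) (%x. f x - fn x)"] z
    have "?X <= 0" by (simp only:)
    then show ?thesis by (rule order_trans) simp
   next
    case False
    define A where "A = enn2real S"
    have SA: "S = ennreal A" unfolding A_def using Sfin by simp
    have A: "0 < A" unfolding A_def using False Sfin by (simp add: enn2real_positive_iff zero_less_iff_neq_zero)
    obtain fn where fn: "fn \<in> shallow_networks k n" and le: "sobolev_norm m (interior unit_cube) (%x. f x - fn x) <= ennreal (K * A * ?rn)"
     using rate[rule_format, OF A SA[unfolded S_def] rf n] by (elim bexE) (rule that)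
    have "?X <= sobolev_norm m (interior unit_cube) (%x. f x - fn x)" by (rule INF_lower[OF fn])
    also note le
    also have "ennreal (K * A * ?rn) = ennreal (K * ?rn) * S"
     unfolding SA using K A rn by (simp add: ennreal_mult'[symmetric] mult_ac)
    also have "... <= ennreal (K * ?rn) * (ennreal Ke * ?I fe)" by (rule mult_left_mono[OF S]) simp
    also have "... = ennreal (K * ?rn * Ke) * ?I fe"
     using K rn Ke by (simp add: ennreal_mult mult.assoc)
    also have "... <= ennreal (C * ?rn) * ?I fe"
    proof (intro mult_right_mono ennreal_leI)
     have "K * ?rn * Ke <= K * ?rn * (Ke + 1)" using K rn by (intro mult_left_mono) auto
     also have "... = C * ?rn" unfolding C_def by (simp only: mult_ac)
     finally show "K * ?rn * Ke <= C * ?rn" .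
    qed simp
    finally show ?thesis .
   qed
  qed
  \<comment> \<open>Dividing by the positive constant first leaves the bare energy of the extension
    on the right, so that the infimum over extensions can be taken there.\<close>
  have inv: "ennreal (1 / (C * ?rn)) * ennreal (C * ?rn) = 1" "ennreal (C * ?rn) * ennreal (1 / (C * ?rn)) = 1"
  proof -
   have "ennreal (1 / y) * ennreal y = 1" "ennreal y * ennreal (1 / y) = 1" if "y > 0" for y :: real
    using that by (simp_all add: ennreal_mult[symmetric])
   from this[OF c] show "ennreal (1 / (C * ?rn)) * ennreal (C * ?rn) = 1" "ennreal (C * ?rn) * ennreal (1 / (C * ?rn)) = 1" .
  qed
  have "ennreal (1 / (C * ?rn)) * ?X <= barron_norm s unit_cube f"
   unfolding barron_norm_def
  proof (rule INF_greatest)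
   fix fe assume "fe \<in> L1_extensions unit_cube f"
   from mult_left_mono[OF main[OF this], of "ennreal (1 / (C * ?rn))"]
   have "ennreal (1 / (C * ?rn)) * ?X <= (ennreal (1 / (C * ?rn)) * ennreal (C * ?rn)) * ?I fe" by (simp only: mult.assoc zero_le)
   then show "ennreal (1 / (C * ?rn)) * ?X <= ?I fe" unfolding inv mult_1_left .
  qed
  from mult_left_mono[OF this, of "ennreal (C * ?rn)"]
  have "(ennreal (C * ?rn) * ennreal (1 / (C * ?rn))) * ?X <= ennreal (C * ?rn) * barron_norm s unit_cube f" by (simp only: mult.assoc zero_le)
  then show "?X <= ennreal (C * real n powr (- rate_exponent CARD('n) s k m) * ln (real n) powr log_exponent CARD('n) s k m) * barron_norm s unit_cube f"
   unfolding inv mult_1_left by (simp only: mult.assoc)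
 qed
qed

end
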